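(* Solitary waves (homoclinic traveling waves) of the viscous Jin--Xin system $$\tau_t-u_x=0,\qquad u_t-c_s^2\tau_x=-f(\tau)-u+u_{xx}$$ always have unstable point spectrum: for every homoclinic profile $(\bar\tau,\bar u)$ of this system, the associated Evans function $D$ has a zero $\lambda$ with $\Re\lambda>0$.
   Context: Here $c_s>0$ is a constant and $f$ is a smooth real function on an interval containing the range of $\bar\tau$. Traveling waves $(\tau,u)=(\bar\tau,\bar u)(x-ct)$ satisfy $\bar u=q-c\bar\tau$, with $q$ a constant, and $(c^2-c_s^2)\bar\tau'=-f(\bar\tau)+c\bar\tau-q-c\bar\tau''$. Homoclinic profiles occur at the speed $c=c_s$, for which the profile ODE is the Hamiltonian nonlinear oscillator $c\bar\tau''=-f(\bar\tau)+c\bar\tau-q$. A homoclinic profile is a nonconstant solution of this equation with $c=c_s$ and $\lim_{x\to\pm\infty}\bar\tau(x)=\tau_0$, where $(\tau_0,0)$ is a nondegenerate saddle equilibrium, i.e. $f(\tau_0)=c\tau_0-q$ and $f'(\tau_0)<c_s$. Linearized eigenvalue equations (moving frame): $\lambda\tau-c\tau'-u'=0$, $\ \lambda u-cu'-c_s^2\tau'=-f'(\bar\tau)\tau-u+u''$. With $W=(\tau,u,u')^T$ they read $W'=A(x,\lambda)W$, where $$A=\begin{pmatrix}\lambda/c&0&-1/c\\0&0&1\\-c_s^2\lambda/c+f'(\bar\tau)&\lambda+1&c_s^2/c-c\end{pmatrix}.$$ Let $A_0(\lambda)=\lim_{x\to\pm\infty}A(x,\lambda)$. Evans function: for real $\lambda$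 near $+\infty$, $A_0(\lambda)$ has a one-dimensional stable and a two-dimensional unstable subspace. Let $\hat{\mathcal S}(\lambda)$ and $\hat{\mathcal U}(\lambda)$ be their continuations as total eigenspaces, for those $\lambda$ for which the maximum real part of the eigenvalues of $A_0(\lambda)$ on $\hat{\mathcal S}$ is strictly less than the minimum real part of those on $\hat{\mathcal U}$ (so $\hat{\mathcal S}$ is the eigenspace of the eigenvalue of strictly smallest real part). Choose bases $V_1^-,V_2^-$ of $\hat{\mathcal U}$ and $V_3^+$ of $\hat{\mathcal S}$, and solutions of $W'=AW$ of the form $W_j^\pm(x)=P_\pm(x,\lambda)e^{A_0(\lambda)x}V_j^\pm$ with $P_\pm\to I$ exponentially as $x\to\pm\infty$ (index $-$ for $j=1,2$, index $+$ for $j=3$). Define $$D(\lambda)=\frac{\det(W_1^-,W_2^-,W_3^+)|_{x=0}}{\det(V_1^-,V_2^-,V_3^+)},$$ which is independent of the choices. The point spectrum is the set of zeros of $D$. It is called unstable if $D$ has zeros with $\Re\lambda\ge0$ other than the single translational zero at $\lambda=0$. *)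

theory Defs
  imports "HOL-Analysis.Analysis"
begin

section \<open>Smooth functions on an interval\<close>

text \<open>The interval need not be open: at an endpoint belonging to \<open>I\<close> derivatives are one-sided.\<close>

definition derivative_on :: "real set \<Rightarrow> (real \<Rightarrow> real) \<Rightarrow> real \<Rightarrow> real" where
  "derivative_on I f y = vector_derivative f (at y within I)"

definition smooth_on_interval :: "real set \<Rightarrow> (real \<Rightarrow> real) \<Rightarrow> bool" where
  "smooth_on_interval I f \<longleftrightarrow>
     is_interval I \<and> (\<forall>n. \<forall>y\<in>I. (derivative_on I ^^ n) f differentiable (at y within I))"


section \<open>Traveling waves of the viscous Jin--Xin system\<close>

definition traveling_wave_profile ::
  "real \<Rightarrow> real \<Rightarrow> (real \<Rightarrow> real) \<Rightarrow> real set \<Rightarrow> real \<Rightarrow> (real \<Rightarrow> real) \<Rightarrow> (real \<Rightarrow> real) \<Rightarrow> bool" where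
  "traveling_wave_profile c cs f I q \<tau> u \<longleftrightarrow>
     range \<tau> \<subseteq> I \<and>
     (\<forall>x. \<tau> differentiable (at x)) \<and> (\<forall>x. deriv \<tau> differentiable (at x)) \<and>
     (\<forall>x. (c\<^sup>2 - cs\<^sup>2) * deriv \<tau> x = - f (\<tau> x) + c * \<tau> x - q - c * deriv (deriv \<tau>) x) \<and>
     (\<forall>x. u x = q - c * \<tau> x)"

text \<open>Such a profile yields a solution \<open>(\<tau>, u)(x - c t)\<close> of
  \<open>\<tau>\<^sub>t - u\<^sub>x = 0\<close>, \<open>u\<^sub>t - cs\<^sup>2 \<tau>\<^sub>x = - f(\<tau>) - u + u\<^sub>x\<^sub>x\<close>:\<close>

lemma traveling_wave_profile_solves_Jin_Xin:
  assumes "traveling_wave_profile c cs f I q \<tau> u"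
  shows "deriv (\<lambda>t. \<tau> (x - c * t)) t - deriv (\<lambda>x. u (x - c * t)) x = 0"
    and "deriv (\<lambda>t. u (x - c * t)) t - cs\<^sup>2 * deriv (\<lambda>x. \<tau> (x - c * t)) x =
           - f (\<tau> (x - c * t)) - u (x - c * t) + deriv (deriv (\<lambda>x. u (x - c * t))) x"
proof -
  have D1: "(\<tau> has_real_derivative deriv \<tau> y) (at y)"
    and D2: "(deriv \<tau> has_real_derivative deriv (deriv \<tau>) y) (at y)" for y
    using assms unfolding traveling_wave_profile_def
    by (auto simp: DERIV_deriv_iff_real_differentiable)
  have u: "u = (\<lambda>x. q - c * \<tau> x)"
    using assms unfolding traveling_wave_profile_def by auto
  have D1t: "((\<lambda>t. \<tau> (x - c * t)) has_real_derivative deriv \<tau> (x - c * t) * (- c)) (at t)" for x t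
    by (rule DERIV_chain2[OF D1]) (auto intro!: derivative_eq_intros)
  have D1x: "((\<lambda>x. \<tau> (x - c * t)) has_real_derivative deriv \<tau> (x - c * t) * 1) (at x)" for x t
    by (rule DERIV_chain2[OF D1]) (auto intro!: derivative_eq_intros)
  have D2x: "((\<lambda>x. deriv \<tau> (x - c * t)) has_real_derivative deriv (deriv \<tau>) (x - c * t) * 1) (at x)" for x t
    by (rule DERIV_chain2[OF D2]) (auto intro!: derivative_eq_intros)
  have t1: "deriv (\<lambda>t. \<tau> (x - c * t)) t = - c * deriv \<tau> (x - c * t)" for x t
    using DERIV_imp_deriv[OF D1t] by simp
  have x1: "deriv (\<lambda>x. \<tau> (x - c * t)) x = deriv \<tau> (x - c * t)" for x t
    using DERIV_imp_deriv[OF D1x] by simp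
  have ut: "deriv (\<lambda>t. u (x - c * t)) t = c\<^sup>2 * deriv \<tau> (x - c * t)" for x t
    unfolding u
    by (rule DERIV_imp_deriv)
       (auto intro!: derivative_eq_intros D1t simp: power2_eq_square)
  have ux: "deriv (\<lambda>x. u (x - c * t)) = (\<lambda>x. - c * deriv \<tau> (x - c * t))" for t
    unfolding u
    by (rule ext, rule DERIV_imp_deriv) (auto intro!: derivative_eq_intros D1x)
  have uxx: "deriv (deriv (\<lambda>x. u (x - c * t))) x = - c * deriv (deriv \<tau>) (x - c * t)" for x t
    unfolding ux
    by (rule DERIV_imp_deriv) (auto intro!: derivative_eq_intros D2x)
  show "deriv (\<lambda>t. \<tau> (x - c * t)) t - deriv (\<lambda>x. u (x - c * t)) x = 0"
    unfolding t1 ux by simp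
  have "(c\<^sup>2 - cs\<^sup>2) * deriv \<tau> (x - c * t) = - f (\<tau> (x - c * t)) + c * \<tau> (x - c * t) - q
          - c * deriv (deriv \<tau>) (x - c * t)"
    using assms unfolding traveling_wave_profile_def by blast
  then show "deriv (\<lambda>t. u (x - c * t)) t - cs\<^sup>2 * deriv (\<lambda>x. \<tau> (x - c * t)) x =
           - f (\<tau> (x - c * t)) - u (x - c * t) + deriv (deriv (\<lambda>x. u (x - c * t))) x"
    unfolding ut uxx x1 by (simp add: u algebra_simps)
qed

text \<open>Homoclinic profiles have speed \<open>c = cs\<close>, where the profile equation is the oscillator
  \<open>c \<tau>'' = - f(\<tau>) + c \<tau> - q\<close>.\<close>

definition homoclinic_profile ::
  "real \<Rightarrow> (real \<Rightarrow> real) \<Rightarrow> real set \<Rightarrow> real \<Rightarrow> real \<Rightarrow> (real \<Rightarrow> real) \<Rightarrow> (real \<Rightarrow> real) \<Rightarrow> bool" where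
  "homoclinic_profile cs f I q \<tau>0 \<tau> u \<longleftrightarrow>
     traveling_wave_profile cs cs f I q \<tau> u \<and>
     \<not> \<tau> constant_on UNIV \<and>
     (\<tau> \<longlongrightarrow> \<tau>0) at_top \<and> (\<tau> \<longlongrightarrow> \<tau>0) at_bot \<and>
     \<tau>0 \<in> I \<and> f \<tau>0 = cs * \<tau>0 - q \<and> derivative_on I f \<tau>0 < cs"


section \<open>Matrices, eigenspaces and the matrix exponential\<close>

text \<open>The type \<open>complex^'n^'n\<close> is no \<open>real_normed_algebra_1\<close> for the matrix product, so the
  library's \<open>exp\<close> and \<open>(^)\<close> do not apply.\<close>

definition matrix_power :: "complex^'n^'n \<Rightarrow> nat \<Rightarrow> complex^'n^'n" where
  "matrix_power M k = (((**) M) ^^ k) (mat 1)"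

definition matrix_exp :: "complex^'n^'n \<Rightarrow> complex^'n^'n" where
  "matrix_exp M = (\<Sum>k. (1 / fact k) *\<^sub>R matrix_power M k)"

definition eigenvalues :: "complex^'n^'n \<Rightarrow> complex set" where
  "eigenvalues M = {\<mu>. \<exists>v. v \<noteq> 0 \<and> M *v v = \<mu> *s v}"

definition generalized_eigenspace :: "complex^'n^'n \<Rightarrow> complex \<Rightarrow> (complex^'n) set" where
  "generalized_eigenspace M \<mu> = {v. \<exists>k. matrix_power (M - mat \<mu>) k *v v = 0}"

text \<open>\<open>vec.span\<close>, \<open>vec.dim\<close>, \<open>vec.independent\<close> are taken over the field \<open>complex\<close>
  (plain \<open>span\<close> would be the real span).\<close>

definition total_eigenspace :: "complex^'n^'n \<Rightarrow> complex set \<Rightarrow> (complex^'n) set" where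
  "total_eigenspace M E = vec.span (\<Union>\<mu>\<in>E. generalized_eigenspace M \<mu>)"


section \<open>The Evans function\<close>

text \<open>\<open>S\<close> and \<open>U\<close> are complementary total eigenspaces of \<open>A0\<close> of dimensions 1 and 2, with the
  spectrum on \<open>S\<close> strictly to the left of that on \<open>U\<close>. They are unique when they exist: \<open>S\<close> is
  the eigenspace of the algebraically simple eigenvalue of strictly smallest real part.\<close>

definition consistent_splitting ::
  "complex^3^3 \<Rightarrow> (complex^3) set \<Rightarrow> (complex^3) set \<Rightarrow> bool" where
  "consistent_splitting A0 S U \<longleftrightarrow>
     (\<exists>E\<^sub>S E\<^sub>U. E\<^sub>S \<union> E\<^sub>U = eigenvalues A0 \<and>
        S = total_eigenspace A0 E\<^sub>S \<and> U = total_eigenspace A0 E\<^sub>U \<and>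
        vec.dim S = 1 \<and> vec.dim U = 2 \<and>
        (\<forall>\<mu>\<in>E\<^sub>S. \<forall>\<nu>\<in>E\<^sub>U. Re \<mu> < Re \<nu>))"

definition tends_to_identity_exponentially ::
  "(real \<Rightarrow> complex^'n^'n) \<Rightarrow> real filter \<Rightarrow> bool" where
  "tends_to_identity_exponentially P F \<longleftrightarrow>
     (\<exists>C \<eta>. \<eta> > 0 \<and> (\<forall>\<^sub>F x in F. norm (P x - mat 1) \<le> C * exp (- \<eta> * \<bar>x\<bar>)))"

definition linear_ode_solution ::
  "(real \<Rightarrow> complex^'n^'n) \<Rightarrow> (real \<Rightarrow> complex^'n) \<Rightarrow> bool" where
  "linear_ode_solution A W \<longleftrightarrow> (\<forall>x. (W has_vector_derivative A x *v W x) (at x))"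

definition det_columns :: "complex^3 \<Rightarrow> complex^3 \<Rightarrow> complex^3 \<Rightarrow> complex" where
  "det_columns a b c = det (transpose (vector [a, b, c] :: complex^3^3))"

text \<open>The same \<open>Pm\<close> serves both \<open>W1\<close> and \<open>W2\<close>. With separate matrices for the two the
  quotient would not be independent of the choices, since a multiple of the solution that decays
  faster at \<open>-\<infinity>\<close> could be added to one of them only.\<close>

definition evans_quotient ::
  "(real \<Rightarrow> complex^3^3) \<Rightarrow> complex^3^3 \<Rightarrow> complex \<Rightarrow> bool" where
  "evans_quotient A A0 d \<longleftrightarrow>
     (\<exists>S U V1 V2 V3 W1 W2 W3 Pm Pp.
        consistent_splitting A0 S U \<and>
        V1 \<noteq> V2 \<and> vec.independent {V1, V2} \<and> vec.span {V1, V2} = U \<and>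
        V3 \<noteq> 0 \<and> vec.span {V3} = S \<and>
        linear_ode_solution A W1 \<and> linear_ode_solution A W2 \<and> linear_ode_solution A W3 \<and>
        (\<forall>x. W1 x = Pm x *v (matrix_exp (x *\<^sub>R A0) *v V1)) \<and>
        (\<forall>x. W2 x = Pm x *v (matrix_exp (x *\<^sub>R A0) *v V2)) \<and>
        (\<forall>x. W3 x = Pp x *v (matrix_exp (x *\<^sub>R A0) *v V3)) \<and>
        tends_to_identity_exponentially Pm at_bot \<and>
        tends_to_identity_exponentially Pp at_top \<and>
        d = det_columns (W1 0) (W2 0) (W3 0) / det_columns V1 V2 V3)"


section \<open>Point spectrum of a profile\<close>

definition evans_matrix ::
  "real \<Rightarrow> real \<Rightarrow> (real \<Rightarrow> real) \<Rightarrow> real set \<Rightarrow> (real \<Rightarrow> real) \<Rightarrow> complex \<Rightarrow> real \<Rightarrow> complex^3^3" where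
  "evans_matrix c cs f I \<tau> z x = vector
     [vector [z / of_real c, 0, - 1 / of_real c],
      vector [0, 0, 1],
      vector [- of_real (cs\<^sup>2) * z / of_real c + of_real (derivative_on I f (\<tau> x)),
              z + 1,
              of_real (cs\<^sup>2 / c - c)]]"

text \<open>For a homoclinic profile the limits at \<open>+\<infinity>\<close> and \<open>-\<infinity>\<close> exist and agree, since
  \<open>f'(\<tau> x)\<close> tends to \<open>f'(\<tau>0)\<close> at both ends.\<close>

definition evans_limit_matrix ::
  "real \<Rightarrow> real \<Rightarrow> (real \<Rightarrow> real) \<Rightarrow> real set \<Rightarrow> (real \<Rightarrow> real) \<Rightarrow> complex \<Rightarrow> complex^3^3" where
  "evans_limit_matrix c cs f I \<tau> z = Lim at_top (evans_matrix c cs f I \<tau> z)"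

definition evans_domain ::
  "real \<Rightarrow> real \<Rightarrow> (real \<Rightarrow> real) \<Rightarrow> real set \<Rightarrow> (real \<Rightarrow> real) \<Rightarrow> complex set" where
  "evans_domain c cs f I \<tau> =
     {z. \<exists>S U. consistent_splitting (evans_limit_matrix c cs f I \<tau> z) S U}"

definition evans_function ::
  "real \<Rightarrow> real \<Rightarrow> (real \<Rightarrow> real) \<Rightarrow> real set \<Rightarrow> (real \<Rightarrow> real) \<Rightarrow> complex \<Rightarrow> complex" where
  "evans_function c cs f I \<tau> z =
     (THE d. evans_quotient (evans_matrix c cs f I \<tau> z) (evans_limit_matrix c cs f I \<tau> z) d)"

definition point_spectrum ::
  "real \<Rightarrow> real \<Rightarrow> (real \<Rightarrow> real) \<Rightarrow> real set \<Rightarrow> (real \<Rightarrow> real) \<Rightarrow> complex set" where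
  "point_spectrum c cs f I \<tau> =
     {z \<in> evans_domain c cs f I \<tau>. evans_function c cs f I \<tau> z = 0}"

end

theory Submission
  imports Defs 
begin

text \<open>
  Substituting \<open>\<tau> = w'\<close>, \<open>u = z w - c w'\<close> turns the eigenvalue system into the scalar equation
  \<open>(\<partial> - m\<^sub>1) (\<partial> - m\<^sub>2) (\<partial> - m\<^sub>3) w = h w'\<close>, where \<open>m\<^sub>3 < 0 \<le> Re m\<^sub>1, Re m\<^sub>2\<close> are the eigenvalues of the limiting
  matrix and \<open>h\<close> decays exponentially. For real \<open>z \<ge> 0\<close> the solution \<open>w\<close> with \<open>w \<sim> exp (m\<^sub>3 x)\<close> at \<open>+\<infinity>\<close>
  comes from a Volterra equation; its component along \<open>exp (m\<^sub>3 x)\<close> at \<open>-\<infinity>\<close>, called \<open>transmission z\<close>,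
  is real, continuous in \<open>z\<close>, and agrees with the Evans function up to a nonzero factor. It is positive for
  large \<open>z\<close>. At \<open>z = 0\<close> the solution is a positive multiple of \<open>\<phi> = \<plusminus> (\<tau> - \<tau>\<^sub>0)\<close>, and as \<open>z\<close> becomes positive the
  Wronskian \<open>c (\<psi> w'' - \<psi>' w')\<close>, \<open>\<psi> = \<phi>'\<close>, moves on the far left at a rate proportional to minus the Melnikov
  integral \<open>\<integral> \<psi> (\<psi>' + 2 c \<psi> - \<phi>) = 2 c \<integral> \<psi>\<^sup>2 > 0\<close>; this forces \<open>w' > 0\<close> near
  \<open>-\<infinity>\<close>, hence \<open>transmission z \<le> 0\<close> for small \<open>z > 0\<close>. The intermediate value theorem gives a zero
  \<open>z > 0\<close>. There the solution decaying at \<open>+\<infinity>\<close> lies in the span of \<open>W\<^sub>1\<^sup>-\<close> and \<open>W\<^sub>2\<^sup>-\<close>.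
  That the Evans function is defined at \<open>z\<close> at all requires the solutions \<open>W\<^sub>j\<^sup>\<plusminus>\<close> themselves, also for a
  double root \<open>m\<^sub>1 = m\<^sub>2\<close>; they are obtained by contraction in exponentially weighted spaces.
\<close>

section \<open>Primitives on the line\<close>

text \<open>The sign does not depend on \<open>f\<close> because \<open>\<psi> \<psi>'\<close> and
  \<open>\<psi> \<phi>\<close> in the Melnikov integrand are exact derivatives of functions
  vanishing at both ends, so only \<open>2 c \<psi>\<^sup>2\<close> survives. The obstacle is the
  left end: \<open>w z\<close> is compared with \<open>w 0\<close> only on half-lines
  \<open>[x0, \<infinity>)\<close>, whereas the transmission is read off at
  \<open>-\<infinity>\<close>. The Wronskian therefore carries the information to one point far on
  the left, and a comparison argument at fixed \<open>z\<close> takes it from there to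
  \<open>-\<infinity>\<close>. Normalizing at \<open>+\<infinity>\<close> keeps all objects
  continuous down to \<open>z = 0\<close>, where one growth rate vanishes, and across double roots:
  only the gaps \<open>m\<^sub>i - m\<^sub>3\<close> enter, and their real parts stay positive. The
  link to the Evans function is that the trace of the coefficient matrix is \<open>z / c\<close>,
  the sum of the three roots. Hence the determinant of the two growing solutions and the decaying
  one, times \<open>exp (- z x / c)\<close>, is constant in \<open>x\<close>, and its limit at
  \<open>-\<infinity>\<close> is a multiple of the transmission.\<close>

lemma has_vector_derivative_exp_scaleR:
  fixes \<nu> :: complex
  shows "((\<lambda>t. exp (t *\<^sub>R \<nu>)) has_vector_derivative \<nu> * exp (x *\<^sub>R \<nu>)) (at x)"
  using exp_scaleR_has_vector_derivative_right[of \<nu> x UNIV] by (simp add: mult.commute)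

lemma norm_exp_scaleR: "norm (exp (x *\<^sub>R (\<nu>::complex))) = exp (x * Re \<nu>)"
  by (simp add: norm_exp_eq_Re)

lemma increment_le:
  fixes f :: "real \<Rightarrow> 'a::real_normed_vector" and \<gamma> :: "real \<Rightarrow> real"
  assumes "a \<le> b"
    and f: "\<And>x. x \<in> {a..b} \<Longrightarrow> (f has_vector_derivative f' x) (at x)"
    and g: "\<And>x. x \<in> {a..b} \<Longrightarrow> (\<gamma> has_real_derivative \<gamma>' x) (at x)"
    and le: "\<And>x. x \<in> {a..b} \<Longrightarrow> norm (f' x) \<le> \<gamma>' x"
  shows "norm (f b - f a) \<le> \<gamma> b - \<gamma> a"
proof (cases "a = b")
  case False
  have cf: "continuous_on {a..b} f"
    using f by (meson continuous_at_imp_continuous_on has_vector_derivative_continuous)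
  have cg: "continuous_on {a..b} \<gamma>"
    using g by (meson DERIV_isCont continuous_at_imp_continuous_on)
  show ?thesis
    by (rule differentiable_bound_general[where f'=f' and \<phi>'=\<gamma>'])
       (use False assms cf cg in \<open>auto simp: has_real_derivative_iff_has_vector_derivative[symmetric]\<close>)
qed simp

lemma antiderivative_exists:
  fixes F :: "real \<Rightarrow> 'a::euclidean_space"
  assumes "continuous_on UNIV F"
  shows "\<exists>Y. \<forall>x. (Y has_vector_derivative F x) (at x)"
  using einterval_antiderivative[of "-\<infinity>" "\<infinity>" F] assms
  by (auto simp: continuous_on_eq_continuous_at)

text \<open>The primitive normalized at \<open>+\<infinity>\<close>: increments of any primitive are
  dominated by those of the scalar majorant \<open>\<gamma>\<close>, so its values at the integers
  form a Cauchy sequence, and subtracting the limit yields both the normalization and the bound by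
  \<open>\<gamma>\<close>.\<close>

lemma tail_primitive:
  fixes F :: "real \<Rightarrow> 'a::euclidean_space" and \<gamma> \<gamma>' :: "real \<Rightarrow> real"
  assumes F: "continuous_on UNIV F"
    and g: "\<And>x. (\<gamma> has_real_derivative \<gamma>' x) (at x)"
    and le: "\<And>x. norm (F x) \<le> - \<gamma>' x"
    and g0: "(\<gamma> \<longlongrightarrow> 0) at_top"
  shows "\<exists>Y. (\<forall>x. (Y has_vector_derivative F x) (at x)) \<and> (Y \<longlongrightarrow> 0) at_top \<and> (\<forall>x. norm (Y x) \<le> \<gamma> x)"
proof -
  obtain Z where Z: "\<And>x. (Z has_vector_derivative F x) (at x)"
    using antiderivative_exists[OF F] by blast
  have inc: "norm (Z b - Z a) \<le> \<gamma> a - \<gamma> b" if "a \<le> b" for a b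
  proof -
    have "norm (Z b - Z a) \<le> (\<lambda>x. - \<gamma> x) b - (\<lambda>x. - \<gamma> x) a"
      by (rule increment_le[where f'=F and \<gamma>'="\<lambda>x. - \<gamma>' x"])
         (use that Z le in \<open>auto intro!: derivative_eq_intros g\<close>)
    then show ?thesis by simp
  qed
  have gn: "(\<lambda>n. \<gamma> (real n)) \<longlonglongrightarrow> 0"
    using filterlim_compose[OF g0 filterlim_real_sequentially] .
  have "Cauchy (\<lambda>n. Z (real n))"
  proof (rule metric_CauchyI)
    fix e :: real assume "e > 0"
    obtain M where M: "\<And>m n. m \<ge> M \<Longrightarrow> n \<ge> M \<Longrightarrow> dist (\<gamma> (real m)) (\<gamma> (real n)) < e"
      using metric_CauchyD[OF LIMSEQ_imp_Cauchy[OF gn] \<open>e > 0\<close>] by blast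
    have "dist (Z (real m)) (Z (real n)) \<le> dist (\<gamma> (real m)) (\<gamma> (real n))" for m n
    proof (cases "m \<le> n")
      case True
      then show ?thesis using inc[of "real m" "real n"]
        by (simp add: dist_norm norm_minus_commute)
    next
      case False
      then show ?thesis using inc[of "real n" "real m"]
        by (simp add: dist_norm norm_minus_commute)
    qed
    then show "\<exists>M. \<forall>m\<ge>M. \<forall>n\<ge>M. dist (Z (real m)) (Z (real n)) < e"
      using M by (meson le_less_trans)
  qed
  then obtain L where L: "(\<lambda>n. Z (real n)) \<longlonglongrightarrow> L"
    using Cauchy_convergent_iff convergent_def by blast
  have bound: "norm (Z x - L) \<le> \<gamma> x" for x
  proof -
    have l: "(\<lambda>n. norm (Z x - Z (real n))) \<longlonglongrightarrow> norm (Z x - L)"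
      by (intro tendsto_intros L)
    have r: "(\<lambda>n. \<gamma> x - \<gamma> (real n)) \<longlonglongrightarrow> \<gamma> x - 0"
      by (intro tendsto_intros gn)
    have "\<forall>\<^sub>F n in sequentially. norm (Z x - Z (real n)) \<le> \<gamma> x - \<gamma> (real n)"
      using eventually_ge_at_top[of "nat \<lceil>x\<rceil>"]
    proof eventually_elim
      case (elim n)
      then have "x \<le> real n" by linarith
      from inc[OF this] show ?case by (simp add: norm_minus_commute)
    qed
    from tendsto_le[OF _ r l this] show ?thesis by simp
  qed
  show ?thesis
  proof (intro exI[of _ "\<lambda>x. Z x - L"] conjI allI bound)
    show "((\<lambda>x. Z x - L) has_vector_derivative F x) (at x)" for x
      using has_vector_derivative_diff[OF Z[of x] has_vector_derivative_const[of L]] by simp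
    show "((\<lambda>x. Z x - L) \<longlongrightarrow> 0) at_top"
      by (rule Lim_null_comparison[OF _ g0]) (use bound in auto)
  qed
qed

lemma vector_derivative_zero_constant:
  fixes Y :: "real \<Rightarrow> 'a::real_normed_vector"
  assumes "\<And>x. (Y has_vector_derivative 0) (at x)"
  shows "Y x = Y y"
proof -
  have "norm (Y b - Y a) \<le> 0" if "a \<le> b" for a b
    using increment_le[of a b Y "\<lambda>_. 0" "\<lambda>_. 0" "\<lambda>_. 0"] assms that by simp
  from this[of x y] this[of y x] show ?thesis by (cases "x \<le> y") auto
qed

lemma reflect_has_vector_derivative:
  assumes "(f has_vector_derivative f') (at (- x))"
  shows "((\<lambda>t. f (- t)) has_vector_derivative - f') (at x)"
proof -
  have "(uminus has_vector_derivative (- 1)) (at x)" for x :: real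
    using has_vector_derivative_minus[OF has_vector_derivative_id, of "at x"] by simp
  from vector_diff_chain_at[OF this assms] show ?thesis by (simp add: o_def)
qed

text \<open>Boundedness on the half-line excludes the growing mode, so the value at \<open>x\<close>
  is a weighted integral of \<open>y\<close> over \<open>[x, \<infinity>)\<close> and sees nothing
  to the left of \<open>x\<close>. This one-sidedness later makes the equation for the amplitude a
  Volterra equation.\<close>

lemma halfline_bound:
  fixes v y :: "real \<Rightarrow> complex"
  assumes v: "\<And>t. t \<ge> x \<Longrightarrow> (v has_vector_derivative \<nu> * v t + y t) (at t)"
    and bd: "\<And>t. t \<ge> x \<Longrightarrow> norm (v t) \<le> M"
    and y: "\<And>t. t \<ge> x \<Longrightarrow> norm (y t) \<le> B"
    and nu: "Re \<nu> > 0"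
  shows "norm (v x) \<le> B / Re \<nu>"
proof -
  let ?r = "Re \<nu>"
  let ?u = "\<lambda>t. exp (t *\<^sub>R (- \<nu>)) * v t"
  have B: "B \<ge> 0" using y[of x] norm_ge_zero order_trans by blast
  have du: "(?u has_vector_derivative exp (t *\<^sub>R (- \<nu>)) * y t) (at t)" if "t \<ge> x" for t
  proof -
    have "(?u has_vector_derivative exp (t *\<^sub>R (- \<nu>)) * (\<nu> * v t + y t) + ((- \<nu>) * exp (t *\<^sub>R (- \<nu>))) * v t) (at t)"
      by (rule has_vector_derivative_mult[OF has_vector_derivative_exp_scaleR v[OF that]])
    then show ?thesis by (simp add: algebra_simps)
  qed
  have dg: "((\<lambda>t. - (B / ?r) * exp (t * - ?r)) has_real_derivative B * exp (t * - ?r)) (at t)" for t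
    using nu by (auto intro!: derivative_eq_intros)
  have le: "norm (?u T - ?u x) \<le> B / ?r * exp (x * - ?r)" if "T \<ge> x" for T
  proof -
    have "norm (?u T - ?u x) \<le> (\<lambda>t. - (B / ?r) * exp (t * - ?r)) T - (\<lambda>t. - (B / ?r) * exp (t * - ?r)) x"
      using y by (intro increment_le[where f'="\<lambda>t. exp (t *\<^sub>R (- \<nu>)) * y t" and \<gamma>'="\<lambda>t. B * exp (t * - ?r)"] that du dg)
         (auto simp: norm_mult norm_exp_scaleR mult.commute)
    also have "\<dots> \<le> B / ?r * exp (x * - ?r)" using B nu by simp
    finally show ?thesis .
  qed
  have "(?u \<longlongrightarrow> 0) at_top"
  proof (rule Lim_null_comparison)
    show "\<forall>\<^sub>F t in at_top. norm (?u t) \<le> exp (t * - ?r) * M"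
      using eventually_ge_at_top[of x]
      by eventually_elim (use bd in \<open>auto simp: norm_mult norm_exp_scaleR\<close>)
    have "filterlim (\<lambda>t. t * - ?r) at_bot at_top"
      using filterlim_tendsto_pos_mult_at_top[OF tendsto_const nu filterlim_ident]
      by (simp add: filterlim_uminus_at_bot mult.commute)
    then show "((\<lambda>t. exp (t * - ?r) * M) \<longlongrightarrow> 0) at_top"
      by (intro tendsto_mult_left_zero filterlim_compose[OF exp_at_bot])
  qed
  then have "((\<lambda>T. norm (?u T - ?u x)) \<longlongrightarrow> norm (0 - ?u x)) at_top"
    by (intro tendsto_intros)
  then have "norm (0 - ?u x) \<le> B / ?r * exp (x * - ?r)"
  proof (rule tendsto_upperbound)
    show "\<forall>\<^sub>F T in at_top. norm (?u T - ?u x) \<le> B / ?r * exp (x * - ?r)"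
      using eventually_ge_at_top[of x] by eventually_elim (rule le)
  qed simp
  then have "norm (v x) * exp (x * - ?r) \<le> B / ?r * exp (x * - ?r)"
    by (simp only: diff_0 norm_minus_cancel norm_mult norm_exp_scaleR) (simp add: mult.commute)
  then show ?thesis by (rule mult_right_le_imp_le) simp
qed

text \<open>Bounding the absolute value of \<open>N'\<close> makes \<open>N exp (- k t)\<close>
  nonincreasing and \<open>N exp (k t)\<close> nondecreasing, so a zero at \<open>x0\<close> spreads
  to both sides. Derivatives are taken only on the segment, which allows solutions known on a
  half-line.\<close>

lemma gronwall_zero:
  fixes N N' :: "real \<Rightarrow> real"
  assumes d: "\<And>t. t \<in> closed_segment x0 x \<Longrightarrow> (N has_real_derivative N' t) (at t)"
    and nn: "N x \<ge> 0" and le: "\<And>t. t \<in> closed_segment x0 x \<Longrightarrow> \<bar>N' t\<bar> \<le> k * N t" and z: "N x0 = 0"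
  shows "N x = 0"
proof (cases "x0 \<le> x")
  case True
  have "N x * exp (- k * x) \<le> N x0 * exp (- k * x0)"
  proof (rule DERIV_nonpos_imp_nonincreasing[OF True])
    fix t assume "x0 \<le> t" "t \<le> x"
    then have t: "t \<in> closed_segment x0 x" by (simp add: closed_segment_eq_real_ivl)
    show "\<exists>D. ((\<lambda>x. N x * exp (- k * x)) has_real_derivative D) (at t) \<and> D \<le> 0"
      by (rule exI[of _ "(N' t - k * N t) * exp (- k * t)"])
         (use le[OF t] in \<open>auto intro!: derivative_eq_intros d[OF t] simp: algebra_simps mult_le_0_iff\<close>)
  qed
  then have "N x \<le> 0" using z by (simp add: mult_le_0_iff)
  then show ?thesis using nn by linarith
next
  case False
  then have "x \<le> x0" by simp
  then have "N x * exp (k * x) \<le> N x0 * exp (k * x0)"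
  proof (rule DERIV_nonneg_imp_nondecreasing)
    fix t assume "x \<le> t" "t \<le> x0"
    then have t: "t \<in> closed_segment x0 x" by (simp add: closed_segment_eq_real_ivl)
    have "0 \<le> (N' t + k * N t) * exp (k * t)" using le[OF t] by auto
    then show "\<exists>D. ((\<lambda>x. N x * exp (k * x)) has_real_derivative D) (at t) \<and> 0 \<le> D"
      by (intro exI[of _ "(N' t + k * N t) * exp (k * t)"])
         (auto intro!: derivative_eq_intros d[OF t] simp: algebra_simps)
  qed
  then have "N x \<le> 0" using z by (simp add: mult_le_0_iff)
  then show ?thesis using nn by linarith
qed

section \<open>Weighted fixed points and linear initial value problems\<close>

text \<open>Banach's fixed point theorem for the sup norm weighted by \<open>\<rho>\<close>, with
  contraction factor 1/2, stated on plain functions so that each equation can bring its own weight.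
  Additivity of \<open>L\<close> is asked for only within a weighted bound, because the operators
  used later are chosen by \<open>SOME\<close> and are meaningful only there.\<close>

lemma contraction_fixpoint:
  fixes L :: "(real \<Rightarrow> 'b::banach) \<Rightarrow> real \<Rightarrow> 'b" and \<rho> :: "real \<Rightarrow> real"
  assumes rho: "continuous_on UNIV \<rho>" "\<And>x. \<rho> x > 0"
    and y0: "continuous_on UNIV y0" "\<And>x. norm (y0 x) \<le> C0 * \<rho> x"
    and L: "\<And>y C. continuous_on UNIV y \<Longrightarrow> (\<And>x. norm (y x) \<le> C * \<rho> x) \<Longrightarrow>
              continuous_on UNIV (L y) \<and> (\<forall>x. norm (L y x) \<le> C / 2 * \<rho> x)"
    and diff: "\<And>y y' C. continuous_on UNIV y \<Longrightarrow> (\<And>x. norm (y x) \<le> C * \<rho> x) \<Longrightarrow>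
              continuous_on UNIV y' \<Longrightarrow> (\<And>x. norm (y' x) \<le> C * \<rho> x) \<Longrightarrow>
              L (\<lambda>x. y x - y' x) = (\<lambda>x. L y x - L y' x)"
  shows "\<exists>y. continuous_on UNIV y \<and> (\<forall>x. norm (y x) \<le> 2 * C0 * \<rho> x) \<and> (\<forall>x. y x = y0 x + L y x)"
proof -
  define S where "S = rec_nat (\<lambda>_. 0) (\<lambda>_ y x. y0 x + L y x)"
  have S0: "S 0 = (\<lambda>_. 0)" and SS: "S (Suc n) = (\<lambda>x. y0 x + L (S n) x)" for n
    by (simp_all add: S_def)
  have C0: "C0 \<ge> 0"
    using order_trans[OF norm_ge_zero y0(2)[of 0]] rho(2)[of 0] by (simp add: zero_le_mult_iff)
  have S: "continuous_on UNIV (S n) \<and> (\<forall>x. norm (S n x) \<le> 2 * C0 * \<rho> x)" for n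
  proof (induction n)
    case 0
    then show ?case using C0 less_imp_le[OF rho(2)] by (simp add: S0)
  next
    case (Suc n)
    then have L': "continuous_on UNIV (L (S n))" "\<And>x. norm (L (S n) x) \<le> 2 * C0 / 2 * \<rho> x"
      using L[of "S n" "2 * C0"] by auto
    have "norm (y0 x + L (S n) x) \<le> 2 * C0 * \<rho> x" for x
      using norm_triangle_le[of "y0 x" "L (S n) x" "C0 * \<rho> x + C0 * \<rho> x"] y0(2)[of x] L'(2)[of x] by simp
    then show ?case using L' y0 by (auto simp: SS intro!: continuous_intros)
  qed
  have step: "\<forall>x. norm (S (Suc n) x - S n x) \<le> C0 / 2 ^ n * \<rho> x" for n
  proof (induction n)
    case 0
    have "L (\<lambda>x. 0) = (\<lambda>x. 0)" using diff[of "\<lambda>_. 0" 0 "\<lambda>_. 0"] by simp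
    then show ?case using y0 by (simp add: SS S0)
  next
    case (Suc n)
    have "L (\<lambda>x. S (Suc n) x - S n x) = (\<lambda>x. L (S (Suc n)) x - L (S n) x)"
      by (rule diff) (use S in auto)
    moreover have "\<forall>x. norm (L (\<lambda>x. S (Suc n) x - S n x) x) \<le> C0 / 2 ^ n / 2 * \<rho> x"
      using L[of "\<lambda>x. S (Suc n) x - S n x" "C0 / 2 ^ n"] Suc S by (auto intro!: continuous_intros)
    ultimately show ?case by (simp add: SS[of "Suc n"] SS[of n] algebra_simps)
  qed
  \<comment> \<open>The partial sum of the geometric series is kept with its exact remainder, so
    that the induction closes.\<close>
  have tele: "norm (S (n + k) x - S n x) \<le> (2 * C0 / 2 ^ n - 2 * C0 / 2 ^ (n + k)) * \<rho> x" for n k x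
  proof (induction k)
    case (Suc k)
    have "norm (S (n + Suc k) x - S n x) \<le> norm (S (Suc (n + k)) x - S (n + k) x) + norm (S (n + k) x - S n x)"
      using norm_triangle_ineq[of "S (Suc (n + k)) x - S (n + k) x" "S (n + k) x - S n x"] by simp
    also have "\<dots> \<le> C0 / 2 ^ (n + k) * \<rho> x + (2 * C0 / 2 ^ n - 2 * C0 / 2 ^ (n + k)) * \<rho> x"
      using step Suc by (intro add_mono) auto
    also have "\<dots> = (2 * C0 / 2 ^ n - 2 * C0 / 2 ^ (n + Suc k)) * \<rho> x"
      by (simp add: field_simps)
    finally show ?case .
  qed simp
  have tele': "norm (S m x - S n x) \<le> 2 * C0 / 2 ^ n * \<rho> x" if "n \<le> m" for n m x
  proof -
    have "norm (S m x - S n x) \<le> (2 * C0 / 2 ^ n - 2 * C0 / 2 ^ m) * \<rho> x"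
      using tele[of n "m - n" x] that by simp
    also have "\<dots> \<le> 2 * C0 / 2 ^ n * \<rho> x"
      using C0 less_imp_le[OF rho(2)[of x]] by (intro mult_right_mono) auto
    finally show ?thesis .
  qed
  have lim0: "(\<lambda>n. 2 * C0 / 2 ^ n * K) \<longlonglongrightarrow> 0" for K :: real
  proof -
    have "(\<lambda>n. 2 * C0 * K * (1/2) ^ n) \<longlonglongrightarrow> 2 * C0 * K * 0"
      by (intro tendsto_intros LIMSEQ_power_zero) simp
    then show ?thesis by (simp add: power_one_over field_simps)
  qed
  have "\<exists>l. (\<lambda>n. S n x) \<longlonglongrightarrow> l" for x
  proof -
    have "Cauchy (\<lambda>n. S n x)"
    proof (rule metric_CauchyI)
      fix e :: real assume "e > 0"
      then obtain M where M: "2 * C0 / 2 ^ M * \<rho> x < e / 2"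
        using order_tendstoD(2)[OF lim0[of "\<rho> x"], of "e / 2"] by (auto simp: eventually_sequentially)
      have "norm (S m x - S n x) < e" if "m \<ge> M" "n \<ge> M" for m n
      proof -
        have "norm (S m x - S n x) \<le> norm (S m x - S M x) + norm (S n x - S M x)"
          using norm_triangle_ineq4[of "S m x - S M x" "S n x - S M x"] by simp
        then show ?thesis using tele'[OF that(1), of x] tele'[OF that(2), of x] M by linarith
      qed
      then show "\<exists>M. \<forall>m\<ge>M. \<forall>n\<ge>M. dist (S m x) (S n x) < e"
        by (auto simp: dist_norm)
    qed
    then show ?thesis using Cauchy_convergent_iff convergent_def by blast
  qed
  then obtain y where y: "\<And>x. (\<lambda>n. S n x) \<longlonglongrightarrow> y x" by metis
  have err: "norm (y x - S n x) \<le> 2 * C0 / 2 ^ n * \<rho> x" for n x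
  proof (rule tendsto_upperbound[where F=sequentially])
    show "(\<lambda>m. norm (S m x - S n x)) \<longlonglongrightarrow> norm (y x - S n x)" by (intro tendsto_intros y)
    show "\<forall>\<^sub>F m in sequentially. norm (S m x - S n x) \<le> 2 * C0 / 2 ^ n * \<rho> x"
      using eventually_ge_at_top[of n] by eventually_elim (rule tele')
  qed simp
  have ybd: "norm (y x) \<le> 2 * C0 * \<rho> x" for x
    using err[of x 0] by (simp add: S0)
  have rn: "\<rho> x \<noteq> 0" for x using rho(2)[of x] by simp
  \<comment> \<open>The weight may be unbounded, so only the rescaled iterates converge uniformly on
    the line; continuity is obtained for \<open>y / \<rho>\<close> and then multiplied back.\<close>
  have "uniform_limit UNIV (\<lambda>n x. S n x /\<^sub>R \<rho> x) (\<lambda>x. y x /\<^sub>R \<rho> x) sequentially"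
  proof (rule uniform_limitI)
    fix e :: real assume "e > 0"
    have "dist (S n x /\<^sub>R \<rho> x) (y x /\<^sub>R \<rho> x) \<le> 2 * C0 / 2 ^ n * 1" for n x
    proof -
      have "dist (S n x /\<^sub>R \<rho> x) (y x /\<^sub>R \<rho> x) = norm (y x - S n x) / \<rho> x"
        using rho(2)[of x]
        by (simp add: dist_norm scaleR_diff_right[symmetric] norm_minus_commute divide_inverse)
      also have "\<dots> \<le> 2 * C0 / 2 ^ n" using err[of x n] rho(2)[of x] by (simp add: divide_le_eq)
      finally show ?thesis by simp
    qed
    then show "\<forall>\<^sub>F n in sequentially. \<forall>x\<in>UNIV. dist (S n x /\<^sub>R \<rho> x) (y x /\<^sub>R \<rho> x) < e"
      by (intro eventually_mono[OF order_tendstoD(2)[OF lim0[of 1] \<open>e > 0\<close>]]) (meson le_less_trans)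
  qed
  then have "continuous_on UNIV (\<lambda>x. y x /\<^sub>R \<rho> x)"
    by (rule uniform_limit_theorem[rotated])
       (use S rho rn in \<open>auto intro!: always_eventually continuous_intros\<close>)
  then have "continuous_on UNIV (\<lambda>x. \<rho> x *\<^sub>R (y x /\<^sub>R \<rho> x))"
    by (rule continuous_on_scaleR[OF rho(1)])
  then have yc: "continuous_on UNIV y" by (simp add: rn)
  have "y x = y0 x + L y x" for x
  proof -
    have "norm (y x - (y0 x + L y x)) \<le> 2 * C0 / 2 ^ n * (2 * \<rho> x)" for n
    proof -
      have "L (\<lambda>x. y x - S n x) = (\<lambda>x. L y x - L (S n) x)"
        by (rule diff[of _ "2 * C0"]) (use S yc ybd in auto)
      moreover have "norm (L (\<lambda>x. y x - S n x) x) \<le> 2 * C0 / 2 ^ n / 2 * \<rho> x"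
        using L[of "\<lambda>x. y x - S n x" "2 * C0 / 2 ^ n"] S yc err by (auto intro!: continuous_intros)
      ultimately have "norm (L y x - L (S n) x) \<le> 2 * C0 / 2 ^ n / 2 * \<rho> x" by simp
      moreover have "norm (y x - S (Suc n) x) \<le> 2 * C0 / 2 ^ Suc n * \<rho> x" by (rule err)
      moreover have "y x - (y0 x + L y x) = (y x - S (Suc n) x) - (L y x - L (S n) x)"
        by (simp add: SS)
      ultimately have "norm (y x - (y0 x + L y x)) \<le> 2 * C0 / 2 ^ Suc n * \<rho> x + 2 * C0 / 2 ^ n / 2 * \<rho> x"
        by (simp only:) (rule order_trans[OF norm_triangle_ineq4], rule add_mono)
      also have "\<dots> \<le> 2 * C0 / 2 ^ n * (2 * \<rho> x)"
        using C0 less_imp_le[OF rho(2)[of x]] by (simp add: field_simps)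
      finally show ?thesis .
    qed
    then have "\<forall>\<^sub>F n in sequentially. norm (y x - (y0 x + L y x)) \<le> 2 * C0 / 2 ^ n * (2 * \<rho> x)"
      by (intro always_eventually allI)
    then have "norm (y x - (y0 x + L y x)) \<le> 0"
      by (rule tendsto_lowerbound[OF lim0]) simp
    then show ?thesis by simp
  qed
  then show ?thesis using yc ybd by blast
qed

text \<open>One contraction serves both time directions: integrated from \<open>x0\<close> either
  way, the weight \<open>cosh (k (x - x0))\<close> reproduces itself up to the factor
  \<open>1 / k\<close>, since \<open>\<bar>sinh\<bar> \<le> cosh\<close>.\<close>

lemma linear_ivp:
  fixes A :: "real \<Rightarrow> complex^'n^'n"
  assumes A: "continuous_on UNIV A" and M: "\<And>x v. norm (A x *v v) \<le> M * norm v"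
  shows "\<exists>W. linear_ode_solution A W \<and> W x0 = w0"
proof -
  \<comment> \<open>The factor 2 yields the contraction constant 1/2; the summand 1 keeps
    \<open>k\<close> positive when \<open>M = 0\<close>.\<close>
  define k where "k = 2 * \<bar>M\<bar> + 1"
  have k: "k > 0" "\<bar>M\<bar> / k \<le> 1 / 2" by (auto simp: k_def field_simps)
  define \<rho> where "\<rho> x = cosh (k * (x - x0))" for x
  have Av: "continuous_on UNIV (\<lambda>x. A x *v y x)" if "continuous_on UNIV y" for y
    unfolding matrix_vector_mult_def
    by (intro continuous_intros continuous_on_vec_lambda A that)
  have ex: "\<exists>Y. (\<forall>x. (Y has_vector_derivative A x *v y x) (at x)) \<and> Y x0 = 0"
    if y: "continuous_on UNIV y" for y
  proof -
    obtain Y where "\<forall>x. (Y has_vector_derivative A x *v y x) (at x)"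
      using antiderivative_exists[OF Av[OF y]] by blast
    then show ?thesis
      by (intro exI[of _ "\<lambda>x. Y x - Y x0"]) (auto intro!: derivative_eq_intros)
  qed
  define L where "L y = (SOME Y. (\<forall>x. (Y has_vector_derivative A x *v y x) (at x)) \<and> Y x0 = 0)" for y
  have L: "(L y has_vector_derivative A x *v y x) (at x)" "L y x0 = 0"
    if "continuous_on UNIV y" for y x
    using someI_ex[OF ex[OF that]] unfolding L_def by auto
  have Lc: "continuous_on UNIV (L y)" if "continuous_on UNIV y" for y
    using L(1)[OF that] by (meson continuous_at_imp_continuous_on has_vector_derivative_continuous)
  have Lb: "norm (L y x) \<le> C / 2 * \<rho> x" if y: "continuous_on UNIV y" and C: "\<And>x. norm (y x) \<le> C * \<rho> x" for y C x
  proof -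
    have C0: "C \<ge> 0" using order_trans[OF norm_ge_zero C[of x0]] by (simp add: \<rho>_def)
    let ?g = "\<lambda>t. \<bar>M\<bar> * C / k * sinh (k * (t - x0))"
    have dg: "(?g has_real_derivative \<bar>M\<bar> * (C * \<rho> t)) (at t)" for t
      using k unfolding \<rho>_def by (auto intro!: derivative_eq_intros)
    have le: "norm (A t *v y t) \<le> \<bar>M\<bar> * (C * \<rho> t)" for t
    proof -
      have "norm (A t *v y t) \<le> \<bar>M\<bar> * norm (y t)"
        using M[of t "y t"] mult_right_mono[OF abs_ge_self norm_ge_zero, of M "y t"] by linarith
      also have "\<dots> \<le> \<bar>M\<bar> * (C * \<rho> t)" by (intro mult_left_mono C) auto
      finally show ?thesis .
    qed
    have "norm (L y x) \<le> \<bar>?g x\<bar>"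
    proof (cases "x0 \<le> x")
      case True
      have "norm (L y x - L y x0) \<le> ?g x - ?g x0"
        by (rule increment_le[OF True L(1)[OF y] dg le])
      then have "norm (L y x) \<le> ?g x" by (simp add: L(2)[OF y])
      then show ?thesis by linarith
    next
      case False
      then have "norm (L y x0 - L y x) \<le> ?g x0 - ?g x"
        by (intro increment_le[OF _ L(1)[OF y] dg le]) auto
      then have "norm (L y x) \<le> - ?g x" by (simp add: L(2)[OF y])
      then show ?thesis by linarith
    qed
    also have "\<dots> = \<bar>M\<bar> / k * C * \<bar>sinh (k * (x - x0))\<bar>"
      using k C0 by (simp add: abs_mult)
    also have "\<dots> \<le> 1 / 2 * C * \<rho> x"
    proof (intro mult_mono)
      show "\<bar>sinh (k * (x - x0))\<bar> \<le> \<rho> x"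
        unfolding \<rho>_def sinh_def cosh_def by (auto simp: abs_le_iff)
    qed (use k C0 in auto)
    finally show ?thesis by simp
  qed
  have "\<exists>y. continuous_on UNIV y \<and> (\<forall>x. norm (y x) \<le> 2 * norm w0 * \<rho> x) \<and> (\<forall>x. y x = w0 + L y x)"
  proof (rule contraction_fixpoint)
    show "continuous_on UNIV \<rho>" unfolding \<rho>_def cosh_def by (intro continuous_intros)
    show "\<rho> x > 0" for x by (simp add: \<rho>_def)
    show "norm w0 \<le> norm w0 * \<rho> x" for x
      using mult_left_mono[OF cosh_real_ge_1, of "norm w0"] by (simp add: \<rho>_def)
    fix y y' :: "real \<Rightarrow> complex^'n" and C
    assume y: "continuous_on UNIV y" and bd: "\<And>x. norm (y x) \<le> C * \<rho> x"
    then show "continuous_on UNIV (L y) \<and> (\<forall>x. norm (L y x) \<le> C / 2 * \<rho> x)" using Lc Lb by blast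
    assume y': "continuous_on UNIV y'"
    have yy: "continuous_on UNIV (\<lambda>x. y x - y' x)" using y y' by (intro continuous_intros)
    show "L (\<lambda>x. y x - y' x) = (\<lambda>x. L y x - L y' x)"
    proof
      fix x
      have "((\<lambda>x. L (\<lambda>x. y x - y' x) x - (L y x - L y' x)) has_vector_derivative 0) (at t)" for t
        using has_vector_derivative_diff[OF L(1)[OF yy] has_vector_derivative_diff[OF L(1)[OF y] L(1)[OF y']], of t]
        by (simp add: matrix_vector_mult_diff_distrib)
      from vector_derivative_zero_constant[OF this, of x x0]
      show "L (\<lambda>x. y x - y' x) x = L y x - L y' x" using L(2) y y' yy by simp
    qed
  qed (intro continuous_intros)
  then obtain y where y: "continuous_on UNIV y" "\<And>x. y x = w0 + L y x" by auto
  have "((\<lambda>x. w0 + L y x) has_vector_derivative A x *v y x) (at x)" for x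
    using has_vector_derivative_add[OF has_vector_derivative_const L(1)[OF y(1)]] by simp
  moreover have "(\<lambda>x. w0 + L y x) = y" using y(2) by auto
  ultimately have "(y has_vector_derivative A x *v y x) (at x)" for x by simp
  then show ?thesis unfolding linear_ode_solution_def using y(2)[of x0] L(2)[OF y(1)] by auto
qed

text \<open>Gronwall's argument for the squared norm, with Cauchy-Schwarz supplying the differential
  inequality.\<close>

lemma linear_ode_zero:
  fixes A :: "real \<Rightarrow> complex^'n^'n"
  assumes W: "\<And>t. t \<in> closed_segment x0 x \<Longrightarrow> (W has_vector_derivative A t *v W t) (at t)"
    and M: "\<And>x v. norm (A x *v v) \<le> M * norm v" and z: "W x0 = 0"
  shows "W x = 0"
proof -
  have "(norm (W x))\<^sup>2 = 0"
  proof (rule gronwall_zero[where x=x and x0=x0 and N="\<lambda>x. (norm (W x))\<^sup>2" and k="2 * M" and N'="\<lambda>x. 2 * (W x \<bullet> (A x *v W x))"])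
    fix x' assume x: "x' \<in> closed_segment x0 x"
    have "((\<lambda>x. W x \<bullet> W x) has_vector_derivative W x' \<bullet> (A x' *v W x') + (A x' *v W x') \<bullet> W x') (at x')"
      by (intro bounded_bilinear.has_vector_derivative[OF bounded_bilinear_inner] W x)
    then show "((\<lambda>x. (norm (W x))\<^sup>2) has_real_derivative 2 * (W x' \<bullet> (A x' *v W x'))) (at x')"
      by (simp add: power2_norm_eq_inner has_real_derivative_iff_has_vector_derivative inner_commute)
    have "\<bar>W x' \<bullet> (A x' *v W x')\<bar> \<le> norm (W x') * norm (A x' *v W x')" by (rule Cauchy_Schwarz_ineq2)
    also have "\<dots> \<le> norm (W x') * (M * norm (W x'))" by (intro mult_left_mono M) auto
    finally show "\<bar>2 * (W x' \<bullet> (A x' *v W x'))\<bar> \<le> 2 * M * (norm (W x'))\<^sup>2"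
      by (simp add: power2_eq_square mult_ac)
  qed (use z in auto)
  then show ?thesis by simp
qed

section \<open>The bounded solution of a scalar first-order equation\<close>

definition bounded_continuous :: "(real \<Rightarrow> complex) \<Rightarrow> bool" where
  "bounded_continuous y \<longleftrightarrow> continuous_on UNIV y \<and> (\<exists>B. \<forall>x. norm (y x) \<le> B)"

lemma bounded_continuousI:
  "continuous_on UNIV y \<Longrightarrow> (\<And>x. norm (y x) \<le> B) \<Longrightarrow> bounded_continuous y"
  by (auto simp: bounded_continuous_def)

lemma bounded_continuousE:
  assumes "bounded_continuous y"
  obtains B where "continuous_on UNIV y" "B > 0" "\<And>x. norm (y x) \<le> B"
proof -
  obtain B where "continuous_on UNIV y" "\<And>x. norm (y x) \<le> B"
    using assms by (auto simp: bounded_continuous_def)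
  then have "\<And>x. norm (y x) \<le> max B 1" by (meson max.coboundedI1)
  then show ?thesis using that[of "max B 1"] \<open>continuous_on UNIV y\<close> by auto
qed

lemma bounded_continuous_add:
  assumes "bounded_continuous y" "bounded_continuous y'"
  shows "bounded_continuous (\<lambda>x. y x + y' x)"
proof -
  obtain B B' where *: "\<And>x. norm (y x) \<le> B" "\<And>x. norm (y' x) \<le> B'"
    using assms by (auto simp: bounded_continuous_def)
  show ?thesis
    by (rule bounded_continuousI[where B="B + B'"])
       (use assms * in \<open>auto simp: bounded_continuous_def intro!: continuous_intros norm_triangle_mono\<close>)
qed

lemma bounded_continuous_mult:
  assumes "bounded_continuous y" "bounded_continuous y'"
  shows "bounded_continuous (\<lambda>x. y x * y' x)"
proof -
  obtain B B' where B: "B > 0" "\<And>x. norm (y x) \<le> B" "\<And>x. norm (y' x) \<le> B'"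
    using assms by (auto elim!: bounded_continuousE)
  show ?thesis
    by (rule bounded_continuousI[where B="B * B'"])
       (use assms B in \<open>auto simp: bounded_continuous_def norm_mult less_imp_le intro!: continuous_intros mult_mono\<close>)
qed

lemma bounded_continuous_const: "bounded_continuous (\<lambda>x. k)"
  by (rule bounded_continuousI[where B="norm k"]) auto

lemma bounded_continuous_diff:
  assumes "bounded_continuous y" "bounded_continuous y'"
  shows "bounded_continuous (\<lambda>x. y x - y' x)"
  using bounded_continuous_add[OF assms(1) bounded_continuous_mult[OF bounded_continuous_const[of "-1"] assms(2)]]
  by simp

lemmas bounded_continuous_intros =
  bounded_continuous_add bounded_continuous_mult bounded_continuous_const bounded_continuous_diff

lemma line_bound:
  fixes v y :: "real \<Rightarrow> complex"
  assumes v: "\<And>t. (v has_vector_derivative \<nu> * v t + y t) (at t)"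
    and bd: "\<And>t. norm (v t) \<le> M" and y: "\<And>t. norm (y t) \<le> B" and nu: "Re \<nu> \<noteq> 0"
  shows "norm (v x) \<le> B / \<bar>Re \<nu>\<bar>"
proof (cases "Re \<nu> > 0")
  case True
  then show ?thesis using halfline_bound[of x v \<nu> y M B] assms by simp
next
  case False
  have "norm ((\<lambda>t. v (- t)) (- x)) \<le> B / Re (- \<nu>)"
  proof (rule halfline_bound[where v="\<lambda>t. v (- t)" and y="\<lambda>t. - y (- t)" and M=M])
    show "((\<lambda>t. v (- t)) has_vector_derivative - \<nu> * v (- t) + - y (- t)) (at t)" for t
      using reflect_has_vector_derivative[OF v] by simp
  qed (use bd y nu False in auto)
  then show ?thesis using False by simp
qed

text \<open>For \<open>Re \<nu> > 0\<close> this is variation of constants with the integral taken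
  from \<open>+\<infinity>\<close>; for \<open>Re \<nu> < 0\<close> the reflected problem has the
  opposite sign.\<close>

lemma bounded_solution_exists:
  fixes y :: "real \<Rightarrow> complex"
  assumes y: "bounded_continuous y" and nu: "Re \<nu> \<noteq> 0"
  shows "\<exists>v. (\<forall>x. (v has_vector_derivative \<nu> * v x + y x) (at x)) \<and> bounded_continuous v"
proof -
  have pos: "\<exists>v. (\<forall>x. (v has_vector_derivative \<nu> * v x + y x) (at x)) \<and> bounded_continuous v"
    if y: "bounded_continuous y" and nu: "Re \<nu> > 0" for y \<nu>
  proof -
    obtain B where B: "continuous_on UNIV y" "B > 0" "\<And>x. norm (y x) \<le> B"
      using y by (auto elim: bounded_continuousE)
    let ?r = "Re \<nu>"
    have "\<exists>Y. (\<forall>x. (Y has_vector_derivative exp (x *\<^sub>R (- \<nu>)) * y x) (at x)) \<and> (Y \<longlongrightarrow> 0) at_top \<and>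
        (\<forall>x. norm (Y x) \<le> B / ?r * exp (x * - ?r))"
    proof (rule tail_primitive)
      show "continuous_on UNIV (\<lambda>x. exp (x *\<^sub>R (- \<nu>)) * y x)" by (intro continuous_intros B)
      show "((\<lambda>t. B / ?r * exp (t * - ?r)) has_real_derivative - (B * exp (t * - ?r))) (at t)" for t
        using nu by (auto intro!: derivative_eq_intros)
      show "norm (exp (x *\<^sub>R - \<nu>) * y x) \<le> - (- (B * exp (x * - ?r)))" for x
        using B(3)[of x] by (simp add: norm_mult norm_exp_eq_Re mult.commute)
      have "filterlim (\<lambda>t. t * - ?r) at_bot at_top"
        using filterlim_tendsto_pos_mult_at_top[OF tendsto_const nu filterlim_ident]
        by (simp add: filterlim_uminus_at_bot mult.commute)
      then show "((\<lambda>t. B / ?r * exp (t * - ?r)) \<longlongrightarrow> 0) at_top"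
        by (intro tendsto_mult_right_zero filterlim_compose[OF exp_at_bot])
    qed
    then obtain Y where Y: "\<And>x. (Y has_vector_derivative exp (x *\<^sub>R (- \<nu>)) * y x) (at x)"
      "\<And>x. norm (Y x) \<le> B / ?r * exp (x * - ?r)" by auto
    let ?v = "\<lambda>x. exp (x *\<^sub>R \<nu>) * Y x"
    have dv: "(?v has_vector_derivative \<nu> * ?v x + y x) (at x)" for x
    proof -
      have "(?v has_vector_derivative exp (x *\<^sub>R \<nu>) * (exp (x *\<^sub>R (- \<nu>)) * y x) + (\<nu> * exp (x *\<^sub>R \<nu>)) * Y x) (at x)"
        by (rule has_vector_derivative_mult[OF has_vector_derivative_exp_scaleR Y(1)])
      then show ?thesis
        by (rule has_vector_derivative_eq_rhs) (simp add: exp_minus field_simps)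
    qed
    have "norm (?v x) \<le> B / ?r" for x
    proof -
      have "norm (?v x) \<le> exp (x * ?r) * (B / ?r * exp (x * - ?r))"
        unfolding norm_mult norm_exp_scaleR by (intro mult_left_mono Y(2)) auto
      also have "\<dots> = B / ?r" by (simp add: exp_minus)
      finally show ?thesis .
    qed
    moreover have "continuous_on UNIV ?v"
      using dv by (meson continuous_at_imp_continuous_on has_vector_derivative_continuous)
    ultimately show ?thesis using dv bounded_continuousI by blast
  qed
  show ?thesis
  proof (cases "Re \<nu> > 0")
    case False
    obtain B where B: "continuous_on UNIV y" "\<And>x. norm (y x) \<le> B"
      using y by (auto simp: bounded_continuous_def)
    have "bounded_continuous (\<lambda>x. - y (- x))"
      by (rule bounded_continuousI[of _ B])
         (use B in \<open>auto intro!: continuous_intros continuous_on_compose2[OF B(1)]\<close>)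
    from pos[OF this, of "- \<nu>"] False nu
    obtain v where v: "\<And>x. (v has_vector_derivative (- \<nu>) * v x + (- y (- x))) (at x)" "bounded_continuous v"
      by auto
    obtain C where C: "continuous_on UNIV v" "\<And>x. norm (v x) \<le> C"
      using v(2) by (auto simp: bounded_continuous_def)
    have "((\<lambda>x. v (- x)) has_vector_derivative \<nu> * v (- x) + y x) (at x)" for x
      using reflect_has_vector_derivative[OF v(1), of x] by (simp add: add.commute)
    moreover have "bounded_continuous (\<lambda>x. v (- x))"
      by (rule bounded_continuousI[of _ C])
         (use C in \<open>auto intro!: continuous_intros continuous_on_compose2[OF C(1)]\<close>)
    ultimately show ?thesis by blast
  qed (use pos y in blast)
qed

text \<open>The inverse of \<open>\<partial> - \<nu>\<close> on bounded continuous functions; off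
  the imaginary axis the bounded solution is unique, so the choice is canonical.\<close>

definition resolvent :: "complex \<Rightarrow> (real \<Rightarrow> complex) \<Rightarrow> real \<Rightarrow> complex" where
  "resolvent \<nu> y = (SOME v. (\<forall>x. (v has_vector_derivative \<nu> * v x + y x) (at x)) \<and> bounded_continuous v)"

lemma resolvent:
  assumes "bounded_continuous y" "Re \<nu> \<noteq> 0"
  shows resolvent_deriv: "(resolvent \<nu> y has_vector_derivative \<nu> * resolvent \<nu> y x + y x) (at x)"
    and resolvent_bounded_continuous: "bounded_continuous (resolvent \<nu> y)"
  using someI_ex[OF bounded_solution_exists[OF assms]] unfolding resolvent_def by auto

lemma resolvent_unique:
  assumes y: "bounded_continuous y" "Re \<nu> \<noteq> 0"
    and v: "\<And>x. (v has_vector_derivative \<nu> * v x + y x) (at x)" "bounded_continuous v"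
  shows "v = resolvent \<nu> y"
proof
  fix x
  obtain M where M: "\<And>x. norm (v x - resolvent \<nu> y x) \<le> M"
    using bounded_continuous_diff[OF v(2) resolvent_bounded_continuous[OF y]]
    by (auto simp: bounded_continuous_def)
  have "norm ((\<lambda>x. v x - resolvent \<nu> y x) x) \<le> 0 / \<bar>Re \<nu>\<bar>"
  proof (rule line_bound[where v="\<lambda>x. v x - resolvent \<nu> y x" and y="\<lambda>_. 0"])
    show "((\<lambda>x. v x - resolvent \<nu> y x) has_vector_derivative \<nu> * (v t - resolvent \<nu> y t) + 0) (at t)" for t
      using has_vector_derivative_diff[OF v(1) resolvent_deriv[OF y], of t] by (simp add: algebra_simps)
  qed (use M y in auto)
  then show "v x = resolvent \<nu> y x" by simp
qed

lemma resolvent_diff: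
  assumes "bounded_continuous y" "bounded_continuous y'" "Re \<nu> \<noteq> 0"
  shows "resolvent \<nu> (\<lambda>x. y x - y' x) = (\<lambda>x. resolvent \<nu> y x - resolvent \<nu> y' x)"
proof (rule resolvent_unique[symmetric])
  show "((\<lambda>x. resolvent \<nu> y x - resolvent \<nu> y' x) has_vector_derivative
      \<nu> * (resolvent \<nu> y x - resolvent \<nu> y' x) + (y x - y' x)) (at x)" for x
    using has_vector_derivative_diff[OF resolvent_deriv[OF assms(1,3)] resolvent_deriv[OF assms(2,3)], of x]
    by (simp add: algebra_simps)
qed (use assms in \<open>auto intro!: bounded_continuous_intros resolvent_bounded_continuous\<close>)

lemma resolvent_bound:
  assumes "bounded_continuous y" "Re \<nu> \<noteq> 0" "\<And>x. norm (y x) \<le> B"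
  shows "norm (resolvent \<nu> y x) \<le> B / \<bar>Re \<nu>\<bar>"
proof -
  obtain M where "\<And>x. norm (resolvent \<nu> y x) \<le> M"
    using resolvent_bounded_continuous[OF assms(1,2)] by (auto simp: bounded_continuous_def)
  then show ?thesis by (intro line_bound[OF resolvent_deriv[OF assms(1,2)]]) (use assms in auto)
qed

lemma resolvent_tail_bound:
  assumes "bounded_continuous y" "Re \<nu> > 0" "\<And>t. t \<ge> x \<Longrightarrow> norm (y t) \<le> B"
  shows "norm (resolvent \<nu> y x) \<le> B / Re \<nu>"
proof -
  have nz: "Re \<nu> \<noteq> 0" using assms by simp
  obtain M where "\<And>x. norm (resolvent \<nu> y x) \<le> M"
    using resolvent_bounded_continuous[OF assms(1) nz] by (auto simp: bounded_continuous_def)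
  then show ?thesis by (intro halfline_bound[OF resolvent_deriv[OF assms(1) nz]]) (use assms in auto)
qed

text \<open>This is the resolvent identity: the difference of the two resolvents is the bounded
  solution at rate \<open>\<nu> i\<close> with source
  \<open>(\<nu> i - \<nu>0) * resolvent \<nu>0 y0 + (y i - y0)\<close>, and that source is uniformly
  small.\<close>

lemma resolvent_uniform_limit:
  assumes nu: "(\<nu> \<longlongrightarrow> \<nu>0) F" "Re \<nu>0 > 0"
    and y: "\<forall>\<^sub>F i in F. bounded_continuous (y i)" "bounded_continuous y0"
    and lim: "uniform_limit UNIV y y0 F"
  shows "uniform_limit UNIV (\<lambda>i. resolvent (\<nu> i) (y i)) (resolvent \<nu>0 y0) F"
proof (rule uniform_limitI)
  fix e :: real assume "e > 0"
  have nz: "Re \<nu>0 \<noteq> 0" using nu by simp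
  obtain B where B: "B > 0" "\<And>x. norm (resolvent \<nu>0 y0 x) \<le> B"
    using resolvent_bounded_continuous[OF y(2) nz] by (auto elim: bounded_continuousE)
  \<comment> \<open>Half of the limiting real part bounds \<open>Re (\<nu> i)\<close> from below;
    the two tolerances are chosen so that the source is at most \<open>e * ?r / 2\<close>.\<close>
  let ?r = "Re \<nu>0 / 2"
  have "e * ?r / 4 > 0" "e * ?r / (4 * B) > 0" using \<open>e > 0\<close> nu B by auto
  have "\<forall>\<^sub>F i in F. Re (\<nu> i) > ?r"
    using order_tendstoD(1)[OF tendsto_Re[OF nu(1)], of ?r] nu by simp
  moreover have "\<forall>\<^sub>F i in F. dist (\<nu> i) \<nu>0 < e * ?r / (4 * B)"
    using nu(1) \<open>e * ?r / (4 * B) > 0\<close> by (rule tendstoD)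
  moreover have "\<forall>\<^sub>F i in F. \<forall>x\<in>UNIV. dist (y i x) (y0 x) < e * ?r / 4"
    using lim \<open>e * ?r / 4 > 0\<close> by (rule uniform_limitD)
  ultimately show "\<forall>\<^sub>F i in F. \<forall>x\<in>UNIV. dist (resolvent (\<nu> i) (y i) x) (resolvent \<nu>0 y0 x) < e"
    using y(1)
  proof eventually_elim
    case (elim i)
    have nzi: "Re (\<nu> i) \<noteq> 0" and pos: "Re (\<nu> i) > 0" using elim(1) nu by auto
    let ?g = "\<lambda>t. (\<nu> i - \<nu>0) * resolvent \<nu>0 y0 t + (y i t - y0 t)"
    let ?d = "\<lambda>t. resolvent (\<nu> i) (y i) t - resolvent \<nu>0 y0 t"
    obtain M where M: "\<And>x. norm (?d x) \<le> M"
      using bounded_continuous_diff[OF resolvent_bounded_continuous[OF elim(4) nzi] resolvent_bounded_continuous[OF y(2) nz]]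
      by (auto simp: bounded_continuous_def)
    have d: "(?d has_vector_derivative \<nu> i * ?d t + ?g t) (at t)" for t
      using has_vector_derivative_diff[OF resolvent_deriv[OF elim(4) nzi] resolvent_deriv[OF y(2) nz], of t]
      by (simp add: algebra_simps)
    have g: "norm (?g t) \<le> e * ?r / 2" for t
    proof -
      have "norm (?g t) \<le> norm (\<nu> i - \<nu>0) * norm (resolvent \<nu>0 y0 t) + norm (y i t - y0 t)"
        by (metis norm_mult norm_triangle_ineq)
      also have "\<dots> \<le> e * ?r / (4 * B) * B + e * ?r / 4"
        using elim(2,3) B nu \<open>e > 0\<close> by (intro add_mono mult_mono) (auto simp: dist_norm less_imp_le)
      also have "\<dots> = e * ?r / 2" using B by (simp add: field_simps)
      finally show ?thesis .
    qed
    have "norm (?d x) < e" for x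
    proof -
      have "norm (?d x) \<le> (e * ?r / 2) / \<bar>Re (\<nu> i)\<bar>"
        by (rule line_bound[OF d M g nzi])
      also have "\<dots> < e"
        using elim(1) pos \<open>e > 0\<close> nu by (simp add: divide_less_eq)
      finally show ?thesis .
    qed
    then show ?case by (simp add: dist_norm)
  qed
qed

section \<open>Solutions with prescribed exponential behaviour\<close>

text \<open>\<open>r\<close> is the correction in \<open>w = w\<^sub>0 + exp ((m - \<delta>) x) r\<close>, where \<open>w\<^sub>0\<close> solves the equation with
  \<open>h = 0\<close> and \<open>q = w\<^sub>0'\<close>.\<close>

lemma asymptotic_correction:
  fixes h :: "real \<Rightarrow> real" and m m1 m2 m3 n1 n2 n3 \<kappa> :: complex and q :: "real \<Rightarrow> complex"
  assumes h: "continuous_on UNIV h" "(h \<longlongrightarrow> 0) at_top"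
    and n: "Re n1 \<noteq> 0" "Re n2 \<noteq> 0" "Re n3 \<noteq> 0"
    and q: "continuous_on UNIV q" "\<And>x. x \<ge> 0 \<Longrightarrow> norm (q x) \<le> B"
  shows "\<exists>X r r1 r2. X \<ge> 0 \<and> bounded_continuous r \<and> bounded_continuous r1 \<and> bounded_continuous r2 \<and>
    (\<forall>x. (r has_vector_derivative r1 x) (at x)) \<and> (\<forall>x. (r1 has_vector_derivative r2 x) (at x)) \<and>
    (\<forall>x\<ge>X. (r2 has_vector_derivative (n1 + n2 + n3) * r2 x - (n1 * n2 + n1 * n3 + n2 * n3) * r1 x
       + n1 * n2 * n3 * r x + of_real (h x) * (r1 x + \<kappa> * r x) + q x) (at x))"
proof -
  \<comment> \<open>If \<open>r\<close> is the triple resolvent of \<open>y\<close>, then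
    \<open>Q y = r' + \<kappa> r\<close>, because
    \<open>r' = n3 r + resolvent n2 (resolvent n1 y)\<close>. Taking the whole right-hand side as
    the unknown turns the differential equation into the fixed point problem
    \<open>y = q + h Q y\<close>.\<close>
  define Q where "Q y = (\<lambda>x. resolvent n2 (resolvent n1 y) x
     + (n3 + \<kappa>) * resolvent n3 (resolvent n2 (resolvent n1 y)) x)" for y
  define M where "M = 1 / \<bar>Re n1\<bar> / \<bar>Re n2\<bar> + norm (n3 + \<kappa>) * (1 / \<bar>Re n1\<bar> / \<bar>Re n2\<bar> / \<bar>Re n3\<bar>)"
  have M: "M \<ge> 0" by (simp add: M_def)
  have QBC: "bounded_continuous (Q y)" if "bounded_continuous y" for y
    unfolding Q_def by (intro bounded_continuous_intros resolvent_bounded_continuous that n)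
  have Qb: "norm (Q y x) \<le> M * C" if y: "bounded_continuous y" and C: "\<And>x. norm (y x) \<le> C" for y C x
  proof -
    note 1 = resolvent_bounded_continuous[OF y n(1)]
    note 2 = resolvent_bounded_continuous[OF 1 n(2)]
    note b1 = resolvent_bound[OF y n(1) C]
    note b2 = resolvent_bound[OF 1 n(2) b1]
    note b3 = resolvent_bound[OF 2 n(3) b2]
    have "norm (Q y x) \<le> C / \<bar>Re n1\<bar> / \<bar>Re n2\<bar> + norm (n3 + \<kappa>) * (C / \<bar>Re n1\<bar> / \<bar>Re n2\<bar> / \<bar>Re n3\<bar>)"
      unfolding Q_def
      by (rule norm_triangle_mono[OF b2]) (simp only: norm_mult, rule mult_left_mono[OF b3], simp)
    also have "\<dots> = M * C" by (simp add: M_def algebra_simps)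
    finally show ?thesis .
  qed
  \<comment> \<open>The summand 2 makes the denominator positive from \<open>M \<ge> 0\<close>
    alone; \<open>M / (2 M + 2) \<le> 1 / 2\<close> is the contraction factor.\<close>
  have "1 / (2 * M + 2) > 0" using M by simp
  from order_tendstoD[OF h(2)] this have "\<forall>\<^sub>F x in at_top. h x < 1 / (2 * M + 2)" "\<forall>\<^sub>F x in at_top. h x > - 1 / (2 * M + 2)"
    by auto
  then have "\<forall>\<^sub>F x in at_top. \<bar>h x\<bar> \<le> 1 / (2 * M + 2)" by eventually_elim auto
  then obtain X0 where X0: "\<And>x. x \<ge> X0 \<Longrightarrow> \<bar>h x\<bar> \<le> 1 / (2 * M + 2)"
    by (auto simp: eventually_at_top_linorder)
  define X where "X = max X0 0"
  \<comment> \<open>Freezing \<open>h\<close> and \<open>q\<close> to the left of \<open>X\<close>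
    makes the coefficient small on the whole line, as the contraction requires; the price is that
    the equation is recovered only for \<open>x \<ge> X\<close>.\<close>
  define hX where "hX x = h (max X x)" for x
  define qX where "qX x = q (max X x)" for x
  have hXc: "continuous_on UNIV hX" unfolding hX_def
    by (rule continuous_on_compose2[OF h(1)]) (auto intro!: continuous_intros)
  have hXb: "\<bar>hX x\<bar> \<le> 1 / (2 * M + 2)" for x unfolding hX_def by (rule X0) (simp add: X_def)
  have qXc: "continuous_on UNIV qX" unfolding qX_def
    by (rule continuous_on_compose2[OF q(1)]) (auto intro!: continuous_intros)
  have qXb: "norm (qX x) \<le> B" for x unfolding qX_def by (rule q) (simp add: X_def)
  have Ldiff: "Q (\<lambda>x. y x - y' x) = (\<lambda>x. Q y x - Q y' x)" if y: "bounded_continuous y" "bounded_continuous y'" for y y'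
    unfolding Q_def using y n
    by (simp add: resolvent_diff resolvent_bounded_continuous algebra_simps)
  have "\<exists>\<phi>. continuous_on UNIV \<phi> \<and> (\<forall>x. norm (\<phi> x) \<le> 2 * B * 1) \<and> (\<forall>x. \<phi> x = qX x + of_real (hX x) * Q \<phi> x)"
  proof (rule contraction_fixpoint[where L="\<lambda>y x. of_real (hX x) * Q y x" and \<rho>="\<lambda>_. 1"])
    fix y y' :: "real \<Rightarrow> complex" and C
    assume "continuous_on UNIV y" and C: "\<And>x. norm (y x) \<le> C * 1"
    then have y: "bounded_continuous y" by (intro bounded_continuousI) auto
    have C0: "C \<ge> 0" using order_trans[OF norm_ge_zero C[of 0]] by simp
    have "norm (of_real (hX x) * Q y x) \<le> C / 2 * 1" for x
    proof -
      have "norm (of_real (hX x) * Q y x) \<le> 1 / (2 * M + 2) * (M * C)"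
        unfolding norm_mult norm_of_real using y C M by (intro mult_mono hXb Qb) auto
      also have "\<dots> \<le> C / 2" using M C0 by (simp add: field_simps)
      finally show ?thesis by simp
    qed
    moreover have "continuous_on UNIV (\<lambda>x. of_real (hX x) * Q y x)"
      using QBC[OF y] hXc by (intro continuous_intros) (auto simp: bounded_continuous_def)
    ultimately show "continuous_on UNIV (\<lambda>x. of_real (hX x) * Q y x) \<and> (\<forall>x. norm (of_real (hX x) * Q y x) \<le> C / 2 * 1)"
      by blast
    assume "continuous_on UNIV y'" and C': "\<And>x. norm (y' x) \<le> C * 1"
    then have y': "bounded_continuous y'" by (intro bounded_continuousI) auto
    show "(\<lambda>x. of_real (hX x) * Q (\<lambda>x. y x - y' x) x) = (\<lambda>x. of_real (hX x) * Q y x - of_real (hX x) * Q y' x)"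
      by (simp add: Ldiff[OF y y'] algebra_simps)
  qed (use qXc qXb in auto)
  then obtain \<phi> where "continuous_on UNIV \<phi>" "\<And>x. norm (\<phi> x) \<le> 2 * B"
    and eq: "\<And>x. \<phi> x = qX x + of_real (hX x) * Q \<phi> x" by auto
  then have \<phi>: "bounded_continuous \<phi>" by (intro bounded_continuousI) auto
  define t s r where "t = resolvent n1 \<phi>" and "s = resolvent n2 t" and "r = resolvent n3 s"
  have BCt: "bounded_continuous t" and dt: "\<And>x. (t has_vector_derivative n1 * t x + \<phi> x) (at x)"
    unfolding t_def using resolvent[OF \<phi> n(1)] by auto
  have BCs: "bounded_continuous s" and ds: "\<And>x. (s has_vector_derivative n2 * s x + t x) (at x)"
    unfolding s_def using resolvent[OF BCt n(2)] by auto
  have BCr: "bounded_continuous r" and dr: "\<And>x. (r has_vector_derivative n3 * r x + s x) (at x)"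
    unfolding r_def using resolvent[OF BCs n(3)] by auto
  define r1 where "r1 x = n3 * r x + s x" for x
  define r2 where "r2 x = n3 * r1 x + (n2 * s x + t x)" for x
  have dr1: "(r1 has_vector_derivative r2 x) (at x)" for x
    unfolding r1_def r2_def
    by (intro has_vector_derivative_add has_vector_derivative_mult_right dr ds)
  have dr2: "(r2 has_vector_derivative n3 * r2 x + (n2 * (n2 * s x + t x) + (n1 * t x + \<phi> x))) (at x)" for x
    unfolding r2_def[abs_def]
    by (intro has_vector_derivative_add has_vector_derivative_mult_right dr1 ds dt | unfold r2_def[symmetric])+
  have "(r2 has_vector_derivative (n1 + n2 + n3) * r2 x - (n1 * n2 + n1 * n3 + n2 * n3) * r1 x
       + n1 * n2 * n3 * r x + of_real (h x) * (r1 x + \<kappa> * r x) + q x) (at x)" if "x \<ge> X" for x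
  proof -
    have "Q \<phi> x = r1 x + \<kappa> * r x"
      unfolding Q_def r1_def r_def s_def t_def by (simp add: algebra_simps)
    then have \<phi>x: "\<phi> x = q x + of_real (h x) * (r1 x + \<kappa> * r x)"
      using eq[of x] that by (simp add: hX_def qX_def)
    show ?thesis
      using dr2[of x] unfolding \<phi>x
      by (rule has_vector_derivative_eq_rhs) (simp add: r2_def r1_def algebra_simps)
  qed
  moreover have "bounded_continuous r1" "bounded_continuous r2"
    unfolding r1_def r2_def by (intro bounded_continuous_intros BCr BCs BCt)+
  moreover have "X \<ge> 0" by (simp add: X_def)
  ultimately show ?thesis
    using BCr dr dr1 unfolding r1_def[symmetric] by blast
qed

section \<open>The solution of fastest decay\<close>

text \<open>Write \<open>w = exp (m\<^sub>3 x) v\<close> for a solution of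
  \<open>(\<partial> - m\<^sub>1) (\<partial> - m\<^sub>2) (\<partial> - m\<^sub>3) w = h w'\<close> and \<open>n\<^sub>i = m\<^sub>i - m\<^sub>3\<close>. Then
  \<open>a = (\<partial> - n\<^sub>1) (\<partial> - n\<^sub>2) v\<close> satisfies \<open>a' = h (v' + m\<^sub>3 v)\<close>, and \<open>volterra_op\<close> recovers
  \<open>v' + m\<^sub>3 v\<close> from \<open>a\<close>.\<close>

definition volterra_op :: "complex \<Rightarrow> complex \<Rightarrow> complex \<Rightarrow> (real \<Rightarrow> complex) \<Rightarrow> real \<Rightarrow> complex" where
  "volterra_op m2 n1 n2 a = (\<lambda>x. m2 * resolvent n2 (resolvent n1 a) x + resolvent n1 a x)"

definition volterra_solution ::
  "(real \<Rightarrow> real) \<Rightarrow> complex \<Rightarrow> complex \<Rightarrow> complex \<Rightarrow> (real \<Rightarrow> complex) \<Rightarrow> bool" where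
  "volterra_solution h m2 n1 n2 a \<longleftrightarrow> bounded_continuous a \<and> (a \<longlongrightarrow> 1) at_top \<and>
     (\<forall>x. (a has_vector_derivative of_real (h x) * volterra_op m2 n1 n2 a x) (at x))"

text \<open>The exponential of \<open>2 M\<close> times the integral over
  \<open>[x, \<infinity>)\<close> of the majorant \<open>K / (1 + t\<^sup>2)\<close> of
  \<open>\<bar>h\<bar>\<close>. In this weight the Volterra integral operator halves norms however
  large \<open>h\<close> is; and since the weight is bounded, a weighted bound is still an ordinary
  bound.\<close>

definition volterra_weight :: "real \<Rightarrow> real \<Rightarrow> real \<Rightarrow> real" where
  "volterra_weight K M x = exp (2 * M * (K * (pi / 2 - arctan x)))"

lemma volterra_op_bounded_continuous:
  assumes "bounded_continuous a" "Re n1 \<noteq> 0" "Re n2 \<noteq> 0"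
  shows "bounded_continuous (volterra_op m2 n1 n2 a)"
  unfolding volterra_op_def
  by (intro bounded_continuous_intros resolvent_bounded_continuous assms)

lemma volterra_op_diff:
  assumes "bounded_continuous a" "bounded_continuous b" "Re n1 \<noteq> 0" "Re n2 \<noteq> 0"
  shows "volterra_op m2 n1 n2 (\<lambda>x. a x - b x) = (\<lambda>x. volterra_op m2 n1 n2 a x - volterra_op m2 n1 n2 b x)"
  unfolding volterra_op_def using assms
  by (simp add: resolvent_diff resolvent_bounded_continuous algebra_simps)

text \<open>Both resolvents look only to the right because \<open>Re n1\<close> and
  \<open>Re n2\<close> are positive. The bound at \<open>x\<close> therefore involves
  \<open>a\<close> on \<open>[x, \<infinity>)\<close> only, and a decreasing weight passes through
  the operator.\<close>

lemma volterra_op_tail_bound: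
  assumes a: "bounded_continuous a" and n: "Re n1 > 0" "Re n2 > 0"
    and M: "(norm m2 / Re n2 + 1) / Re n1 \<le> M"
    and bd: "\<And>t. t \<ge> x \<Longrightarrow> norm (a t) \<le> C"
  shows "norm (volterra_op m2 n1 n2 a x) \<le> M * C"
proof -
  have nz: "Re n1 \<noteq> 0" "Re n2 \<noteq> 0" using n by auto
  have C: "C \<ge> 0" using order_trans[OF norm_ge_zero bd[of x]] by simp
  have b1: "norm (resolvent n1 a t) \<le> C / Re n1" if "t \<ge> x" for t
    by (rule resolvent_tail_bound[OF a n(1)]) (use bd that in auto)
  have b2: "norm (resolvent n2 (resolvent n1 a) x) \<le> C / Re n1 / Re n2"
    by (rule resolvent_tail_bound[OF resolvent_bounded_continuous[OF a nz(1)] n(2)]) (use b1 in auto)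
  have "norm (volterra_op m2 n1 n2 a x) \<le> norm m2 * (C / Re n1 / Re n2) + C / Re n1"
    unfolding volterra_op_def
    by (rule norm_triangle_mono) (use b1[of x] mult_left_mono[OF b2, of "norm m2"] in \<open>auto simp: norm_mult\<close>)
  also have "\<dots> = (norm m2 / Re n2 + 1) / Re n1 * C" using n by (simp add: field_simps)
  also have "\<dots> \<le> M * C" by (intro mult_right_mono M C)
  finally show ?thesis .
qed

lemma volterra_op_norm_pos:
  fixes m2 :: complex
  assumes "Re n1 > 0" "Re n2 > 0" shows "(norm m2 / Re n2 + 1) / Re n1 > 0"
proof -
  have "norm m2 / Re n2 \<ge> 0" using assms by simp
  then have "norm m2 / Re n2 + 1 > 0" by linarith
  then show ?thesis using assms(1) by (rule divide_pos_pos)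
qed

section \<open>The exponential weight and its tail integrals\<close>

lemma volterra_weight_ge_1: "M \<ge> 0 \<Longrightarrow> K \<ge> 0 \<Longrightarrow> volterra_weight K M x \<ge> 1"
  unfolding volterra_weight_def using arctan_ubound[of x] by (simp add: mult_nonneg_nonneg)

lemma volterra_weight_le:
  assumes "M \<ge> 0" "K \<ge> 0" shows "volterra_weight K M x \<le> exp (2 * M * (K * pi))"
  unfolding volterra_weight_def
  by (subst exp_le_cancel_iff, intro mult_left_mono) (use assms arctan_lbound[of x] in auto)

lemma volterra_weight_antimono:
  assumes "M \<ge> 0" "K \<ge> 0" "x \<le> y" shows "volterra_weight K M y \<le> volterra_weight K M x"
  unfolding volterra_weight_def
  by (subst exp_le_cancel_iff, intro mult_left_mono) (use assms arctan_le_iff[of x y] in auto)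

lemma continuous_volterra_weight: "continuous_on UNIV (volterra_weight K M)"
  unfolding volterra_weight_def by (intro continuous_intros)

lemma arctan_tail_deriv:
  "((\<lambda>x. C * (K * (pi / 2 - arctan x))) has_real_derivative - (C * (K / (1 + x\<^sup>2)))) (at x)"
  by (rule DERIV_cong[OF DERIV_cmult[OF DERIV_cmult[OF DERIV_diff[OF DERIV_const DERIV_arctan]]]])
     (simp add: inverse_eq_divide)

lemma volterra_weight_deriv:
  "(volterra_weight K M has_real_derivative - (2 * M * (K / (1 + x\<^sup>2))) * volterra_weight K M x) (at x)"
  unfolding volterra_weight_def
  by (rule DERIV_cong[OF DERIV_fun_exp[OF arctan_tail_deriv]]) simp

lemma volterra_weight_tendsto: "(volterra_weight K M \<longlongrightarrow> 1) at_top"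
proof -
  have "((\<lambda>x. exp (2 * M * (K * (pi / 2 - arctan x)))) \<longlongrightarrow> exp (2 * M * (K * (pi / 2 - pi / 2)))) at_top"
    by (intro tendsto_intros tendsto_arctan_at_top)
  then show ?thesis by (simp add: volterra_weight_def[abs_def])
qed

lemma tail_bound:
  fixes Y F :: "real \<Rightarrow> 'a::real_normed_vector"
  assumes Y: "\<And>t. t \<ge> x \<Longrightarrow> (Y has_vector_derivative F t) (at t)" and Y0: "(Y \<longlongrightarrow> l) at_top"
    and g: "\<And>t. t \<ge> x \<Longrightarrow> (\<gamma> has_real_derivative \<gamma>' t) (at t)" and g0: "(\<gamma> \<longlongrightarrow> 0) at_top"
    and le: "\<And>t. t \<ge> x \<Longrightarrow> norm (F t) \<le> - \<gamma>' t"
  shows "norm (Y x - l) \<le> \<gamma> x"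
proof -
  have "norm (Y T - Y x) \<le> \<gamma> x - \<gamma> T" if "x \<le> T" for T
  proof -
    have "norm (Y T - Y x) \<le> (\<lambda>x. - \<gamma> x) T - (\<lambda>x. - \<gamma> x) x"
      by (rule increment_le[where f'=F and \<gamma>'="\<lambda>x. - \<gamma>' x"])
         (use that Y le g in \<open>auto intro!: derivative_eq_intros\<close>)
    then show ?thesis by simp
  qed
  then have "\<forall>\<^sub>F T in at_top. norm (Y T - Y x) \<le> \<gamma> x - \<gamma> T"
    by (rule eventually_mono[OF eventually_ge_at_top[of x]])
  moreover have "((\<lambda>T. norm (Y T - Y x)) \<longlongrightarrow> norm (l - Y x)) at_top" by (intro tendsto_intros Y0)
  moreover have "((\<lambda>T. \<gamma> x - \<gamma> T) \<longlongrightarrow> \<gamma> x - 0) at_top" by (intro tendsto_intros g0)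
  ultimately have "norm (l - Y x) \<le> \<gamma> x - 0"
    by (intro tendsto_le[of at_top]) auto
  then show ?thesis by (simp add: norm_minus_commute)
qed

text \<open>The purpose of the weight: \<open>\<gamma>\<close> is the exact tail integral of
  \<open>K / (1 + t\<^sup>2) * M * C\<close> times the weight, the 2 in the exponent having become
  the 1/2 in front.\<close>

lemma volterra_weight_tail:
  fixes C :: real
  assumes K: "K \<ge> 0" and M: "M > 0"
  defines "\<gamma> \<equiv> \<lambda>t. C / 2 * (volterra_weight K M t - 1)"
  shows "(\<gamma> has_real_derivative - (K / (1 + t\<^sup>2) * (M * C * volterra_weight K M t))) (at t)"
    and "(\<gamma> \<longlongrightarrow> 0) at_top" and "C \<ge> 0 \<Longrightarrow> \<gamma> t \<le> C / 2 * volterra_weight K M t"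
proof -
  have e: "C / 2 * (- (2 * M * u) * W - 0) = - (u * (M * C * W))" for u W by (simp add: algebra_simps)
  show "(\<gamma> has_real_derivative - (K / (1 + t\<^sup>2) * (M * C * volterra_weight K M t))) (at t)"
    unfolding \<gamma>_def
    by (rule DERIV_cong[OF DERIV_cmult[OF DERIV_diff[OF volterra_weight_deriv DERIV_const]]], rule e)
  have "(\<gamma> \<longlongrightarrow> C / 2 * (1 - 1)) at_top" unfolding \<gamma>_def
    by (intro tendsto_intros volterra_weight_tendsto)
  then show "(\<gamma> \<longlongrightarrow> 0) at_top" by simp
  show "C \<ge> 0 \<Longrightarrow> \<gamma> t \<le> C / 2 * volterra_weight K M t" by (simp add: \<gamma>_def algebra_simps)
qed

lemma volterra_solution_exists:
  fixes h :: "real \<Rightarrow> real"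
  assumes h: "continuous_on UNIV h" "\<And>x. \<bar>h x\<bar> \<le> K / (1 + x\<^sup>2)"
    and n: "Re n1 > 0" "Re n2 > 0"
  shows "\<exists>a. volterra_solution h m2 n1 n2 a"
proof -
  define M where "M = (norm m2 / Re n2 + 1) / Re n1"
  have M: "M > 0" unfolding M_def by (rule volterra_op_norm_pos[OF n])
  have K: "K \<ge> 0" using order_trans[OF abs_ge_zero h(2)[of 0]] by simp
  have nz: "Re n1 \<noteq> 0" "Re n2 \<noteq> 0" using n by auto
  let ?\<rho> = "volterra_weight K M"
  let ?F = "\<lambda>a x. of_real (h x) * volterra_op m2 n1 n2 a x"
  have rho0: "?\<rho> x > 0" for x by (simp add: volterra_weight_def)
  have BC: "bounded_continuous a" if "continuous_on UNIV a" "\<And>x. norm (a x) \<le> C * ?\<rho> x" for a C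
  proof (rule bounded_continuousI[OF that(1)])
    fix x
    have "C \<ge> 0" using order_trans[OF norm_ge_zero that(2)[of 0]] rho0[of 0] by (simp add: zero_le_mult_iff)
    then show "norm (a x) \<le> C * exp (2 * M * (K * pi))"
      by (intro order_trans[OF that(2) mult_left_mono[OF volterra_weight_le]]) (use M K in auto)
  qed
  have Fb: "norm (?F a x) \<le> K / (1 + x\<^sup>2) * (M * C * ?\<rho> x)"
    if "continuous_on UNIV a" and C: "\<And>x. norm (a x) \<le> C * ?\<rho> x" for a C x
  proof -
    have "C \<ge> 0" using order_trans[OF norm_ge_zero C[of 0]] rho0[of 0] by (simp add: zero_le_mult_iff)
    then have "norm (volterra_op m2 n1 n2 a x) \<le> M * (C * ?\<rho> x)"
      by (intro volterra_op_tail_bound[OF BC[OF that] n] order_trans[OF C mult_left_mono[OF volterra_weight_antimono]])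
         (use M K in \<open>auto simp: M_def\<close>)
    then have "norm (?F a x) \<le> K / (1 + x\<^sup>2) * (M * (C * ?\<rho> x))"
      unfolding norm_mult norm_of_real by (intro mult_mono h) (use K in auto)
    then show ?thesis by (simp add: mult.assoc)
  qed
  have Fc: "continuous_on UNIV (?F a)" if "bounded_continuous a" for a
    using volterra_op_bounded_continuous[OF that nz] h(1)
    by (intro continuous_intros) (auto simp: bounded_continuous_def)
  have ex: "\<exists>Y. (\<forall>x. (Y has_vector_derivative ?F a x) (at x)) \<and> (Y \<longlongrightarrow> 0) at_top"
    if bc: "bounded_continuous a" for a
  proof -
    obtain C where C: "continuous_on UNIV a" "C > 0" "\<And>x. norm (a x) \<le> C"
      using bounded_continuousE[OF bc] by metis
    have C': "norm (a x) \<le> C * ?\<rho> x" for x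
    proof -
      have "C * 1 \<le> C * ?\<rho> x" by (intro mult_left_mono volterra_weight_ge_1) (use C M K in auto)
      then show ?thesis using C(3)[of x] by linarith
    qed
    have "norm (?F a x) \<le> - (- (K / (1 + x\<^sup>2) * (M * C * ?\<rho> x)))" for x
      using Fb[OF C(1) C'] by simp
    from tail_primitive[OF Fc[OF bc] volterra_weight_tail(1)[OF K M] this volterra_weight_tail(2)[OF K M]]
    show ?thesis by blast
  qed
  \<comment> \<open>Integration from \<open>+\<infinity>\<close>, so that the fixed point of
    \<open>a = 1 + L a\<close> has limit 1 there.\<close>
  define L where "L a = (SOME Y. (\<forall>x. (Y has_vector_derivative ?F a x) (at x)) \<and> (Y \<longlongrightarrow> 0) at_top)" for a
  have L: "(L a has_vector_derivative ?F a x) (at x)" "(L a \<longlongrightarrow> 0) at_top" if "bounded_continuous a" for a x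
    using someI_ex[OF ex[OF that]] unfolding L_def by auto
  have "\<exists>a. continuous_on UNIV a \<and> (\<forall>x. norm (a x) \<le> 2 * 1 * ?\<rho> x) \<and> (\<forall>x. a x = 1 + L a x)"
  proof (rule contraction_fixpoint[OF continuous_volterra_weight rho0])
    show "norm (1::complex) \<le> 1 * ?\<rho> x" for x using volterra_weight_ge_1[of M K x] M K by simp
    fix a b :: "real \<Rightarrow> complex" and C
    assume ac: "continuous_on UNIV a" and aC: "\<And>x. norm (a x) \<le> C * ?\<rho> x"
    note a = BC[OF this]
    have C: "C \<ge> 0" using order_trans[OF norm_ge_zero aC[of 0]] rho0[of 0] by (simp add: zero_le_mult_iff)
    have "norm (L a x - 0) \<le> C / 2 * (?\<rho> x - 1)" for x
      by (rule tail_bound[OF L(1)[OF a] L(2)[OF a] volterra_weight_tail(1)[OF K M] volterra_weight_tail(2)[OF K M]])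
         (use Fb[OF ac aC] in auto)
    then have "norm (L a x) \<le> C / 2 * ?\<rho> x" for x
      by (intro order_trans[OF _ volterra_weight_tail(3)[OF K M C]]) (simp only: diff_0_right)
    moreover have "continuous_on UNIV (L a)"
      using L(1)[OF a] by (meson continuous_at_imp_continuous_on has_vector_derivative_continuous)
    ultimately show "continuous_on UNIV (L a) \<and> (\<forall>x. norm (L a x) \<le> C / 2 * ?\<rho> x)" by blast
    assume "continuous_on UNIV b" and "\<And>x. norm (b x) \<le> C * ?\<rho> x"
    note b = BC[OF this]
    note ab = bounded_continuous_diff[OF a b]
    show "L (\<lambda>x. a x - b x) = (\<lambda>x. L a x - L b x)"
    proof
      fix x
      have "((\<lambda>x. L (\<lambda>x. a x - b x) x - (L a x - L b x)) has_vector_derivative 0) (at t)" for t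
        using has_vector_derivative_diff[OF L(1)[OF ab] has_vector_derivative_diff[OF L(1)[OF a] L(1)[OF b]], of t]
        by (simp add: volterra_op_diff[OF a b nz] algebra_simps)
      moreover have "((\<lambda>x. L (\<lambda>x. a x - b x) x - (L a x - L b x)) \<longlongrightarrow> 0 - (0 - 0)) at_top"
        by (intro tendsto_intros L a b ab)
      ultimately have "norm ((L (\<lambda>x. a x - b x) x - (L a x - L b x)) - (0 - (0 - 0))) \<le> 0"
        by (intro tail_bound[where Y="\<lambda>x. L (\<lambda>x. a x - b x) x - (L a x - L b x)" and F="\<lambda>_. 0" and \<gamma>="\<lambda>_. 0" and \<gamma>'="\<lambda>_. 0"]) auto
      then show "L (\<lambda>x. a x - b x) x = L a x - L b x" by simp
    qed
  qed (intro continuous_intros)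
  then obtain a where ac: "continuous_on UNIV a" and aC: "\<And>x. norm (a x) \<le> 2 * 1 * ?\<rho> x"
    and eq: "\<And>x. a x = 1 + L a x" by blast
  note a = BC[OF ac aC]
  have fe: "(\<lambda>x. 1 + L a x) = a" using eq by auto
  have "(a has_vector_derivative ?F a x) (at x)" for x
    using has_vector_derivative_add[OF has_vector_derivative_const[of 1] L(1)[OF a], of x] by (simp add: fe)
  moreover have "((\<lambda>x. 1 + L a x) \<longlongrightarrow> 1 + 0) at_top" by (intro tendsto_intros L a)
  then have "(a \<longlongrightarrow> 1) at_top" by (simp add: fe)
  ultimately show ?thesis using a unfolding volterra_solution_def by blast
qed

text \<open>The weighted supremum \<open>S\<close> of \<open>d\<close> satisfies
  \<open>S \<le> (S + E / M) / 2\<close>, hence \<open>S \<le> E / M\<close>. This self-improvement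
  is legitimate because \<open>d\<close> is already known to be bounded, so that \<open>S\<close> is
  finite.\<close>

lemma volterra_stability:
  fixes h :: "real \<Rightarrow> real"
  assumes h: "\<And>x. \<bar>h x\<bar> \<le> K / (1 + x\<^sup>2)"
    and n: "Re n1 > 0" "Re n2 > 0" and M: "(norm m2 / Re n2 + 1) / Re n1 \<le> M"
    and d: "bounded_continuous d" "(d \<longlongrightarrow> 0) at_top"
      "\<And>x. (d has_vector_derivative of_real (h x) * (volterra_op m2 n1 n2 d x + e x)) (at x)"
    and e: "\<And>x. norm (e x) \<le> E"
  shows "norm (d x) \<le> E / M * exp (2 * M * (K * pi))"
proof -
  have "(norm m2 / Re n2 + 1) / Re n1 > 0" using volterra_op_norm_pos[OF n] .
  then have M0: "M > 0" using M by linarith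
  have K: "K \<ge> 0" using order_trans[OF abs_ge_zero h[of 0]] by simp
  have E: "E \<ge> 0" using order_trans[OF norm_ge_zero e[of 0]] by simp
  let ?\<rho> = "volterra_weight K M"
  have rho1: "?\<rho> x \<ge> 1" for x using volterra_weight_ge_1[of M K x] M0 K by simp
  define S where "S = (SUP x. norm (d x) / ?\<rho> x)"
  obtain B where B: "B > 0" "\<And>x. norm (d x) \<le> B" using d(1) by (auto elim: bounded_continuousE)
  have bdd: "bdd_above (range (\<lambda>x. norm (d x) / ?\<rho> x))"
  proof (rule bdd_aboveI2)
    show "norm (d x) / ?\<rho> x \<le> B" for x
    proof -
      have "norm (d x) / ?\<rho> x \<le> norm (d x) / 1" by (intro divide_left_mono rho1) (use rho1[of x] in auto)
      then show ?thesis using B(2)[of x] by simp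
    qed
  qed
  have dS: "norm (d x) \<le> S * ?\<rho> x" for x
  proof -
    have "norm (d x) / ?\<rho> x \<le> S" unfolding S_def by (rule cSUP_upper[OF _ bdd]) simp
    then show ?thesis using rho1[of x] by (simp add: divide_le_eq split: if_splits)
  qed
  have S0: "S \<ge> 0"
    using order_trans[OF norm_ge_zero dS[of 0]] rho1[of 0] by (auto simp: zero_le_mult_iff)
  let ?C = "S + E / M"
  have C0: "?C \<ge> 0" using S0 E M0 by simp
  have F: "norm (of_real (h t) * (volterra_op m2 n1 n2 d t + e t)) \<le> K / (1 + t\<^sup>2) * (M * ?C * ?\<rho> t)" for t
  proof -
    have "norm (volterra_op m2 n1 n2 d t) \<le> M * (S * ?\<rho> t)"
      by (rule volterra_op_tail_bound[OF d(1) n M], rule order_trans[OF dS mult_left_mono[OF volterra_weight_antimono]])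
         (use S0 M0 K in auto)
    moreover have "norm (e t) \<le> E * ?\<rho> t"
      using e[of t] mult_left_mono[OF rho1[of t] E] by simp
    moreover have "M * ?C * ?\<rho> t = M * (S * ?\<rho> t) + E * ?\<rho> t" using M0 by (simp add: field_simps)
    ultimately have "norm (volterra_op m2 n1 n2 d t + e t) \<le> M * ?C * ?\<rho> t"
      using norm_triangle_ineq[of "volterra_op m2 n1 n2 d t" "e t"] by linarith
    then show ?thesis unfolding norm_mult norm_of_real by (intro mult_mono h) (use K in auto)
  qed
  have "norm (d x - 0) \<le> ?C / 2 * (?\<rho> x - 1)" for x
    by (rule tail_bound[OF d(3) d(2) volterra_weight_tail(1)[OF K M0] volterra_weight_tail(2)[OF K M0]])
       (use F in auto)
  then have "norm (d x) \<le> ?C / 2 * ?\<rho> x" for x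
    by (intro order_trans[OF _ volterra_weight_tail(3)[OF K M0 C0]]) (simp only: diff_0_right)
  then have "norm (d x) / ?\<rho> x \<le> ?C / 2" for x using rho1[of x] by (simp add: divide_le_eq split: if_splits)
  then have "S \<le> ?C / 2" unfolding S_def by (intro cSUP_least) auto
  then have "S \<le> E / M" by simp
  then have "S * ?\<rho> x \<le> E / M * exp (2 * M * (K * pi))"
    using volterra_weight_le[of M K x] M0 K E rho1[of x] by (intro mult_mono) auto
  then show ?thesis using dS[of x] by linarith
qed

lemma volterra_op_uniform_limit:
  assumes m: "(m2 \<longlongrightarrow> m20) F" and n1: "(n1 \<longlongrightarrow> n10) F" "Re n10 > 0" and n2: "(n2 \<longlongrightarrow> n20) F" "Re n20 > 0"
    and a: "\<forall>\<^sub>F i in F. bounded_continuous (a i)" "bounded_continuous a0" "uniform_limit UNIV a a0 F"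
  shows "uniform_limit UNIV (\<lambda>i. resolvent (n1 i) (a i)) (resolvent n10 a0) F"
    and "uniform_limit UNIV (\<lambda>i. resolvent (n2 i) (resolvent (n1 i) (a i))) (resolvent n20 (resolvent n10 a0)) F"
    and "uniform_limit UNIV (\<lambda>i. volterra_op (m2 i) (n1 i) (n2 i) (a i)) (volterra_op m20 n10 n20 a0) F"
proof -
  have nz: "Re n10 \<noteq> 0" "Re n20 \<noteq> 0" using n1 n2 by auto
  have "\<forall>\<^sub>F i in F. Re (n1 i) > 0" using order_tendstoD(1)[OF tendsto_Re[OF n1(1)]] n1(2) by simp
  then have BC: "\<forall>\<^sub>F i in F. bounded_continuous (resolvent (n1 i) (a i))"
    using a(1) by eventually_elim (auto intro: resolvent_bounded_continuous)
  show 1: "uniform_limit UNIV (\<lambda>i. resolvent (n1 i) (a i)) (resolvent n10 a0) F"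
    by (rule resolvent_uniform_limit[OF n1 a])
  show 2: "uniform_limit UNIV (\<lambda>i. resolvent (n2 i) (resolvent (n1 i) (a i))) (resolvent n20 (resolvent n10 a0)) F"
    by (rule resolvent_uniform_limit[OF n2 BC resolvent_bounded_continuous[OF a(2) nz(1)] 1])
  have "bounded_continuous (resolvent n20 (resolvent n10 a0))"
    using a(2) nz by (intro resolvent_bounded_continuous)
  then have "bounded (range (resolvent n20 (resolvent n10 a0)))"
    by (auto simp: bounded_continuous_def bounded_iff)
  moreover have "uniform_limit UNIV (\<lambda>i (x::real). m2 i) (\<lambda>x. m20) F"
  proof (rule uniform_limitI)
    fix e :: real assume "e > 0"
    from tendstoD[OF m this] show "\<forall>\<^sub>F i in F. \<forall>x\<in>UNIV. dist (m2 i) m20 < e" by simp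
  qed
  ultimately show "uniform_limit UNIV (\<lambda>i. volterra_op (m2 i) (n1 i) (n2 i) (a i)) (volterra_op m20 n10 n20 a0) F"
    unfolding volterra_op_def by (intro uniform_limit_intros 1 2) auto
qed

text \<open>The difference of two amplitudes solves the Volterra equation with a source, namely the
  change of operator applied to \<open>a0\<close>. Uniformity on the entire line is what lets the
  limits at \<open>-\<infinity>\<close> depend continuously on the parameter.\<close>

lemma volterra_solution_uniform_limit:
  fixes h :: "real \<Rightarrow> real"
  assumes h: "\<And>x. \<bar>h x\<bar> \<le> K / (1 + x\<^sup>2)"
    and m: "(m2 \<longlongrightarrow> m20) F" and n1: "(n1 \<longlongrightarrow> n10) F" "Re n10 > 0" and n2: "(n2 \<longlongrightarrow> n20) F" "Re n20 > 0"
    and a: "\<forall>\<^sub>F i in F. volterra_solution h (m2 i) (n1 i) (n2 i) (a i)" "volterra_solution h m20 n10 n20 a0"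
  shows "uniform_limit UNIV a a0 F"
proof (rule uniform_limitI)
  fix e :: real assume e: "e > 0"
  \<comment> \<open>The summand 1 leaves room for the operator norms at nearby parameters.\<close>
  define M where "M = (norm m20 / Re n20 + 1) / Re n10 + 1"
  have "(norm m20 / Re n20 + 1) / Re n10 > 0" by (rule volterra_op_norm_pos[OF n1(2) n2(2)])
  then have M: "M > 0" by (simp add: M_def)
  have a0: "bounded_continuous a0" "(a0 \<longlongrightarrow> 1) at_top"
     "\<And>x. (a0 has_vector_derivative of_real (h x) * volterra_op m20 n10 n20 a0 x) (at x)"
    using a(2) by (auto simp: volterra_solution_def)
  \<comment> \<open>Chosen so that the stability bound \<open>c / M * exp (2 * M * (K * pi))\<close>
    equals \<open>e / 2\<close>.\<close>
  define c where "c = e * M / exp (2 * M * (K * pi)) / 2"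
  have c: "c > 0" using e M by (simp add: c_def)
  have "((\<lambda>i. (norm (m2 i) / Re (n2 i) + 1) / Re (n1 i)) \<longlongrightarrow> (norm m20 / Re n20 + 1) / Re n10) F"
    using n1 n2 by (intro tendsto_intros m n1 n2) auto
  then have "\<forall>\<^sub>F i in F. (norm (m2 i) / Re (n2 i) + 1) / Re (n1 i) < M"
    by (rule order_tendstoD) (simp add: M_def)
  moreover have "\<forall>\<^sub>F i in F. Re (n1 i) > 0" using order_tendstoD(1)[OF tendsto_Re[OF n1(1)]] n1(2) by simp
  moreover have "\<forall>\<^sub>F i in F. Re (n2 i) > 0" using order_tendstoD(1)[OF tendsto_Re[OF n2(1)]] n2(2) by simp
  moreover have "uniform_limit UNIV (\<lambda>i. volterra_op (m2 i) (n1 i) (n2 i) a0) (volterra_op m20 n10 n20 a0) F"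
    using a0(1) by (intro volterra_op_uniform_limit m n1 n2) (auto intro: uniform_limit_const)
  then have "\<forall>\<^sub>F i in F. \<forall>x\<in>UNIV. dist (volterra_op (m2 i) (n1 i) (n2 i) a0 x) (volterra_op m20 n10 n20 a0 x) < c"
    using c by (rule uniform_limitD)
  ultimately show "\<forall>\<^sub>F i in F. \<forall>x\<in>UNIV. dist (a i x) (a0 x) < e"
    using a(1)
  proof eventually_elim
    case (elim i)
    have nz: "Re (n1 i) \<noteq> 0" "Re (n2 i) \<noteq> 0" using elim by auto
    have ai: "bounded_continuous (a i)" "(a i \<longlongrightarrow> 1) at_top"
       "\<And>x. (a i has_vector_derivative of_real (h x) * volterra_op (m2 i) (n1 i) (n2 i) (a i) x) (at x)"
      using elim(5) by (auto simp: volterra_solution_def)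
    have "norm (a i x - a0 x) \<le> c / M * exp (2 * M * (K * pi))" for x
    proof (rule volterra_stability[OF h elim(2,3) less_imp_le[OF elim(1)], where d="\<lambda>x. a i x - a0 x"
        and e="\<lambda>x. volterra_op (m2 i) (n1 i) (n2 i) a0 x - volterra_op m20 n10 n20 a0 x"])
      show "bounded_continuous (\<lambda>x. a i x - a0 x)" by (intro bounded_continuous_intros ai a0)
      show "((\<lambda>x. a i x - a0 x) \<longlongrightarrow> 0) at_top" using tendsto_diff[OF ai(2) a0(2)] by simp
      show "((\<lambda>x. a i x - a0 x) has_vector_derivative
          of_real (h x) * (volterra_op (m2 i) (n1 i) (n2 i) (\<lambda>x. a i x - a0 x) x
           + (volterra_op (m2 i) (n1 i) (n2 i) a0 x - volterra_op m20 n10 n20 a0 x))) (at x)" for x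
        using has_vector_derivative_diff[OF ai(3) a0(3), of x]
        by (simp add: volterra_op_diff[OF ai(1) a0(1) nz] algebra_simps)
      show "norm (volterra_op (m2 i) (n1 i) (n2 i) a0 x - volterra_op m20 n10 n20 a0 x) \<le> c" for x
        using elim(4) by (auto simp: dist_norm less_imp_le)
    qed
    also have "c / M * exp (2 * M * (K * pi)) = e / 2" using M by (simp add: c_def)
    finally have b: "norm (a i x - a0 x) \<le> e / 2" for x .
    have "norm (a i x - a0 x) < e" for x using b[of x] e by linarith
    then show ?case by (simp add: dist_norm)
  qed
qed

text \<open>The derivative of \<open>a\<close> is dominated by a multiple of
  \<open>1 / (1 + x\<^sup>2)\<close>, hence integrable; the primitive normalized at
  \<open>+\<infinity>\<close> is applied to the reflected function.\<close>

lemma volterra_solution_at_bot: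
  fixes h :: "real \<Rightarrow> real"
  assumes h: "continuous_on UNIV h" "\<And>x. \<bar>h x\<bar> \<le> K / (1 + x\<^sup>2)"
    and n: "Re n1 > 0" "Re n2 > 0" and a: "volterra_solution h m2 n1 n2 a"
  shows "\<exists>l. (a \<longlongrightarrow> l) at_bot"
proof -
  have nz: "Re n1 \<noteq> 0" "Re n2 \<noteq> 0" using n by auto
  let ?R = "volterra_op m2 n1 n2 a"
  have R: "bounded_continuous ?R"
    using a nz by (intro volterra_op_bounded_continuous) (auto simp: volterra_solution_def)
  obtain C where C: "continuous_on UNIV ?R" "C > 0" "\<And>x. norm (?R x) \<le> C"
    using R by (auto elim: bounded_continuousE)
  have "\<exists>Y. (\<forall>x. (Y has_vector_derivative of_real (h (- x)) * ?R (- x)) (at x)) \<and> (Y \<longlongrightarrow> 0) at_top \<and>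
        (\<forall>x. norm (Y x) \<le> C * (K * (pi / 2 - arctan x)))"
  proof (rule tail_primitive)
    show "continuous_on UNIV (\<lambda>x. of_real (h (- x)) * ?R (- x))"
      by (intro continuous_intros continuous_on_compose2[OF h(1)] continuous_on_compose2[OF C(1)]) auto
    show "((\<lambda>x. C * (K * (pi / 2 - arctan x))) has_real_derivative - (C * (K / (1 + x\<^sup>2)))) (at x)" for x
      by (rule arctan_tail_deriv)
    show "norm (of_real (h (- x)) * ?R (- x)) \<le> - (- (C * (K / (1 + x\<^sup>2))))" for x
    proof -
      have "norm (of_real (h (- x)) * ?R (- x)) \<le> K / (1 + (- x)\<^sup>2) * C"
        unfolding norm_mult norm_of_real
        using order_trans[OF abs_ge_zero h(2)[of "- x"]] by (intro mult_mono h C) auto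
      then show ?thesis by (simp add: mult.commute)
    qed
    have "((\<lambda>x. C * (K * (pi / 2 - arctan x))) \<longlongrightarrow> C * (K * (pi / 2 - pi / 2))) at_top"
      by (intro tendsto_intros tendsto_arctan_at_top)
    then show "((\<lambda>x. C * (K * (pi / 2 - arctan x))) \<longlongrightarrow> 0) at_top" by simp
  qed
  then obtain Y where Y: "\<And>x. (Y has_vector_derivative of_real (h (- x)) * ?R (- x)) (at x)" "(Y \<longlongrightarrow> 0) at_top"
    by blast
  have "((\<lambda>x. a (- x) + Y x) has_vector_derivative 0) (at x)" for x
    using has_vector_derivative_add[OF reflect_has_vector_derivative Y(1), of a "of_real (h (- x)) * ?R (- x)" x] a
    by (simp add: volterra_solution_def)
  from vector_derivative_zero_constant[OF this, of _ 0]
  have "(\<lambda>x. a (- x)) = (\<lambda>x. (a 0 + Y 0) - Y x)" by (auto simp: algebra_simps)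
  moreover have "((\<lambda>x. (a 0 + Y 0) - Y x) \<longlongrightarrow> (a 0 + Y 0) - 0) at_top" by (intro tendsto_intros Y)
  ultimately have "((\<lambda>x. a (- x)) \<longlongrightarrow> a 0 + Y 0) at_top" by simp
  then show ?thesis unfolding filterlim_at_bot_mirror by blast
qed

text \<open>When the total mass \<open>pi * K * M\<close> is at most 1/4, the plain supremum
  \<open>S\<close> of \<open>a\<close> satisfies \<open>S \<le> 1 + S / 4\<close>, and the distance
  to 1 is at most \<open>S / 4 \<le> 1 / 3\<close>.\<close>

lemma volterra_solution_near_one:
  fixes h :: "real \<Rightarrow> real"
  assumes h: "\<And>x. \<bar>h x\<bar> \<le> K / (1 + x\<^sup>2)"
    and n: "Re n1 > 0" "Re n2 > 0" and M: "(norm m2 / Re n2 + 1) / Re n1 \<le> M" "pi * K * M \<le> 1 / 4"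
    and a: "volterra_solution h m2 n1 n2 a"
  shows "norm (a x - 1) \<le> 1 / 2"
proof -
  have a': "bounded_continuous a" "(a \<longlongrightarrow> 1) at_top"
     "\<And>x. (a has_vector_derivative of_real (h x) * volterra_op m2 n1 n2 a x) (at x)"
    using a by (auto simp: volterra_solution_def)
  have K: "K \<ge> 0" using order_trans[OF abs_ge_zero h[of 0]] by simp
  have "(norm m2 / Re n2 + 1) / Re n1 > 0" using volterra_op_norm_pos[OF n] .
  then have M0: "M > 0" using M by linarith
  obtain B where B: "B > 0" "\<And>x. norm (a x) \<le> B" using a'(1) by (auto elim: bounded_continuousE)
  define S where "S = (SUP x. norm (a x))"
  have bdd: "bdd_above (range (\<lambda>x. norm (a x)))" by (rule bdd_aboveI2) (rule B)
  have aS: "norm (a x) \<le> S" for x unfolding S_def by (rule cSUP_upper[OF _ bdd]) simp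
  have S0: "S \<ge> 0" using order_trans[OF norm_ge_zero aS[of 0]] .
  have F: "norm (of_real (h t) * volterra_op m2 n1 n2 a t) \<le> - (- (M * S * (K / (1 + t\<^sup>2))))" for t
  proof -
    have "norm (volterra_op m2 n1 n2 a t) \<le> M * S"
      by (rule volterra_op_tail_bound[OF a'(1) n M(1) aS])
    then have "norm (of_real (h t) * volterra_op m2 n1 n2 a t) \<le> K / (1 + t\<^sup>2) * (M * S)"
      unfolding norm_mult norm_of_real by (intro mult_mono h) (use K in auto)
    then show ?thesis by (simp add: mult_ac)
  qed
  have "norm (a x - 1) \<le> S / 4" for x
  proof -
    have "norm (a x - 1) \<le> M * S * (K * (pi / 2 - arctan x))"
    proof (rule tail_bound[OF a'(3,2) _ _ F])
      show "((\<lambda>x. M * S * (K * (pi / 2 - arctan x))) has_real_derivative - (M * S * (K / (1 + x\<^sup>2)))) (at x)" for x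
        by (rule arctan_tail_deriv)
      have "((\<lambda>x. M * S * (K * (pi / 2 - arctan x))) \<longlongrightarrow> M * S * (K * (pi / 2 - pi / 2))) at_top"
        by (intro tendsto_intros tendsto_arctan_at_top)
      then show "((\<lambda>x. M * S * (K * (pi / 2 - arctan x))) \<longlongrightarrow> 0) at_top" by simp
    qed
    also have "\<dots> \<le> M * S * (K * pi)"
      using arctan_lbound[of x] M0 S0 K by (intro mult_left_mono) auto
    also have "\<dots> = (pi * K * M) * S" by simp
    also have "\<dots> \<le> 1 / 4 * S" by (intro mult_right_mono M S0)
    finally show ?thesis by simp
  qed
  note b = this
  have "norm (a x) \<le> 1 + S / 4" for x
    using b[of x] norm_triangle_ineq[of "a x - 1" 1] by simp
  then have "S \<le> 1 + S / 4" unfolding S_def by (intro cSUP_least) auto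
  then show ?thesis using b[of x] by linarith
qed

section \<open>Roots of the characteristic polynomial\<close>

text \<open>Eliminating \<open>\<tau>\<close> and \<open>u\<close> through \<open>\<tau> = w'\<close>, \<open>u = z w - c w'\<close> turns the limiting eigenvalue
  system into the constant-coefficient equation with this characteristic polynomial, where
  \<open>k = (c - f'(\<tau>\<^sub>0)) / c\<close>.\<close>

definition char_poly3 :: "real \<Rightarrow> real \<Rightarrow> real \<Rightarrow> real \<Rightarrow> real" where
  "char_poly3 c k z \<mu> = \<mu> ^ 3 - (z / c) * \<mu>\<^sup>2 - (2 * z + k) * \<mu> + z * (z + 1) / c"

definition decay_rate :: "real \<Rightarrow> real \<Rightarrow> real \<Rightarrow> real" where
  "decay_rate c k z = (THE \<mu>. \<mu> < 0 \<and> char_poly3 c k z \<mu> = 0)"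

text \<open>Together with \<open>growth_prod\<close>, the sum and product of the two remaining roots
  by Vieta, from the root sum \<open>z / c\<close> and the root product
  \<open>- z (z + 1) / c\<close>. They stay real and continuous where the roots themselves become
  complex or collide.\<close>

definition growth_sum :: "real \<Rightarrow> real \<Rightarrow> real \<Rightarrow> real" where
  "growth_sum c k z = z / c - decay_rate c k z"

definition growth_prod :: "real \<Rightarrow> real \<Rightarrow> real \<Rightarrow> real" where
  "growth_prod c k z = - (z * (z + 1) / c) / decay_rate c k z"

text \<open>A square root along the real axis that is continuous through 0, so that the two growth
  roots remain continuous where the discriminant changes sign.\<close>

definition real_csqrt :: "real \<Rightarrow> complex" where
  "real_csqrt t = Complex (sqrt (max t 0)) (sqrt (max (- t) 0))"

definition growth_root1 :: "real \<Rightarrow> real \<Rightarrow> real \<Rightarrow> complex" where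
  "growth_root1 c k z = of_real (growth_sum c k z / 2) + real_csqrt ((growth_sum c k z)\<^sup>2 / 4 - growth_prod c k z)"

definition growth_root2 :: "real \<Rightarrow> real \<Rightarrow> real \<Rightarrow> complex" where
  "growth_root2 c k z = of_real (growth_sum c k z / 2) - real_csqrt ((growth_sum c k z)\<^sup>2 / 4 - growth_prod c k z)"

lemma real_csqrt_square: "real_csqrt t * real_csqrt t = of_real t"
  by (simp add: real_csqrt_def complex_eq_iff max_def)

context
  fixes c k :: real
  assumes c: "c > 0" and k: "k > 0"
begin

lemma char_poly3_pos_near_0:
  obtains s where "s > 0" "\<And>z. z \<ge> 0 \<Longrightarrow> char_poly3 c k z (- s) > 0"
proof
  \<comment> \<open>In the value at \<open>- s\<close>, the bound \<open>s \<le> sqrt k / 2\<close>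
    makes the factor \<open>k - s\<^sup>2\<close> positive and \<open>s \<le> c\<close> makes
    \<open>2 - s / c\<close> nonnegative.\<close>
  let ?s = "min (sqrt k / 2) c"
  show s: "?s > 0" using c k by simp
  have "?s\<^sup>2 \<le> (sqrt k / 2)\<^sup>2" using s by (intro power_mono) auto
  also have "\<dots> < k" using k by (simp add: power_divide)
  finally have sk: "?s\<^sup>2 < k" .
  fix z :: real assume z: "z \<ge> 0"
  have "?s / c \<le> 1" using c by (simp add: divide_le_eq)
  then have "2 - ?s / c \<ge> 0" by linarith
  then have "z * ?s * (2 - ?s / c) \<ge> 0" using z s by (intro mult_nonneg_nonneg less_imp_le[OF s])
  moreover have "?s * (k - ?s\<^sup>2) > 0" using s sk by (intro mult_pos_pos) auto
  moreover have "z * (z + 1) / c \<ge> 0" using z c by simp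
  moreover have "char_poly3 c k z (- ?s) = ?s * (k - ?s\<^sup>2) + z * ?s * (2 - ?s / c) + z * (z + 1) / c"
    by (simp add: char_poly3_def algebra_simps power2_eq_square power3_eq_cube)
  ultimately show "char_poly3 c k z (- ?s) > 0" by linarith
qed

lemma char_poly3_factor:
  assumes "\<mu>0 < 0" "char_poly3 c k z \<mu>0 = 0"
  shows "char_poly3 c k z \<mu> = (\<mu> - \<mu>0) * (\<mu>\<^sup>2 - (z / c - \<mu>0) * \<mu> - (z * (z + 1) / c) / \<mu>0)"
proof -
  let ?b = "z * (z + 1) / c"
  have b: "?b = - (\<mu>0\<^sup>2 - (z / c) * \<mu>0 - (2 * z + k)) * \<mu>0"
  proof -
    have "b = - (m\<^sup>2 - t * m - s) * m" if "m ^ 3 - t * m\<^sup>2 - s * m + b = 0" for b m t s :: real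
      using that by (simp add: algebra_simps power2_eq_square power3_eq_cube)
    from this[OF assms(2)[unfolded char_poly3_def]] show ?thesis .
  qed
  have e: "?b / \<mu>0 = - (\<mu>0\<^sup>2 - (z / c) * \<mu>0 - (2 * z + k))"
    unfolding b using assms(1) by simp
  have "m ^ 3 - t * m\<^sup>2 - s * m + - (n\<^sup>2 - t * n - s) * n = (m - n) * (m\<^sup>2 - (t - n) * m - - (n\<^sup>2 - t * n - s))"
    for m n t s :: real by (simp add: algebra_simps power2_eq_square power3_eq_cube)
  from this[of \<mu> "z / c" "2 * z + k" \<mu>0] show ?thesis
    unfolding e unfolding char_poly3_def b .
qed

text \<open>No term of the quadratic cofactor is negative for \<open>\<mu> < 0\<close>. On the
  negative axis the cubic thus has the sign of \<open>\<mu> - \<mu>0\<close>: there is just one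
  negative root, and comparing a negative number with it is a polynomial inequality.\<close>

lemma char_poly3_cofactor_pos:
  assumes "\<mu>0 < 0" "\<mu> < 0" "z \<ge> 0"
  shows "\<mu>\<^sup>2 - (z / c - \<mu>0) * \<mu> - (z * (z + 1) / c) / \<mu>0 > 0"
proof -
  have "z / c \<ge> 0" using assms c by simp
  then have "(z / c - \<mu>0) * \<mu> \<le> 0" using assms by (intro mult_nonneg_nonpos) auto
  moreover have "(z * (z + 1) / c) / \<mu>0 \<le> 0"
    using assms c by (intro divide_nonneg_neg) auto
  moreover have "\<mu>\<^sup>2 > 0" using assms by simp
  ultimately show ?thesis by linarith
qed

lemma decay_rate_ex1:
  assumes z: "z \<ge> 0"
  shows "\<exists>!\<mu>. \<mu> < 0 \<and> char_poly3 c k z \<mu> = 0"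
proof -
  obtain s where s: "s > 0" "char_poly3 c k z (- s) > 0"
    using char_poly3_pos_near_0 z by metis
  let ?b = "2 * z + k + z * (z + 1) / c"
  \<comment> \<open>Exceeding 1 and \<open>?b\<close> makes the cube dominate the linear and
    constant terms; exceeding \<open>s\<close> puts \<open>- S\<close> to the left of
    \<open>- s\<close>.\<close>
  define S where "S = 1 + s + ?b"
  have b0: "?b > 0" and zc: "z * (z + 1) / c \<ge> 0" using z c k by (auto intro: add_pos_nonneg)
  have S: "S > 1" "S > s" using s b0 by (auto simp: S_def)
  have "char_poly3 c k z (- S) = - (S ^ 3) - (z / c) * S\<^sup>2 + (2 * z + k) * S + z * (z + 1) / c"
    by (simp add: char_poly3_def)
  moreover have "(z / c) * S\<^sup>2 \<ge> 0" using z c by simp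
  moreover have "z * (z + 1) / c * 1 \<le> z * (z + 1) / c * S" using zc S by (intro mult_left_mono) auto
  moreover have "?b * S < S * S" using S s by (intro mult_strict_right_mono) (auto simp: S_def)
  moreover have "S * S \<le> S ^ 3" using S by (simp add: power3_eq_cube mult_le_cancel_right1)
  ultimately have "char_poly3 c k z (- S) < 0" by (simp add: algebra_simps)
  then have "\<exists>\<mu>. - S \<le> \<mu> \<and> \<mu> \<le> - s \<and> char_poly3 c k z \<mu> = 0"
    using s S c unfolding char_poly3_def
    by (intro IVT') (auto intro!: continuous_intros simp: less_imp_le)
  then obtain \<mu>0 where m: "\<mu>0 < 0" "char_poly3 c k z \<mu>0 = 0" using s by force
  have "\<mu> = \<mu>0" if "\<mu> < 0" "char_poly3 c k z \<mu> = 0" for \<mu>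
    using char_poly3_factor[OF m, of \<mu>] char_poly3_cofactor_pos[OF m(1) that(1) z] that(2) by auto
  then show ?thesis using m by blast
qed

lemma decay_rate:
  assumes "z \<ge> 0"
  shows decay_rate_neg: "decay_rate c k z < 0" and decay_rate_root: "char_poly3 c k z (decay_rate c k z) = 0"
  using theI'[OF decay_rate_ex1[OF assms]] unfolding decay_rate_def by auto

lemma char_poly3_pos_iff:
  assumes "z \<ge> 0" "\<mu> < 0"
  shows "char_poly3 c k z \<mu> > 0 \<longleftrightarrow> \<mu> > decay_rate c k z"
  unfolding char_poly3_factor[OF decay_rate[OF assms(1)]]
  using char_poly3_cofactor_pos[OF decay_rate_neg[OF assms(1)] assms(2,1)]
  by (simp add: zero_less_mult_iff)

lemma char_poly3_neg_iff:
  assumes "z \<ge> 0" "\<mu> < 0"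
  shows "char_poly3 c k z \<mu> < 0 \<longleftrightarrow> \<mu> < decay_rate c k z"
  unfolding char_poly3_factor[OF decay_rate[OF assms(1)]]
  using char_poly3_cofactor_pos[OF decay_rate_neg[OF assms(1)] assms(2,1)]
  by (simp add: mult_less_0_iff)

text \<open>For negative \<open>y\<close>, \<open>y < decay_rate c k z\<close> is the inequality
  \<open>char_poly3 c k z y < 0\<close>, an open condition on \<open>z\<close>, and likewise for the
  reverse order.\<close>

lemma continuous_decay_rate: "continuous_on {0..} (decay_rate c k)"
  unfolding continuous_on_def
proof (intro ballI order_tendstoI)
  fix z y :: real assume z: "z \<in> {0..}"
  have cont: "((\<lambda>z. char_poly3 c k z \<mu>) \<longlongrightarrow> char_poly3 c k z \<mu>) (at z within {0..})" for \<mu>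
    unfolding char_poly3_def using c by (intro tendsto_intros) auto
  have ev: "\<forall>\<^sub>F x in at z within {0..}. x \<ge> (0::real)" by (simp add: eventually_at_filter)
  show "\<forall>\<^sub>F x in at z within {0..}. y < decay_rate c k x" if "y < decay_rate c k z"
  proof -
    have y: "y < 0" using that decay_rate_neg[of z] z by simp
    have "char_poly3 c k z y < 0" using char_poly3_neg_iff[of z y] z y that by simp
    from order_tendstoD(2)[OF cont this] ev show ?thesis
      by eventually_elim (use char_poly3_neg_iff y in blast)
  qed
  show "\<forall>\<^sub>F x in at z within {0..}. decay_rate c k x < y" if "decay_rate c k z < y"
  proof -
    \<comment> \<open>The sign criterion holds only on the negative axis and \<open>y\<close> may
      lie outside it, so \<open>y\<close> is replaced by a negative point in between.\<close>
    have "decay_rate c k z < min y 0" using that decay_rate_neg[of z] z by simp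
    from dense[OF this] obtain y' where y': "decay_rate c k z < y'" "y' < min y 0" by blast
    then have "char_poly3 c k z y' > 0" using char_poly3_pos_iff[of z y'] z by simp
    from order_tendstoD(1)[OF cont this] ev show ?thesis
      by eventually_elim (use char_poly3_pos_iff[of _ y'] y' in fastforce)
  qed
qed

lemma growth_sum_prod:
  assumes z: "z \<ge> 0"
  shows "growth_sum c k z > 0" "growth_prod c k z \<ge> 0" "growth_sum c k z + decay_rate c k z = z / c"
    "growth_prod c k z + growth_sum c k z * decay_rate c k z = - (2 * z + k)"
    "growth_prod c k z * decay_rate c k z = - (z * (z + 1) / c)"
proof -
  note d = decay_rate[OF z]
  have "z / c \<ge> 0" using z c by simp
  then show "growth_sum c k z > 0" using d unfolding growth_sum_def by linarith
  have "z * (z + 1) / c / decay_rate c k z \<le> 0" using z c d by (intro divide_nonneg_neg) auto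
  then show "growth_prod c k z \<ge> 0" by (simp add: growth_prod_def)
  show "growth_sum c k z + decay_rate c k z = z / c" by (simp add: growth_sum_def)
  show p: "growth_prod c k z * decay_rate c k z = - (z * (z + 1) / c)" using d by (simp add: growth_prod_def)
  have "(r + (t - m) * m + s) * m = 0" if "m ^ 3 - t * m\<^sup>2 - s * m + b = 0" "r * m = - b" for m t s b r :: real
  proof -
    have "(r + (t - m) * m + s) * m = r * m + b - (m ^ 3 - t * m\<^sup>2 - s * m + b)"
      by (simp add: algebra_simps power2_eq_square power3_eq_cube)
    then show ?thesis using that by simp
  qed
  from this[OF d(2)[unfolded char_poly3_def] p]
  have "(growth_prod c k z + growth_sum c k z * decay_rate c k z + (2 * z + k)) * decay_rate c k z = 0"
    unfolding growth_sum_def .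
  then show "growth_prod c k z + growth_sum c k z * decay_rate c k z = - (2 * z + k)" using d by simp
qed

lemma growth_roots:
  assumes z: "z \<ge> 0"
  shows growth_roots_sum: "growth_root1 c k z + growth_root2 c k z = of_real (growth_sum c k z)"
    and growth_roots_prod: "growth_root1 c k z * growth_root2 c k z = of_real (growth_prod c k z)"
    and growth_root1_Re: "Re (growth_root1 c k z) \<ge> growth_sum c k z / 2"
    and growth_root2_Re: "Re (growth_root2 c k z) \<ge> 0"
proof -
  let ?P = "growth_sum c k z" and ?r = "growth_prod c k z"
  note g = growth_sum_prod[OF z]
  show "growth_root1 c k z + growth_root2 c k z = of_real ?P"
    by (simp add: growth_root1_def growth_root2_def complex_eq_iff)
  have "growth_root1 c k z * growth_root2 c k z = of_real (?P / 2) * of_real (?P / 2) - real_csqrt (?P\<^sup>2 / 4 - ?r) * real_csqrt (?P\<^sup>2 / 4 - ?r)"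
    unfolding growth_root1_def growth_root2_def by (simp add: algebra_simps)
  also have "\<dots> = of_real ?r"
    unfolding real_csqrt_square by (simp add: power2_eq_square)
  finally show "growth_root1 c k z * growth_root2 c k z = of_real ?r" .
  show "Re (growth_root1 c k z) \<ge> ?P / 2" by (simp add: growth_root1_def real_csqrt_def)
  have "(?P / 2)\<^sup>2 = ?P\<^sup>2 / 4" by (simp add: power_divide)
  then have "max (?P\<^sup>2 / 4 - ?r) 0 \<le> (?P / 2)\<^sup>2" using g(2) by (intro max.boundedI zero_le_power2) linarith
  then have "sqrt (max (?P\<^sup>2 / 4 - ?r) 0) \<le> sqrt ((?P / 2)\<^sup>2)" by (rule real_sqrt_le_mono)
  then show "Re (growth_root2 c k z) \<ge> 0" using g(1) by (simp add: growth_root2_def real_csqrt_def)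
qed

lemma continuous_growth_roots:
  "continuous_on {0..} (growth_root1 c k)" "continuous_on {0..} (growth_root2 c k)"
proof -
  have nz: "\<forall>z\<in>{0..}. decay_rate c k z \<noteq> 0" using decay_rate_neg by force
  have s: "continuous_on {0..} (growth_sum c k)"
    unfolding growth_sum_def[abs_def] using c by (intro continuous_intros continuous_decay_rate) auto
  have p: "continuous_on {0..} (growth_prod c k)"
    unfolding growth_prod_def[abs_def] using c nz by (intro continuous_intros continuous_decay_rate) auto
  have q: "continuous_on UNIV real_csqrt"
    unfolding real_csqrt_def[abs_def] Complex_eq by (intro continuous_intros)
  have r: "continuous_on {0..} (\<lambda>z. real_csqrt ((growth_sum c k z)\<^sup>2 / 4 - growth_prod c k z))"
    by (rule continuous_on_compose2[OF q]) (intro continuous_intros s p, auto)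
  show "continuous_on {0..} (growth_root1 c k)" "continuous_on {0..} (growth_root2 c k)"
    unfolding growth_root1_def[abs_def] growth_root2_def[abs_def] by (auto intro!: continuous_intros s r)
qed

text \<open>For large \<open>z\<close> the negative root lies beyond \<open>- 8 c\<close>. That
  makes the product of the other two roots at most
  \<open>z (2 z) / (8 c\<^sup>2) = (z / c)\<^sup>2 / 4\<close>, so their discriminant is
  nonnegative; they are real and the inner quotient is at most 1. The outer denominator is at least
  \<open>z / (2 c)\<close>.\<close>

lemma growth_rates_large:
  assumes z: "z \<ge> 1 + 48 * c\<^sup>2 + 512 * c ^ 4"
  defines "d \<equiv> complex_of_real (decay_rate c k z)"
  shows "(norm (growth_root2 c k z) / Re (growth_root2 c k z - d) + 1) / Re (growth_root1 c k z - d) \<le> 4 * c / z"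
proof -
  have "c\<^sup>2 \<ge> 0" "c ^ 4 \<ge> 0" using c by simp_all
  then have z1: "z \<ge> 1" "z \<ge> 48 * c\<^sup>2 + 512 * c ^ 4" using z by linarith+
  then have z0: "z \<ge> 0" by simp
  note g = growth_sum_prod[OF z0] and dn = decay_rate_neg[OF z0]
  let ?P = "growth_sum c k z" and ?r = "growth_prod c k z" and ?d = "decay_rate c k z"
  have "z * (48 * c\<^sup>2 + 512 * c ^ 4) \<le> z * z" using z1 by (intro mult_left_mono) auto
  moreover have "1 * (512 * c ^ 4) \<le> z * (512 * c ^ 4)" using z1 by (intro mult_right_mono) auto
  ultimately have zz: "48 * c\<^sup>2 * z + 512 * c ^ 4 \<le> z * z" by (simp add: algebra_simps)
  \<comment> \<open>Origin of the threshold on \<open>z\<close>: \<open>512\<close> is the cube of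
    8, and \<open>48 = 64 - 16\<close> combines the quadratic and the linear term.\<close>
  have "char_poly3 c k z (- (8 * c)) = (z * z - (48 * c\<^sup>2 * z + 512 * c ^ 4)) / c + z / c + 8 * k * c"
    using c by (simp add: char_poly3_def field_simps power2_eq_square power3_eq_cube power4_eq_xxxx)
  also have "\<dots> > 0" using zz c k z1 by (intro add_nonneg_pos) auto
  finally have "?d < - (8 * c)" using char_poly3_pos_iff[OF z0, of "- (8 * c)"] c by simp
  then have d8: "- ?d \<ge> 8 * c" by simp
  have "?r = z * (z + 1) / c / (- ?d)" by (simp add: growth_prod_def)
  also have "\<dots> \<le> z * (z + 1) / c / (8 * c)" using d8 z1 c dn by (intro divide_left_mono) (auto simp: mult_pos_neg)
  also have "\<dots> \<le> z * (2 * z) / c / (8 * c)" using z1 c by (intro divide_right_mono mult_left_mono) auto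
  also have "\<dots> = (z / c)\<^sup>2 / 4" by (simp add: power2_eq_square)
  also have "\<dots> \<le> ?P\<^sup>2 / 4" using dn c z0 by (intro divide_right_mono power_mono) (auto simp: growth_sum_def)
  finally have disc: "?P\<^sup>2 / 4 - ?r \<ge> 0" by simp
  then have "Im (growth_root2 c k z) = 0" by (simp add: growth_root2_def real_csqrt_def)
  then have "norm (growth_root2 c k z) = Re (growth_root2 c k z)"
    using growth_root2_Re[OF z0] by (simp add: cmod_eq_Re)
  then have "norm (growth_root2 c k z) / Re (growth_root2 c k z - d) \<le> 1"
    using growth_root2_Re[OF z0] dn by (simp add: d_def)
  moreover have n1: "z / (2 * c) \<le> Re (growth_root1 c k z - d)"
  proof -
    have "z / (2 * c) = z / c / 2" by simp
    moreover have "growth_sum c k z \<ge> z / c" using dn by (simp add: growth_sum_def)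
    ultimately show ?thesis using growth_root1_Re[OF z0] dn by (simp add: d_def)
  qed
  ultimately have "(norm (growth_root2 c k z) / Re (growth_root2 c k z - d) + 1) / Re (growth_root1 c k z - d) \<le> 2 / (z / (2 * c))"
    using z1 c growth_root2_Re[OF z0] dn by (intro frac_le) (auto simp: d_def)
  then show ?thesis by (simp add: field_simps)
qed

end

section \<open>Homoclinic profiles\<close>

lemma nonneg_of_mono_at_bot:
  fixes F F' :: "real \<Rightarrow> real"
  assumes d: "\<And>x. x \<le> x0 \<Longrightarrow> (F has_real_derivative F' x) (at x)" and F': "\<And>x. x \<le> x0 \<Longrightarrow> F' x \<ge> 0"
    and lim: "(F \<longlongrightarrow> 0) at_bot" and x: "x \<le> x0"
  shows "F x \<ge> 0"
proof (rule tendsto_upperbound[OF lim])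
  show "\<forall>\<^sub>F y in at_bot. F y \<le> F x"
    using eventually_le_at_bot[of x]
  proof eventually_elim
    case (elim y)
    show ?case
      by (rule DERIV_nonneg_imp_nondecreasing[OF elim]) (use d F' x in \<open>meson order_trans\<close>)
  qed
qed simp

text \<open>Comparison with the linear saddle: \<open>\<psi>\<^sup>2 - l \<phi>\<^sup>2\<close>
  vanishes at \<open>-\<infinity>\<close> and has derivative
  \<open>2 \<psi> (\<alpha> - l \<phi>)\<close>, so it is monotone for \<open>l = k / 2\<close> and
  for \<open>l = 3 k / 2\<close>. The orbit is squeezed between two lines through the saddle, whose
  slopes are rounded to \<open>sqrt k / 2\<close> and \<open>2 sqrt k\<close>.\<close>

lemma unstable_branch_bounds:
  fixes \<phi> \<psi> \<alpha> :: "real \<Rightarrow> real"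
  assumes k: "k > 0"
    and d\<phi>: "\<And>x. (\<phi> has_real_derivative \<psi> x) (at x)" and d\<psi>: "\<And>x. (\<psi> has_real_derivative \<alpha> x) (at x)"
    and pos: "\<And>x. x \<le> x0 \<Longrightarrow> \<phi> x > 0"
    and \<alpha>: "\<And>x. x \<le> x0 \<Longrightarrow> k / 2 * \<phi> x \<le> \<alpha> x" "\<And>x. x \<le> x0 \<Longrightarrow> \<alpha> x \<le> 3 * k / 2 * \<phi> x"
    and lim: "(\<phi> \<longlongrightarrow> 0) at_bot" "(\<psi> \<longlongrightarrow> 0) at_bot"
    and x: "x \<le> x0"
  shows "\<psi> x > 0" "\<alpha> x > 0" "sqrt k / 2 * \<phi> x \<le> \<psi> x" "\<psi> x \<le> 2 * sqrt k * \<phi> x"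
    "\<phi> x \<le> \<phi> x0 * exp (sqrt k / 2 * (x - x0))"
proof -
  have cpos: "\<alpha> y > 0" if "y \<le> x0" for y
    using \<alpha>(1)[OF that] mult_pos_pos[OF _ pos[OF that], of "k / 2"] k by simp
  then show "\<alpha> x > 0" using x .
  have p0: "\<psi> y \<ge> 0" if "y \<le> x0" for y
    by (rule nonneg_of_mono_at_bot[OF d\<psi> less_imp_le[OF cpos] lim(2) that])
  have ppos: "\<psi> y > 0" if "y \<le> x0" for y
  proof -
    have "\<psi> (y - 1) < \<psi> y"
      by (rule DERIV_pos_imp_increasing) (use d\<psi> cpos that in \<open>auto intro!: exI\<close>)
    moreover have "\<psi> (y - 1) \<ge> 0" using that by (intro p0) simp
    ultimately show ?thesis by linarith
  qed
  then show "\<psi> x > 0" using x .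
  have lim2: "((\<lambda>y. (\<psi> y)\<^sup>2 - l * (\<phi> y)\<^sup>2) \<longlongrightarrow> 0\<^sup>2 - l * 0\<^sup>2) at_bot" for l
    by (intro tendsto_intros lim)
  have d2: "((\<lambda>y. (\<psi> y)\<^sup>2 - l * (\<phi> y)\<^sup>2) has_real_derivative 2 * \<psi> y * (\<alpha> y - l * \<phi> y)) (at y)" for l y
    by (auto intro!: derivative_eq_intros d\<phi> d\<psi> simp: algebra_simps)
  have low: "(\<psi> y)\<^sup>2 - k / 2 * (\<phi> y)\<^sup>2 \<ge> 0" if "y \<le> x0" for y
    by (rule nonneg_of_mono_at_bot[OF d2 _ _ that])
       (use p0 \<alpha>(1) lim2[of "k / 2"] in auto)
  have "- ((\<psi> y)\<^sup>2 - 3 * k / 2 * (\<phi> y)\<^sup>2) \<ge> 0" if "y \<le> x0" for y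
    by (rule nonneg_of_mono_at_bot[OF DERIV_minus[OF d2] _ _ that])
       (use p0 \<alpha>(2) tendsto_minus[OF lim2[of "3 * k / 2"]] in \<open>auto simp: mult_nonneg_nonpos mult_le_0_iff\<close>)
  then have up: "(\<psi> y)\<^sup>2 \<le> 3 * k / 2 * (\<phi> y)\<^sup>2" if "y \<le> x0" for y using that by simp
  have L: "sqrt k / 2 * \<phi> y \<le> \<psi> y" if "y \<le> x0" for y
  proof (rule power2_le_imp_le)
    have "(sqrt k / 2 * \<phi> y)\<^sup>2 = k / 4 * (\<phi> y)\<^sup>2" using k by (simp add: power_mult_distrib power_divide)
    also have "\<dots> \<le> k / 2 * (\<phi> y)\<^sup>2" using k by (intro mult_right_mono) auto
    also have "\<dots> \<le> (\<psi> y)\<^sup>2" using low[OF that] by simp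
    finally show "(sqrt k / 2 * \<phi> y)\<^sup>2 \<le> (\<psi> y)\<^sup>2" .
  qed (rule p0[OF that])
  then show "sqrt k / 2 * \<phi> x \<le> \<psi> x" using x .
  show "\<psi> x \<le> 2 * sqrt k * \<phi> x"
  proof (rule power2_le_imp_le)
    have "(\<psi> x)\<^sup>2 \<le> 3 * k / 2 * (\<phi> x)\<^sup>2" by (rule up[OF x])
    also have "\<dots> \<le> 4 * k * (\<phi> x)\<^sup>2" using k by (intro mult_right_mono) auto
    also have "\<dots> = (2 * sqrt k * \<phi> x)\<^sup>2" using k by (simp add: power_mult_distrib)
    finally show "(\<psi> x)\<^sup>2 \<le> (2 * sqrt k * \<phi> x)\<^sup>2" .
  qed (use k pos[OF x] in simp)
  have "\<phi> x * exp (- (sqrt k / 2) * x) \<le> \<phi> x0 * exp (- (sqrt k / 2) * x0)"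
  proof (rule DERIV_nonneg_imp_nondecreasing[OF x])
    fix y assume "x \<le> y" "y \<le> x0"
    then have "(\<psi> y - sqrt k / 2 * \<phi> y) * exp (- (sqrt k / 2) * y) \<ge> 0" using L[of y] by simp
    moreover have "((\<lambda>x. \<phi> x * exp (- (sqrt k / 2) * x)) has_real_derivative (\<psi> y - sqrt k / 2 * \<phi> y) * exp (- (sqrt k / 2) * y)) (at y)"
      by (auto intro!: derivative_eq_intros d\<phi> simp: algebra_simps)
    ultimately show "\<exists>D. ((\<lambda>x. \<phi> x * exp (- (sqrt k / 2) * x)) has_real_derivative D) (at y) \<and> 0 \<le> D" by blast
  qed
  then have "\<phi> x * exp (- (sqrt k / 2) * x) * exp (sqrt k / 2 * x) \<le> \<phi> x0 * exp (- (sqrt k / 2) * x0) * exp (sqrt k / 2 * x)"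
    by (intro mult_right_mono) auto
  then show "\<phi> x \<le> \<phi> x0 * exp (sqrt k / 2 * (x - x0))"
    by (simp add: mult.assoc exp_add[symmetric] algebra_simps diff_divide_distrib)
qed

text \<open>The bound is a value of \<open>\<tau>\<close> or its limit, hence a point of the
  interval on which \<open>f\<close> is smooth. With its mirror image it encloses the profile in a
  compact subinterval, whatever the endpoints of the interval are.\<close>

lemma lower_bound_of_limits:
  fixes \<tau> :: "real \<Rightarrow> real"
  assumes c: "continuous_on UNIV \<tau>" and lim: "(\<tau> \<longlongrightarrow> l) at_top" "(\<tau> \<longlongrightarrow> l) at_bot"
  shows "\<exists>m \<in> insert l (range \<tau>). m \<le> l \<and> (\<forall>x. m \<le> \<tau> x)"
proof (cases "\<forall>x. l \<le> \<tau> x")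
  case False
  then obtain x1 where x1: "\<tau> x1 < l" by (meson not_le)
  obtain a b where a: "\<And>x. x \<ge> a \<Longrightarrow> \<tau> x1 < \<tau> x" and b: "\<And>x. x \<le> b \<Longrightarrow> \<tau> x1 < \<tau> x"
    using order_tendstoD(1)[OF lim(1) x1] order_tendstoD(1)[OF lim(2) x1]
    by (auto simp: eventually_at_top_linorder eventually_at_bot_linorder)
  let ?J = "{min b x1..max a x1}"
  have "compact ?J" "?J \<noteq> {}" by auto
  from continuous_attains_inf[OF this continuous_on_subset[OF c]]
  obtain x2 where x2: "x2 \<in> ?J" "\<And>x. x \<in> ?J \<Longrightarrow> \<tau> x2 \<le> \<tau> x" by auto
  have x21: "\<tau> x2 \<le> \<tau> x1" by (rule x2) auto
  have "\<tau> x2 \<le> \<tau> x" for x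
  proof (cases "x \<in> ?J")
    case False
    then have "x \<ge> a \<or> x \<le> b" by auto
    then have "\<tau> x1 < \<tau> x" using a b by blast
    then show ?thesis using x21 by linarith
  qed (rule x2)
  moreover have "\<tau> x2 \<le> l" using x21 x1 by linarith
  ultimately show ?thesis by blast
qed auto

text \<open>What the spectral argument retains of a profile: \<open>\<phi>\<close> is the deviation
  from \<open>\<tau>0\<close> with its sign normalized to be positive, \<open>\<psi>\<close> and
  \<open>\<alpha>\<close> are its first two derivatives, and \<open>d\<alpha>\<close> says that
  \<open>\<psi>\<close> solves the linearized oscillator.\<close>

locale homoclinic_orbit =
  fixes c k K \<eta> :: real and \<phi> \<psi> \<alpha> h :: "real \<Rightarrow> real"
  assumes c: "c > 0" and k: "k > 0" and eta: "\<eta> > 0"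
    and d\<phi>: "\<And>x. (\<phi> has_real_derivative \<psi> x) (at x)"
    and d\<psi>: "\<And>x. (\<psi> has_real_derivative \<alpha> x) (at x)"
    and d\<alpha>: "\<And>x. (\<alpha> has_real_derivative (k + h x) * \<psi> x) (at x)"
    and \<phi>_pos: "\<And>x. \<phi> x > 0"
    and h: "continuous_on UNIV h" "\<And>x. \<bar>h x\<bar> \<le> K * exp (- \<eta> * \<bar>x\<bar>)"
    and \<psi>_le: "\<And>x. \<bar>\<psi> x\<bar> \<le> K * exp (- \<eta> * \<bar>x\<bar>)"
    and lim_top: "(\<phi> \<longlongrightarrow> 0) at_top" "(\<psi> \<longlongrightarrow> 0) at_top" "(\<alpha> \<longlongrightarrow> 0) at_top"
    and lim_bot: "(\<phi> \<longlongrightarrow> 0) at_bot" "(\<psi> \<longlongrightarrow> 0) at_bot"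
    and near_bot: "\<forall>\<^sub>F x in at_bot. \<psi> x > 0 \<and> \<alpha> x > 0 \<and> sqrt k / 2 * \<phi> x \<le> \<psi> x"
    and near_top: "\<forall>\<^sub>F x in at_top. \<psi> x < 0 \<and> \<alpha> x > 0"

lemma homoclinic_profile_orbit:
  fixes cs q \<tau>0 :: real and f \<tau> u :: "real \<Rightarrow> real" and I :: "real set"
  assumes cs: "cs > 0" and sm: "smooth_on_interval I f" and hp: "homoclinic_profile cs f I q \<tau>0 \<tau> u"
  defines "k \<equiv> (cs - derivative_on I f \<tau>0) / cs"
    and "h \<equiv> \<lambda>x. (derivative_on I f \<tau>0 - derivative_on I f (\<tau> x)) / cs"
  shows "\<exists>K \<eta> \<phi> \<psi> \<alpha>. homoclinic_orbit cs k K \<eta> \<phi> \<psi> \<alpha> h"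
proof -
  let ?f1 = "derivative_on I f" and ?f2 = "derivative_on I (derivative_on I f)"
  have I: "is_interval I" and diff: "\<And>n y. y \<in> I \<Longrightarrow> (derivative_on I ^^ n) f differentiable (at y within I)"
    using sm by (auto simp: smooth_on_interval_def)
  have df: "(f has_real_derivative ?f1 y) (at y within I)" if "y \<in> I" for y
    using diff[OF that, of 0] unfolding has_real_derivative_iff_has_vector_derivative derivative_on_def
    by (simp add: vector_derivative_works)
  have df1: "(?f1 has_real_derivative ?f2 y) (at y within I)" if "y \<in> I" for y
    using diff[OF that, of 1] unfolding has_real_derivative_iff_has_vector_derivative
    by (simp add: vector_derivative_works derivative_on_def[of I "derivative_on I f"])
  have "?f2 differentiable (at y within I)" if "y \<in> I" for y
    using diff[OF that, of 2] by (simp add: numeral_2_eq_2)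
  then have cf2: "continuous_on I ?f2"
    by (simp add: continuous_on_eq_continuous_within differentiable_imp_continuous_within)
  have cf1: "continuous_on I ?f1"
    using df1 by (meson DERIV_continuous continuous_on_eq_continuous_within)
  have cf: "continuous_on I f"
    using df by (meson DERIV_continuous continuous_on_eq_continuous_within)
  have rI: "range \<tau> \<subseteq> I" and t0: "\<tau>0 \<in> I" and eq0: "f \<tau>0 = cs * \<tau>0 - q" and sad: "?f1 \<tau>0 < cs"
    and lim: "(\<tau> \<longlongrightarrow> \<tau>0) at_top" "(\<tau> \<longlongrightarrow> \<tau>0) at_bot" and nonc: "\<not> \<tau> constant_on UNIV"
    using hp by (auto simp: homoclinic_profile_def traveling_wave_profile_def)
  have d1: "(\<tau> has_real_derivative deriv \<tau> x) (at x)"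
    and d2: "(deriv \<tau> has_real_derivative deriv (deriv \<tau>) x) (at x)" for x
    using hp by (auto simp: homoclinic_profile_def traveling_wave_profile_def DERIV_deriv_iff_real_differentiable)
  \<comment> \<open>The force of the oscillator, \<open>\<tau>'' = T \<tau>\<close>; it vanishes at
    \<open>\<tau>0\<close> and has slope \<open>k\<close> there.\<close>
  define T where "T s = (- f s + cs * s - q) / cs" for s
  have ode: "deriv (deriv \<tau>) x = T (\<tau> x)" for x
  proof -
    have "(cs\<^sup>2 - cs\<^sup>2) * deriv \<tau> x = - f (\<tau> x) + cs * \<tau> x - q - cs * deriv (deriv \<tau>) x"
      using hp by (auto simp: homoclinic_profile_def traveling_wave_profile_def)
    then show ?thesis using cs by (simp add: T_def field_simps)
  qed
  have dT: "(T has_real_derivative (cs - ?f1 y) / cs) (at y within I)" if "y \<in> I" for y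
    using cs unfolding T_def by (auto intro!: derivative_eq_intros df that)
  have T0: "T \<tau>0 = 0" by (simp add: T_def eq0)
  have tc: "continuous_on UNIV \<tau>"
    using d1 by (meson DERIV_isCont continuous_at_imp_continuous_on)
  have k: "k > 0" using sad cs by (simp add: k_def)
  obtain lo where lo: "lo \<in> I" "lo \<le> \<tau>0" "\<And>x. lo \<le> \<tau> x"
    using lower_bound_of_limits[OF tc lim] rI t0 by auto
  have "\<exists>m \<in> insert (- \<tau>0) (range (\<lambda>x. - \<tau> x)). m \<le> - \<tau>0 \<and> (\<forall>x. m \<le> - \<tau> x)"
    by (rule lower_bound_of_limits) (intro continuous_intros tc tendsto_intros lim)+
  then obtain m where m: "m \<in> insert (- \<tau>0) (range (\<lambda>x. - \<tau> x))" "m \<le> - \<tau>0" "\<And>x. m \<le> - \<tau> x" by blast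
  have "- m \<in> I" using m(1) rI t0 by auto
  then obtain hi where hi: "hi \<in> I" "\<tau>0 \<le> hi" "\<And>x. \<tau> x \<le> hi"
    using m by (intro that[of "- m"]) (auto simp: le_minus_iff)
  let ?J = "{lo..hi}"
  have JI: "?J \<subseteq> I" using lo(1) hi(1) I by (meson atLeastAtMost_iff is_interval_1 subsetI)
  have tJ: "\<tau> x \<in> ?J" "\<tau>0 \<in> ?J" for x using lo hi by auto
  have "compact (?f2 ` ?J)" "compact (?f1 ` ?J)"
    by (intro compact_continuous_image continuous_on_subset[OF cf2 JI] continuous_on_subset[OF cf1 JI] compact_Icc)+
  then obtain B L where B: "\<And>s. s \<in> ?J \<Longrightarrow> \<bar>?f2 s\<bar> \<le> B" and L: "\<And>s. s \<in> ?J \<Longrightarrow> \<bar>?f1 s\<bar> \<le> L"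
    by (metis (no_types, lifting) bounded_iff compact_imp_bounded imageI real_norm_def)
  have B0: "B \<ge> 0" using B[of \<tau>0] tJ abs_ge_zero order_trans by blast
  have df1J: "(?f1 has_real_derivative ?f2 y) (at y within ?J)"
    and dTJ: "(T has_real_derivative (cs - ?f1 y) / cs) (at y within ?J)" if "y \<in> ?J" for y
    using DERIV_subset[OF df1 JI] DERIV_subset[OF dT JI] that JI by blast+
  have lip1: "\<bar>?f1 s - ?f1 \<tau>0\<bar> \<le> B * \<bar>s - \<tau>0\<bar>" if "s \<in> ?J" for s
    using field_differentiable_bound[OF convex_real_interval(5) df1J _ that tJ(2), of B] B by auto
  have lipT: "\<bar>T s\<bar> \<le> (cs + L) / cs * \<bar>s - \<tau>0\<bar>" if "s \<in> ?J" for s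
  proof -
    have "\<bar>(cs - ?f1 y) / cs\<bar> \<le> (cs + L) / cs" if "y \<in> ?J" for y
      using L[OF that] cs by (auto simp: abs_le_iff field_simps)
    then have "norm (T s - T \<tau>0) \<le> (cs + L) / cs * norm (s - \<tau>0)"
      by (intro field_differentiable_bound[OF convex_real_interval(5) dTJ _ that tJ(2)]) simp_all
    then show ?thesis by (simp add: T0)
  qed
  \<comment> \<open>The remainder has derivative \<open>(?f1 \<tau>0 - ?f1 y) / cs\<close>, which
    the Lipschitz bound on \<open>?f1\<close> makes small between \<open>\<tau>0\<close> and
    \<open>s\<close>.\<close>
  have quadT: "\<bar>T s - k * (s - \<tau>0)\<bar> \<le> B / cs * \<bar>s - \<tau>0\<bar> * \<bar>s - \<tau>0\<bar>" if "s \<in> ?J" for s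
  proof -
    let ?S = "closed_segment \<tau>0 s"
    have SJ: "?S \<subseteq> ?J" using that tJ by (intro closed_segment_subset) auto
    have "((\<lambda>s. T s - k * (s - \<tau>0)) has_real_derivative (?f1 \<tau>0 - ?f1 y) / cs) (at y within ?S)" if "y \<in> ?S" for y
    proof -
      have "((\<lambda>s. T s - k * (s - \<tau>0)) has_real_derivative (cs - ?f1 y) / cs - k) (at y within ?S)"
        using that SJ JI by (auto intro!: derivative_eq_intros DERIV_subset[OF dT])
      then show ?thesis by (rule DERIV_cong) (use cs in \<open>simp add: k_def field_simps\<close>)
    qed
    moreover have "norm ((?f1 \<tau>0 - ?f1 y) / cs) \<le> B / cs * \<bar>s - \<tau>0\<bar>" if "y \<in> ?S" for y
    proof -
      have "\<bar>?f1 y - ?f1 \<tau>0\<bar> \<le> B * \<bar>y - \<tau>0\<bar>" using lip1 SJ that by blast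
      also have "\<dots> \<le> B * \<bar>s - \<tau>0\<bar>"
        using that B0 by (intro mult_left_mono) (auto simp: closed_segment_eq_real_ivl split: if_splits)
      finally show ?thesis using cs by (simp add: divide_right_mono abs_minus_commute)
    qed
    ultimately have "norm ((T s - k * (s - \<tau>0)) - (T \<tau>0 - k * (\<tau>0 - \<tau>0))) \<le> B / cs * \<bar>s - \<tau>0\<bar> * norm (s - \<tau>0)"
      by (intro field_differentiable_bound[of ?S "\<lambda>s. T s - k * (s - \<tau>0)" "\<lambda>y. (?f1 \<tau>0 - ?f1 y) / cs"]) auto
    then show ?thesis by (simp add: T0)
  qed
  \<comment> \<open>the energy \<open>(\<tau>')\<^sup>2 / 2 - G \<tau>\<close> is conserved\<close>
  define G where "G s = integral {lo..s} T" for s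
  have cT: "continuous_on ?J T"
    using dT JI by (meson DERIV_continuous continuous_on_eq_continuous_within continuous_on_subset)
  have dG: "(G has_real_derivative T s) (at s within ?J)" if "s \<in> ?J" for s
    unfolding G_def has_real_derivative_iff_has_vector_derivative
    by (rule integral_has_vector_derivative[OF cT that])
  have dGt: "((\<lambda>x. G (\<tau> x)) has_real_derivative T (\<tau> x) * deriv \<tau> x) (at x)" for x
  proof -
    have "(G has_real_derivative T (\<tau> x)) (at (\<tau> x) within range \<tau>)"
      by (rule DERIV_subset[OF dG[OF tJ(1)]]) (use tJ in auto)
    from DERIV_image_chain[OF this d1] show ?thesis by (simp add: o_def)
  qed
  have cG: "continuous_on ?J G" using dG by (meson DERIV_continuous continuous_on_eq_continuous_within)
  have limG: "((\<lambda>x. G (\<tau> x)) \<longlongrightarrow> G \<tau>0) F" if "(\<tau> \<longlongrightarrow> \<tau>0) F" for F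
    by (rule continuous_on_tendsto_compose[OF cG that]) (use tJ in auto)
  define e where "e = (deriv \<tau> 0)\<^sup>2 / 2 - G (\<tau> 0)"
  have "((\<lambda>x. (deriv \<tau> x)\<^sup>2 / 2 - G (\<tau> x)) has_real_derivative 0) (at x)" for x
    by (auto intro!: derivative_eq_intros d2 dGt simp: ode)
  then have en: "(deriv \<tau> x)\<^sup>2 = 2 * (e + G (\<tau> x))" for x
    using DERIV_isconst_all[of "\<lambda>x. (deriv \<tau> x)\<^sup>2 / 2 - G (\<tau> x)" x 0] by (simp add: e_def)
  have lim_sq: "((\<lambda>x. (deriv \<tau> x)\<^sup>2) \<longlongrightarrow> 2 * (e + G \<tau>0)) F" if "(\<tau> \<longlongrightarrow> \<tau>0) F" for F
    unfolding en by (intro tendsto_intros limG that)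
  \<comment> \<open>Energy conservation gives a limit of the squared slope. It is 0 because at the
    mean value points \<open>\<xi> n\<close> the slope is an increment of a convergent function over
    a unit interval.\<close>
  have "e + G \<tau>0 = 0"
  proof -
    have "\<exists>\<xi>>real n. \<xi> < real n + 1 \<and> \<tau> (real n + 1) - \<tau> (real n) = deriv \<tau> \<xi>" for n
      using MVT2[of "real n" "real n + 1" \<tau> "deriv \<tau>"] d1 by auto
    then obtain \<xi> where xi: "\<And>n. \<xi> n > real n" "\<And>n. \<tau> (real n + 1) - \<tau> (real n) = deriv \<tau> (\<xi> n)" by metis
    have "filterlim \<xi> at_top sequentially"
      by (rule filterlim_at_top_mono[OF filterlim_real_sequentially]) (use xi in \<open>auto intro!: always_eventually less_imp_le\<close>)
    then have A: "(\<lambda>n. (deriv \<tau> (\<xi> n))\<^sup>2) \<longlonglongrightarrow> 2 * (e + G \<tau>0)"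
      by (rule filterlim_compose[OF lim_sq[OF lim(1)]])
    have n1: "filterlim (\<lambda>n. real n + 1) at_top sequentially"
      by (rule filterlim_at_top_mono[OF filterlim_real_sequentially]) auto
    have "(\<lambda>n. (\<tau> (real n + 1) - \<tau> (real n))\<^sup>2) \<longlonglongrightarrow> (\<tau>0 - \<tau>0)\<^sup>2"
      by (intro tendsto_intros filterlim_compose[OF lim(1)] n1 filterlim_real_sequentially)
    then have "(\<lambda>n. (deriv \<tau> (\<xi> n))\<^sup>2) \<longlonglongrightarrow> 0" by (simp add: xi(2))
    from LIMSEQ_unique[OF A this] show ?thesis by simp
  qed
  then have en: "(deriv \<tau> x)\<^sup>2 = 2 * (G (\<tau> x) - G \<tau>0)" for x using en[of x] by simp
  have lim\<psi>: "(deriv \<tau> \<longlongrightarrow> 0) F" if "(\<tau> \<longlongrightarrow> \<tau>0) F" for F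
  proof -
    have "((\<lambda>x. sqrt ((deriv \<tau> x)\<^sup>2)) \<longlongrightarrow> sqrt 0) F"
      using lim_sq[OF that] \<open>e + G \<tau>0 = 0\<close> by (intro tendsto_intros) simp
    then show ?thesis by (simp add: tendsto_rabs_zero_iff)
  qed
  \<comment> \<open>If \<open>\<tau>\<close> reached \<open>\<tau>0\<close>, the energy identity
    would give slope 0 there, and uniqueness at the equilibrium would make \<open>\<tau>\<close>
    constant.\<close>
  have nz: "\<tau> x1 \<noteq> \<tau>0" for x1
  proof
    assume x1: "\<tau> x1 = \<tau>0"
    then have p1: "deriv \<tau> x1 = 0" using en[of x1] by simp
    let ?l = "(cs + L) / cs"
    have "L \<ge> 0" using L[of \<tau>0] tJ abs_ge_zero order_trans by blast
    then have l0: "?l \<ge> 0" using cs by simp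
    have "(\<tau> x - \<tau>0)\<^sup>2 + (deriv \<tau> x)\<^sup>2 = 0" for x
    proof (rule gronwall_zero[where x=x and N="\<lambda>x. (\<tau> x - \<tau>0)\<^sup>2 + (deriv \<tau> x)\<^sup>2" and k="1 + ?l" and x0=x1
          and N'="\<lambda>x. 2 * (\<tau> x - \<tau>0) * deriv \<tau> x + 2 * deriv \<tau> x * T (\<tau> x)"])
      fix x
      show "((\<lambda>x. (\<tau> x - \<tau>0)\<^sup>2 + (deriv \<tau> x)\<^sup>2) has_real_derivative
          2 * (\<tau> x - \<tau>0) * deriv \<tau> x + 2 * deriv \<tau> x * T (\<tau> x)) (at x)"
        by (auto intro!: derivative_eq_intros d1 d2 simp: ode)
      have am: "2 * \<bar>a\<bar> * \<bar>b\<bar> \<le> a\<^sup>2 + b\<^sup>2" for a b :: real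
        using zero_le_power2[of "\<bar>a\<bar> - \<bar>b\<bar>"] by (simp add: power2_diff)
      have "\<bar>2 * (\<tau> x - \<tau>0) * deriv \<tau> x + 2 * deriv \<tau> x * T (\<tau> x)\<bar>
          \<le> 2 * \<bar>\<tau> x - \<tau>0\<bar> * \<bar>deriv \<tau> x\<bar> + 2 * \<bar>deriv \<tau> x\<bar> * \<bar>T (\<tau> x)\<bar>"
        by (rule order_trans[OF abs_triangle_ineq]) (simp only: abs_mult abs_numeral order_refl)
      also have "\<dots> \<le> 2 * \<bar>\<tau> x - \<tau>0\<bar> * \<bar>deriv \<tau> x\<bar> + 2 * \<bar>deriv \<tau> x\<bar> * (?l * \<bar>\<tau> x - \<tau>0\<bar>)"
        by (intro add_left_mono mult_left_mono lipT tJ) auto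
      also have "\<dots> = (1 + ?l) * (2 * \<bar>\<tau> x - \<tau>0\<bar> * \<bar>deriv \<tau> x\<bar>)" by (simp only: distrib_right) (simp only: mult_1 mult_ac)
      also have "\<dots> \<le> (1 + ?l) * ((\<tau> x - \<tau>0)\<^sup>2 + (deriv \<tau> x)\<^sup>2)"
        using l0 by (intro mult_left_mono am) auto
      finally show "\<bar>2 * (\<tau> x - \<tau>0) * deriv \<tau> x + 2 * deriv \<tau> x * T (\<tau> x)\<bar> \<le> (1 + ?l) * ((\<tau> x - \<tau>0)\<^sup>2 + (deriv \<tau> x)\<^sup>2)" .
    qed (use x1 p1 in auto)
    then have "\<tau> x = \<tau>0" for x by (simp add: sum_power2_eq_zero_iff)
    then show False using nonc by (auto simp: constant_on_def)
  qed
  \<comment> \<open>Turns pulses below \<open>\<tau>0\<close> into pulses above it; one sign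
    suffices since \<open>\<tau>0\<close> is never crossed.\<close>
  define \<sigma> where "\<sigma> = sgn (\<tau> 0 - \<tau>0)"
  have s2: "\<sigma> * \<sigma> = 1" "\<bar>\<sigma>\<bar> = 1" using nz[of 0] by (auto simp: \<sigma>_def sgn_real_def)
  define \<phi> \<psi> \<alpha> where "\<phi> x = \<sigma> * (\<tau> x - \<tau>0)" and "\<psi> x = \<sigma> * deriv \<tau> x" and "\<alpha> x = \<sigma> * T (\<tau> x)" for x
  have d\<phi>: "(\<phi> has_real_derivative \<psi> x) (at x)" for x
    unfolding \<phi>_def \<psi>_def by (auto intro!: derivative_eq_intros d1)
  have d\<psi>: "(\<psi> has_real_derivative \<alpha> x) (at x)" for x
    unfolding \<psi>_def \<alpha>_def using d2[of x] by (auto intro!: derivative_eq_intros simp: ode)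
  have d\<alpha>: "(\<alpha> has_real_derivative (k + h x) * \<psi> x) (at x)" for x
  proof -
    have "(T has_real_derivative (cs - ?f1 (\<tau> x)) / cs) (at (\<tau> x) within range \<tau>)"
      by (rule DERIV_subset[OF dT]) (use rI in auto)
    from DERIV_image_chain[OF this d1]
    have "((\<lambda>x. T (\<tau> x)) has_real_derivative (cs - ?f1 (\<tau> x)) / cs * deriv \<tau> x) (at x)" by (simp add: o_def)
    from DERIV_cmult[OF this, of \<sigma>] show ?thesis
      unfolding \<alpha>_def \<psi>_def by (rule DERIV_cong) (use cs in \<open>simp add: k_def h_def field_simps\<close>)
  qed
  have c\<phi>: "continuous_on UNIV \<phi>"
    using d\<phi> by (meson DERIV_isCont continuous_at_imp_continuous_on)
  have \<phi>nz: "\<phi> x \<noteq> 0" for x using nz[of x] s2 by (auto simp: \<phi>_def)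
  have pos: "\<phi> x > 0" for x
  proof (rule ccontr)
    assume "\<not> \<phi> x > 0"
    moreover have "\<phi> 0 > 0" using nz[of 0] by (auto simp: \<phi>_def \<sigma>_def sgn_real_def)
    ultimately have "\<exists>y. \<phi> y = 0"
      using IVT'[of \<phi> x 0 0] IVT2'[of \<phi> x 0 0] continuous_on_subset[OF c\<phi>]
      by (cases "x \<le> 0") (fastforce simp: not_less)+
    then show False using \<phi>nz by blast
  qed
  have abs\<phi>: "\<bar>\<tau> x - \<tau>0\<bar> = \<phi> x" for x
    using pos[of x] s2 by (metis \<phi>_def abs_mult abs_of_pos mult_1)
  have lim\<phi>: "(\<phi> \<longlongrightarrow> 0) F" if "(\<tau> \<longlongrightarrow> \<tau>0) F" for F
  proof -
    have "(\<phi> \<longlongrightarrow> \<sigma> * (\<tau>0 - \<tau>0)) F" unfolding \<phi>_def by (intro tendsto_intros that)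
    then show ?thesis by simp
  qed
  have lim\<psi>: "(\<psi> \<longlongrightarrow> 0) F" if "(\<tau> \<longlongrightarrow> \<tau>0) F" for F
    unfolding \<psi>_def using lim\<psi>[OF that] by (rule tendsto_mult_right_zero)
  have quad: "\<bar>\<alpha> x - k * \<phi> x\<bar> \<le> B / cs * \<phi> x * \<phi> x" for x
  proof -
    have "\<alpha> x - k * \<phi> x = \<sigma> * (T (\<tau> x) - k * (\<tau> x - \<tau>0))" by (simp add: \<alpha>_def \<phi>_def algebra_simps)
    then show ?thesis using quadT[OF tJ(1), of x] by (simp add: abs_mult s2 abs\<phi>)
  qed
  \<comment> \<open>Near either end the quadratic remainder is at most half of the linear part
    \<open>k \<phi>\<close>.\<close>
  have ev: "\<forall>\<^sub>F x in F. k / 2 * \<phi> x \<le> \<alpha> x \<and> \<alpha> x \<le> 3 * k / 2 * \<phi> x" if "(\<tau> \<longlongrightarrow> \<tau>0) F" for F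
  proof -
    have "((\<lambda>x. B / cs * \<phi> x) \<longlongrightarrow> B / cs * 0) F" by (intro tendsto_intros lim\<phi> that)
    then have "\<forall>\<^sub>F x in F. B / cs * \<phi> x < k / 2" by (rule order_tendstoD) (use k in simp)
    then show ?thesis
    proof eventually_elim
      case (elim x)
      then have "B / cs * \<phi> x * \<phi> x \<le> k / 2 * \<phi> x" using pos[of x] by (intro mult_right_mono) auto
      then show ?case using quad[of x] by linarith
    qed
  qed
  have lim\<alpha>: "(\<alpha> \<longlongrightarrow> 0) at_top"
  proof (rule tendsto_sandwich[of "\<lambda>x. k / 2 * \<phi> x" _ _ "\<lambda>x. 3 * k / 2 * \<phi> x"])
    show "\<forall>\<^sub>F x in at_top. k / 2 * \<phi> x \<le> \<alpha> x" "\<forall>\<^sub>F x in at_top. \<alpha> x \<le> 3 * k / 2 * \<phi> x"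
      using ev[OF lim(1)] by (auto elim: eventually_mono)
  qed (intro tendsto_mult_right_zero lim\<phi> lim)+
  obtain x0 where x0: "\<And>x. x \<le> x0 \<Longrightarrow> k / 2 * \<phi> x \<le> \<alpha> x" "\<And>x. x \<le> x0 \<Longrightarrow> \<alpha> x \<le> 3 * k / 2 * \<phi> x"
    using ev[OF lim(2)] by (auto simp: eventually_at_bot_linorder)
  have left: "\<psi> x > 0" "\<alpha> x > 0" "sqrt k / 2 * \<phi> x \<le> \<psi> x" "\<psi> x \<le> 2 * sqrt k * \<phi> x"
    "\<phi> x \<le> \<phi> x0 * exp (sqrt k / 2 * (x - x0))" if "x \<le> x0" for x
    using unstable_branch_bounds[OF k d\<phi> d\<psi> pos _ _ lim\<phi>[OF lim(2)] lim\<psi>[OF lim(2)], of x0 x] x0 that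
    by auto
  obtain x1 where x1: "\<And>x. x \<ge> x1 \<Longrightarrow> k / 2 * \<phi> x \<le> \<alpha> x" "\<And>x. x \<ge> x1 \<Longrightarrow> \<alpha> x \<le> 3 * k / 2 * \<phi> x"
    using ev[OF lim(1)] by (auto simp: eventually_at_top_linorder)
  \<comment> \<open>Seen from the right end, the reflected orbit leaves the saddle along the
    unstable branch, so the same bounds apply with the sign of \<open>\<psi>\<close>
    changed.\<close>
  have rd\<phi>: "((\<lambda>x. \<phi> (- x)) has_real_derivative - \<psi> (- x)) (at x)" for x
    using DERIV_chain2[OF d\<phi> DERIV_minus[OF DERIV_ident]] by simp
  have rd\<psi>: "((\<lambda>x. - \<psi> (- x)) has_real_derivative \<alpha> (- x)) (at x)" for x
    using DERIV_minus[OF DERIV_chain2[OF d\<psi> DERIV_minus[OF DERIV_ident]]] by simp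
  have mirror: "((\<lambda>x. y (- x)) \<longlongrightarrow> l) at_bot" if "(y \<longlongrightarrow> l) at_top" for y :: "real \<Rightarrow> real" and l
    using filterlim_compose[OF that filterlim_uminus_at_top_at_bot] .
  have right: "- \<psi> x > 0" "\<alpha> x > 0" "- \<psi> x \<le> 2 * sqrt k * \<phi> x" "\<phi> x \<le> \<phi> x1 * exp (sqrt k / 2 * (x1 - x))" if "x \<ge> x1" for x
    using unstable_branch_bounds[OF k rd\<phi> rd\<psi> pos _ _ mirror[OF lim\<phi>[OF lim(1)]] , of "- x1" "- x"]
      x1 that tendsto_minus[OF mirror[OF lim\<psi>[OF lim(1)]]] by auto
  define \<eta> where "\<eta> = sqrt k / 2"
  have eta: "\<eta> > 0" using k by (simp add: \<eta>_def)
  have ext: "\<exists>K. \<forall>x. \<bar>y x\<bar> \<le> K * exp (- \<eta> * \<bar>x\<bar>)"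
    if cy: "continuous_on UNIV y" and R: "\<And>x. x \<le> x0 \<or> x \<ge> x1 \<Longrightarrow> \<bar>y x\<bar> \<le> R * \<phi> x" and R0: "R \<ge> 0" for y :: "real \<Rightarrow> real" and R
  proof -
    have "compact ((\<lambda>x. y x / exp (- \<eta> * \<bar>x\<bar>)) ` {x0..x1})"
      by (intro compact_continuous_image continuous_intros continuous_on_subset[OF cy] compact_Icc) auto
    then obtain M where M: "\<And>x. x \<in> {x0..x1} \<Longrightarrow> \<bar>y x / exp (- \<eta> * \<bar>x\<bar>)\<bar> \<le> M"
      by (metis (no_types, lifting) bounded_iff compact_imp_bounded imageI real_norm_def)
    \<comment> \<open>The doubled absolute value covers both signs of \<open>x0\<close>: for
      \<open>x \<le> x0\<close> one has
      \<open>x - x0 \<le> 2 \<bar>x0\<bar> - \<bar>x\<bar>\<close>, and similarly at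
      \<open>x1\<close>.\<close>
    define K where "K = max (max M (R * (\<phi> x0 * exp (\<eta> * (\<bar>x0\<bar> + \<bar>x0\<bar>)))))  (R * (\<phi> x1 * exp (\<eta> * (\<bar>x1\<bar> + \<bar>x1\<bar>))))"
    have "\<bar>y x\<bar> \<le> K * exp (- \<eta> * \<bar>x\<bar>)" for x
    proof -
      consider "x \<le> x0" | "x \<ge> x1" | "x \<in> {x0..x1}" by fastforce
      then show ?thesis
      proof cases
        case 1
        have "\<bar>y x\<bar> \<le> R * (\<phi> x0 * exp (\<eta> * (x - x0)))"
          by (rule order_trans[OF R mult_left_mono[OF _ R0]]) (use 1 left(5)[OF 1] in \<open>auto simp: \<eta>_def\<close>)
        also have "\<dots> \<le> R * (\<phi> x0 * exp (\<eta> * (\<bar>x0\<bar> + \<bar>x0\<bar>) + - \<eta> * \<bar>x\<bar>))"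
        proof (intro mult_left_mono R0)
          have "x - x0 \<le> \<bar>x0\<bar> + \<bar>x0\<bar> - \<bar>x\<bar>" using 1 by linarith
          from mult_left_mono[OF this less_imp_le[OF eta]]
          show "exp (\<eta> * (x - x0)) \<le> exp (\<eta> * (\<bar>x0\<bar> + \<bar>x0\<bar>) + - \<eta> * \<bar>x\<bar>)" by (simp add: algebra_simps)
        qed (use pos[of x0] in auto)
        also have "\<dots> = (R * (\<phi> x0 * exp (\<eta> * (\<bar>x0\<bar> + \<bar>x0\<bar>)))) * exp (- \<eta> * \<bar>x\<bar>)" by (simp only: exp_add mult.assoc)
        also have "\<dots> \<le> K * exp (- \<eta> * \<bar>x\<bar>)" by (intro mult_right_mono) (auto simp: K_def)
        finally show ?thesis .
      next
        case 2
        have "\<bar>y x\<bar> \<le> R * (\<phi> x1 * exp (\<eta> * (x1 - x)))"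
          by (rule order_trans[OF R mult_left_mono[OF _ R0]]) (use 2 right(4)[OF 2] in \<open>auto simp: \<eta>_def\<close>)
        also have "\<dots> \<le> R * (\<phi> x1 * exp (\<eta> * (\<bar>x1\<bar> + \<bar>x1\<bar>) + - \<eta> * \<bar>x\<bar>))"
        proof (intro mult_left_mono R0)
          have "x1 - x \<le> \<bar>x1\<bar> + \<bar>x1\<bar> - \<bar>x\<bar>" using 2 by linarith
          from mult_left_mono[OF this less_imp_le[OF eta]]
          show "exp (\<eta> * (x1 - x)) \<le> exp (\<eta> * (\<bar>x1\<bar> + \<bar>x1\<bar>) + - \<eta> * \<bar>x\<bar>)" by (simp add: algebra_simps)
        qed (use pos[of x1] in auto)
        also have "\<dots> = (R * (\<phi> x1 * exp (\<eta> * (\<bar>x1\<bar> + \<bar>x1\<bar>)))) * exp (- \<eta> * \<bar>x\<bar>)" by (simp only: exp_add mult.assoc)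
        also have "\<dots> \<le> K * exp (- \<eta> * \<bar>x\<bar>)" by (intro mult_right_mono) (auto simp: K_def)
        finally show ?thesis .
      next
        case 3
        have "\<bar>y x\<bar> \<le> M * exp (- \<eta> * \<bar>x\<bar>)" using M[OF 3] by (simp add: abs_divide divide_le_eq)
        also have "\<dots> \<le> K * exp (- \<eta> * \<bar>x\<bar>)" by (intro mult_right_mono) (auto simp: K_def)
        finally show ?thesis .
      qed
    qed
    then show ?thesis by blast
  qed
  have hc: "continuous_on UNIV h"
    unfolding h_def by (intro continuous_intros continuous_on_compose2[OF cf1 tc rI]) (use cs in auto)
  have hb: "\<bar>h x\<bar> \<le> B / cs * \<phi> x" for x
    using lip1[OF tJ(1), of x] cs unfolding h_def abs\<phi>
    by (simp add: abs_divide abs_minus_commute divide_right_mono)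
  obtain K1 where K1: "\<And>x. \<bar>h x\<bar> \<le> K1 * exp (- \<eta> * \<bar>x\<bar>)"
    using ext[OF hc hb] B0 cs by auto
  have \<psi>c: "continuous_on UNIV \<psi>"
    using d\<psi> by (meson DERIV_isCont continuous_at_imp_continuous_on)
  have "\<bar>\<psi> x\<bar> \<le> 2 * sqrt k * \<phi> x" if "x \<le> x0 \<or> x \<ge> x1" for x
    using that left(1)[of x] left(4)[of x] right(1)[of x] right(3)[of x] by (auto simp: abs_if)
  from ext[OF \<psi>c this] obtain K2 where K2: "\<And>x. \<bar>\<psi> x\<bar> \<le> K2 * exp (- \<eta> * \<bar>x\<bar>)" using k by auto
  have mx: "K1 * exp (- \<eta> * \<bar>x\<bar>) \<le> max K1 K2 * exp (- \<eta> * \<bar>x\<bar>)" "K2 * exp (- \<eta> * \<bar>x\<bar>) \<le> max K1 K2 * exp (- \<eta> * \<bar>x\<bar>)" for x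
    by (intro mult_right_mono; simp)+
  have "homoclinic_orbit cs k (max K1 K2) \<eta> \<phi> \<psi> \<alpha> h"
  proof
    show "\<forall>\<^sub>F x in at_bot. \<psi> x > 0 \<and> \<alpha> x > 0 \<and> sqrt k / 2 * \<phi> x \<le> \<psi> x"
      using eventually_le_at_bot[of x0] by eventually_elim (use left in auto)
    show "\<forall>\<^sub>F x in at_top. \<psi> x < 0 \<and> \<alpha> x > 0"
      using eventually_ge_at_top[of x1] by eventually_elim (use right in auto)
    show "\<bar>h x\<bar> \<le> max K1 K2 * exp (- \<eta> * \<bar>x\<bar>)" "\<bar>\<psi> x\<bar> \<le> max K1 K2 * exp (- \<eta> * \<bar>x\<bar>)" for x
      using K1[of x] K2[of x] mx[of x] by linarith+
  qed (use cs k eta d\<phi> d\<psi> d\<alpha> pos hc lim\<phi> lim\<psi> lim lim\<alpha> in auto)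
  then show ?thesis by blast
qed

section \<open>A real zero of the transmission coefficient\<close>

lemma quadratic_exp_bound:
  fixes \<eta> x :: real
  assumes "\<eta> > 0"
  shows "exp (- \<eta> * \<bar>x\<bar>) \<le> (1 + 2 / \<eta>\<^sup>2) / (1 + x\<^sup>2)"
proof -
  let ?t = "\<eta> * \<bar>x\<bar>"
  have t: "?t \<ge> 0" using assms by simp
  have "1 + ?t + ?t\<^sup>2 / 2 \<le> exp ?t" by (rule exp_lower_Taylor_quadratic[OF t])
  then have 1: "?t\<^sup>2 / 2 \<le> exp ?t" "1 \<le> exp ?t" using t zero_le_power2[of ?t] by linarith+
  have "x\<^sup>2 = 2 / \<eta>\<^sup>2 * (?t\<^sup>2 / 2)" using assms by (simp add: power_mult_distrib)
  also have "\<dots> \<le> 2 / \<eta>\<^sup>2 * exp ?t" using 1 by (intro mult_left_mono) auto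
  finally have "1 + x\<^sup>2 \<le> exp ?t + 2 / \<eta>\<^sup>2 * exp ?t" using 1(2) by linarith
  then have "1 + x\<^sup>2 \<le> (1 + 2 / \<eta>\<^sup>2) * exp ?t" by (simp only: distrib_right mult_1)
  moreover have "1 + x\<^sup>2 > 0" by (intro add_pos_nonneg) auto
  ultimately show ?thesis by (simp add: exp_minus field_simps)
qed

lemma abs_exp_diff_le:
  fixes a b :: real
  assumes "a \<le> L" "b \<le> L"
  shows "\<bar>exp a - exp b\<bar> \<le> exp L * \<bar>a - b\<bar>"
proof -
  have "norm (exp a - exp b) \<le> exp L * norm (a - b)"
    by (rule field_differentiable_bound[where S="{..L}" and f'=exp])
       (use assms in \<open>auto intro!: derivative_eq_intros\<close>)
  then show ?thesis by simp
qed

text \<open>The exponents move with the parameter, so the two exponentials differ by an amount of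
  order \<open>\<bar>x\<bar>\<close>, which the weight \<open>1 + \<bar>x\<bar>\<close> absorbs.
  Nonpositive exponents keep both exponentials bounded on \<open>[x0, \<infinity>)\<close>.\<close>

lemma weighted_exp_limit:
  fixes V :: "'i \<Rightarrow> real \<Rightarrow> complex" and V0 :: "real \<Rightarrow> complex" and m :: "'i \<Rightarrow> real"
  assumes m: "(m \<longlongrightarrow> m0) F" "\<forall>\<^sub>F i in F. m i \<le> 0" "m0 \<le> 0"
    and V: "uniform_limit UNIV V V0 F" "\<And>x. norm (V0 x) \<le> B" and e: "e > 0"
  shows "\<forall>\<^sub>F i in F. \<forall>x\<ge>x0. \<bar>exp (m i * x) * Re (V i x) - exp (m0 * x) * Re (V0 x)\<bar> \<le> e * (1 + \<bar>x\<bar>)"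
proof -
  \<comment> \<open>Bounds both exponents on \<open>[x0, \<infinity>)\<close> once
    \<open>m i\<close> is within 1 of \<open>m0\<close>: they are nonpositive for
    \<open>x \<ge> 0\<close>, and negative \<open>x\<close> satisfy
    \<open>\<bar>x\<bar> \<le> \<bar>x0\<bar>\<close>.\<close>
  define L where "L = (\<bar>m0\<bar> + 1) * \<bar>x0\<bar>"
  define d where "d = e / (exp L * (\<bar>B\<bar> + 1))"
  have d: "d > 0" using e by (simp add: d_def)
  have B: "B \<ge> 0" using order_trans[OF norm_ge_zero V(2)] .
  have Lb: "a * x \<le> L" if "a \<le> 0" "\<bar>a - m0\<bar> \<le> 1" "x \<ge> x0" for a x
  proof (cases "x \<ge> 0")
    case True
    then have "a * x \<le> 0" using that by (simp add: mult_nonpos_nonneg)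
    moreover have "L \<ge> 0" by (simp add: L_def)
    ultimately show ?thesis by linarith
  next
    case False
    have "a * x = \<bar>a\<bar> * \<bar>x\<bar>" using False that by (simp add: abs_mult[symmetric] mult_nonpos_nonpos)
    also have "\<dots> \<le> L" unfolding L_def using False that by (intro mult_mono) auto
    finally show ?thesis .
  qed
  have "\<forall>\<^sub>F i in F. dist (m i) m0 < min d 1" by (rule tendstoD[OF m(1)]) (use d in simp)
  moreover have "\<forall>\<^sub>F i in F. \<forall>x\<in>UNIV. dist (V i x) (V0 x) < d" by (rule uniform_limitD[OF V(1) d])
  ultimately show ?thesis using m(2)
  proof eventually_elim
    case (elim i)
    show ?case
    proof (intro allI impI)
      fix x assume x: "x \<ge> x0"
      have 1: "m i * x \<le> L" "m0 * x \<le> L"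
        using elim x m(3) by (auto intro!: Lb simp: dist_real_def)
      have "\<bar>exp (m i * x) * Re (V i x) - exp (m0 * x) * Re (V0 x)\<bar>
          = \<bar>exp (m i * x) * Re (V i x - V0 x) + (exp (m i * x) - exp (m0 * x)) * Re (V0 x)\<bar>"
        by (simp add: algebra_simps)
      also have "\<dots> \<le> exp (m i * x) * \<bar>Re (V i x - V0 x)\<bar> + \<bar>exp (m i * x) - exp (m0 * x)\<bar> * \<bar>Re (V0 x)\<bar>"
        by (rule order_trans[OF abs_triangle_ineq]) (simp add: abs_mult)
      also have "\<dots> \<le> exp L * d + (exp L * (d * \<bar>x\<bar>)) * B"
      proof (intro add_mono mult_mono)
        show "exp (m i * x) \<le> exp L" using 1 by simp
        show "\<bar>Re (V i x - V0 x)\<bar> \<le> d"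
          using order_trans[OF abs_Re_le_cmod, of "V i x - V0 x" d] elim(2) by (simp add: dist_norm less_imp_le)
        have "\<bar>m i * x - m0 * x\<bar> \<le> d * \<bar>x\<bar>"
          using elim(1) by (auto simp: left_diff_distrib[symmetric] abs_mult dist_real_def intro!: mult_right_mono)
        then show "\<bar>exp (m i * x) - exp (m0 * x)\<bar> \<le> exp L * (d * \<bar>x\<bar>)"
          using order_trans[OF abs_exp_diff_le[OF 1] mult_left_mono] by simp
        show "\<bar>Re (V0 x)\<bar> \<le> B" by (rule order_trans[OF abs_Re_le_cmod V(2)])
      qed (use d in auto)
      also have "\<dots> = exp L * d * (1 + B * \<bar>x\<bar>)" by (simp add: algebra_simps)
      also have "\<dots> \<le> exp L * d * ((\<bar>B\<bar> + 1) * (1 + \<bar>x\<bar>))"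
        using d B by (intro mult_left_mono) (auto simp: algebra_simps)
      also have "\<dots> = (exp L * d * (\<bar>B\<bar> + 1)) * (1 + \<bar>x\<bar>)" by (simp only: mult.assoc)
      also have "exp L * d * (\<bar>B\<bar> + 1) = e" using B by (simp add: d_def)
      finally show "\<bar>exp (m i * x) * Re (V i x) - exp (m0 * x) * Re (V0 x)\<bar> \<le> e * (1 + \<bar>x\<bar>)" .
    qed
  qed
qed

section \<open>The decaying solution for real nonnegative spectral parameter\<close>

context homoclinic_orbit
begin

text \<open>Trades exponential decay for decay like \<open>1 / (1 + x\<^sup>2)\<close>, whose tail
  integral is explicit through \<open>arctan\<close>.\<close>

definition K' :: real where "K' = K * (1 + 2 / \<eta>\<^sup>2)"

lemma K_nonneg: "K \<ge> 0"
  using order_trans[OF abs_ge_zero h(2)[of 0]] by simp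

lemma K'_nonneg: "K' \<ge> 0" using K_nonneg by (simp add: K'_def)

lemma decay_quadratic:
  assumes "\<bar>y\<bar> \<le> K * exp (- \<eta> * \<bar>x\<bar>)" shows "\<bar>y\<bar> \<le> K' / (1 + x\<^sup>2)"
  using order_trans[OF assms mult_left_mono[OF quadratic_exp_bound[OF eta] K_nonneg]] by (simp add: K'_def)

lemma h_le: "\<bar>h x\<bar> \<le> K' / (1 + x\<^sup>2)"
  by (rule decay_quadratic[OF h(2)])

text \<open>Pays for the linear weight in the limit \<open>z \<rightarrow> 0\<close>: the
  exponential is split into two halves, each giving a factor \<open>1 / (1 + x\<^sup>2)\<close>, and
  one of them cancels \<open>1 + \<bar>x\<bar>\<close>.\<close>

lemma \<psi>_weighted: "\<bar>\<psi> x\<bar> * (1 + \<bar>x\<bar>) \<le> 2 * K * (1 + 8 / \<eta>\<^sup>2)\<^sup>2 / (1 + x\<^sup>2)"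
proof -
  let ?C = "1 + 8 / \<eta>\<^sup>2" and ?s = "1 + x\<^sup>2"
  have s: "?s > 0" by (intro add_pos_nonneg) auto
  have e: "exp (- (\<eta> / 2) * \<bar>x\<bar>) \<le> ?C / ?s"
    using quadratic_exp_bound[of "\<eta> / 2" x] eta by (simp add: power_divide)
  have "\<bar>x\<bar> \<le> 1 + x\<^sup>2" using zero_le_power2[of "\<bar>x\<bar> - 1"] abs_ge_zero[of x] by (simp add: power2_diff) 
  then have "1 + \<bar>x\<bar> \<le> 1 + (1 + x\<^sup>2)" by simp
  also have "\<dots> \<le> 2 * ?s" by simp
  finally have x2: "1 + \<bar>x\<bar> \<le> 2 * ?s" .
  have "exp (- \<eta> * \<bar>x\<bar>) = exp (- (\<eta> / 2) * \<bar>x\<bar>) * exp (- (\<eta> / 2) * \<bar>x\<bar>)"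
    by (simp add: exp_add[symmetric])
  also have "\<dots> \<le> (?C / ?s) * (?C / ?s)" by (intro mult_mono e) (use s in auto)
  finally have "\<bar>\<psi> x\<bar> \<le> K * ((?C / ?s) * (?C / ?s))"
    by (intro order_trans[OF \<psi>_le mult_left_mono] K_nonneg)
  then have "\<bar>\<psi> x\<bar> * (1 + \<bar>x\<bar>) \<le> K * ((?C / ?s) * (?C / ?s)) * (2 * ?s)"
    by (rule mult_mono[OF _ x2]) (use K_nonneg s in auto)
  also have "K * ((C / t) * (C / t)) * (2 * t) = 2 * K * C\<^sup>2 / t" if "t > 0" for C t :: real
    using that by (simp add: field_simps power2_eq_square)
  note this[OF s]
  finally show ?thesis .
qed

abbreviation "m3 \<equiv> decay_rate c k"
abbreviation "m1 \<equiv> growth_root1 c k"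
abbreviation "m2 \<equiv> growth_root2 c k"
definition "n1 z = m1 z - of_real (m3 z)"
definition "n2 z = m2 z - of_real (m3 z)"
definition "amp z = (SOME a. volterra_solution h (m2 z) (n1 z) (n2 z) a)"
text \<open>For the complex solution of fastest decay, \<open>aux\<close>, \<open>V0\<close>,
  \<open>V1\<close>, \<open>V2\<close> are \<open>exp (- m3 x)\<close> times
  \<open>(\<partial> - m2) w\<close>, \<open>w\<close>, \<open>w'\<close>, \<open>w''\<close>. The
  real functions \<open>w\<close>, \<open>w1\<close>, \<open>w2\<close> are obtained by taking real
  parts, which the equation permits since its coefficients are real even when \<open>m1\<close> and
  \<open>m2\<close> are not.\<close>

definition "aux z = resolvent (n1 z) (amp z)"
definition "V0 z = resolvent (n2 z) (aux z)"
definition "V1 z = volterra_op (m2 z) (n1 z) (n2 z) (amp z)"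
definition "V2 z = (\<lambda>x. m2 z * m2 z * V0 z x + (m1 z + m2 z) * aux z x + amp z x)"
definition "w z x = exp (m3 z * x) * Re (V0 z x)"
definition "w1 z x = exp (m3 z * x) * Re (V1 z x)"
definition "w2 z x = exp (m3 z * x) * Re (V2 z x)"
definition "transmission z = Lim at_bot (\<lambda>x. Re (amp z x))"

lemma n_pos: assumes "z \<ge> 0" shows "Re (n1 z) > 0" "Re (n2 z) > 0"
proof -
  show "Re (n2 z) > 0" using growth_root2_Re[OF c k assms] decay_rate_neg[OF c k assms] by (simp add: n2_def)
  show "Re (n1 z) > 0"
    using growth_root1_Re[OF c k assms] growth_sum_prod(1)[OF c k assms] decay_rate_neg[OF c k assms]
    by (simp add: n1_def)
qed

lemma n_nz: assumes "z \<ge> 0" shows "Re (n1 z) \<noteq> 0" "Re (n2 z) \<noteq> 0"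
  using n_pos[OF assms] by auto

lemma amp: assumes "z \<ge> 0" shows "volterra_solution h (m2 z) (n1 z) (n2 z) (amp z)"
  unfolding amp_def by (rule someI_ex[OF volterra_solution_exists[OF h(1) h_le n_pos[OF assms]]])

lemma amp_facts:
  assumes z: "z \<ge> 0"
  shows "bounded_continuous (amp z)" "(amp z \<longlongrightarrow> 1) at_top"
    "(amp z has_vector_derivative of_real (h x) * V1 z x) (at x)"
  using amp[OF z] by (auto simp: volterra_solution_def V1_def)

lemma V_bounded_continuous:
  assumes z: "z \<ge> 0"
  shows "bounded_continuous (aux z)" "bounded_continuous (V0 z)" "bounded_continuous (V1 z)" "bounded_continuous (V2 z)"
proof -
  show a: "bounded_continuous (aux z)" "bounded_continuous (V0 z)"
    unfolding aux_def V0_def by (intro resolvent_bounded_continuous amp_facts n_nz z)+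
  show "bounded_continuous (V1 z)"
    unfolding V1_def by (intro volterra_op_bounded_continuous amp_facts n_nz z)
  show "bounded_continuous (V2 z)"
    unfolding V2_def by (intro bounded_continuous_intros a amp_facts z)
qed

lemma V1_eq: "V1 z x = m2 z * V0 z x + aux z x"
  by (simp add: V1_def volterra_op_def V0_def aux_def)

lemma vieta:
  assumes z: "z \<ge> 0"
  shows "m1 z + m2 z + of_real (m3 z) = of_real (z / c)"
    and "m1 z * m2 z + (m1 z + m2 z) * of_real (m3 z) = - of_real (2 * z + k)"
    and "m1 z * m2 z * of_real (m3 z) = - of_real (z * (z + 1) / c)"
  using growth_sum_prod(3-5)[OF c k z]
  unfolding growth_roots_sum[OF c k z] growth_roots_prod[OF c k z]
  by (simp_all only: of_real_add[symmetric] of_real_mult[symmetric] of_real_minus[symmetric])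

lemma V_derivs:
  assumes z: "z \<ge> 0"
  shows "(V0 z has_vector_derivative V1 z x - of_real (m3 z) * V0 z x) (at x)"
    and "(V1 z has_vector_derivative V2 z x - of_real (m3 z) * V1 z x) (at x)"
    and "(V2 z has_vector_derivative of_real (z / c) * V2 z x + of_real (2 * z + k + h x) * V1 z x
           - of_real (z * (z + 1) / c) * V0 z x - of_real (m3 z) * V2 z x) (at x)"
proof -
  have da: "(aux z has_vector_derivative n1 z * aux z x + amp z x) (at x)" for x
    unfolding aux_def by (intro resolvent_deriv amp_facts n_nz z)
  have d0: "(V0 z has_vector_derivative n2 z * V0 z x + aux z x) (at x)" for x
    using resolvent_deriv[OF V_bounded_continuous(1)[OF z] n_nz(2)[OF z]] unfolding V0_def .
  show "(V0 z has_vector_derivative V1 z x - of_real (m3 z) * V0 z x) (at x)"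
    using d0 by (rule has_vector_derivative_eq_rhs) (simp add: V1_eq n2_def algebra_simps)
  have "(V1 z has_vector_derivative m2 z * (n2 z * V0 z x + aux z x) + (n1 z * aux z x + amp z x)) (at x)"
    unfolding V1_eq[abs_def] by (intro has_vector_derivative_add has_vector_derivative_mult_right d0 da)
  then show "(V1 z has_vector_derivative V2 z x - of_real (m3 z) * V1 z x) (at x)"
    by (rule has_vector_derivative_eq_rhs) (simp add: V1_eq V2_def n1_def n2_def algebra_simps)
  have "(V2 z has_vector_derivative m2 z * m2 z * (n2 z * V0 z x + aux z x)
      + (m1 z + m2 z) * (n1 z * aux z x + amp z x) + of_real (h x) * V1 z x) (at x)"
    unfolding V2_def by (intro has_vector_derivative_add has_vector_derivative_mult_right d0 da amp_facts z)
  moreover have "m2 z * m2 z * (n2 z * V0 z x + aux z x) + (m1 z + m2 z) * (n1 z * aux z x + amp z x) + of_real (h x) * V1 z x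
      = (m1 z + m2 z + of_real (m3 z)) * V2 z x - (m1 z * m2 z + (m1 z + m2 z) * of_real (m3 z)) * V1 z x
        + m1 z * m2 z * of_real (m3 z) * V0 z x + of_real (h x) * V1 z x - of_real (m3 z) * V2 z x"
    by (simp add: V1_eq V2_def n1_def n2_def algebra_simps)
  moreover have "complex_of_real (2 * z + k + h x) = of_real (2 * z + k) + of_real (h x)" by (rule of_real_add)
  moreover have "S * a - - Q * b + - B * d + H * b - m * a = S * a + (Q + H) * b - B * d - m * a"
    for S Q B H a b d m :: complex by (simp add: algebra_simps)
  ultimately show "(V2 z has_vector_derivative of_real (z / c) * V2 z x + of_real (2 * z + k + h x) * V1 z x
           - of_real (z * (z + 1) / c) * V0 z x - of_real (m3 z) * V2 z x) (at x)"
    unfolding vieta[OF z] by (simp only:)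
qed

lemma exp_Re_deriv:
  assumes "(V has_vector_derivative V' - of_real m * V x) (at x)"
  shows "((\<lambda>x. exp (m * x) * Re (V x)) has_real_derivative exp (m * x) * Re V') (at x)"
proof -
  have "((\<lambda>x. Re (V x)) has_real_derivative Re (V' - of_real m * V x)) (at x)"
    using bounded_linear.has_vector_derivative[OF bounded_linear_Re assms]
    by (simp add: has_real_derivative_iff_has_vector_derivative)
  moreover have "((\<lambda>x. exp (m * x)) has_real_derivative exp (m * x) * m) (at x)"
    by (auto intro!: derivative_eq_intros)
  ultimately have "((\<lambda>x. exp (m * x) * Re (V x)) has_real_derivative
      exp (m * x) * m * Re (V x) + Re (V' - of_real m * V x) * exp (m * x)) (at x)"
    by (intro DERIV_mult)
  then show ?thesis by (rule DERIV_cong) (simp add: algebra_simps)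
qed

lemma w_derivs:
  assumes z: "z \<ge> 0"
  shows dw: "(w z has_real_derivative w1 z x) (at x)"
    and dw1: "(w1 z has_real_derivative w2 z x) (at x)"
    and dw2: "(w2 z has_real_derivative (z / c) * w2 z x + (2 * z + k + h x) * w1 z x - (z * (z + 1) / c) * w z x) (at x)"
proof -
  show "(w z has_real_derivative w1 z x) (at x)" "(w1 z has_real_derivative w2 z x) (at x)"
    unfolding w_def[abs_def] w1_def[abs_def] w2_def by (intro exp_Re_deriv V_derivs z)+
  have "(w2 z has_real_derivative exp (m3 z * x) * Re (of_real (z / c) * V2 z x + of_real (2 * z + k + h x) * V1 z x
           - of_real (z * (z + 1) / c) * V0 z x)) (at x)"
    unfolding w2_def[abs_def] by (intro exp_Re_deriv V_derivs z)
  moreover have "Re (of_real p * a + of_real q * b - of_real r * d) = p * Re a + q * Re b - r * Re d" for p q r a b d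
    by simp
  moreover have "E * (p * a + q * b - r * d) = p * (E * a) + q * (E * b) - r * (E * d)" for E p q r a b d :: real
    by (simp add: algebra_simps)
  ultimately show "(w2 z has_real_derivative (z / c) * w2 z x + (2 * z + k + h x) * w1 z x - (z * (z + 1) / c) * w z x) (at x)"
    unfolding w_def w1_def w2_def by (simp only:)
qed

text \<open>The operator \<open>(\<partial> - m1) (\<partial> - m2)\<close> undoes the two
  resolvents; its coefficients are the real symmetric functions of the roots, so it commutes with
  taking real parts.\<close>

lemma w_amp:
  assumes z: "z \<ge> 0"
  shows "w2 z x - growth_sum c k z * w1 z x + growth_prod c k z * w z x = exp (m3 z * x) * Re (amp z x)"
proof -
  have "V2 z x - of_real (growth_sum c k z) * V1 z x + of_real (growth_prod c k z) * V0 z x = amp z x"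
    unfolding growth_roots_sum[OF c k z, symmetric] growth_roots_prod[OF c k z, symmetric]
    by (simp add: V1_eq V2_def algebra_simps)
  from arg_cong[OF this, of Re]
  have e: "Re (V2 z x) - growth_sum c k z * Re (V1 z x) + growth_prod c k z * Re (V0 z x) = Re (amp z x)"
    by simp
  then show ?thesis unfolding w_def w1_def w2_def by (simp add: e[symmetric] algebra_simps)
qed

lemma w_top:
  assumes z: "z \<ge> 0"
  shows "(w z \<longlongrightarrow> 0) at_top" "(w1 z \<longlongrightarrow> 0) at_top" "(w2 z \<longlongrightarrow> 0) at_top"
proof -
  have "((\<lambda>x. exp (m3 z * x) * Re (V x)) \<longlongrightarrow> 0) at_top" if V: "bounded_continuous V" for V
  proof -
    obtain B where B: "\<And>x. norm (V x) \<le> B" using V by (auto simp: bounded_continuous_def)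
    show ?thesis
    proof (rule Lim_null_comparison)
      show "\<forall>\<^sub>F x in at_top. norm (exp (m3 z * x) * Re (V x)) \<le> exp (m3 z * x) * B"
        using order_trans[OF abs_Re_le_cmod B] by (intro always_eventually) (auto simp: abs_mult)
      have "filterlim (\<lambda>x. - m3 z * x) at_top at_top"
        by (rule filterlim_tendsto_pos_mult_at_top[OF tendsto_const _ filterlim_ident])
           (use decay_rate_neg[OF c k z] in simp)
      then have "filterlim (\<lambda>x. m3 z * x) at_bot at_top" by (simp add: filterlim_uminus_at_bot)
      then show "((\<lambda>x. exp (m3 z * x) * B) \<longlongrightarrow> 0) at_top"
        by (intro tendsto_mult_left_zero filterlim_compose[OF exp_at_bot])
    qed
  qed
  then show "(w z \<longlongrightarrow> 0) at_top" "(w1 z \<longlongrightarrow> 0) at_top" "(w2 z \<longlongrightarrow> 0) at_top"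
    unfolding w_def[abs_def] w1_def[abs_def] w2_def[abs_def] using V_bounded_continuous[OF z] by blast+
qed

lemma transmission_tendsto:
  assumes z: "z \<ge> 0" shows "((\<lambda>x. Re (amp z x)) \<longlongrightarrow> transmission z) at_bot"
proof -
  obtain l where "(amp z \<longlongrightarrow> l) at_bot"
    using volterra_solution_at_bot[OF h(1) h_le n_pos[OF z] amp[OF z]] by blast
  then have "((\<lambda>x. Re (amp z x)) \<longlongrightarrow> Re l) at_bot" by (rule tendsto_Re)
  moreover from tendsto_Lim[OF _ this] have "transmission z = Re l" by (simp add: transmission_def)
  ultimately show ?thesis by simp
qed

section \<open>Continuity in the parameter and the regime of large parameters\<close>

lemma parameter_limits:
  assumes z: "z0 \<ge> 0"
  shows "(m3 \<longlongrightarrow> m3 z0) (at z0 within {0..})" "(m2 \<longlongrightarrow> m2 z0) (at z0 within {0..})"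
    "(m1 \<longlongrightarrow> m1 z0) (at z0 within {0..})"
    "(n1 \<longlongrightarrow> n1 z0) (at z0 within {0..})" "(n2 \<longlongrightarrow> n2 z0) (at z0 within {0..})"
proof -
  show 3: "(m3 \<longlongrightarrow> m3 z0) (at z0 within {0..})" and 2: "(m2 \<longlongrightarrow> m2 z0) (at z0 within {0..})"
    and 1: "(m1 \<longlongrightarrow> m1 z0) (at z0 within {0..})"
    using continuous_decay_rate[OF c k] continuous_growth_roots[OF c k] z by (auto simp: continuous_on_def)
  show "(n1 \<longlongrightarrow> n1 z0) (at z0 within {0..})" "(n2 \<longlongrightarrow> n2 z0) (at z0 within {0..})"
    unfolding n1_def[abs_def] n2_def[abs_def] by (intro tendsto_intros 1 2 3)+
qed

lemma uniform_limits:
  assumes z: "z0 \<ge> 0"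
  defines "F \<equiv> at z0 within {0..}"
  shows "uniform_limit UNIV amp (amp z0) F"
    "uniform_limit UNIV V0 (V0 z0) F" "uniform_limit UNIV V1 (V1 z0) F" "uniform_limit UNIV V2 (V2 z0) F"
proof -
  have ev: "\<forall>\<^sub>F z in F. z \<ge> 0" by (simp add: F_def eventually_at_filter)
  note p = parameter_limits[OF z, folded F_def]
  show a: "uniform_limit UNIV amp (amp z0) F"
    by (rule volterra_solution_uniform_limit[OF h_le p(2) p(4) n_pos(1)[OF z] p(5) n_pos(2)[OF z] _ amp[OF z]])
       (use ev in eventually_elim, rule amp)
  have BC: "\<forall>\<^sub>F z in F. bounded_continuous (amp z)" using ev by eventually_elim (rule amp_facts)
  note op = volterra_op_uniform_limit[OF p(2) p(4) n_pos(1)[OF z] p(5) n_pos(2)[OF z] BC amp_facts(1)[OF z] a]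
  show 0: "uniform_limit UNIV V0 (V0 z0) F" and "uniform_limit UNIV V1 (V1 z0) F"
    using op(2,3) unfolding V0_def[abs_def] aux_def[abs_def] V1_def[abs_def] .
  have x: "uniform_limit UNIV aux (aux z0) F" using op(1) unfolding aux_def[abs_def] .
  have const: "uniform_limit UNIV (\<lambda>z (x::real). g z) (\<lambda>x. g z0) F" if "(g \<longlongrightarrow> g z0) F" for g :: "real \<Rightarrow> complex"
  proof (rule uniform_limitI)
    fix e :: real assume "e > 0"
    from tendstoD[OF that this] show "\<forall>\<^sub>F i in F. \<forall>x\<in>UNIV. dist (g i) (g z0) < e" by simp
  qed
  have bd: "bounded (range y)" if "bounded_continuous y" for y
    using that by (auto simp: bounded_continuous_def bounded_iff)
  show "uniform_limit UNIV V2 (V2 z0) F"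
    unfolding V2_def[abs_def]
    by (intro uniform_limit_intros const 0 x a p bd V_bounded_continuous bounded_continuous_const z tendsto_mult tendsto_add)
qed

lemma transmission_continuous: "continuous_on {0..} transmission"
  unfolding continuous_on_def
proof (intro ballI tendstoI)
  fix z0 e :: real assume "z0 \<in> {0..}" and e: "e > 0"
  then have z0: "z0 \<ge> 0" by simp
  have ev: "\<forall>\<^sub>F z in at z0 within {0..}. z \<ge> (0::real)" by (simp add: eventually_at_filter)
  have "\<forall>\<^sub>F z in at z0 within {0..}. \<forall>x\<in>UNIV. dist (amp z x) (amp z0 x) < e / 2"
    by (rule uniform_limitD[OF uniform_limits(1)[OF z0]]) (use e in simp)
  then show "\<forall>\<^sub>F z in at z0 within {0..}. dist (transmission z) (transmission z0) < e"
    using ev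
  proof eventually_elim
    case (elim z)
    have "((\<lambda>x. \<bar>Re (amp z x) - Re (amp z0 x)\<bar>) \<longlongrightarrow> \<bar>transmission z - transmission z0\<bar>) at_bot"
      by (intro tendsto_intros transmission_tendsto elim z0)
    moreover have "\<bar>Re (amp z x) - Re (amp z0 x)\<bar> \<le> e / 2" for x
      using order_trans[OF abs_Re_le_cmod, of "amp z x - amp z0 x" "e / 2"] elim(1)
      by (simp add: dist_norm less_imp_le)
    ultimately have "\<bar>transmission z - transmission z0\<bar> \<le> e / 2"
      by (intro tendsto_upperbound[where F=at_bot]) (auto intro!: always_eventually)
    then show ?case using e by (simp add: dist_real_def)
  qed
qed

lemma transmission_large: "\<exists>Z>0. \<forall>z\<ge>Z. transmission z > 0"
proof (intro exI conjI allI impI)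
  \<comment> \<open>The first three summands are the threshold for the growth rates; the last one
    makes \<open>pi * K' * (4 * c / z)\<close> at most 1/4, the smallness under which the amplitude
    stays near 1.\<close>
  let ?Z = "1 + 48 * c\<^sup>2 + 512 * c ^ 4 + 16 * pi * K' * c"
  have nn: "c\<^sup>2 \<ge> 0" "c ^ 4 \<ge> 0" "16 * pi * K' * c \<ge> 0" using c K'_nonneg by auto
  show "?Z > 0" using nn by linarith
  fix z assume z: "z \<ge> ?Z"
  then have z0: "z > 0" and z1: "z \<ge> 1 + 48 * c\<^sup>2 + 512 * c ^ 4" and z2: "z \<ge> 16 * pi * K' * c" using nn by linarith+
  have M: "(norm (m2 z) / Re (n2 z) + 1) / Re (n1 z) \<le> 4 * c / z"
    unfolding n1_def n2_def by (rule growth_rates_large[OF c k z1])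
  have "pi * K' * (4 * c / z) \<le> 1 / 4" using z0 z2 by (simp add: field_simps)
  from volterra_solution_near_one[OF h_le n_pos M this amp]
  have "norm (amp z x - 1) \<le> 1 / 2" for x using z0 by simp
  then have b: "Re (amp z x) \<ge> 1 / 2" for x
    using abs_Re_le_cmod[of "amp z x - 1"] by (smt (verit) field_sum_of_halves minus_complex.sel(1) one_complex.sel(1))
  have "1 / 2 \<le> transmission z"
    by (rule tendsto_lowerbound[OF transmission_tendsto]) (use z0 b in auto)
  then show "transmission z > 0" by simp
qed

end

section \<open>The regime of small parameters: Wronskian and Melnikov integral\<close>

context homoclinic_orbit
begin

text \<open>At \<open>z = 0\<close> both \<open>w'\<close> and \<open>\<psi>\<close> solve \<open>y'' = (k + h) y\<close> and vanish at \<open>+\<infinity>\<close>, so their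
  Wronskian is zero.\<close>

lemma w_0_eq: "\<exists>\<kappa>>0. \<forall>x. w 0 x = \<kappa> * \<phi> x \<and> w1 0 x = \<kappa> * \<psi> x \<and> w2 0 x = \<kappa> * \<alpha> x"
proof -
  have z: "(0::real) \<ge> 0" by simp
  have dw2': "(w2 0 has_real_derivative (k + h x) * w1 0 x) (at x)" for x using dw2[OF z, of x] by simp
  obtain X where X: "\<And>x. x \<ge> X \<Longrightarrow> \<psi> x < 0 \<and> \<alpha> x > 0"
    using near_top by (auto simp: eventually_at_top_linorder)
  have "((\<lambda>x. w2 0 x * \<psi> x - w1 0 x * \<alpha> x) has_real_derivative 0) (at x)" for x
    by (auto intro!: derivative_eq_intros dw2' dw1[OF z] d\<psi> d\<alpha> simp: algebra_simps)
  then have const: "w2 0 x * \<psi> x - w1 0 x * \<alpha> x = w2 0 y * \<psi> y - w1 0 y * \<alpha> y" for x y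
    by (rule DERIV_isconst_all[OF allI])
  have "((\<lambda>x. w2 0 x * \<psi> x - w1 0 x * \<alpha> x) \<longlongrightarrow> 0 * 0 - 0 * 0) at_top"
    by (intro tendsto_intros w_top z lim_top)
  moreover have "(\<lambda>x. w2 0 x * \<psi> x - w1 0 x * \<alpha> x) = (\<lambda>x. w2 0 0 * \<psi> 0 - w1 0 0 * \<alpha> 0)" using const by blast
  ultimately have "w2 0 0 * \<psi> 0 - w1 0 0 * \<alpha> 0 = 0"
    by (simp add: tendsto_const_iff)
  then have wr: "w2 0 x * \<psi> x - w1 0 x * \<alpha> x = 0" for x using const[of x 0] by simp
  \<comment> \<open>Matches the first derivatives at \<open>X\<close>, where \<open>\<psi>\<close>
    is nonzero; the vanishing Wronskian then matches the second ones.\<close>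
  define \<kappa> where "\<kappa> = w1 0 X / \<psi> X"
  have X1: "w1 0 X = \<kappa> * \<psi> X" using X[of X] by (simp add: \<kappa>_def)
  have X2: "w2 0 X = \<kappa> * \<alpha> X"
  proof -
    have "w2 0 X * \<psi> X = (\<kappa> * \<alpha> X) * \<psi> X" using wr[of X] X1 by simp
    then show ?thesis using X[of X] by simp
  qed
  have hb: "\<bar>k + h x\<bar> \<le> k + K" for x
  proof -
    have "\<bar>h x\<bar> \<le> K * 1"
      using h(2)[of x] by (rule order_trans) (intro mult_left_mono K_nonneg, use eta in simp)
    then show ?thesis using k by linarith
  qed
  have "(w1 0 x - \<kappa> * \<psi> x)\<^sup>2 + (w2 0 x - \<kappa> * \<alpha> x)\<^sup>2 = 0" for x
  proof (rule gronwall_zero[where x=x and N="\<lambda>x. (w1 0 x - \<kappa> * \<psi> x)\<^sup>2 + (w2 0 x - \<kappa> * \<alpha> x)\<^sup>2" and k="1 + (k + K)" and x0=X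
        and N'="\<lambda>x. 2 * (w1 0 x - \<kappa> * \<psi> x) * (w2 0 x - \<kappa> * \<alpha> x) + 2 * (w2 0 x - \<kappa> * \<alpha> x) * ((k + h x) * (w1 0 x - \<kappa> * \<psi> x))"])
    fix x
    let ?a = "w1 0 x - \<kappa> * \<psi> x" and ?b = "w2 0 x - \<kappa> * \<alpha> x"
    show "((\<lambda>x. (w1 0 x - \<kappa> * \<psi> x)\<^sup>2 + (w2 0 x - \<kappa> * \<alpha> x)\<^sup>2) has_real_derivative
        2 * ?a * ?b + 2 * ?b * ((k + h x) * ?a)) (at x)"
      by (auto intro!: derivative_eq_intros dw2' dw1[OF z] d\<psi> d\<alpha> simp: algebra_simps)
    have am: "2 * \<bar>a\<bar> * \<bar>b\<bar> \<le> a\<^sup>2 + b\<^sup>2" for a b :: real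
      using zero_le_power2[of "\<bar>a\<bar> - \<bar>b\<bar>"] by (simp add: power2_diff)
    have "2 * ?a * ?b + 2 * ?b * ((k + h x) * ?a) = (1 + (k + h x)) * (2 * ?a * ?b)" by algebra
    then have "\<bar>2 * ?a * ?b + 2 * ?b * ((k + h x) * ?a)\<bar> = \<bar>1 + (k + h x)\<bar> * (2 * \<bar>?a\<bar> * \<bar>?b\<bar>)"
      by (simp only: abs_mult abs_numeral)
    also have "\<dots> \<le> (1 + (k + K)) * (?a\<^sup>2 + ?b\<^sup>2)"
      using hb[of x] k K_nonneg by (intro mult_mono am) (linarith | simp)+
    finally show "\<bar>2 * ?a * ?b + 2 * ?b * ((k + h x) * ?a)\<bar> \<le> (1 + (k + K)) * (?a\<^sup>2 + ?b\<^sup>2)" .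
  qed (use X1 X2 in auto)
  then have e1: "w1 0 x = \<kappa> * \<psi> x" and e2: "w2 0 x = \<kappa> * \<alpha> x" for x
    by (simp_all add: sum_power2_eq_zero_iff)
  have "((\<lambda>x. w 0 x - \<kappa> * \<phi> x) has_real_derivative 0) (at x)" for x
    by (auto intro!: derivative_eq_intros dw[OF z] d\<phi> simp: e1)
  then have c0: "w 0 x - \<kappa> * \<phi> x = w 0 y - \<kappa> * \<phi> y" for x y
    by (rule DERIV_isconst_all[OF allI])
  have "((\<lambda>x. w 0 x - \<kappa> * \<phi> x) \<longlongrightarrow> 0 - \<kappa> * 0) at_top"
    by (intro tendsto_intros w_top z lim_top)
  moreover have "(\<lambda>x. w 0 x - \<kappa> * \<phi> x) = (\<lambda>x. w 0 0 - \<kappa> * \<phi> 0)" using c0 by blast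
  ultimately have "w 0 0 - \<kappa> * \<phi> 0 = 0"
    by (simp add: tendsto_const_iff)
  then have e0: "w 0 x = \<kappa> * \<phi> x" for x using c0[of x 0] by simp
  \<comment> \<open>The sign of \<open>\<kappa>\<close> comes from the normalization: far to the
    right \<open>w2 - growth_sum * w1\<close> has the sign of the amplitude, which tends to 1, and
    \<open>\<alpha> - growth_sum * \<psi>\<close> is positive.\<close>
  have "((\<lambda>x. Re (amp 0 x)) \<longlongrightarrow> Re 1) at_top" by (intro tendsto_Re amp_facts z)
  then have "\<forall>\<^sub>F x in at_top. Re (amp 0 x) > 0" by (rule order_tendstoD) simp
  then have "\<forall>\<^sub>F x in at_top. x \<ge> X \<and> Re (amp 0 x) > 0"
    using eventually_ge_at_top[of X] by eventually_elim simp
  then obtain x where x: "x \<ge> X" "Re (amp 0 x) > 0"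
    using eventually_happens'[OF trivial_limit_at_top_linorder] by blast
  have "growth_prod c k 0 = 0" by (simp add: growth_prod_def)
  then have "w2 0 x - growth_sum c k 0 * w1 0 x = exp (m3 0 * x) * Re (amp 0 x)"
    using w_amp[OF z, of x] by simp
  moreover have "w2 0 x - growth_sum c k 0 * w1 0 x = \<kappa> * (\<alpha> x - growth_sum c k 0 * \<psi> x)"
    unfolding e1 e2 by (simp add: right_diff_distrib)
  ultimately have "\<kappa> * (\<alpha> x - growth_sum c k 0 * \<psi> x) > 0" using x(2) by simp
  moreover have "growth_sum c k 0 * \<psi> x < 0"
    using growth_sum_prod(1)[OF c k z] X[OF x(1)] by (simp add: mult_pos_neg)
  then have "\<alpha> x - growth_sum c k 0 * \<psi> x > 0" using X[OF x(1)] by linarith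
  ultimately have "\<kappa> > 0" by (simp add: zero_less_mult_iff)
  then show ?thesis using e0 e1 e2 by blast
qed

text \<open>The limit is uniform only on right half-lines, with the linear weight forced by the
  moving exponent \<open>m3 z\<close>.\<close>

lemma near_0:
  assumes e: "e > 0"
  shows "\<forall>\<^sub>F z in at_right 0. \<forall>x\<ge>x0. \<bar>w z x - w 0 x\<bar> \<le> e * (1 + \<bar>x\<bar>) \<and> \<bar>w1 z x - w1 0 x\<bar> \<le> e * (1 + \<bar>x\<bar>)
     \<and> \<bar>w2 z x - w2 0 x\<bar> \<le> e * (1 + \<bar>x\<bar>)"
proof -
  let ?F = "at (0::real) within {0..}"
  have z: "(0::real) \<ge> 0" by simp
  have ev: "\<forall>\<^sub>F z in ?F. z \<ge> 0" by (simp add: eventually_at_filter)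
  have neg: "\<forall>\<^sub>F z in ?F. m3 z \<le> 0"
    using ev by eventually_elim (rule less_imp_le[OF decay_rate_neg[OF c k]])
  have neg0: "m3 0 \<le> 0" by (rule less_imp_le[OF decay_rate_neg[OF c k z]])
  have *: "\<forall>\<^sub>F z in ?F. \<forall>x\<ge>x0. \<bar>exp (m3 z * x) * Re (V z x) - exp (m3 0 * x) * Re (V 0 x)\<bar> \<le> e * (1 + \<bar>x\<bar>)"
    if "uniform_limit UNIV V (V 0) ?F" and bc: "bounded_continuous (V 0)" for V :: "real \<Rightarrow> real \<Rightarrow> complex"
  proof -
    obtain B where "\<And>x. norm (V 0 x) \<le> B" using bc by (auto simp: bounded_continuous_def)
    from weighted_exp_limit[OF parameter_limits(1)[OF z] neg neg0 that(1) this e] show ?thesis .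
  qed
  have "\<forall>\<^sub>F z in ?F. \<forall>x\<ge>x0. \<bar>w z x - w 0 x\<bar> \<le> e * (1 + \<bar>x\<bar>) \<and> \<bar>w1 z x - w1 0 x\<bar> \<le> e * (1 + \<bar>x\<bar>)
     \<and> \<bar>w2 z x - w2 0 x\<bar> \<le> e * (1 + \<bar>x\<bar>)"
    using *[OF uniform_limits(2)[OF z] V_bounded_continuous(2)[OF z]]
      *[OF uniform_limits(3)[OF z] V_bounded_continuous(3)[OF z]]
      *[OF uniform_limits(4)[OF z] V_bounded_continuous(4)[OF z]]
    by eventually_elim (simp add: w_def w1_def w2_def)
  then show ?thesis by (rule filter_leD[OF at_le, rotated]) auto
qed

text \<open>Pairs \<open>w'\<close> with \<open>\<psi>\<close>, which solves the equation for
  \<open>w'\<close> at \<open>z = 0\<close>. For \<open>z = 0\<close> it would be constant, so its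
  derivative carries a factor \<open>z\<close> and the quotient by \<open>z\<close> has a
  limit.\<close>

definition "wronskian z x = c * (\<psi> x * w2 z x - \<alpha> x * w1 z x)"

lemma wronskian_deriv:
  assumes z: "z \<ge> 0"
  shows "(wronskian z has_real_derivative z * (\<psi> x * (w2 z x + 2 * c * w1 z x - (z + 1) * w z x))) (at x)"
proof -
  have "(wronskian z has_real_derivative c * (\<alpha> x * w2 z x + \<psi> x * ((z / c) * w2 z x + (2 * z + k + h x) * w1 z x - (z * (z + 1) / c) * w z x)
      - ((k + h x) * \<psi> x * w1 z x + \<alpha> x * w2 z x))) (at x)"
    unfolding wronskian_def[abs_def]
    by (auto intro!: derivative_eq_intros dw2[OF z] dw1[OF z] d\<psi> d\<alpha>)
  then show ?thesis
    by (rule DERIV_cong) (use c in \<open>simp add: field_simps\<close>)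
qed

lemma wronskian_top: assumes z: "z \<ge> 0" shows "(wronskian z \<longlongrightarrow> 0) at_top"
proof -
  have "(wronskian z \<longlongrightarrow> c * (0 * 0 - 0 * 0)) at_top"
    unfolding wronskian_def[abs_def] by (intro tendsto_intros lim_top w_top z)
  then show ?thesis by simp
qed

lemma \<phi>_le: "\<phi> x \<le> K' * pi"
proof -
  have "norm (\<phi> x - 0) \<le> 1 * (K' * (pi / 2 - arctan x))"
  proof (rule tail_bound[OF _ lim_top(1) arctan_tail_deriv])
    show "(\<phi> has_vector_derivative \<psi> t) (at t)" for t
      using d\<phi> by (simp add: has_real_derivative_iff_has_vector_derivative)
    have "((\<lambda>x. 1 * (K' * (pi / 2 - arctan x))) \<longlongrightarrow> 1 * (K' * (pi / 2 - pi / 2))) at_top"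
      by (intro tendsto_intros tendsto_arctan_at_top)
    then show "((\<lambda>x. 1 * (K' * (pi / 2 - arctan x))) \<longlongrightarrow> 0) at_top" by simp
    show "norm (\<psi> t) \<le> - (- (1 * (K' / (1 + t\<^sup>2))))" for t
      using decay_quadratic[OF \<psi>_le] by simp
  qed
  also have "\<dots> \<le> K' * pi" using mult_left_mono[OF _ K'_nonneg, of "pi / 2 - arctan x" pi] arctan_lbound[of x] by simp
  finally show ?thesis by simp
qed

text \<open>Melnikov's computation: \<open>\<integral>\<^sub>x \<psi> (\<alpha> + 2 c \<psi> - \<phi>)\<close> over \<open>[x, \<infinity>)\<close> equals
  \<open>- (\<psi>\<^sup>2 - \<phi>\<^sup>2) / 2 - 2 c Y(x)\<close>.\<close>

lemma wronskian_limit: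
  assumes Y: "\<And>x. (Y has_real_derivative (\<psi> x)\<^sup>2) (at x)" "(Y \<longlongrightarrow> 0) at_top"
    and kap: "\<kappa> > 0" "\<And>x. w 0 x = \<kappa> * \<phi> x" "\<And>x. w1 0 x = \<kappa> * \<psi> x" "\<And>x. w2 0 x = \<kappa> * \<alpha> x"
  shows "((\<lambda>z. wronskian z x0 / z) \<longlongrightarrow> \<kappa> * ((\<psi> x0)\<^sup>2 / 2 - (\<phi> x0)\<^sup>2 / 2 + 2 * c * Y x0)) (at_right 0)"
proof (rule tendstoI)
  fix e :: real assume e: "e > 0"
  define \<Xi> where "\<Xi> x = \<kappa> * ((\<psi> x)\<^sup>2 / 2 - (\<phi> x)\<^sup>2 / 2 + 2 * c * Y x)" for x
  have d\<Xi>: "(\<Xi> has_real_derivative \<psi> x * (w2 0 x + 2 * c * w1 0 x - w 0 x)) (at x)" for x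
    unfolding \<Xi>_def[abs_def]
    by (auto intro!: derivative_eq_intros d\<psi> d\<phi> Y simp: kap algebra_simps power2_eq_square)
  have "(\<Xi> \<longlongrightarrow> \<kappa> * (0\<^sup>2 / 2 - 0\<^sup>2 / 2 + 2 * c * 0)) at_top"
    unfolding \<Xi>_def[abs_def] by (intro tendsto_intros lim_top Y) auto
  then have \<Xi>0: "(\<Xi> \<longlongrightarrow> 0) at_top" by simp
  \<comment> \<open>In the first factor, 3 is 1 for the error of \<open>w2\<close> plus 2 for that
    of \<open>(z + 1) * w\<close> with \<open>z < 1\<close>; \<open>2 * c\<close> belongs to
    \<open>w1\<close>, and \<open>\<kappa> * (K' * pi)\<close> bounds \<open>w 0\<close> in the
    leftover term \<open>z * w 0\<close>.\<close>
  define C where "C = (3 + 2 * c + \<kappa> * (K' * pi)) * (2 * K * (1 + 8 / \<eta>\<^sup>2)\<^sup>2)"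
  have C0: "C \<ge> 0" unfolding C_def using c kap K_nonneg K'_nonneg by (intro mult_nonneg_nonneg add_nonneg_nonneg) auto
  define \<epsilon> where "\<epsilon> = e / (2 * (C * pi + 1))"
  have \<epsilon>: "\<epsilon> > 0" using e C0 by (simp add: \<epsilon>_def add_nonneg_pos)
  have "0 < min 1 \<epsilon>" using \<epsilon> by simp
  from eventually_at_right_real[OF this] have "\<forall>\<^sub>F z in at_right 0. z < min 1 \<epsilon>"
    by eventually_elim simp
  moreover have "\<forall>\<^sub>F z in at_right 0. z > (0::real)" by (simp add: eventually_at_filter)
  ultimately show "\<forall>\<^sub>F z in at_right 0. dist (wronskian z x0 / z) (\<kappa> * ((\<psi> x0)\<^sup>2 / 2 - (\<phi> x0)\<^sup>2 / 2 + 2 * c * Y x0)) < e"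
    using near_0[OF \<epsilon>, of x0]
  proof eventually_elim
    case (elim z)
    then have z: "z \<ge> 0" "z > 0" "z < 1" "z < \<epsilon>" by auto
    let ?F = "\<lambda>x. \<psi> x * (w2 z x + 2 * c * w1 z x - (z + 1) * w z x) - \<psi> x * (w2 0 x + 2 * c * w1 0 x - w 0 x)"
    have "norm ((\<lambda>x. wronskian z x / z - \<Xi> x) x0 - (0 / z - 0)) \<le> (\<epsilon> * (C * (pi / 2 - arctan x0)))"
    proof (rule tail_bound[where Y="\<lambda>x. wronskian z x / z - \<Xi> x" and F="?F", OF _ _ arctan_tail_deriv])
      show "((\<lambda>x. wronskian z x / z - \<Xi> x) has_vector_derivative ?F t) (at t)" for t
      proof -
        have "((\<lambda>x. wronskian z x / z) has_real_derivative z * (\<psi> t * (w2 z t + 2 * c * w1 z t - (z + 1) * w z t)) / z) (at t)"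
          by (rule DERIV_cdivide[OF wronskian_deriv[OF z(1)]])
        then have "((\<lambda>x. wronskian z x / z) has_real_derivative \<psi> t * (w2 z t + 2 * c * w1 z t - (z + 1) * w z t)) (at t)"
          using z by simp
        from DERIV_diff[OF this d\<Xi>] show ?thesis
          by (simp add: has_real_derivative_iff_has_vector_derivative)
      qed
      show "((\<lambda>x. wronskian z x / z - \<Xi> x) \<longlongrightarrow> 0 / z - 0) at_top"
        using z by (intro tendsto_intros wronskian_top \<Xi>0) auto
      have "((\<lambda>x. \<epsilon> * (C * (pi / 2 - arctan x))) \<longlongrightarrow> \<epsilon> * (C * (pi / 2 - pi / 2))) at_top"
        by (intro tendsto_intros tendsto_arctan_at_top)
      then show "((\<lambda>x. \<epsilon> * (C * (pi / 2 - arctan x))) \<longlongrightarrow> 0) at_top" by simp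
      fix t assume t: "t \<ge> x0"
      let ?s = "1 + \<bar>t\<bar>"
      let ?d0 = "w z t - w 0 t" and ?d1 = "w1 z t - w1 0 t" and ?d2 = "w2 z t - w2 0 t"
      have b: "\<bar>?d0\<bar> \<le> \<epsilon> * ?s" "\<bar>?d1\<bar> \<le> \<epsilon> * ?s" "\<bar>?d2\<bar> \<le> \<epsilon> * ?s" using elim(3) t by auto
      have "\<bar>w 0 t\<bar> \<le> \<kappa> * (K' * pi)"
        using kap \<phi>_pos[of t] \<phi>_le[of t] by (simp add: abs_mult)
      then have b0: "z * \<bar>w 0 t\<bar> \<le> \<epsilon> * (\<kappa> * (K' * pi)) * 1"
        using z \<epsilon> by (simp add: mult_mono)
      also have "\<dots> \<le> \<epsilon> * (\<kappa> * (K' * pi)) * ?s"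
        using \<epsilon> kap K'_nonneg by (intro mult_left_mono) auto
      finally have b3: "\<bar>z * w 0 t\<bar> \<le> \<epsilon> * (\<kappa> * (K' * pi)) * ?s" using z by (simp add: abs_mult)
      have b4: "\<bar>2 * c * ?d1\<bar> \<le> 2 * c * (\<epsilon> * ?s)" using b(2) c by (simp add: abs_mult)
      have b5: "\<bar>(z + 1) * ?d0\<bar> \<le> 2 * (\<epsilon> * ?s)"
        unfolding abs_mult using z b(1) by (intro mult_mono) auto
      have "?F t = \<psi> t * (?d2 + 2 * c * ?d1 - (z + 1) * ?d0 - z * w 0 t)" by (simp add: algebra_simps)
      moreover have "\<bar>?d2 + 2 * c * ?d1 - (z + 1) * ?d0 - z * w 0 t\<bar>
          \<le> \<epsilon> * ?s + 2 * c * (\<epsilon> * ?s) + 2 * (\<epsilon> * ?s) + \<epsilon> * (\<kappa> * (K' * pi)) * ?s"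
        using b(3) b3 b4 b5 by linarith
      moreover have "\<epsilon> * ?s + 2 * c * (\<epsilon> * ?s) + 2 * (\<epsilon> * ?s) + \<epsilon> * (\<kappa> * (K' * pi)) * ?s
          = \<epsilon> * (3 + 2 * c + \<kappa> * (K' * pi)) * ?s" by algebra
      ultimately have "norm (?F t) \<le> \<bar>\<psi> t\<bar> * (\<epsilon> * (3 + 2 * c + \<kappa> * (K' * pi)) * ?s)"
        by (simp only: real_norm_def abs_mult) (rule mult_left_mono, simp_all)
      also have "\<dots> = \<epsilon> * (3 + 2 * c + \<kappa> * (K' * pi)) * (\<bar>\<psi> t\<bar> * ?s)" by (simp only: mult_ac)
      also have "\<dots> \<le> \<epsilon> * (3 + 2 * c + \<kappa> * (K' * pi)) * (2 * K * (1 + 8 / \<eta>\<^sup>2)\<^sup>2 / (1 + t\<^sup>2))"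
        using \<epsilon> c kap K'_nonneg by (intro mult_left_mono \<psi>_weighted mult_nonneg_nonneg add_nonneg_nonneg) auto
      also have "\<dots> = - (- (\<epsilon> * (C / (1 + t\<^sup>2))))" by (simp add: C_def)
      finally show "norm (?F t) \<le> - (- (\<epsilon> * (C / (1 + t\<^sup>2))))" .
    qed
    also have "\<dots> \<le> \<epsilon> * (C * pi)"
      using \<epsilon> C0 arctan_lbound[of x0] by (intro mult_left_mono) auto
    also have "\<dots> \<le> \<epsilon> * (C * pi + 1)" using \<epsilon> by simp
    also have "\<dots> = e / 2"
    proof -
      have "e / (2 * q) * q = e / 2" if "q > 0" for q using that by simp
      moreover have "C * pi + 1 > 0" using C0 by (simp add: add_nonneg_pos)
      ultimately show ?thesis unfolding \<epsilon>_def by blast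
    qed
    finally show ?case using e by (simp add: dist_real_def \<Xi>_def)
  qed
qed

text \<open>The Melnikov limit makes the Wronskian negative at one point far to the left. A negative
  Wronskian means that \<open>w1 / \<psi>\<close> decreases in \<open>x\<close>, so going left
  \<open>w1\<close> stays positive and \<open>w\<close> stays below its value at that point. A
  positive transmission would instead keep \<open>w2\<close> above 1 near
  \<open>-\<infinity>\<close> and thereby push \<open>w1\<close> below 0.\<close>

lemma transmission_nonpos: "\<forall>\<^sub>F z in at_right 0. transmission z \<le> 0"
proof -
  obtain \<kappa> where kap: "\<kappa> > 0" "\<And>x. w 0 x = \<kappa> * \<phi> x" "\<And>x. w1 0 x = \<kappa> * \<psi> x" "\<And>x. w2 0 x = \<kappa> * \<alpha> x"
    using w_0_eq by blast
  have c\<psi>: "continuous_on UNIV \<psi>" using d\<psi> by (meson DERIV_isCont continuous_at_imp_continuous_on)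
  have "\<exists>Y. (\<forall>x. (Y has_vector_derivative (\<psi> x)\<^sup>2) (at x)) \<and> (Y \<longlongrightarrow> 0) at_top \<and> (\<forall>x. norm (Y x) \<le> K * (K' * (pi / 2 - arctan x)))"
  proof (rule tail_primitive[OF _ arctan_tail_deriv])
    show "continuous_on UNIV (\<lambda>x. (\<psi> x)\<^sup>2)" by (intro continuous_intros c\<psi>)
    show "norm ((\<psi> x)\<^sup>2) \<le> - (- (K * (K' / (1 + x\<^sup>2))))" for x
    proof -
      have "\<bar>\<psi> x\<bar> \<le> K * 1"
        by (rule order_trans[OF \<psi>_le]) (intro mult_left_mono K_nonneg, use eta in simp)
      then have "\<bar>\<psi> x\<bar> * \<bar>\<psi> x\<bar> \<le> K * (K' / (1 + x\<^sup>2))"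
        using decay_quadratic[OF \<psi>_le, of x] K_nonneg by (intro mult_mono) auto
      then show ?thesis by (simp add: power2_eq_square)
    qed
    have "((\<lambda>x. K * (K' * (pi / 2 - arctan x))) \<longlongrightarrow> K * (K' * (pi / 2 - pi / 2))) at_top"
      by (intro tendsto_intros tendsto_arctan_at_top)
    then show "((\<lambda>x. K * (K' * (pi / 2 - arctan x))) \<longlongrightarrow> 0) at_top" by simp
  qed
  then obtain Y where Y: "\<And>x. (Y has_real_derivative (\<psi> x)\<^sup>2) (at x)" "(Y \<longlongrightarrow> 0) at_top"
    by (auto simp: has_real_derivative_iff_has_vector_derivative)
  obtain xs where xs: "\<And>x. x \<le> xs \<Longrightarrow> \<psi> x > 0 \<and> \<alpha> x > 0 \<and> sqrt k / 2 * \<phi> x \<le> \<psi> x"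
    using near_bot by (auto simp: eventually_at_bot_linorder)
  have Ymono: "Y x \<le> Y y" if "x \<le> y" for x y
    by (rule DERIV_nonneg_imp_nondecreasing[OF that]) (use Y(1) zero_le_power2 in blast)
  have "Y xs \<le> 0"
    by (rule tendsto_lowerbound[OF Y(2) eventually_mono[OF eventually_ge_at_top[of xs]]]) (rule Ymono, simp_all)
  moreover have "Y (xs - 1) < Y xs"
    by (rule DERIV_pos_imp_increasing) (use Y(1) xs in \<open>auto intro!: exI less_imp_neq[symmetric]\<close>)
  ultimately have i0: "Y (xs - 1) < 0" by linarith
  \<comment> \<open>The coefficient \<open>3 / 2\<close> is \<open>2 - 1 / 2\<close>: the Melnikov
    value contains \<open>- \<phi>\<^sup>2 / 2\<close>, and the correction in \<open>N\<close> below
    contributes \<open>2 \<phi>\<^sup>2\<close>. Moving left makes these squares small, while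
    \<open>Y\<close> stays below the negative number \<open>Y (xs - 1)\<close>.\<close>
  have "((\<lambda>x. (\<psi> x)\<^sup>2 / 2 + 3 / 2 * (\<phi> x)\<^sup>2) \<longlongrightarrow> 0\<^sup>2 / 2 + 3 / 2 * 0\<^sup>2) at_bot"
    by (intro tendsto_intros lim_bot) auto
  then have "\<forall>\<^sub>F x in at_bot. (\<psi> x)\<^sup>2 / 2 + 3 / 2 * (\<phi> x)\<^sup>2 < - (2 * c * Y (xs - 1))"
    by (rule order_tendstoD) (use i0 c in \<open>simp add: mult_pos_neg\<close>)
  then have "\<forall>\<^sub>F x in at_bot. x \<le> xs - 1 \<and> (\<psi> x)\<^sup>2 / 2 + 3 / 2 * (\<phi> x)\<^sup>2 < - (2 * c * Y (xs - 1))"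
    using eventually_le_at_bot[of "xs - 1"] by eventually_elim simp
  then obtain x0 where x0: "x0 \<le> xs - 1" "(\<psi> x0)\<^sup>2 / 2 + 3 / 2 * (\<phi> x0)\<^sup>2 < - (2 * c * Y (xs - 1))"
    using eventually_happens'[OF trivial_limit_at_bot_linorder] by blast
  have near: "\<psi> x > 0" "\<alpha> x > 0" "sqrt k / 2 * \<phi> x \<le> \<psi> x" if "x \<le> x0" for x
    using xs[of x] x0 that by auto
  have lw: "((\<lambda>z. w z x0) \<longlongrightarrow> \<kappa> * \<phi> x0) (at_right 0)" "((\<lambda>z. w1 z x0) \<longlongrightarrow> \<kappa> * \<psi> x0) (at_right 0)"
  proof -
    have lt: "\<bar>d\<bar> < e" if "\<bar>d\<bar> \<le> e / (2 * (1 + \<bar>x0\<bar>)) * (1 + \<bar>x0\<bar>)" "e > 0" for d e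
    proof -
      have "e / (2 * q) * q = e / 2" if "q > 0" for q using that by simp
      from this[of "1 + \<bar>x0\<bar>"] have half: "e / (2 * (1 + \<bar>x0\<bar>)) * (1 + \<bar>x0\<bar>) = e / 2" by linarith
      show ?thesis using that(1)[unfolded half] that(2) by linarith
    qed
    have ep: "e / (2 * (1 + \<bar>x0\<bar>)) > 0" if "e > 0" for e using that by simp
    show "((\<lambda>z. w z x0) \<longlongrightarrow> \<kappa> * \<phi> x0) (at_right 0)"
    proof (rule tendstoI)
      fix e :: real assume e: "e > 0"
      show "\<forall>\<^sub>F z in at_right 0. dist (w z x0) (\<kappa> * \<phi> x0) < e"
        using near_0[OF ep[OF e], of x0]
        by eventually_elim (simp add: dist_real_def flip: kap, intro lt e, simp)
    qed
    show "((\<lambda>z. w1 z x0) \<longlongrightarrow> \<kappa> * \<psi> x0) (at_right 0)"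
    proof (rule tendstoI)
      fix e :: real assume e: "e > 0"
      show "\<forall>\<^sub>F z in at_right 0. dist (w1 z x0) (\<kappa> * \<psi> x0) < e"
        using near_0[OF ep[OF e], of x0]
        by eventually_elim (simp add: dist_real_def flip: kap, intro lt e, simp)
    qed
  qed
  have "((\<lambda>z. wronskian z x0 / z + 2 * (1 + z) * w z x0 * \<phi> x0) \<longlongrightarrow>
      \<kappa> * ((\<psi> x0)\<^sup>2 / 2 - (\<phi> x0)\<^sup>2 / 2 + 2 * c * Y x0) + 2 * (1 + 0) * (\<kappa> * \<phi> x0) * \<phi> x0) (at_right 0)"
    by (intro tendsto_intros wronskian_limit Y kap lw)
  moreover have "\<kappa> * ((\<psi> x0)\<^sup>2 / 2 - (\<phi> x0)\<^sup>2 / 2 + 2 * c * Y x0) + 2 * (1 + 0) * (\<kappa> * \<phi> x0) * \<phi> x0 < 0"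
  proof -
    have "2 * c * Y x0 \<le> 2 * c * Y (xs - 1)" using c Ymono[OF x0(1)] by simp
    then have "(\<psi> x0)\<^sup>2 / 2 + 3 / 2 * (\<phi> x0)\<^sup>2 + 2 * c * Y x0 < 0" using x0(2) by linarith
    then have "\<kappa> * ((\<psi> x0)\<^sup>2 / 2 + 3 / 2 * (\<phi> x0)\<^sup>2 + 2 * c * Y x0) < 0" using kap by (simp add: mult_pos_neg)
    then show ?thesis by (simp add: algebra_simps power2_eq_square)
  qed
  ultimately have ev1: "\<forall>\<^sub>F z in at_right 0. wronskian z x0 / z + 2 * (1 + z) * w z x0 * \<phi> x0 < 0"
    by (rule order_tendstoD)
  have ev2: "\<forall>\<^sub>F z in at_right 0. w z x0 > 0" "\<forall>\<^sub>F z in at_right 0. w1 z x0 > 0"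
    using order_tendstoD(1)[OF lw(1), of 0] order_tendstoD(1)[OF lw(2), of 0] kap \<phi>_pos[of x0] near(1)[of x0] by auto
  \<comment> \<open>Below this threshold \<open>2 (z / c) \<le> sqrt k / 2\<close>, hence
    \<open>2 (z / c) \<phi> \<le> \<psi>\<close> to the left of \<open>x0\<close>.\<close>
  have "0 < c * sqrt k / 4" using c k by simp
  from eventually_at_right_real[OF this] have ev3: "\<forall>\<^sub>F z in at_right 0. z < c * sqrt k / 4"
    by eventually_elim simp
  have "\<forall>\<^sub>F z in at_right 0. z > (0::real)" by (simp add: eventually_at_filter)
  then show ?thesis using ev1 ev2 ev3
  proof eventually_elim
    case (elim z)
    then have z: "z \<ge> 0" "z > 0" by auto
    define \<epsilon> where "\<epsilon> = w z x0"
    have \<epsilon>: "\<epsilon> > 0" using elim by (simp add: \<epsilon>_def)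
    \<comment> \<open>The term with \<open>- w\<close> spoils the monotonicity of the Wronskian;
      while \<open>w \<le> \<epsilon>\<close>, a multiple of \<open>\<phi>\<close> repairs it. Of
      the factor 2, one half turns \<open>- w\<close> into \<open>\<epsilon> - w\<close>, and the
      other pays for the term that the exponential factor below creates.\<close>
    define N where "N x = wronskian z x + 2 * z * (1 + z) * \<epsilon> * \<phi> x" for x
    have "N x0 = z * (wronskian z x0 / z + 2 * (1 + z) * w z x0 * \<phi> x0)"
      using z by (simp add: N_def \<epsilon>_def field_simps)
    then have N0: "N x0 < 0" using elim(2) z by (simp add: mult_pos_neg)
    have cont: "continuous_on S (w1 z)" for S
      using dw1[OF z(1)] by (meson DERIV_isCont continuous_at_imp_continuous_on)
    have w1pos: "w1 z xb > 0" if xb: "xb \<le> x0" for xb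
    proof (rule ccontr)
      assume nb: "\<not> w1 z xb > 0"
      \<comment> \<open>Its maximum \<open>x1\<close> is the last point before \<open>x0\<close> at
        which \<open>w1\<close> is not positive; all sign conditions hold between \<open>x1\<close>
        and \<open>x0\<close>.\<close>
      let ?S = "{x \<in> {xb..x0}. w1 z x \<le> 0}"
      have "closed {x. w1 z x \<le> 0}" by (intro closed_Collect_le cont continuous_on_const)
      then have "compact ({xb..x0} \<inter> {x. w1 z x \<le> 0})" by (intro compact_Int_closed compact_Icc)
      moreover have "?S = {xb..x0} \<inter> {x. w1 z x \<le> 0}" by auto
      ultimately have "compact ?S" by simp
      moreover have "?S \<noteq> {}" using nb xb by auto
      ultimately obtain x1 where x1: "x1 \<in> ?S" "\<And>x. x \<in> ?S \<Longrightarrow> x \<le> x1"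
        using continuous_attains_sup[of ?S "\<lambda>x. x"] by auto
      have lt: "x1 < x0" using x1(1) elim(4) by (cases "x1 = x0") auto
      have pos: "w1 z x > 0" if "x1 < x" "x \<le> x0" for x
      proof (rule ccontr)
        assume "\<not> w1 z x > 0"
        then have "x \<in> ?S" using x1(1) that by simp
        from x1(2)[OF this] that show False by simp
      qed
      have wle: "w z x \<le> \<epsilon>" if "x1 < x" "x \<le> x0" for x
        unfolding \<epsilon>_def
      proof (rule DERIV_nonneg_imp_nondecreasing[OF that(2)])
        fix y assume "x \<le> y" "y \<le> x0"
        then show "\<exists>D. (w z has_real_derivative D) (at y) \<and> 0 \<le> D"
          using dw[OF z(1), of y] pos[of y] that by (intro exI[of _ "w1 z y"]) simp
      qed
      have Nneg: "N y < 0" if y: "x1 < y" "y \<le> x0" for y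
      proof -
        \<comment> \<open>The exponential factor removes \<open>z * \<psi> * w2\<close>, which
          equals \<open>z / c\<close> times the Wronskian plus the favourable term
          \<open>z * \<alpha> * w1\<close>.\<close>
        have "N y * exp (- (z / c) * y) \<le> N x0 * exp (- (z / c) * x0)"
        proof (rule DERIV_nonneg_imp_nondecreasing[OF y(2)])
          fix x assume "y \<le> x" and x0': "x \<le> x0"
          then have x: "x1 < x" using y by simp
          let ?N' = "z * (\<psi> x * (w2 z x + 2 * c * w1 z x - (z + 1) * w z x)) + 2 * z * (1 + z) * \<epsilon> * \<psi> x"
          have dN: "(N has_real_derivative ?N') (at x)"
            unfolding N_def[abs_def]
            by (intro DERIV_add wronskian_deriv[OF z(1)] DERIV_cmult d\<phi>)
          have "((\<lambda>x. exp (- (z / c) * x)) has_real_derivative exp (- (z / c) * x) * - (z / c)) (at x)"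
            by (rule DERIV_fun_exp[OF DERIV_cmult_Id])
          note dprod = DERIV_mult[OF dN this]
          have prod: "D * E + E * - t * M = (D - t * M) * E" for D E t M :: real
            by (simp add: algebra_simps)
          from dprod
          have "((\<lambda>x. N x * exp (- (z / c) * x)) has_real_derivative
              (?N' - (z / c) * N x) * exp (- (z / c) * x)) (at x)"
            by (rule DERIV_cong) (rule prod)
          moreover have "(?N' - (z / c) * N x) * exp (- (z / c) * x) \<ge> 0"
          proof -
            have "z * (p * (a + 2 * c * b - (z + 1) * d)) + 2 * z * (1 + z) * e * p
                  - t * (c * (p * a - q * b) + 2 * z * (1 + z) * e * f)
                = z * q * b + 2 * c * z * p * b + z * (1 + z) * (p * (e - d)) + z * (1 + z) * e * (p - 2 * t * f)"
              if "t * c = z" for t p q a b d e f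
              unfolding that[symmetric] by (simp add: algebra_simps)
            from this[of "z / c"]
            have e: "?N' - (z / c) * N x = z * \<alpha> x * w1 z x + 2 * c * z * \<psi> x * w1 z x
                + z * (1 + z) * (\<psi> x * (\<epsilon> - w z x)) + z * (1 + z) * \<epsilon> * (\<psi> x - 2 * (z / c) * \<phi> x)"
              using c unfolding N_def wronskian_def by simp
            have "2 * (z / c) \<le> sqrt k / 2" using elim(5) c by (simp add: field_simps)
            then have "2 * (z / c) * \<phi> x \<le> sqrt k / 2 * \<phi> x" using \<phi>_pos[of x] by (intro mult_right_mono) auto
            then have "\<psi> x - 2 * (z / c) * \<phi> x \<ge> 0" using near(3)[OF x0'] by linarith
            then have "z * (1 + z) * \<epsilon> * (\<psi> x - 2 * (z / c) * \<phi> x) \<ge> 0" using z \<epsilon> by simp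
            moreover have "z * (1 + z) * (\<psi> x * (\<epsilon> - w z x)) \<ge> 0"
              using z near(1)[OF x0'] wle[OF x x0'] by simp
            moreover have "z * \<alpha> x * w1 z x \<ge> 0" "2 * c * z * \<psi> x * w1 z x \<ge> 0"
              using z c near(1,2)[OF x0'] pos[OF x x0'] by simp_all
            ultimately show ?thesis unfolding e by simp
          qed
          ultimately show "\<exists>D. ((\<lambda>x. N x * exp (- (z / c) * x)) has_real_derivative D) (at x) \<and> 0 \<le> D" by blast
        qed
        also have "\<dots> < 0" using N0 by (simp add: mult_neg_pos)
        finally show ?thesis by (simp add: mult_less_0_iff)
      qed
      \<comment> \<open>\<open>N < 0\<close> and the nonnegative correction make the Wronskian
        nonpositive, and the Wronskian is \<open>c\<close> times the numerator of the derivative of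
        \<open>w1 / \<psi>\<close>.\<close>
      have "w1 z x0 / \<psi> x0 \<le> w1 z x1 / \<psi> x1"
      proof (rule DERIV_nonpos_imp_decreasing_open[OF less_imp_le[OF lt]])
        fix x assume x: "x1 < x" "x < x0"
        have px: "\<psi> x > 0" using near(1)[of x] x by simp
        have "((\<lambda>x. w1 z x / \<psi> x) has_real_derivative (w2 z x * \<psi> x - w1 z x * \<alpha> x) / (\<psi> x * \<psi> x)) (at x)"
          using px by (intro DERIV_divide dw1[OF z(1)] d\<psi>) simp
        moreover have "2 * z * (1 + z) * \<epsilon> * \<phi> x \<ge> 0"
          using \<epsilon> z \<phi>_pos[of x] by (intro mult_nonneg_nonneg) auto
        then have "wronskian z x \<le> 0" using Nneg[of x] x unfolding N_def by linarith
        then have "w2 z x * \<psi> x - w1 z x * \<alpha> x \<le> 0"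
          using c by (simp add: wronskian_def mult_le_0_iff mult.commute)
        then have "(w2 z x * \<psi> x - w1 z x * \<alpha> x) / (\<psi> x * \<psi> x) \<le> 0"
          using px by (intro divide_nonpos_pos) auto
        ultimately show "\<exists>y. ((\<lambda>x. w1 z x / \<psi> x) has_real_derivative y) (at x) \<and> y \<le> 0" by blast
      next
        show "continuous_on {x1..x0} (\<lambda>x. w1 z x / \<psi> x)"
        proof (intro continuous_on_divide cont continuous_on_subset[OF c\<psi>] subset_UNIV ballI)
          fix x assume "x \<in> {x1..x0}"
          then show "\<psi> x \<noteq> 0" using near(1)[of x] by simp
        qed
      qed
      moreover have "w1 z x0 / \<psi> x0 > 0" using elim(4) near(1)[of x0] by simp
      moreover have "w1 z x1 / \<psi> x1 \<le> 0" using x1(1) near(1)[of x1] lt by (simp add: divide_nonpos_pos)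
      ultimately show False by linarith
    qed
    show "transmission z \<le> 0"
    proof (rule ccontr)
      assume "\<not> transmission z \<le> 0"
      then have "transmission z / 2 < transmission z" and T: "transmission z > 0" by auto
      from order_tendstoD(1)[OF transmission_tendsto[OF z(1)] this(1)]
      have ev: "\<forall>\<^sub>F x in at_bot. Re (amp z x) > transmission z / 2" .
      let ?r = "growth_prod c k z"
      note g = growth_sum_prod[OF c k z(1)]
      have "filterlim (\<lambda>x. - m3 z * x) at_top at_top"
        by (rule filterlim_tendsto_pos_mult_at_top[OF tendsto_const _ filterlim_ident])
           (use decay_rate_neg[OF c k z(1)] in simp)
      then have "filterlim (\<lambda>x. m3 z * x) at_top at_bot" by (simp add: filterlim_at_bot_mirror)
      then have "filterlim (\<lambda>x. exp (m3 z * x)) at_top at_bot"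
        by (rule filterlim_compose[OF exp_at_top])
      then have "\<forall>\<^sub>F x in at_bot. exp (m3 z * x) \<ge> (1 + ?r * \<epsilon>) / (transmission z / 2)"
        by (simp add: filterlim_at_top)
      then have "\<forall>\<^sub>F x in at_bot. w2 z x \<ge> 1" using ev eventually_le_at_bot[of x0]
      proof eventually_elim
        case (elim x)
        have "w z x \<le> \<epsilon>" unfolding \<epsilon>_def
        proof (rule DERIV_nonneg_imp_nondecreasing[OF elim(3)])
          fix y assume "y \<le> x0"
          then show "\<exists>D. (w z has_real_derivative D) (at y) \<and> 0 \<le> D"
            using dw[OF z(1), of y] w1pos[of y] by (intro exI[of _ "w1 z y"]) simp
        qed
        then have "?r * w z x \<le> ?r * \<epsilon>" using g by (intro mult_left_mono)
        moreover have "growth_sum c k z * w1 z x \<ge> 0" using g w1pos[OF elim(3)] by simp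
        moreover have "1 + ?r * \<epsilon> \<le> exp (m3 z * x) * (transmission z / 2)"
          using elim(1) T by (simp add: divide_le_eq)
        moreover have "exp (m3 z * x) * (transmission z / 2) \<le> exp (m3 z * x) * Re (amp z x)"
          using elim(2) by (intro mult_left_mono) auto
        ultimately show ?case using w_amp[OF z(1), of x] by linarith
      qed
      then obtain xl where xl: "\<And>x. x \<le> xl \<Longrightarrow> w2 z x \<ge> 1"
        by (auto simp: eventually_at_bot_linorder)
      define x2 where "x2 = min xl x0"
      have x2: "x2 \<le> x0" "\<And>x. x \<le> x2 \<Longrightarrow> w2 z x \<ge> 1" by (auto simp: x2_def xl)
      \<comment> \<open>With slope at least 1, \<open>w1\<close> loses its whole value over a
        leftward distance equal to that value.\<close>
      let ?x = "x2 - w1 z x2"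
      have le: "?x \<le> x2" using w1pos[OF x2(1)] by simp
      have "w1 z ?x - ?x \<le> w1 z x2 - x2"
      proof (rule DERIV_nonneg_imp_nondecreasing[OF le])
        fix x assume "?x \<le> x" "x \<le> x2"
        then show "\<exists>y. ((\<lambda>x. w1 z x - x) has_real_derivative y) (at x) \<and> 0 \<le> y"
          by (intro exI[of _ "w2 z x - 1"]) (use x2 in \<open>auto intro!: derivative_eq_intros dw1[OF z(1)]\<close>)
      qed
      then have "w1 z ?x \<le> 0" by simp
      then show False using w1pos[of ?x] le x2 by simp
    qed
  qed
qed

lemma transmission_zero: "\<exists>z>0. transmission z = 0"
proof -
  obtain Z where Z: "Z > 0" "\<And>z. z \<ge> Z \<Longrightarrow> transmission z > 0" using transmission_large by blast
  have "\<forall>\<^sub>F z in at_right 0. z > (0::real)" by (simp add: eventually_at_filter)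
  with transmission_nonpos have "\<forall>\<^sub>F z in at_right 0. transmission z \<le> 0 \<and> z > 0" by eventually_elim simp
  then obtain z1 where z1: "z1 > 0" "transmission z1 \<le> 0"
    using eventually_happens'[OF trivial_limit_at_right_real] by blast
  have "z1 \<le> Z" using Z(2)[of z1] z1 by linarith
  then have "\<exists>z. z1 \<le> z \<and> z \<le> Z \<and> transmission z = 0"
    using z1 Z by (intro IVT' continuous_on_subset[OF transmission_continuous]) (auto simp: less_imp_le)
  then show ?thesis using z1(1) by (meson less_le_trans)
qed

end

section \<open>Matrix exponentials and eigenspaces\<close>

lemma mat_mult_vector: "mat \<mu> *v x = \<mu> *s (x :: 'a::comm_semiring_1 ^ 'n)"
  by (simp add: vec_eq_iff matrix_vector_mult_def mat_def if_distrib if_distribR cong: if_cong)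

lemma matrix_power_Suc_vector: "matrix_power M (Suc n) *v v = M *v (matrix_power M n *v v)"
  by (simp add: matrix_power_def matrix_vector_mul_assoc)

lemma matrix_power_0_vector: "matrix_power M 0 *v v = v"
  by (simp add: matrix_power_def)

lemma linear_matrix_left: "linear (\<lambda>N :: complex^'n^'n. M ** N)"
proof (rule linearI)
  show "M ** (x + y) = M ** x + M ** y" for x y :: "complex^'n^'n" by (rule matrix_add_ldistrib)
qed (simp add: vec_eq_iff matrix_matrix_mult_def scaleR_sum_right)

lemma linear_matrix_vector: "linear (\<lambda>M :: complex^'n^'n. M *v v)"
proof (rule linearI)
  show "(x + y) *v v = x *v v + y *v v" for x y :: "complex^'n^'n" by (rule matrix_vector_mult_add_rdistrib)
qed (simp add: vec_eq_iff matrix_vector_mult_def scaleR_sum_right)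

lemma summable_matrix_exp:
  fixes M :: "complex^'n^'n"
  shows "summable (\<lambda>n. (1 / fact n) *\<^sub>R matrix_power M n)"
proof -
  have "bounded_linear (\<lambda>N :: complex^'n^'n. M ** N)"
    using linear_matrix_left linear_conv_bounded_linear by blast
  then obtain K where K: "K > 0" "\<And>N :: complex^'n^'n. norm (M ** N) \<le> norm N * K"
    using bounded_linear.pos_bounded by metis
  have p: "norm (matrix_power M n) \<le> K ^ n * norm (mat 1 :: complex^'n^'n)" for n
  proof (induction n)
    case (Suc n)
    have "norm (matrix_power M (Suc n)) \<le> norm (matrix_power M n) * K"
      by (simp add: matrix_power_def K)
    also have "\<dots> \<le> K ^ n * norm (mat 1 :: complex^'n^'n) * K" using Suc K by (intro mult_right_mono) auto
    finally show ?case by (simp add: mult_ac)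
  qed (simp add: matrix_power_def)
  show ?thesis
  proof (rule summable_comparison_test'[where N=0])
    show "summable (\<lambda>n. (K ^ n /\<^sub>R fact n) * norm (mat 1 :: complex^'n^'n))"
      by (intro summable_mult2 summable_exp_generic)
    show "norm ((1 / fact n) *\<^sub>R matrix_power M n) \<le> (K ^ n /\<^sub>R fact n) * norm (mat 1 :: complex^'n^'n)" for n
      using mult_left_mono[OF p[of n], of "inverse (fact n)"] by (simp add: divide_inverse mult.assoc)
  qed
qed

lemma matrix_exp_vector_sums:
  fixes M :: "complex^'n^'n"
  shows "(\<lambda>n. (1 / fact n) *\<^sub>R (matrix_power M n *v v)) sums (matrix_exp M *v v)"
proof -
  have bl: "bounded_linear (\<lambda>M :: complex^'n^'n. M *v v)"
    using linear_matrix_vector linear_conv_bounded_linear by blast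
  from bounded_linear.sums[OF bl summable_sums[OF summable_matrix_exp[of M]]]
  have "(\<lambda>n. ((1 / fact n) *\<^sub>R matrix_power M n) *v v) sums (matrix_exp M *v v)"
    by (simp add: matrix_exp_def)
  then show ?thesis by (simp add: linear_cmul[OF linear_matrix_vector])
qed

lemma bounded_linear_smult: "bounded_linear (\<lambda>t :: complex. t *s (v :: complex^'n))"
proof -
  have "linear (\<lambda>t :: complex. t *s v)"
    by (rule linearI) (simp_all add: vec_eq_iff algebra_simps)
  then show ?thesis using linear_conv_bounded_linear by blast
qed

text \<open>The scalar \<open>s\<close> is free so that the statement covers \<open>x A\<close>,
  whose nilpotent part is \<open>x\<close> times that of \<open>A\<close>, and with
  \<open>s = 0\<close> also eigenvectors.\<close>

lemma matrix_exp_jordan: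
  fixes M :: "complex^'n^'n"
  assumes v1: "M *v v1 = \<mu> *s v1" and v2: "M *v v2 = \<mu> *s v2 + s *s v1"
  shows "matrix_exp M *v v2 = exp \<mu> *s v2 + (s * exp \<mu>) *s v1"
proof -
  have p: "matrix_power M n *v v2 = (\<mu> ^ n) *s v2 + (of_nat n * \<mu> ^ (n - 1) * s) *s v1" for n
  proof (induction n)
    case (Suc n)
    have "\<mu> * (of_nat n * \<mu> ^ (n - 1) * s) + \<mu> ^ n * s = of_nat (Suc n) * \<mu> ^ n * s"
      by (cases n) (simp_all add: algebra_simps)
    then have e: "(\<mu> ^ n * s) *s v1 + (of_nat n * \<mu> ^ (n - 1) * s * \<mu>) *s v1 = (of_nat (Suc n) * \<mu> ^ n * s) *s v1"
      by (simp only: vec.scale_left_distrib[symmetric]) (simp add: algebra_simps)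
    have "matrix_power M (Suc n) *v v2 = (\<mu> ^ n * \<mu>) *s v2 + ((\<mu> ^ n * s) *s v1 + (of_nat n * \<mu> ^ (n - 1) * s * \<mu>) *s v1)"
      by (simp only: matrix_power_Suc_vector Suc matrix_vector_right_distrib vector_scalar_commute v1 v2
          vec.scale_right_distrib vec.scale_scale add.assoc)
    then show ?case unfolding e by (simp add: mult.commute)
  qed (simp add: matrix_power_0_vector)
  have s1: "(\<lambda>n. ((1 / fact n) *\<^sub>R \<mu> ^ n) *s v2) sums (exp \<mu> *s v2)"
    using bounded_linear.sums[OF bounded_linear_smult exp_converges[of \<mu>]] by (simp add: divide_inverse)
  \<comment> \<open>Shifted by one index, \<open>n / fact n\<close> becomes
    \<open>1 / fact (n - 1)\<close>; the term at 0 vanishes through the factor \<open>n\<close>, the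
    truncated exponent \<open>n - 1\<close> being 0 there.\<close>
  define f where "f n = (1 / fact n) *\<^sub>R (of_nat n * \<mu> ^ (n - 1) * s)" for n
  have "f (Suc n) = (\<mu> ^ n /\<^sub>R fact n) * s" for n
  proof -
    have "f (Suc n) = (of_nat (Suc n) * (\<mu> ^ n * s)) / (of_nat (Suc n) * fact n)"
      by (simp add: f_def scaleR_conv_of_real)
    also have "\<dots> = (\<mu> ^ n * s) / fact n"
      by (rule mult_divide_mult_cancel_left) (simp del: of_nat_Suc)
    finally show ?thesis by (simp add: scaleR_conv_of_real field_simps)
  qed
  then have "(\<lambda>n. f (Suc n)) sums (exp \<mu> * s)"
    using sums_mult2[OF exp_converges[of \<mu>], of s] by simp
  moreover have "f 0 = 0" by (simp add: f_def)
  ultimately have "f sums (exp \<mu> * s)" using sums_Suc[of f "exp \<mu> * s"] by simp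
  then have "(\<lambda>n. (1 / fact n) *\<^sub>R (of_nat n * \<mu> ^ (n - 1) * s)) sums (exp \<mu> * s)"
    unfolding f_def .
  from bounded_linear.sums[OF bounded_linear_smult this]
  have s2: "(\<lambda>n. ((1 / fact n) *\<^sub>R (of_nat n * \<mu> ^ (n - 1) * s)) *s v1) sums ((exp \<mu> * s) *s v1)" .
  have "(\<lambda>n. (1 / fact n) *\<^sub>R (matrix_power M n *v v2)) =
      (\<lambda>n. ((1 / fact n) *\<^sub>R \<mu> ^ n) *s v2 + ((1 / fact n) *\<^sub>R (of_nat n * \<mu> ^ (n - 1) * s)) *s v1)"
    by (simp add: p fun_eq_iff vec_eq_iff scaleR_add_right)
  with sums_unique2[OF matrix_exp_vector_sums[of M v2]] sums_add[OF s1 s2]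
  show ?thesis by (simp add: mult.commute)
qed

lemma matrix_exp_eigenvector:
  fixes M :: "complex^'n^'n"
  assumes "M *v v = \<mu> *s v"
  shows "matrix_exp M *v v = exp \<mu> *s v"
  using matrix_exp_jordan[of M 0 \<mu> v 0] assms by simp

lemma scaleR_matrix_vector: "(x *\<^sub>R (A :: complex^'n^'m)) *v v = of_real x *s (A *v v)"
  by (simp add: vec_eq_iff matrix_vector_mult_def sum_distrib_left) (simp add: scaleR_conv_of_real mult.assoc)

lemma matrix_exp_scaleR_eigenvector:
  fixes A :: "complex^'n^'n"
  assumes "A *v v = \<mu> *s v"
  shows "matrix_exp (x *\<^sub>R A) *v v = exp (x *\<^sub>R \<mu>) *s v"
  by (rule matrix_exp_eigenvector, unfold scaleR_matrix_vector assms) (simp add: scaleR_conv_of_real)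

lemma matrix_exp_scaleR_jordan:
  fixes A :: "complex^'n^'n"
  assumes v1: "A *v v1 = \<mu> *s v1" and v2: "A *v v2 = \<mu> *s v2 + v1"
  shows "matrix_exp (x *\<^sub>R A) *v v2 = exp (x *\<^sub>R \<mu>) *s v2 + (of_real x * exp (x *\<^sub>R \<mu>)) *s v1"
  by (rule matrix_exp_jordan; unfold scaleR_matrix_vector assms)
     (simp_all add: scaleR_conv_of_real vec.scale_right_distrib)

section \<open>Determinants, spans and spectral subspaces in coordinates\<close>

lemma det_columns_eq:
  "det_columns a b d = a$1 * (b$2 * d$3 - b$3 * d$2) - b$1 * (a$2 * d$3 - a$3 * d$2) + d$1 * (a$2 * b$3 - a$3 * b$2)"
  by (simp add: det_columns_def det_3 transpose_def algebra_simps)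

lemma in_span_2: "x \<in> vec.span {a, b :: complex^'n} \<longleftrightarrow> (\<exists>s t. x = s *s a + t *s b)"
proof
  assume "x \<in> vec.span {a, b}"
  then obtain s t where "x - s *s a = t *s b" by (auto simp: vec.span_insert vec.span_singleton)
  then have "x = s *s a + t *s b" by (simp add: algebra_simps)
  then show "\<exists>s t. x = s *s a + t *s b" by blast
next
  assume "\<exists>s t. x = s *s a + t *s b"
  then show "x \<in> vec.span {a, b}"
    by (auto intro!: vec.span_add vec.span_scale intro: vec.span_base)
qed

lemma in_span_1: "x \<in> vec.span {a :: complex^'n} \<longleftrightarrow> (\<exists>s. x = s *s a)"
  by (auto simp: vec.span_singleton)

lemma independent_2:
  fixes a b :: "complex^'n"
  assumes "\<And>s t. s *s a + t *s b = 0 \<Longrightarrow> s = 0 \<and> t = 0"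
  shows "a \<noteq> b" "vec.independent {a, b}"
proof -
  show ab: "a \<noteq> b" using assms[of 1 "-1"] by (auto simp: vec.scale_minus_left)
  have "b \<noteq> 0" using assms[of 0 1] by auto
  moreover have "a \<notin> vec.span {b}"
  proof
    assume "a \<in> vec.span {b}"
    then obtain t where "a = t *s b" by (auto simp: in_span_1)
    then have "1 *s a + (- t) *s b = 0" by (simp add: vec.scale_minus_left)
    from assms[OF this] show False by simp
  qed
  moreover have "vec.independent {b}" using \<open>b \<noteq> 0\<close> by (simp add: vec.dependent_single)
  ultimately show "vec.independent {a, b}" using vec.independent_insertI[of a "{b}"] by simp
qed

lemma matrix_inv:
  fixes A :: "'a::semiring_1^'n^'m"
  assumes "invertible A"
  shows "A ** matrix_inv A = mat 1" "matrix_inv A ** A = mat 1"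
  using someI_ex[OF assms[unfolded invertible_def]] unfolding matrix_inv_def by auto

lemma add_smult: "v + r *s v = (1 + r) *s (v :: complex^'n)"
  by (simp add: vec_eq_iff algebra_simps)

text \<open>A triangular basis in place of an eigenbasis: for \<open>m1 = m2\<close> the pair
  \<open>E1\<close>, \<open>E2\<close> is a Jordan chain, and for \<open>m1 \<noteq> m2\<close> it
  still spans the sum of the two eigenspaces, so that both cases share the same lemmas.\<close>

locale triangular3 =
  fixes A :: "complex^3^3" and E1 E2 E3 :: "complex^3" and m1 m2 m3 :: complex
  assumes AE1: "A *v E1 = m1 *s E1" and AE2: "A *v E2 = m2 *s E2 + E1" and AE3: "A *v E3 = m3 *s E3"
    and nondegenerate: "det_columns E1 E2 E3 \<noteq> 0"
    and Re_less: "Re m3 < Re m1" "Re m3 < Re m2"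
begin

definition coords :: "complex^3 \<Rightarrow> complex^3" where
  "coords v = matrix_inv (transpose (vector [E1, E2, E3])) *v v"

lemma columns_mult: "transpose (vector [E1, E2, E3] :: complex^3^3) *v y = y$1 *s E1 + y$2 *s E2 + y$3 *s E3"
  by (simp add: vec_eq_iff matrix_vector_mult_def transpose_def sum_3 forall_3 mult.commute)

lemma columns_invertible: "invertible (transpose (vector [E1, E2, E3]) :: complex^3^3)"
  using nondegenerate unfolding invertible_det_nz det_columns_def .

lemma expand: "v = coords v $ 1 *s E1 + coords v $ 2 *s E2 + coords v $ 3 *s E3"
  unfolding columns_mult[symmetric] coords_def
  by (simp only: matrix_vector_mul_assoc matrix_inv(1)[OF columns_invertible] matrix_vector_mul_lid)

lemma coords_combination:
  "coords (a *s E1 + b *s E2 + d *s E3) = vector [a, b, d]"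
proof -
  have "coords (a *s E1 + b *s E2 + d *s E3) = coords (transpose (vector [E1, E2, E3] :: complex^3^3) *v vector [a, b, d])"
    unfolding columns_mult by simp
  also have "\<dots> = vector [a, b, d]"
    unfolding coords_def
    by (simp only: matrix_vector_mul_assoc matrix_inv(2)[OF columns_invertible] matrix_vector_mul_lid)
  finally show ?thesis .
qed

lemma coords_zero: "coords 0 = 0"
  by (simp add: coords_def)

lemma coords_shift:
  "coords ((A - mat \<mu>) *v v) = vector [(m1 - \<mu>) * coords v $ 1 + coords v $ 2, (m2 - \<mu>) * coords v $ 2, (m3 - \<mu>) * coords v $ 3]"
proof -
  let ?a = "coords v $ 1" and ?b = "coords v $ 2" and ?d = "coords v $ 3"
  have "(A - mat \<mu>) *v v = A *v (?a *s E1 + ?b *s E2 + ?d *s E3) - \<mu> *s (?a *s E1 + ?b *s E2 + ?d *s E3)"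
    using expand[of v] by (simp add: matrix_vector_mult_diff_rdistrib mat_mult_vector)
  also have "\<dots> = ((m1 - \<mu>) * ?a + ?b) *s E1 + ((m2 - \<mu>) * ?b) *s E2 + ((m3 - \<mu>) * ?d) *s E3"
    by (simp add: matrix_vector_right_distrib vector_scalar_commute AE1 AE2 AE3 vec_eq_iff algebra_simps)
  finally have e: "(A - mat \<mu>) *v v = ((m1 - \<mu>) * ?a + ?b) *s E1 + ((m2 - \<mu>) * ?b) *s E2 + ((m3 - \<mu>) * ?d) *s E3" .
  show ?thesis unfolding e by (rule coords_combination)
qed

text \<open>A vector killed by some power of \<open>A - mat \<mu>\<close> has coordinate 0 wherever
  the diagonal entry is nonzero; the first coordinate decouples only once the second one is
  0.\<close>

lemma coords_power:
  shows "coords (matrix_power (A - mat \<mu>) n *v v) $ 3 = (m3 - \<mu>) ^ n * coords v $ 3"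
    and "coords (matrix_power (A - mat \<mu>) n *v v) $ 2 = (m2 - \<mu>) ^ n * coords v $ 2"
    and "coords v $ 2 = 0 \<Longrightarrow> coords (matrix_power (A - mat \<mu>) n *v v) $ 1 = (m1 - \<mu>) ^ n * coords v $ 1"
proof -
  show "coords (matrix_power (A - mat \<mu>) n *v v) $ 3 = (m3 - \<mu>) ^ n * coords v $ 3"
    by (induction n) (simp_all add: matrix_power_0_vector matrix_power_Suc_vector coords_shift)
  show 2: "coords (matrix_power (A - mat \<mu>) n *v v) $ 2 = (m2 - \<mu>) ^ n * coords v $ 2" for n
    by (induction n) (simp_all add: matrix_power_0_vector matrix_power_Suc_vector coords_shift)
  show "coords v $ 2 = 0 \<Longrightarrow> coords (matrix_power (A - mat \<mu>) n *v v) $ 1 = (m1 - \<mu>) ^ n * coords v $ 1"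
    by (induction n) (simp_all add: matrix_power_0_vector matrix_power_Suc_vector coords_shift 2)
qed

lemma basis_nonzero: "E1 \<noteq> 0" "E3 \<noteq> 0"
  using nondegenerate by (auto simp: det_columns_eq)

lemma m3_neq: "m3 \<noteq> m1" "m3 \<noteq> m2"
  using Re_less by auto

lemma second_eigenvector: "\<exists>v. v \<noteq> 0 \<and> A *v v = m2 *s v \<and> coords v $ 3 = 0"
proof (cases "m1 = m2")
  case True
  have "coords E1 $ 3 = 0" using coords_combination[of 1 0 0] by simp
  then show ?thesis using True AE1 basis_nonzero by blast
next
  case False
  let ?v = "E2 + (1 / (m2 - m1)) *s E1"
  have c: "coords ?v = vector [1 / (m2 - m1), 1, 0]"
    using coords_combination[of "1 / (m2 - m1)" 1 0] by (simp add: add.commute)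
  have "?v \<noteq> 0"
  proof
    assume "?v = 0"
    with c show False by (simp add: coords_zero vec_eq_iff forall_3)
  qed
  moreover have "A *v ?v = m2 *s ?v"
  proof -
    have "1 + m1 / (m2 - m1) = m2 / (m2 - m1)" using False by (simp add: field_simps)
    then have "E1 + (m1 / (m2 - m1)) *s E1 = (m2 / (m2 - m1)) *s E1" by (simp only: add_smult)
    then show ?thesis
      by (simp add: matrix_vector_right_distrib vector_scalar_commute AE1 AE2 vec.scale_right_distrib add.assoc)
  qed
  ultimately show ?thesis using c by (intro exI[of _ ?v]) simp
qed

lemma eigenvalues_eq: "eigenvalues A = {m1, m2, m3}"
proof
  show "eigenvalues A \<subseteq> {m1, m2, m3}"
  proof
    fix \<mu> assume "\<mu> \<in> eigenvalues A"
    then obtain v where v: "v \<noteq> 0" "A *v v = \<mu> *s v" by (auto simp: eigenvalues_def)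
    then have "(A - mat \<mu>) *v v = 0" by (simp add: matrix_vector_mult_diff_rdistrib mat_mult_vector)
    then have "coords ((A - mat \<mu>) *v v) = 0" by (simp add: coords_zero)
    then have 0: "(m1 - \<mu>) * coords v $ 1 + coords v $ 2 = 0" "(m2 - \<mu>) * coords v $ 2 = 0" "(m3 - \<mu>) * coords v $ 3 = 0"
      unfolding coords_shift vec_eq_iff forall_3 by simp_all
    show "\<mu> \<in> {m1, m2, m3}"
    proof (rule ccontr)
      assume "\<mu> \<notin> {m1, m2, m3}"
      then have "coords v $ 1 = 0" "coords v $ 2 = 0" "coords v $ 3 = 0" using 0 by auto
      then show False using expand[of v] v(1) by simp
    qed
  qed
  show "{m1, m2, m3} \<subseteq> eigenvalues A"
    using AE1 AE3 basis_nonzero second_eigenvector by (auto simp: eigenvalues_def)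
qed

lemma eigenvector_generalized: "A *v v = \<mu> *s v \<Longrightarrow> v \<in> generalized_eigenspace A \<mu>"
  unfolding generalized_eigenspace_def
  by (auto intro!: exI[of _ "Suc 0"] simp: matrix_power_Suc_vector matrix_power_0_vector
      matrix_vector_mult_diff_rdistrib mat_mult_vector)

lemma stable_space: "total_eigenspace A {m3} = vec.span {E3}"
proof
  show "vec.span {E3} \<subseteq> total_eigenspace A {m3}"
    unfolding total_eigenspace_def using eigenvector_generalized[OF AE3] by (intro vec.span_mono) auto
  have "generalized_eigenspace A m3 \<subseteq> vec.span {E3}"
  proof
    fix v assume "v \<in> generalized_eigenspace A m3"
    then obtain n where n: "matrix_power (A - mat m3) n *v v = 0" by (auto simp: generalized_eigenspace_def)
    have 2: "coords v $ 2 = 0" using coords_power(2)[of m3 n v] n m3_neq by (simp add: coords_zero)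
    have 1: "coords v $ 1 = 0" using coords_power(3)[OF 2, of m3 n] n m3_neq by (simp add: coords_zero)
    show "v \<in> vec.span {E3}" using expand[of v] 1 2 by (auto simp: in_span_1)
  qed
  then show "total_eigenspace A {m3} \<subseteq> vec.span {E3}"
    unfolding total_eigenspace_def by (intro vec.span_minimal vec.subspace_span) auto
qed

lemma independent_E12: "E1 \<noteq> E2" "vec.independent {E1, E2}"
proof -
  have "s = 0 \<and> t = 0" if "s *s E1 + t *s E2 = 0" for s t
    using coords_combination[of s t 0] that by (simp add: coords_zero vec_eq_iff forall_3)
  from independent_2[OF this] show "E1 \<noteq> E2" "vec.independent {E1, E2}" by blast+
qed

lemma unstable_space: "total_eigenspace A {m1, m2} = vec.span {E1, E2}"
proof
  have "generalized_eigenspace A \<mu> \<subseteq> vec.span {E1, E2}" if "\<mu> \<in> {m1, m2}" for \<mu>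
  proof
    fix v assume "v \<in> generalized_eigenspace A \<mu>"
    then obtain n where n: "matrix_power (A - mat \<mu>) n *v v = 0" by (auto simp: generalized_eigenspace_def)
    have "coords v $ 3 = 0" using coords_power(1)[of \<mu> n v] n m3_neq that by (auto simp: coords_zero)
    then show "v \<in> vec.span {E1, E2}" using expand[of v] by (auto simp: in_span_2)
  qed
  then show "total_eigenspace A {m1, m2} \<subseteq> vec.span {E1, E2}"
    unfolding total_eigenspace_def by (intro vec.span_minimal vec.subspace_span) auto
  have 1: "E1 \<in> total_eigenspace A {m1, m2}"
    unfolding total_eigenspace_def using eigenvector_generalized[OF AE1] by (intro vec.span_base) auto
  have "E2 \<in> total_eigenspace A {m1, m2}"
  proof (cases "m1 = m2")
    case True
    have "(A - mat m2) *v E2 = E1" "(A - mat m2) *v E1 = 0"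
      using True by (simp_all add: matrix_vector_mult_diff_rdistrib mat_mult_vector AE1 AE2)
    then have "matrix_power (A - mat m2) (Suc (Suc 0)) *v E2 = 0"
      by (simp add: matrix_power_Suc_vector matrix_power_0_vector)
    then have "E2 \<in> generalized_eigenspace A m2" unfolding generalized_eigenspace_def by blast
    then show ?thesis unfolding total_eigenspace_def by (intro vec.span_base) auto
  next
    case False
    let ?v = "E2 + (1 / (m2 - m1)) *s E1"
    have "1 + m1 / (m2 - m1) = m2 / (m2 - m1)" using False by (simp add: field_simps)
    then have "E1 + (m1 / (m2 - m1)) *s E1 = (m2 / (m2 - m1)) *s E1" by (simp only: add_smult)
    then have "A *v ?v = m2 *s ?v"
      by (simp add: matrix_vector_right_distrib vector_scalar_commute AE1 AE2 vec.scale_right_distrib add.assoc)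
    then have "?v \<in> total_eigenspace A {m1, m2}"
      unfolding total_eigenspace_def using eigenvector_generalized by (intro vec.span_base) auto
    then have "?v - (1 / (m2 - m1)) *s E1 \<in> total_eigenspace A {m1, m2}"
      using 1 unfolding total_eigenspace_def by (intro vec.span_diff vec.span_scale)
    then show ?thesis by simp
  qed
  then show "vec.span {E1, E2} \<subseteq> total_eigenspace A {m1, m2}"
    using 1 unfolding total_eigenspace_def by (intro vec.span_minimal vec.subspace_span) auto
qed

text \<open>The ordering and the dimension force the splitting: if \<open>m3\<close> were outside
  \<open>ES\<close>, some member of \<open>ES\<close> would have real part below that of
  \<open>m3\<close>; and a further eigenvalue in \<open>ES\<close> would put two independent
  eigenvectors into a space of dimension 1.\<close>

lemma consistent_splitting_iff:
  "consistent_splitting A S U \<longleftrightarrow> S = vec.span {E3} \<and> U = vec.span {E1, E2}"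
proof
  assume "S = vec.span {E3} \<and> U = vec.span {E1, E2}"
  moreover have "vec.dim (vec.span {E3}) = 1"
    using vec.dim_span_eq_card_independent[of "{E3}"] basis_nonzero by (simp add: vec.dependent_single)
  moreover have "vec.dim (vec.span {E1, E2}) = 2"
    using vec.dim_span_eq_card_independent[OF independent_E12(2)] independent_E12(1) by simp
  moreover have "{m3} \<union> {m1, m2} = eigenvalues A" unfolding eigenvalues_eq by blast
  moreover have "\<forall>\<mu>\<in>{m3}. \<forall>\<nu>\<in>{m1, m2}. Re \<mu> < Re \<nu>" using Re_less by blast
  ultimately show "consistent_splitting A S U"
    unfolding consistent_splitting_def using stable_space unstable_space by metis
next
  assume "consistent_splitting A S U"
  then obtain ES EU where E0: "ES \<union> EU = {m1, m2, m3} \<and> S = total_eigenspace A ES \<and> U = total_eigenspace A EU \<and>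
      vec.dim S = 1 \<and> vec.dim U = 2 \<and> (\<forall>\<mu>\<in>ES. \<forall>\<nu>\<in>EU. Re \<mu> < Re \<nu>)"
    unfolding consistent_splitting_def eigenvalues_eq by (elim exE)
  have E: "ES \<union> EU = {m1, m2, m3}" "S = total_eigenspace A ES" "U = total_eigenspace A EU" "vec.dim S = 1"
    using E0 by blast+
  have E5: "Re \<mu> < Re \<nu>" if "\<mu> \<in> ES" "\<nu> \<in> EU" for \<mu> \<nu> using E0 that by blast
  have "ES \<noteq> {}"
  proof
    assume "ES = {}"
    then have "S = {0}" using E(2) by (simp add: total_eigenspace_def)
    then show False using E(4) by simp
  qed
  have m3S: "m3 \<in> ES"
  proof (rule ccontr)
    assume n: "m3 \<notin> ES"
    then have "m3 \<in> EU" using E(1) by blast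
    obtain \<mu> where \<mu>: "\<mu> \<in> ES" using \<open>ES \<noteq> {}\<close> by blast
    then have "\<mu> \<in> {m1, m2}" using n E(1) by blast
    then show False using E5[OF \<mu> \<open>m3 \<in> EU\<close>] Re_less by auto
  qed
  have "\<mu> \<notin> ES" if v: "A *v v = \<mu> *s v" "v \<noteq> 0" "coords v $ 3 = 0" for \<mu> v
  proof
    assume \<mu>: "\<mu> \<in> ES"
    have "s = 0 \<and> t = 0" if "s *s v + t *s E3 = 0" for s t
    proof -
      have "s *s v = s *s (coords v $ 1 *s E1 + coords v $ 2 *s E2 + coords v $ 3 *s E3)"
        by (rule arg_cong[OF expand])
      then have "0 = (s * coords v $ 1) *s E1 + (s * coords v $ 2) *s E2 + t *s E3"
        using that by (simp add: v(3) vec.scale_right_distrib)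
      from coords_combination[of "s * coords v $ 1" "s * coords v $ 2" t, folded this]
      have 0: "s * coords v $ 1 = 0" "s * coords v $ 2 = 0" "t = 0"
        by (simp_all add: coords_zero vec_eq_iff forall_3)
      have "s = 0"
      proof (rule ccontr)
        assume "s \<noteq> 0"
        then show False using 0 expand[of v] v(2,3) by simp
      qed
      then show ?thesis using 0 by simp
    qed
    from independent_2[OF this] have i: "v \<noteq> E3" "vec.independent {v, E3}" by blast+
    have "v \<in> S" "E3 \<in> S"
      unfolding E(2) total_eigenspace_def
      using eigenvector_generalized[OF v(1)] eigenvector_generalized[OF AE3] \<mu> m3S
      by (auto intro!: vec.span_base)
    then have "card {v, E3} \<le> vec.dim S" by (intro vec.independent_card_le_dim i) auto
    then show False using i(1) E(4) by simp
  qed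
  note notin = this
  have "coords E1 $ 3 = 0" using coords_combination[of 1 0 0] by simp
  then have "m1 \<notin> ES" using notin[OF AE1] basis_nonzero by blast
  moreover have "m2 \<notin> ES" using notin second_eigenvector by blast
  moreover have sub: "\<mu> \<in> ES \<or> \<mu> \<in> EU \<longleftrightarrow> \<mu> = m1 \<or> \<mu> = m2 \<or> \<mu> = m3" for \<mu>
    using E(1) by (simp add: set_eq_iff)
  ultimately have ES: "ES = {m3}" using m3S by (intro subset_antisym subsetI) (metis insertI1, metis singletonD)
  then have "m3 \<notin> EU" using E5[of m3 m3] by auto
  moreover have "m1 \<in> EU" "m2 \<in> EU" using sub ES m3_neq by (metis singletonD)+
  ultimately have "EU = {m1, m2}" using sub by (intro subset_antisym subsetI) (metis insertI1 insertI2, metis insertE singletonD)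
  then show "S = vec.span {E3} \<and> U = vec.span {E1, E2}" using ES E by (simp add: stable_space unstable_space)
qed

text \<open>A basis on which the exponential is explicit. \<open>E1 - (m1 - m2) *s E2\<close> is an
  eigenvector for \<open>m2\<close>; it collapses to \<open>E1\<close> when the roots merge, and
  there the Jordan chain takes over.\<close>

lemma unstable_exp_basis:
  obtains B1 B2 where "B1 \<noteq> B2" "vec.independent {B1, B2}" "vec.span {B1, B2} = vec.span {E1, E2}"
    "det_columns B1 B2 E3 \<noteq> 0" "B1 = E1"
    "m1 \<noteq> m2 \<and> B2 = E1 - (m1 - m2) *s E2 \<and> (\<forall>x. matrix_exp (x *\<^sub>R A) *v B2 = exp (x *\<^sub>R m2) *s B2) \<or>
     m1 = m2 \<and> B2 = E2 \<and> (\<forall>x. matrix_exp (x *\<^sub>R A) *v B2 = exp (x *\<^sub>R m2) *s B2 + (of_real x * exp (x *\<^sub>R m2)) *s E1)"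
proof (cases "m1 = m2")
  case True
  show ?thesis
    by (rule that[of E1 E2])
       (use True independent_E12 nondegenerate matrix_exp_scaleR_jordan[of A E1 m2 E2] AE1 AE2 in auto)
next
  case False
  let ?B = "E1 - (m1 - m2) *s E2"
  have A: "A *v ?B = m2 *s ?B"
    by (simp add: matrix_vector_mult_diff_distrib vector_scalar_commute AE1 AE2 vec_eq_iff algebra_simps)
  have indep: "s = 0 \<and> t = 0" if "s *s E1 + t *s ?B = 0" for s t
  proof -
    have e: "s *s E1 + t *s ?B = (s + t) *s E1 + (- t * (m1 - m2)) *s E2 + 0 *s E3"
      by (simp add: vec_eq_iff algebra_simps)
    have "(s + t) *s E1 + (- t * (m1 - m2)) *s E2 + 0 *s E3 = 0" by (rule trans[OF e[symmetric] that])
    from arg_cong[OF this, of coords] have "vector [s + t, - t * (m1 - m2), 0] = (0 :: complex^3)"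
      unfolding coords_combination coords_zero .
    then have "s + t = 0" "- t * (m1 - m2) = 0" unfolding vec_eq_iff forall_3 by simp_all
    then show ?thesis using False by simp
  qed
  have "vec.span {E1, ?B} = vec.span {E1, E2}"
  proof (intro subset_antisym vec.span_minimal vec.subspace_span)
    have e1: "E1 \<in> vec.span {E1, E2}" "E2 \<in> vec.span {E1, E2}" "E1 \<in> vec.span {E1, ?B}" "?B \<in> vec.span {E1, ?B}"
      by (auto intro: vec.span_base)
    show "{E1, ?B} \<subseteq> vec.span {E1, E2}" using vec.span_diff[OF e1(1) vec.span_scale[OF e1(2)]] e1 by blast
    have "E1 - ?B = (m1 - m2) *s E2" by simp
    then have e2: "(1 / (m1 - m2)) *s (E1 - ?B) = E2" using False by (simp only: vec.scale_scale) simp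
    have "(1 / (m1 - m2)) *s (E1 - ?B) \<in> vec.span {E1, ?B}" by (rule vec.span_scale[OF vec.span_diff[OF e1(3,4)]])
    then have "E2 \<in> vec.span {E1, ?B}" unfolding e2 .
    then show "{E1, E2} \<subseteq> vec.span {E1, ?B}" using e1(3) by blast
  qed
  moreover have "det_columns E1 ?B E3 = - (m1 - m2) * det_columns E1 E2 E3"
    by (simp add: det_columns_eq algebra_simps)
  then have "det_columns E1 ?B E3 \<noteq> 0" using nondegenerate False by simp
  ultimately show ?thesis
    using that[of E1 ?B] independent_2[OF indep] False matrix_exp_scaleR_eigenvector[OF A] by blast
qed

lemma exp_E: "matrix_exp (x *\<^sub>R A) *v E1 = exp (x *\<^sub>R m1) *s E1" "matrix_exp (x *\<^sub>R A) *v E3 = exp (x *\<^sub>R m3) *s E3"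
  using matrix_exp_scaleR_eigenvector AE1 AE3 by blast+

text \<open>A rank-two correction of the identity: the rows of the inverse basis matrix are the dual
  basis, so \<open>R1\<close> and \<open>R2\<close> can be prescribed as the displacements of
  \<open>b1\<close> and \<open>b2\<close>. One \<open>P\<close> for both vectors is what
  \<open>evans_quotient\<close> demands.\<close>

lemma identity_perturbation:
  assumes R: "\<forall>\<^sub>F x in F. norm (R1 x) \<le> C * exp (- \<eta> * \<bar>x\<bar>)" "\<forall>\<^sub>F x in F. norm (R2 x) \<le> C * exp (- \<eta> * \<bar>x\<bar>)"
    and eta: "\<eta> > 0" and B: "det_columns b1 b2 b3 \<noteq> 0"
  shows "\<exists>P. tends_to_identity_exponentially P F \<and> (\<forall>x. P x *v b1 = b1 + R1 x) \<and> (\<forall>x. P x *v b2 = b2 + R2 x)"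
proof -
  let ?E = "transpose (vector [b1, b2, b3]) :: complex^3^3"
  let ?I = "matrix_inv ?E"
  have inv: "invertible ?E" using B unfolding invertible_det_nz det_columns_def .
  have mult: "?E *v y = y$1 *s b1 + y$2 *s b2 + y$3 *s b3" for y
    by (simp add: vec_eq_iff matrix_vector_mult_def transpose_def sum_3 forall_3 mult.commute)
  have Ib: "?I *v (?E *v y) = y" for y 
    by (simp only: matrix_vector_mul_assoc matrix_inv(2)[OF inv] matrix_vector_mul_lid)
  have b1: "?I *v b1 = vector [1, 0, 0]" using Ib[of "vector [1, 0, 0]", unfolded mult] by simp
  have b2: "?I *v b2 = vector [0, 1, 0]" using Ib[of "vector [0, 1, 0]", unfolded mult] by simp
  define P where "P x = mat 1 + (\<chi> i j. R1 x $ i * ?I $ 1 $ j + R2 x $ i * ?I $ 2 $ j)" for x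
  have "(\<chi> i j. R1 x $ i * ?I $ 1 $ j + R2 x $ i * ?I $ 2 $ j) *v v = (?I *v v) $ 1 *s R1 x + (?I *v v) $ 2 *s R2 x" for x v
    by (simp add: vec_eq_iff matrix_vector_mult_def sum_distrib_right sum_distrib_left sum.distrib algebra_simps)
  then have Pv: "P x *v v = v + (?I *v v) $ 1 *s R1 x + (?I *v v) $ 2 *s R2 x" for x v
    unfolding P_def matrix_vector_mult_add_rdistrib matrix_vector_mul_lid by (simp add: add.assoc)
  have l1: "norm (x :: 'b::real_normed_vector ^ 3) \<le> (\<Sum>i\<in>UNIV. norm (x $ i))" for x
    unfolding norm_vec_def by (rule L2_set_le_sum) simp
  have "\<forall>\<^sub>F x in F. norm (P x - mat 1) \<le> (\<Sum>i\<in>(UNIV::3 set). \<Sum>j\<in>(UNIV::3 set). C * norm (?I $ 1 $ j) + C * norm (?I $ 2 $ j)) * exp (- \<eta> * \<bar>x\<bar>)"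
    using R
  proof eventually_elim
    case (elim x)
    have c: "norm (R1 x $ i) \<le> C * exp (- \<eta> * \<bar>x\<bar>)" "norm (R2 x $ i) \<le> C * exp (- \<eta> * \<bar>x\<bar>)" for i
      using elim order_trans[OF Finite_Cartesian_Product.norm_nth_le] by blast+
    have "norm (P x - mat 1) \<le> (\<Sum>i\<in>UNIV. norm ((P x - mat 1) $ i))" by (rule l1)
    also have "\<dots> \<le> (\<Sum>i\<in>UNIV. \<Sum>j\<in>UNIV. norm ((P x - mat 1) $ i $ j))" by (intro sum_mono l1)
    also have "\<dots> \<le> (\<Sum>i\<in>(UNIV::3 set). \<Sum>j\<in>(UNIV::3 set). (C * norm (?I $ 1 $ j) + C * norm (?I $ 2 $ j)) * exp (- \<eta> * \<bar>x\<bar>))"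
    proof (intro sum_mono)
      fix i j :: 3
      have "norm ((P x - mat 1) $ i $ j) \<le> norm (R1 x $ i) * norm (?I $ 1 $ j) + norm (R2 x $ i) * norm (?I $ 2 $ j)"
        by (simp add: P_def norm_triangle_le norm_mult)
      also have "\<dots> \<le> C * exp (- \<eta> * \<bar>x\<bar>) * norm (?I $ 1 $ j) + C * exp (- \<eta> * \<bar>x\<bar>) * norm (?I $ 2 $ j)"
        by (intro add_mono mult_right_mono c) auto
      finally show "norm ((P x - mat 1) $ i $ j) \<le> (C * norm (?I $ 1 $ j) + C * norm (?I $ 2 $ j)) * exp (- \<eta> * \<bar>x\<bar>)"
        by (simp add: algebra_simps)
    qed
    finally show ?case by (simp only: sum_distrib_right)
  qed
  then have "tends_to_identity_exponentially P F"
    unfolding tends_to_identity_exponentially_def using eta by blast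
  moreover have "P x *v b1 = b1 + R1 x" "P x *v b2 = b2 + R2 x" for x
    unfolding Pv b1 b2 by simp_all
  ultimately show ?thesis by blast
qed

end

section \<open>The eigenvalue system\<close>

lemma has_vector_derivative_vec:
  fixes f :: "real \<Rightarrow> complex^'n"
  assumes "\<And>i. ((\<lambda>t. f t $ i) has_vector_derivative f' $ i) (at x)"
  shows "(f has_vector_derivative f') (at x)"
proof -
  have bl: "bounded_linear (\<lambda>a :: complex. a *s (axis i 1 :: complex^'n))" for i
    by (rule bounded_linear_smult)
  have e: "v = (\<Sum>i\<in>UNIV. v $ i *s axis i 1)" for v :: "complex^'n"
    by (simp add: vec_eq_iff axis_def if_distrib cong: if_cong)
  have "((\<lambda>t. \<Sum>i\<in>UNIV. f t $ i *s axis i 1) has_vector_derivative (\<Sum>i\<in>UNIV. f' $ i *s axis i 1)) (at x)"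
    by (intro has_vector_derivative_sum bounded_linear.has_vector_derivative[OF bl] assms)
  then show ?thesis using e by simp
qed

lemma has_vector_derivative_nth:
  fixes f :: "real \<Rightarrow> complex^'n"
  assumes "(f has_vector_derivative f') (at x)"
  shows "((\<lambda>t. f t $ i) has_vector_derivative f' $ i) (at x)"
  using bounded_linear.has_vector_derivative[OF bounded_linear_vec_nth assms] .

lemma norm_le_sum_3: "norm (v :: complex^3) \<le> norm (v$1) + norm (v$2) + norm (v$3)"
proof -
  have "norm v \<le> (\<Sum>i\<in>UNIV. norm (v $ i))" unfolding norm_vec_def by (rule L2_set_le_sum) simp
  then show ?thesis by (simp add: sum_3)
qed

lemma linear_ode_solution_linear:
  assumes "linear_ode_solution A W" "linear_ode_solution A W'"
  shows "linear_ode_solution A (\<lambda>x. a *s W x + b *s W' x)"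
  unfolding linear_ode_solution_def
proof
  fix x
  have "((\<lambda>x. a *s W x + b *s W' x) has_vector_derivative a *s (A x *v W x) + b *s (A x *v W' x)) (at x)"
  proof (rule has_vector_derivative_vec)
    fix i
    show "((\<lambda>t. (a *s W t + b *s W' t) $ i) has_vector_derivative (a *s (A x *v W x) + b *s (A x *v W' x)) $ i) (at x)"
      using has_vector_derivative_nth[of W "A x *v W x" x i] has_vector_derivative_nth[of W' "A x *v W' x" x i] assms
      unfolding linear_ode_solution_def vector_add_component vector_smult_component
      by (intro has_vector_derivative_add has_vector_derivative_mult_right) auto
  qed
  then show "((\<lambda>x. a *s W x + b *s W' x) has_vector_derivative A x *v (a *s W x + b *s W' x)) (at x)"
    by (simp add: matrix_vector_right_distrib vector_scalar_commute)
qed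

definition evans_mat :: "real \<Rightarrow> complex \<Rightarrow> complex \<Rightarrow> complex^3^3" where
  "evans_mat c z g = vector
     [vector [z / of_real c, 0, - 1 / of_real c],
      vector [0, 0, 1],
      vector [- of_real (c\<^sup>2) * z / of_real c + g, z + 1, of_real (c\<^sup>2 / c - c)]]"

lemma evans_mat_mult:
  assumes "c \<noteq> 0"
  shows "evans_mat c z g *v W = vector
    [(z * W$1 - W$3) / of_real c, W$3, (- of_real c * z + g) * W$1 + (z + 1) * W$2]"
  using assms
  by (simp add: evans_mat_def vec_eq_iff forall_3 matrix_vector_mult_def sum_3 power2_eq_square diff_divide_distrib)

lemma det_columns_linear_3: "det_columns p q (a *s u) = a * det_columns p q u"
  by (simp add: det_columns_eq algebra_simps)

text \<open>Liouville's formula: the trace is \<open>z / c\<close>, because the last diagonal entry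
  \<open>c\<^sup>2 / c - c\<close> vanishes.\<close>

lemma Abel_identity:
  fixes g :: "real \<Rightarrow> complex"
  assumes c: "c \<noteq> 0" and A: "\<And>x. A x = evans_mat c z (g x)"
    and W: "linear_ode_solution A W1" "linear_ode_solution A W2" "linear_ode_solution A W3"
  shows "((\<lambda>x. det_columns (W1 x) (W2 x) (W3 x)) has_vector_derivative
      z / of_real c * det_columns (W1 x) (W2 x) (W3 x)) (at x)"
proof -
  have d: "((\<lambda>t. W t $ 1) has_vector_derivative (z * W x $ 1 - W x $ 3) / of_real c) (at x)"
    "((\<lambda>t. W t $ 2) has_vector_derivative W x $ 3) (at x)"
    "((\<lambda>t. W t $ 3) has_vector_derivative (- of_real c * z + g x) * W x $ 1 + (z + 1) * W x $ 2) (at x)"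
    if "linear_ode_solution A W" for W
  proof -
    have *: "((\<lambda>t. W t $ i) has_vector_derivative (A x *v W x) $ i) (at x)" for i
      using that unfolding linear_ode_solution_def by (intro has_vector_derivative_nth) auto
    show "((\<lambda>t. W t $ 1) has_vector_derivative (z * W x $ 1 - W x $ 3) / of_real c) (at x)"
      "((\<lambda>t. W t $ 2) has_vector_derivative W x $ 3) (at x)"
      "((\<lambda>t. W t $ 3) has_vector_derivative (- of_real c * z + g x) * W x $ 1 + (z + 1) * W x $ 2) (at x)"
      using *[of 1] *[of 2] *[of 3] unfolding A evans_mat_mult[OF c] by simp_all
  qed
  note 1 = d[OF W(1)] and 2 = d[OF W(2)] and 3 = d[OF W(3)]
  show ?thesis
    unfolding det_columns_eq
    by (rule has_vector_derivative_eq_rhs,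
        (rule has_vector_derivative_add has_vector_derivative_diff has_vector_derivative_mult 1 2 3)+)
       (use c in \<open>simp add: field_simps\<close>)
qed

section \<open>The first-order system in scalar coordinates\<close>

locale evans_problem = homoclinic_orbit +
  fixes z :: real
  assumes z_pos: "z > 0"
begin

lemma z_nonneg: "z \<ge> 0" using z_pos by simp

definition A :: "real \<Rightarrow> complex^3^3" where
  "A x = evans_mat c (of_real z) (of_real (c - c * (k + h x)))"

definition A0 :: "complex^3^3" where
  "A0 = evans_mat c (of_real z) (of_real (c - c * k))"

abbreviation (input) "M1 \<equiv> m1 z"
abbreviation (input) "M2 \<equiv> m2 z"
abbreviation (input) "M3 \<equiv> complex_of_real (m3 z)"

text \<open>Takes \<open>(w, w', w'')\<close> to \<open>(\<tau>, u, u')\<close>. The inverse is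
  given by \<open>scalar0\<close>, the first component and \<open>scalar2\<close>; it divides by
  \<open>z\<close>, so the correspondence holds away from \<open>z = 0\<close>.\<close>

definition lift :: "complex \<Rightarrow> complex \<Rightarrow> complex \<Rightarrow> complex^3" where
  "lift a b d = vector [b, of_real z * a - of_real c * b, of_real z * b - of_real c * d]"

text \<open>The value of \<open>w'''\<close> that the scalar equation prescribes, with
  \<open>t\<close> in place of \<open>h x\<close>; \<open>t = 0\<close> is the limiting
  equation.\<close>

definition third :: "real \<Rightarrow> complex \<Rightarrow> complex \<Rightarrow> complex \<Rightarrow> complex" where
  "third t a b d = of_real (z / c) * d + of_real (2 * z + k + t) * b - of_real (z * (z + 1) / c) * a"

definition scalar0 :: "complex^3 \<Rightarrow> complex" where "scalar0 W = (of_real c * W$1 + W$2) / of_real z"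
definition scalar2 :: "complex^3 \<Rightarrow> complex" where "scalar2 W = (of_real z * W$1 - W$3) / of_real c"

text \<open>The operator \<open>(\<partial> - m1) (\<partial> - m2)\<close> acting on
  \<open>(w, w', w'')\<close>: it annihilates \<open>E1\<close> and \<open>E2\<close>, hence
  measures the component along \<open>E3\<close>.\<close>

definition growth :: "complex^3 \<Rightarrow> complex" where
  "growth W = scalar2 W - (M1 + M2) * W$1 + M1 * M2 * scalar0 W"

lemma c_nz: "c \<noteq> 0" "complex_of_real c \<noteq> 0" and z_nz: "complex_of_real z \<noteq> 0"
  using c z_pos by auto

lemma lift_scalar: "lift (scalar0 W) (W$1) (scalar2 W) = W"
  using c_nz z_nz by (simp add: lift_def scalar0_def scalar2_def vec_eq_iff forall_3)

lemma scalar_lift: "scalar0 (lift a b d) = a" "lift a b d $ 1 = b" "scalar2 (lift a b d) = d"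
  using c_nz z_nz by (simp_all add: lift_def scalar0_def scalar2_def)

lemma growth_lift: "growth (lift a b d) = d - (M1 + M2) * b + M1 * M2 * a"
  by (simp add: growth_def scalar_lift)

lemma third_vieta: "third t a b d = (M1 + M2 + M3) * d - (M1 * M2 + (M1 + M2) * M3) * b + M1 * M2 * M3 * a + of_real t * b"
  unfolding vieta[OF z_nonneg] third_def by (simp add: algebra_simps)

lemma evans_mat_lift:
  "evans_mat c (of_real z) (of_real (c - c * (k + t))) *v lift a b d = lift b d (third t a b d)"
  using c_nz unfolding evans_mat_mult[OF c_nz(1)] lift_def third_def
  by (simp add: vec_eq_iff forall_3 field_simps)

lemma lift_deriv:
  fixes w w1 w2 :: "real \<Rightarrow> complex"
  assumes "(w has_vector_derivative w1 x) (at x)" "(w1 has_vector_derivative w2 x) (at x)"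
    "(w2 has_vector_derivative third (h x) (w x) (w1 x) (w2 x)) (at x)"
  shows "((\<lambda>x. lift (w x) (w1 x) (w2 x)) has_vector_derivative A x *v lift (w x) (w1 x) (w2 x)) (at x)"
proof (rule has_vector_derivative_vec)
  have d: "((\<lambda>t. (of_real z * a t - of_real c * b t)) has_vector_derivative of_real z * a' - of_real c * b') (at x)"
    if "(a has_vector_derivative a') (at x)" "(b has_vector_derivative b') (at x)" for a b :: "real \<Rightarrow> complex" and a' b'
    by (intro has_vector_derivative_diff has_vector_derivative_mult_right that)
  fix i :: 3
  have "i = 1 \<or> i = 2 \<or> i = 3" by (rule exhaust_3)
  then show "((\<lambda>x. lift (w x) (w1 x) (w2 x) $ i) has_vector_derivative (A x *v lift (w x) (w1 x) (w2 x)) $ i) (at x)"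
    unfolding A_def evans_mat_lift
    using assms(2) d[OF assms(1,2)] d[OF assms(2,3)] by (elim disjE) (simp_all add: lift_def)
qed

lemma scalar_deriv:
  assumes "(W has_vector_derivative A x *v W x) (at x)"
  shows "((\<lambda>x. scalar0 (W x)) has_vector_derivative W x $ 1) (at x)"
    "((\<lambda>x. W x $ 1) has_vector_derivative scalar2 (W x)) (at x)"
    "((\<lambda>x. scalar2 (W x)) has_vector_derivative third (h x) (scalar0 (W x)) (W x $ 1) (scalar2 (W x))) (at x)"
proof -
  have e: "A x *v W x = lift (W x $ 1) (scalar2 (W x)) (third (h x) (scalar0 (W x)) (W x $ 1) (scalar2 (W x)))"
    using evans_mat_lift[of "h x" "scalar0 (W x)" "W x $ 1" "scalar2 (W x)"] by (simp add: A_def lift_scalar)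
  have n: "((\<lambda>x. W x $ i) has_vector_derivative (A x *v W x) $ i) (at x)" for i
    by (rule has_vector_derivative_nth[OF assms])
  have dv: "((\<lambda>t. f t / s) has_vector_derivative f' / s) (at x)" if "(f has_vector_derivative f') (at x)"
    for f :: "real \<Rightarrow> complex" and f' s
    using has_vector_derivative_mult_left[OF that, of "inverse s"] by (simp add: divide_inverse)
  have "((\<lambda>x. scalar0 (W x)) has_vector_derivative scalar0 (A x *v W x)) (at x)"
    unfolding scalar0_def by (intro dv has_vector_derivative_add has_vector_derivative_mult_right n)
  then show "((\<lambda>x. scalar0 (W x)) has_vector_derivative W x $ 1) (at x)" unfolding e scalar_lift .
  show "((\<lambda>x. W x $ 1) has_vector_derivative scalar2 (W x)) (at x)"
    using n[of 1] unfolding e scalar_lift .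
  have "((\<lambda>x. scalar2 (W x)) has_vector_derivative scalar2 (A x *v W x)) (at x)"
    unfolding scalar2_def by (intro dv has_vector_derivative_diff has_vector_derivative_mult_right n)
  then show "((\<lambda>x. scalar2 (W x)) has_vector_derivative third (h x) (scalar0 (W x)) (W x $ 1) (scalar2 (W x))) (at x)"
    unfolding e scalar_lift .
qed

lemma h_bounded: "\<bar>h x\<bar> \<le> K"
proof -
  have "\<bar>h x\<bar> \<le> K * 1"
    using h(2)[of x] by (rule order_trans) (intro mult_left_mono K_nonneg, use eta in simp)
  then show ?thesis by simp
qed

lemma A_bound: "\<exists>M. \<forall>x v. norm (A x *v v) \<le> M * norm v"
proof (intro exI allI)
  fix x and v :: "complex^3"
  let ?n = "norm v"
  have n: "norm (v $ i) \<le> ?n" for i by (rule Finite_Cartesian_Product.norm_nth_le)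
  have a: "norm (- complex_of_real c * of_real z + of_real (c - c * (k + h x))) \<le> c * z + (c + c * (k + K))"
  proof -
    have "\<bar>k + h x\<bar> \<le> k + K" using h_bounded[of x] k by linarith
    then have "c * \<bar>k + h x\<bar> \<le> c * (k + K)" using c by simp
    moreover have "norm (- complex_of_real c * of_real z + of_real (c - c * (k + h x))) = \<bar>- c * z + (c - c * (k + h x))\<bar>"
      by (metis norm_of_real of_real_add of_real_minus of_real_mult)
    moreover have "c * \<bar>k + h x\<bar> = \<bar>c * (k + h x)\<bar>" using c by (simp add: abs_mult)
    moreover have "c * z \<ge> 0" using c z_pos by simp
    ultimately show ?thesis using c by (simp only: mult_minus_left)
  qed
  have "norm (A x *v v) \<le> norm ((of_real z * v$1 - v$3) / of_real c) + norm (v$3)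
      + norm ((- complex_of_real c * of_real z + of_real (c - c * (k + h x))) * v$1 + (of_real z + 1) * v$2)"
    using norm_le_sum_3[of "A x *v v"] unfolding A_def evans_mat_mult[OF c_nz(1)] by simp
  also have "\<dots> \<le> (z * ?n + ?n) / c + ?n + ((c * z + (c + c * (k + K))) * ?n + (z + 1) * ?n)"
  proof (intro add_mono)
    have "norm (of_real z * v$1 - v$3) \<le> z * ?n + ?n"
      using z_pos n[of 1] n[of 3]
      by (intro order_trans[OF norm_triangle_ineq4] add_mono) (auto simp: norm_mult)
    then show "norm ((of_real z * v$1 - v$3) / of_real c) \<le> (z * ?n + ?n) / c"
      using c by (simp add: norm_divide divide_right_mono)
    have "norm (of_real z + 1 :: complex) \<le> z + 1"
      using z_pos norm_triangle_ineq[of "complex_of_real z" 1] by simp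
    then show "norm ((- complex_of_real c * of_real z + of_real (c - c * (k + h x))) * v$1 + (of_real z + 1) * v$2)
        \<le> (c * z + (c + c * (k + K))) * ?n + (z + 1) * ?n"
      using c z_pos k K_nonneg
      by (intro order_trans[OF norm_triangle_ineq] add_mono; unfold norm_mult; intro mult_mono a n) auto
  qed (rule n)
  also have "\<dots> = ((z + 1) / c + 1 + (c * z + (c + c * (k + K))) + (z + 1)) * ?n"
    by (simp add: algebra_simps add_divide_distrib)
  finally show "norm (A x *v v) \<le> ((z + 1) / c + 1 + (c * z + (c + c * (k + K))) + (z + 1)) * ?n" .
qed

lemma A_perturbation: "A x = A0 - (c * h x) *\<^sub>R vector [0, 0, vector [1, 0, 0]]"
  unfolding A_def A0_def evans_mat_def
  by (simp add: vec_eq_iff forall_3) (simp add: scaleR_conv_of_real algebra_simps)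

lemma A_continuous: "continuous_on UNIV A"
  unfolding A_perturbation[abs_def] by (intro continuous_intros h(1))

definition E1 :: "complex^3" where "E1 = lift 1 M1 (M1 * M1)"
text \<open>The divided difference of \<open>(1, m, m\<^sup>2)\<close> between \<open>M1\<close> and
  \<open>M2\<close>, which becomes the derivative at a double root.\<close>

definition E2 :: "complex^3" where "E2 = lift 0 1 (M1 + M2)"
definition E3 :: "complex^3" where "E3 = lift 1 M3 (M3 * M3)"

lemma third_root:
  assumes "\<mu> = M1 \<or> \<mu> = M2 \<or> \<mu> = M3"
  shows "third 0 1 \<mu> (\<mu> * \<mu>) = \<mu> * (\<mu> * \<mu>)"
  unfolding third_vieta using assms by (elim disjE) (simp_all add: algebra_simps)

lemma smult_lift: "s *s lift a b d = lift (s * a) (s * b) (s * d)"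
  by (simp add: lift_def vec_eq_iff forall_3 algebra_simps)

lemma add_lift: "lift a b d + lift a' b' d' = lift (a + a') (b + b') (d + d')"
  by (simp add: lift_def vec_eq_iff forall_3 algebra_simps)

lemma diff_lift: "lift a b d - lift a' b' d' = lift (a - a') (b - b') (d - d')"
  by (simp add: lift_def vec_eq_iff forall_3 algebra_simps)

lemma A0_lift: "A0 *v lift a b d = lift b d (third 0 a b d)"
  using evans_mat_lift[of 0] by (simp add: A0_def)

lemma det_E12: "det_columns E1 E2 W = of_real z * of_real c * growth W"
proof -
  have "det_columns E1 E2 (lift a b d) = of_real z * of_real c * (d - (M1 + M2) * b + M1 * M2 * a)" for a b d
    by (simp add: E1_def E2_def lift_def det_columns_eq algebra_simps)
  then show ?thesis using lift_scalar[of W] by (metis growth_def)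
qed

sublocale triangular3 A0 E1 E2 E3 M1 M2 M3
proof
  show "A0 *v E1 = M1 *s E1" "A0 *v E3 = M3 *s E3"
    unfolding E1_def E3_def A0_lift smult_lift by (simp_all add: third_root)
  have "third 0 0 1 (M1 + M2) = M1 * M1 + M2 * (M1 + M2)"
    unfolding third_vieta by (simp add: algebra_simps)
  then show "A0 *v E2 = M2 *s E2 + E1"
    unfolding E2_def E1_def A0_lift smult_lift add_lift by (simp add: algebra_simps)
  have "growth E3 = (M3 - M1) * (M3 - M2)"
    unfolding E3_def growth_lift by (simp add: algebra_simps)
  moreover have "Re M3 < Re M1" "Re M3 < Re M2"
    using n_pos[OF z_nonneg] by (simp_all add: n1_def n2_def)
  moreover from this have "M3 \<noteq> M1" "M3 \<noteq> M2" by (metis order_less_irrefl)+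
  ultimately show "det_columns E1 E2 E3 \<noteq> 0" "Re M3 < Re M1" "Re M3 < Re M2"
    unfolding det_E12 using c_nz z_nz by auto
qed

text \<open>The solution vanishes because it would otherwise dominate, at \<open>+\<infinity>\<close>, the sup norm of its
  own Volterra integral.\<close>

lemma decaying_solution_zero:
  assumes W: "linear_ode_solution A W"
    and bd: "\<And>x. x \<ge> X0 \<Longrightarrow> norm (exp (x *\<^sub>R (- M3)) *s W x) \<le> B"
    and lim: "((\<lambda>x. growth (exp (x *\<^sub>R (- M3)) *s W x)) \<longlongrightarrow> 0) at_top"
  shows "W x = 0"
proof -
  let ?e = "\<lambda>x. exp (x *\<^sub>R (- M3))"
  \<comment> \<open>Scaled by \<open>exp (- M3 x)\<close>, these are \<open>w\<close>,
    \<open>(\<partial> - M2) w\<close> and \<open>(\<partial> - M1) (\<partial> - M2) w\<close>, a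
    triangular first-order system. They are controlled only for \<open>x \<ge> X0\<close>, so
    half-line bounds take the place of the resolvents.\<close>
  define v where "v x = ?e x * scalar0 (W x)" for x
  define y where "y x = ?e x * (W x $ 1 - M2 * scalar0 (W x))" for x
  define a where "a x = ?e x * growth (W x)" for x
  have n: "Re (n1 z) > 0" "Re (n2 z) > 0" by (rule n_pos[OF z_nonneg])+
  have dW: "(W has_vector_derivative A x *v W x) (at x)" for x using W by (simp add: linear_ode_solution_def)
  note d = scalar_deriv[OF dW]
  have de: "((\<lambda>x. ?e x * f x) has_vector_derivative ?e x * (f' - M3 * f x)) (at x)"
    if "(f has_vector_derivative f') (at x)" for f f' x
  proof -
    have "((\<lambda>x. ?e x * f x) has_vector_derivative ?e x * f' + (- M3) * ?e x * f x) (at x)"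
      by (rule has_vector_derivative_mult[OF has_vector_derivative_exp_scaleR that])
    then show ?thesis by (rule has_vector_derivative_eq_rhs) (simp add: algebra_simps)
  qed
  have dv: "(v has_vector_derivative n2 z * v x + y x) (at x)" for x
    unfolding v_def using de[OF d(1)]
    by (rule has_vector_derivative_eq_rhs) (simp add: y_def n2_def algebra_simps)
  have dy: "(y has_vector_derivative n1 z * y x + a x) (at x)" for x
    unfolding y_def using de[OF has_vector_derivative_diff[OF d(2) has_vector_derivative_mult_right[OF d(1), of M2]]]
    by (rule has_vector_derivative_eq_rhs) (simp add: a_def growth_def n1_def algebra_simps)
  have da: "(a has_vector_derivative of_real (h x) * (M2 * v x + y x)) (at x)" for x
    unfolding a_def growth_def
    using de[OF has_vector_derivative_add[OF has_vector_derivative_diff[OF d(3) has_vector_derivative_mult_right[OF d(2), of "M1 + M2"]]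
          has_vector_derivative_mult_right[OF d(1), of "M1 * M2"]]]
    by (rule has_vector_derivative_eq_rhs) (simp add: third_vieta v_def y_def algebra_simps)
  have es: "?e x * W x $ i = (?e x *s W x) $ i" for x i by simp
  have bi: "norm (?e x * W x $ i) \<le> B" if "x \<ge> X0" for x i
    unfolding es by (rule order_trans[OF Finite_Cartesian_Product.norm_nth_le bd[OF that]])
  define Bv where "Bv = (c * B + B) / z"
  define By where "By = B + norm M2 * Bv"
  have v_bd: "norm (v x) \<le> Bv" if "x \<ge> X0" for x
  proof -
    have "v x = (of_real c * (?e x * W x $ 1) + ?e x * W x $ 2) / of_real z"
      by (simp add: v_def scalar0_def algebra_simps)
    moreover have "norm (of_real c * (?e x * W x $ 1) + ?e x * W x $ 2) \<le> c * B + B"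
      using bi[OF that] c by (intro order_trans[OF norm_triangle_ineq] add_mono) (auto simp: norm_mult)
    ultimately show ?thesis using z_pos unfolding Bv_def by (simp add: norm_divide divide_right_mono)
  qed
  have y_bd: "norm (y x) \<le> By" if "x \<ge> X0" for x
  proof -
    have "y x = ?e x * W x $ 1 - M2 * v x" by (simp add: y_def v_def algebra_simps)
    then show ?thesis unfolding By_def
      using bi[OF that, of 1] mult_left_mono[OF v_bd[OF that], of "norm M2"]
      by (auto intro!: order_trans[OF norm_triangle_ineq4] add_mono simp: norm_mult)
  qed
  have a0: "(a \<longlongrightarrow> 0) at_top"
  proof -
    have "growth (?e x *s W x) = a x" for x
      by (simp add: a_def growth_def scalar0_def scalar2_def algebra_simps)
    then show ?thesis using lim by simp
  qed
  define M where "M = (norm M2 / Re (n2 z) + 1) / Re (n1 z)"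
  have M: "M > 0" unfolding M_def by (rule volterra_op_norm_pos[OF n])
  have "((\<lambda>x. M * (K' * (pi / 2 - arctan x))) \<longlongrightarrow> M * (K' * (pi / 2 - pi / 2))) at_top"
    by (intro tendsto_intros tendsto_arctan_at_top)
  then have "\<forall>\<^sub>F x in at_top. M * (K' * (pi / 2 - arctan x)) < 1 / 2"
    by (rule order_tendstoD) simp
  moreover have "\<forall>\<^sub>F x in at_top. norm (a x) < 1"
    using order_tendstoD(2)[OF tendsto_norm_zero[OF a0], of 1] by simp
  ultimately have "\<forall>\<^sub>F x in at_top. M * (K' * (pi / 2 - arctan x)) \<le> 1 / 2 \<and> norm (a x) \<le> 1 \<and> x \<ge> X0"
    using eventually_ge_at_top[of X0] by eventually_elim simp
  then obtain X where X: "\<And>x. x \<ge> X \<Longrightarrow> M * (K' * (pi / 2 - arctan x)) \<le> 1 / 2"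
    "\<And>x. x \<ge> X \<Longrightarrow> norm (a x) \<le> 1" "\<And>x. x \<ge> X \<Longrightarrow> x \<ge> X0"
    by (auto simp: eventually_at_top_linorder)
  have yb: "norm (y x) \<le> S / Re (n1 z)" if "\<And>t. t \<ge> X \<Longrightarrow> norm (a t) \<le> S" "x \<ge> X" for S x
    by (rule halfline_bound[OF dy, of x By]) (use that y_bd X(3) n in auto)
  have vb: "norm (v x) \<le> S / Re (n1 z) / Re (n2 z)" if "\<And>t. t \<ge> X \<Longrightarrow> norm (a t) \<le> S" "x \<ge> X" for S x
    by (rule halfline_bound[OF dv, of x Bv]) (use that v_bd yb[OF that(1)] X(3) n in auto)
  have half: "norm (a x) \<le> S / 2" if S: "\<And>t. t \<ge> X \<Longrightarrow> norm (a t) \<le> S" and x: "x \<ge> X" for S x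
  proof -
    have S0: "S \<ge> 0" using order_trans[OF norm_ge_zero S[OF x]] .
    have "norm (a x - 0) \<le> M * S * (K' * (pi / 2 - arctan x))"
    proof (rule tail_bound[OF da a0 arctan_tail_deriv])
      have "((\<lambda>x. M * S * (K' * (pi / 2 - arctan x))) \<longlongrightarrow> M * S * (K' * (pi / 2 - pi / 2))) at_top"
        by (intro tendsto_intros tendsto_arctan_at_top)
      then show "((\<lambda>x. M * S * (K' * (pi / 2 - arctan x))) \<longlongrightarrow> 0) at_top" by simp
      fix t assume "t \<ge> x"
      then have t: "t \<ge> X" using x by simp
      have "norm (M2 * v t + y t) \<le> norm M2 * (S / Re (n1 z) / Re (n2 z)) + S / Re (n1 z)"
        by (intro order_trans[OF norm_triangle_ineq] add_mono yb[OF S t])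
           (simp only: norm_mult, intro mult_left_mono vb[OF S t] norm_ge_zero)
      also have "\<dots> = M * S" using n by (simp add: M_def field_simps)
      finally have "norm (of_real (h t) * (M2 * v t + y t)) \<le> K' / (1 + t\<^sup>2) * (M * S)"
        unfolding norm_mult norm_of_real
        by (intro mult_mono h_le) (use K'_nonneg in auto)
      then show "norm (of_real (h t) * (M2 * v t + y t)) \<le> - (- (M * S * (K' / (1 + t\<^sup>2))))"
        by (simp only: minus_minus mult.commute)
    qed
    also have "\<dots> = (M * (K' * (pi / 2 - arctan x))) * S" by (simp only: mult_ac)
    also have "\<dots> \<le> 1 / 2 * S" by (intro mult_right_mono X(1) x S0)
    finally show ?thesis by simp
  qed
  \<comment> \<open>The bound on \<open>[X, \<infinity>)\<close> can be halved again and again,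
    which forces \<open>a\<close> to vanish there.\<close>
  have pow: "\<forall>x\<ge>X. norm (a x) \<le> (1 / 2) ^ n" for n
  proof (induction n)
    case (Suc n)
    then show ?case using half[of "(1 / 2) ^ n"] by simp
  qed (use X in simp)
  have "norm (a x) \<le> 0" if "x \<ge> X" for x
  proof (rule tendsto_lowerbound[of "\<lambda>n. (1 / 2) ^ n" _ sequentially])
    show "(\<lambda>n. (1 / 2 :: real) ^ n) \<longlonglongrightarrow> 0" by (rule LIMSEQ_power_zero) simp
  qed (use pow that in auto)
  then have aX: "norm (a t) \<le> 0" if "t \<ge> X" for t using that by blast
  have yX: "y X = 0" using yb[OF aX, of X] by simp
  have vX: "v X = 0" using vb[OF aX, of X] by simp
  have "scalar0 (W X) = 0" using vX by (simp add: v_def)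
  moreover from this have "W X $ 1 = 0" using yX by (simp add: y_def)
  moreover from calculation have "scalar2 (W X) = 0" using aX[of X] by (simp add: a_def growth_def)
  ultimately have "W X = lift 0 0 0" using lift_scalar[of "W X"] by simp
  then have "W X = 0" by (simp add: lift_def vec_eq_iff forall_3)
  obtain Mb where "\<And>x v. norm (A x *v v) \<le> Mb * norm v" using A_bound by blast
  from linear_ode_zero[OF dW this \<open>W X = 0\<close>] show ?thesis .
qed

definition S3 :: "real \<Rightarrow> complex^3" where
  "S3 x = lift (of_real (w z x)) (of_real (w1 z x)) (of_real (w2 z x))"

lemma S3_solution: "linear_ode_solution A S3"
proof -
  have r: "((\<lambda>x. complex_of_real (f x)) has_vector_derivative of_real f') (at x)"
    if "(f has_real_derivative f') (at x)" for f f' x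
    using bounded_linear.has_vector_derivative[OF bounded_linear_of_real that[unfolded has_real_derivative_iff_has_vector_derivative]] .
  show ?thesis
    unfolding linear_ode_solution_def S3_def
  proof (intro allI lift_deriv)
    fix x
    have "third (h x) (of_real (w z x)) (of_real (w1 z x)) (of_real (w2 z x))
        = of_real ((z / c) * w2 z x + (2 * z + k + h x) * w1 z x - (z * (z + 1) / c) * w z x)"
      by (simp add: third_def)
    then show "((\<lambda>x. complex_of_real (w2 z x)) has_vector_derivative
        third (h x) (of_real (w z x)) (of_real (w1 z x)) (of_real (w2 z x))) (at x)"
      using r[OF dw2[OF z_nonneg, of x]] by simp
  qed (rule r dw[OF z_nonneg] dw1[OF z_nonneg])+
qed

lemma S3_scaled: "exp (x *\<^sub>R (- M3)) *s S3 x = lift (of_real (Re (V0 z x))) (of_real (Re (V1 z x))) (of_real (Re (V2 z x)))"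
proof -
  have "exp (x *\<^sub>R (- M3)) * of_real (exp (m3 z * x) * r) = of_real r" for r
  proof -
    have "exp (x *\<^sub>R (- M3)) = of_real (exp (- (m3 z * x)))"
      by (simp add: scaleR_conv_of_real exp_of_real[symmetric] mult.commute)
    then have "exp (x *\<^sub>R (- M3)) * of_real (exp (m3 z * x) * r) = of_real (exp (- (m3 z * x)) * (exp (m3 z * x) * r))"
      by (simp only: of_real_mult)
    also have "exp (- (m3 z * x)) * (exp (m3 z * x) * r) = r"
      by (simp only: mult.assoc[symmetric] exp_add[symmetric]) simp
    finally show ?thesis .
  qed
  then show ?thesis unfolding S3_def smult_lift w_def w1_def w2_def by (simp only:)
qed

lemma S3_growth: "growth (exp (x *\<^sub>R (- M3)) *s S3 x) = of_real (Re (amp z x))"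
proof -
  have "Re (V2 z x) - growth_sum c k z * Re (V1 z x) + growth_prod c k z * Re (V0 z x) = Re (amp z x)"
  proof -
    have "exp (m3 z * x) * (Re (V2 z x) - growth_sum c k z * Re (V1 z x) + growth_prod c k z * Re (V0 z x))
        = exp (m3 z * x) * Re (amp z x)"
      using w_amp[OF z_nonneg, of x] unfolding w_def w1_def w2_def by (simp add: algebra_simps)
    then show ?thesis by (simp only: mult_left_cancel[OF exp_not_eq_zero])
  qed
  then show ?thesis
    unfolding S3_scaled growth_lift growth_roots_sum[OF c k z_nonneg] growth_roots_prod[OF c k z_nonneg]
    by (simp flip: of_real_mult of_real_diff of_real_add)
qed

lemma norm_lift_le:
  "norm (lift a b d) \<le> (1 + 2 * c + 2 * z) * (norm a + norm b + norm d)"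
proof -
  have "norm (lift a b d) \<le> norm b + norm (of_real z * a - of_real c * b) + norm (of_real z * b - of_real c * d)"
    using norm_le_sum_3[of "lift a b d"] by (simp add: lift_def)
  also have "\<dots> \<le> norm b + (z * norm a + c * norm b) + (z * norm b + c * norm d)"
    using c z_pos by (intro add_mono order_trans[OF norm_triangle_ineq4]) (auto simp: norm_mult)
  also have "\<dots> \<le> (1 + 2 * c + 2 * z) * (norm a + norm b + norm d)"
  proof -
    have "c * norm a \<ge> 0" "c * norm b \<ge> 0" "c * norm d \<ge> 0" "z * norm a \<ge> 0" "z * norm b \<ge> 0" "z * norm d \<ge> 0"
      using c z_pos by auto
    then show ?thesis using norm_ge_zero[of a] norm_ge_zero[of d] by (simp add: algebra_simps)
  qed
  finally show ?thesis .
qed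

lemma S3_bounded: "\<exists>B. \<forall>x. norm (exp (x *\<^sub>R (- M3)) *s S3 x) \<le> B"
proof -
  obtain B0 B1 B2 where B: "\<And>x. norm (V0 z x) \<le> B0" "\<And>x. norm (V1 z x) \<le> B1" "\<And>x. norm (V2 z x) \<le> B2"
    using V_bounded_continuous[OF z_nonneg] by (auto simp: bounded_continuous_def)
  have "norm (exp (x *\<^sub>R (- M3)) *s S3 x) \<le> (1 + 2 * c + 2 * z) * (B0 + B1 + B2)" for x
    unfolding S3_scaled using c z_pos
    by (intro order_trans[OF norm_lift_le] mult_left_mono add_mono)
       (auto intro: order_trans[OF abs_Re_le_cmod B(1)] order_trans[OF abs_Re_le_cmod B(2)] order_trans[OF abs_Re_le_cmod B(3)])
  then show ?thesis by blast
qed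

end

section \<open>Zeros of the Evans quotient\<close>

lemma filterlim_abs_at_top_or_bot:
  assumes "F = at_top \<or> F = at_bot"
  shows "filterlim (\<lambda>x :: real. \<bar>x\<bar>) at_top F"
proof -
  have "filterlim (\<lambda>x :: real. \<bar>x\<bar>) at_top at_top"
    by (rule filterlim_at_top_mono[OF filterlim_ident always_eventually]) (auto intro: abs_ge_self)
  moreover from this have "filterlim (\<lambda>x :: real. \<bar>x\<bar>) at_top at_bot"
    unfolding filterlim_at_bot_mirror by simp
  ultimately show ?thesis using assms by blast
qed

lemma tends_to_identity_vector:
  fixes P :: "real \<Rightarrow> complex^'n^'n"
  assumes P: "tends_to_identity_exponentially P F" and F: "F = at_top \<or> F = at_bot"
  shows "((\<lambda>x. P x *v v) \<longlongrightarrow> v) F"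
proof -
  obtain C \<eta> where C: "\<eta> > 0" "\<forall>\<^sub>F x in F. norm (P x - mat 1) \<le> C * exp (- \<eta> * \<bar>x\<bar>)"
    using P by (auto simp: tends_to_identity_exponentially_def)
  have "filterlim (\<lambda>x. \<eta> * \<bar>x\<bar>) at_top F"
    by (rule filterlim_tendsto_pos_mult_at_top[OF tendsto_const C(1) filterlim_abs_at_top_or_bot[OF F]])
  then have "filterlim (\<lambda>x. - \<eta> * \<bar>x\<bar>) at_bot F" by (simp add: filterlim_uminus_at_bot)
  then have "((\<lambda>x. C * exp (- \<eta> * \<bar>x\<bar>)) \<longlongrightarrow> 0) F"
    by (intro tendsto_mult_right_zero filterlim_compose[OF exp_at_bot])
  then have "((\<lambda>x. P x - mat 1) \<longlongrightarrow> 0) F" by (rule Lim_null_comparison[OF C(2)])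
  then have PI: "(P \<longlongrightarrow> mat 1) F" by (simp add: LIM_zero_iff)
  have "bounded_linear (\<lambda>M :: complex^'n^'n. M *v v)"
    using linear_matrix_vector linear_conv_bounded_linear by blast
  from bounded_linear.tendsto[OF this PI] show ?thesis by simp
qed

context evans_problem
begin

lemma growth_linear: "growth (a *s u + b *s v) = a * growth u + b * growth v"
  unfolding growth_def scalar0_def scalar2_def by (simp add: add_divide_distrib diff_divide_distrib algebra_simps)

lemma growth_tendsto: "(f \<longlongrightarrow> l) F \<Longrightarrow> ((\<lambda>x. growth (f x)) \<longlongrightarrow> growth l) F"
  unfolding growth_def scalar0_def scalar2_def
  using c_nz z_nz by (intro tendsto_intros tendsto_vec_nth)

text \<open>\<open>W3\<close> is a multiple of \<open>S3\<close>, and the determinant of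
  \<open>W1\<close>, \<open>W2\<close>, \<open>S3\<close> is \<open>exp (z x / c)\<close> times a
  constant. Evaluated at \<open>-\<infinity>\<close>, that constant is a multiple of the limit of
  \<open>growth\<close> on the scaled \<open>S3\<close>, that is, of
  \<open>transmission z\<close>.\<close>

lemma evans_quotient_zero:
  assumes T: "transmission z = 0" and q: "evans_quotient A A0 d"
  shows "d = 0"
proof -
  obtain S U v1 v2 v3 W1 W2 W3 Pm Pp where
    q: "consistent_splitting A0 S U" "vec.span {v1, v2} = U" "vec.span {v3} = S"
    "linear_ode_solution A W1" "linear_ode_solution A W2" "linear_ode_solution A W3"
    "\<And>x. W1 x = Pm x *v (matrix_exp (x *\<^sub>R A0) *v v1)"
    "\<And>x. W2 x = Pm x *v (matrix_exp (x *\<^sub>R A0) *v v2)"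
    "\<And>x. W3 x = Pp x *v (matrix_exp (x *\<^sub>R A0) *v v3)"
    "tends_to_identity_exponentially Pm at_bot" "tends_to_identity_exponentially Pp at_top"
    and d: "d = det_columns (W1 0) (W2 0) (W3 0) / det_columns v1 v2 v3"
    using q unfolding evans_quotient_def by blast
  have S: "S = vec.span {E3}" and U: "U = vec.span {E1, E2}"
    using q(1) unfolding consistent_splitting_iff by blast+
  have "v3 \<in> vec.span {E3}" using q(3) S by (metis vec.span_base singletonI)
  then obtain s where s: "v3 = s *s E3" by (auto simp: in_span_1)
  \<comment> \<open>the solution decaying at \<open>+\<infinity>\<close> is a multiple of \<open>S3\<close>\<close>
  have sc3: "exp (x *\<^sub>R (- M3)) *s W3 x = s *s (Pp x *v E3)" for x
  proof -
    have "exp (x *\<^sub>R (- M3)) * (s * exp (x *\<^sub>R M3)) = s * (exp (x *\<^sub>R (- M3)) * exp (x *\<^sub>R M3))" by simp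
    also have "exp (x *\<^sub>R (- M3)) * exp (x *\<^sub>R M3) = 1" by (simp flip: exp_add)
    finally have e: "exp (x *\<^sub>R (- M3)) * (s * exp (x *\<^sub>R M3)) = s" by simp
    show ?thesis unfolding q(9) s by (simp only: vector_scalar_commute exp_E vec.scale_scale e)
  qed
  define l where "l = growth (s *s E3)"
  have lim3: "((\<lambda>x. exp (x *\<^sub>R (- M3)) *s W3 x) \<longlongrightarrow> s *s E3) at_top"
  proof (rule vec_tendstoI)
    fix i
    show "((\<lambda>x. (exp (x *\<^sub>R (- M3)) *s W3 x) $ i) \<longlongrightarrow> (s *s E3) $ i) at_top"
      unfolding sc3 vector_smult_component
      by (intro tendsto_intros tendsto_vec_nth tends_to_identity_vector q) simp
  qed
  obtain B3 where B3: "\<And>x. norm (exp (x *\<^sub>R (- M3)) *s S3 x) \<le> B3" using S3_bounded by blast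
  \<comment> \<open>The limits of \<open>growth\<close> at \<open>+\<infinity>\<close>, after
    scaling, are \<open>l\<close> for \<open>W3\<close> and 1 for \<open>S3\<close>, so they cancel
    in \<open>D\<close>.\<close>
  define D where "D x = 1 *s W3 x + (- l) *s S3 x" for x
  have Dsc: "exp (x *\<^sub>R (- M3)) *s D x = 1 *s (exp (x *\<^sub>R (- M3)) *s W3 x) + (- l) *s (exp (x *\<^sub>R (- M3)) *s S3 x)" for x
    unfolding D_def by (simp add: vec_eq_iff algebra_simps)
  have "\<forall>\<^sub>F x in at_top. norm (exp (x *\<^sub>R (- M3)) *s W3 x) < norm (s *s E3) + 1"
    by (rule order_tendstoD(2)[OF tendsto_norm[OF lim3]]) simp
  then obtain X where X: "\<And>x. x \<ge> X \<Longrightarrow> norm (exp (x *\<^sub>R (- M3)) *s W3 x) < norm (s *s E3) + 1"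
    by (auto simp: eventually_at_top_linorder)
  have nl: "norm ((- l) *s v) \<le> norm l * (norm (v$1) + norm (v$2) + norm (v$3))" for v :: "complex^3"
    using norm_le_sum_3[of "(- l) *s v"] by (simp add: norm_mult algebra_simps)
  have "D x = 0" for x
  proof (rule decaying_solution_zero)
    show "linear_ode_solution A D" unfolding D_def by (intro linear_ode_solution_linear q S3_solution)
    show "norm (exp (x *\<^sub>R (- M3)) *s D x) \<le> (norm (s *s E3) + 1) + norm l * (B3 + B3 + B3)" if "x \<ge> X" for x
      unfolding Dsc vec.scale_one
    proof (rule order_trans[OF norm_triangle_ineq add_mono])
      have b: "norm ((exp (x *\<^sub>R (- M3)) *s S3 x) $ i) \<le> B3" for i
        by (rule order_trans[OF Finite_Cartesian_Product.norm_nth_le B3])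
      show "norm ((- l) *s (exp (x *\<^sub>R (- M3)) *s S3 x)) \<le> norm l * (B3 + B3 + B3)"
        by (rule order_trans[OF nl]) (intro mult_left_mono add_mono b norm_ge_zero)
    qed (use X[OF that] in simp)
    have "((\<lambda>x. 1 * growth (exp (x *\<^sub>R (- M3)) *s W3 x) + (- l) * of_real (Re (amp z x))) \<longlongrightarrow> 1 * l + (- l) * of_real (Re 1)) at_top"
      unfolding l_def by (intro tendsto_intros growth_tendsto[OF lim3] amp_facts z_nonneg)
    then show "((\<lambda>x. growth (exp (x *\<^sub>R (- M3)) *s D x)) \<longlongrightarrow> 0) at_top"
      unfolding Dsc growth_linear S3_growth by simp
  qed
  then have W3: "W3 0 = l *s S3 0" by (simp add: D_def vec_eq_iff)
  \<comment> \<open>the growing part of \<open>S3\<close> at \<open>-\<infinity>\<close> vanishes, so it lies in the span of \<open>W1\<close> and \<open>W2\<close>\<close>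
  obtain B1 B2 where BB: "vec.span {B1, B2} = vec.span {E1, E2}" "B1 = E1"
    and B2: "m1 z \<noteq> m2 z \<and> B2 = E1 - (m1 z - m2 z) *s E2 \<and> (\<forall>x. matrix_exp (x *\<^sub>R A0) *v B2 = exp (x *\<^sub>R m2 z) *s B2) \<or>
     m1 z = m2 z \<and> B2 = E2 \<and> (\<forall>x. matrix_exp (x *\<^sub>R A0) *v B2 = exp (x *\<^sub>R m2 z) *s B2 + (of_real x * exp (x *\<^sub>R m2 z)) *s E1)"
    by (rule unstable_exp_basis)
  \<comment> \<open>The Jordan term is a multiple of \<open>B1\<close> in either case and drops out
    of the determinant, so \<open>\<theta>\<close> may stay unspecified.\<close>
  have "\<exists>\<theta>. \<forall>x. matrix_exp (x *\<^sub>R A0) *v B2 = exp (x *\<^sub>R M2) *s B2 + \<theta> x *s B1"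
    using B2
  proof (elim disjE conjE)
    assume "\<forall>x. matrix_exp (x *\<^sub>R A0) *v B2 = exp (x *\<^sub>R M2) *s B2"
    then show ?thesis by (intro exI[of _ "\<lambda>_. 0"]) simp
  next
    assume "\<forall>x. matrix_exp (x *\<^sub>R A0) *v B2 = exp (x *\<^sub>R M2) *s B2 + (of_real x * exp (x *\<^sub>R M2)) *s E1"
    then show ?thesis unfolding BB(2) by (rule exI[of _ "\<lambda>x. of_real x * exp (x *\<^sub>R M2)"])
  qed
  then obtain \<theta> where e2: "\<And>x. matrix_exp (x *\<^sub>R A0) *v B2 = exp (x *\<^sub>R M2) *s B2 + \<theta> x *s B1" by blast
  have e1: "matrix_exp (x *\<^sub>R A0) *v B1 = exp (x *\<^sub>R M1) *s B1" for x unfolding BB(2) by (rule exp_E)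
  obtain \<rho> where \<rho>: "\<And>v. det_columns B1 B2 v = \<rho> * growth v"
  proof -
    have "\<exists>r. \<forall>v. det_columns B1 B2 v = r * det_columns E1 E2 v"
      using B2
    proof (elim disjE conjE)
      assume b2: "B2 = E1 - (m1 z - m2 z) *s E2"
      have "det_columns p (p - r *s p') v = (- r) * det_columns p p' v" for p p' v r
        by (simp add: det_columns_eq algebra_simps)
      then have "\<forall>v. det_columns B1 B2 v = (- (m1 z - m2 z)) * det_columns E1 E2 v"
        unfolding BB(2) b2 by blast
      then show ?thesis by blast
    next
      assume "B2 = E2"
      then have "\<forall>v. det_columns B1 B2 v = 1 * det_columns E1 E2 v" using BB(2) by simp
      then show ?thesis by blast
    qed
    then obtain r where "\<And>v. det_columns B1 B2 v = r * det_columns E1 E2 v" by blast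
    then have "\<And>v. det_columns B1 B2 v = (r * (of_real z * of_real c)) * growth v" by (simp add: det_E12)
    then show ?thesis by (rule that)
  qed
  have "v1 \<in> vec.span {B1, B2}" "v2 \<in> vec.span {B1, B2}"
    unfolding BB(1) U[symmetric] q(2)[symmetric] by (auto intro: vec.span_base)
  then obtain a1 b1 a2 b2 where v: "v1 = a1 *s B1 + b1 *s B2" "v2 = a2 *s B1 + b2 *s B2"
    unfolding in_span_2 by blast
  define G where "G x = det_columns (W1 x) (W2 x) (S3 x)" for x
  define F where "F x = exp (x *\<^sub>R (- (of_real (z / c)))) * G x" for x
  have dG: "(G has_vector_derivative of_real z / of_real c * G x) (at x)" for x
    unfolding G_def[abs_def] by (rule Abel_identity[OF c_nz(1) A_def q(4,5) S3_solution])
  have "(F has_vector_derivative 0) (at x)" for x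
  proof -
    have "(F has_vector_derivative exp (x *\<^sub>R (- of_real (z / c))) * (of_real z / of_real c * G x)
        + (- of_real (z / c)) * exp (x *\<^sub>R (- of_real (z / c))) * G x) (at x)"
      unfolding F_def[abs_def] by (rule has_vector_derivative_mult[OF has_vector_derivative_exp_scaleR dG])
    then show ?thesis by (rule has_vector_derivative_eq_rhs) simp
  qed
  from vector_derivative_zero_constant[OF this] have Fc: "F x = F 0" for x .
  let ?p1 = "\<lambda>x. Pm x *v B1" and ?p2 = "\<lambda>x. Pm x *v B2" and ?s = "\<lambda>x. exp (x *\<^sub>R (- M3)) *s S3 x"
  \<comment> \<open>The roots sum to \<open>z / c\<close>, so the three exponentials combine to
    \<open>exp (- M3 x)\<close>, precisely the factor that keeps \<open>S3\<close> bounded.\<close>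
  have Feq: "F x = (a1 * b2 - b1 * a2) * det_columns (?p1 x) (?p2 x) (?s x)" for x
  proof -
    let ?x1 = "exp (x *\<^sub>R M1)" and ?x2 = "exp (x *\<^sub>R M2)"
    have w: "W1 x = a1 *s (?x1 *s ?p1 x) + b1 *s (?x2 *s ?p2 x + \<theta> x *s ?p1 x)"
      "W2 x = a2 *s (?x1 *s ?p1 x) + b2 *s (?x2 *s ?p2 x + \<theta> x *s ?p1 x)"
      unfolding q(7,8) v by (simp_all only: matrix_vector_right_distrib vector_scalar_commute e1 e2)
    have G: "G x = (a1 * b2 - b1 * a2) * (?x1 * ?x2) * det_columns (?p1 x) (?p2 x) (S3 x)"
      unfolding G_def w by (simp add: det_columns_eq algebra_simps)
    have e: "exp (x *\<^sub>R (- (of_real (z / c)))) * (?x1 * ?x2) = exp (x *\<^sub>R (- M3))"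
      unfolding vieta(1)[OF z_nonneg, symmetric] by (simp add: algebra_simps flip: exp_add)
    have r: "a * (b * p * y) = b * ((a * p) * y)" for a b p y :: complex by (simp only: mult_ac)
    show ?thesis unfolding F_def G r e det_columns_linear_3 ..
  qed
  have lim1: "(?p1 \<longlongrightarrow> B1) at_bot" and lim2: "(?p2 \<longlongrightarrow> B2) at_bot"
    by (rule tends_to_identity_vector[OF q(10)], simp)+
  have n3: "norm (?s x $ i) \<le> B3" for x i
    by (rule order_trans[OF Finite_Cartesian_Product.norm_nth_le B3])
  \<comment> \<open>At \<open>-\<infinity>\<close> the scaled \<open>S3\<close> is known to be
    bounded, but a limit is available only for its \<open>growth\<close>. Expanding along the third
    column separates it from the converging cofactors.\<close>
  define cof where "cof i u v = det_columns u v (axis i 1)" for i :: 3 and u v :: "complex^3"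
  have det_cof: "det_columns u v y = y$1 * cof 1 u v + y$2 * cof 2 u v + y$3 * cof 3 u v" for u v y
    by (simp add: cof_def det_columns_eq axis_def algebra_simps)
  have cof_lim: "((\<lambda>x. cof i (?p1 x) (?p2 x) - cof i B1 B2) \<longlongrightarrow> 0) at_bot" for i
  proof -
    have "((\<lambda>x. cof i (?p1 x) (?p2 x)) \<longlongrightarrow> cof i B1 B2) at_bot"
      unfolding cof_def det_columns_eq
      by (intro tendsto_intros tendsto_vec_nth lim1 lim2)
    then show ?thesis by (simp add: LIM_zero_iff)
  qed
  have small: "((\<lambda>x. ?s x $ i * (cof i (?p1 x) (?p2 x) - cof i B1 B2)) \<longlongrightarrow> 0) at_bot" for i
  proof (rule Lim_null_comparison)
    show "((\<lambda>x. B3 * norm (cof i (?p1 x) (?p2 x) - cof i B1 B2)) \<longlongrightarrow> 0) at_bot"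
      by (intro tendsto_mult_right_zero tendsto_norm_zero cof_lim)
    show "\<forall>\<^sub>F x in at_bot. norm (?s x $ i * (cof i (?p1 x) (?p2 x) - cof i B1 B2)) \<le> B3 * norm (cof i (?p1 x) (?p2 x) - cof i B1 B2)"
      unfolding norm_mult by (intro always_eventually allI mult_right_mono n3) simp
  qed
  have "((\<lambda>x. det_columns B1 B2 (?s x)) \<longlongrightarrow> \<rho> * of_real (transmission z)) at_bot"
    unfolding \<rho> S3_growth by (intro tendsto_intros transmission_tendsto z_nonneg)
  from tendsto_add[OF tendsto_add[OF tendsto_add[OF small[of 1] small[of 2]] small[of 3]] this]
  have "((\<lambda>x. det_columns (?p1 x) (?p2 x) (?s x)) \<longlongrightarrow> 0) at_bot"
    unfolding T det_cof by (simp add: algebra_simps)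
  from tendsto_mult_right_zero[OF this, of "a1 * b2 - b1 * a2"]
  have "(F \<longlongrightarrow> 0) at_bot" unfolding Feq[symmetric] .
  moreover have "F = (\<lambda>_. F 0)" using Fc by blast
  ultimately have "((\<lambda>_ :: real. F 0) \<longlongrightarrow> 0) at_bot" by simp
  then have "F 0 = 0" by (simp add: tendsto_const_iff)
  then have "det_columns (W1 0) (W2 0) (W3 0) = 0"
    unfolding W3 det_columns_linear_3 by (simp add: F_def G_def)
  then show "d = 0" unfolding d by simp
qed

end

section \<open>Existence of the Evans data\<close>

lemma linear_exp_bound:
  fixes \<eta> x :: real
  assumes "\<eta> > 0" "x \<ge> 0"
  shows "(1 + x) * exp (- \<eta> * x) \<le> 1 + 1 / \<eta>"
proof -
  have "1 + \<eta> * x \<le> exp (\<eta> * x)" by (rule exp_ge_add_one_self)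
  moreover have "\<eta> * x \<ge> 0" using assms by simp
  ultimately have e: "1 \<le> exp (\<eta> * x)" "\<eta> * x \<le> exp (\<eta> * x)" by linarith+
  then have "x \<le> 1 / \<eta> * exp (\<eta> * x)" using assms(1) by (simp add: field_simps)
  then have "1 + x \<le> exp (\<eta> * x) + 1 / \<eta> * exp (\<eta> * x)" using e(1) by linarith
  then have "1 + x \<le> (1 + 1 / \<eta>) * exp (\<eta> * x)" by (simp only: distrib_right mult_1)
  then have "(1 + x) * exp (- \<eta> * x) \<le> (1 + 1 / \<eta>) * exp (\<eta> * x) * exp (- \<eta> * x)"
    by (intro mult_right_mono) auto
  moreover have "exp (\<eta> * x) * exp (- \<eta> * x) = 1" by (simp flip: exp_add)
  ultimately show ?thesis by (simp only: mult.assoc mult_1_right)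
qed

text \<open>The decay rate \<open>\<delta>\<close> of the correction must avoid the finitely many values for which
  a translated root \<open>m\<^sub>i - m + \<delta>\<close> is purely imaginary.\<close>

lemma asymptotic_solution:
  fixes h :: "real \<Rightarrow> real" and m1 m2 m3 m :: complex and p0 p1 p2 :: "real \<Rightarrow> complex"
  assumes h: "continuous_on UNIV h" "\<And>x. \<bar>h x\<bar> \<le> K * exp (- \<eta> * \<bar>x\<bar>)" and eta: "\<eta> > 0"
    and p: "\<And>x. (p0 has_vector_derivative p1 x) (at x)" "\<And>x. (p1 has_vector_derivative p2 x) (at x)"
      "\<And>x. (p2 has_vector_derivative (m1 + m2 + m3) * p2 x - (m1 * m2 + m1 * m3 + m2 * m3) * p1 x + m1 * m2 * m3 * p0 x) (at x)"
    and pb: "\<And>x. x \<ge> 0 \<Longrightarrow> norm (p1 x) \<le> C * ((1 + x) * exp (x * Re m))"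
  shows "\<exists>\<delta> X B w0 w1 w2. \<delta> > 0 \<and> X \<ge> 0 \<and> (\<forall>x\<ge>X.
    (w0 has_vector_derivative w1 x) (at x) \<and> (w1 has_vector_derivative w2 x) (at x) \<and>
    (w2 has_vector_derivative (m1 + m2 + m3) * w2 x - (m1 * m2 + m1 * m3 + m2 * m3) * w1 x + m1 * m2 * m3 * w0 x + of_real (h x) * w1 x) (at x) \<and>
    norm (w0 x - p0 x) \<le> B * exp (x * (Re m - \<delta>)) \<and> norm (w1 x - p1 x) \<le> B * exp (x * (Re m - \<delta>)) \<and>
    norm (w2 x - p2 x) \<le> B * exp (x * (Re m - \<delta>)))"
proof -
  let ?bad = "{Re m - Re m1, Re m - Re m2, Re m - Re m3}"
  have "infinite ({0<..<\<eta> / 2} - ?bad)" using eta by (intro Diff_infinite_finite) auto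
  then obtain \<delta> where \<delta>: "\<delta> \<in> {0<..<\<eta> / 2}" "\<delta> \<notin> ?bad" by (metis Diff_iff finite.emptyI equals0I)
  \<comment> \<open>The bound \<open>\<delta> < \<eta> / 2\<close> leaves more than
    \<open>\<eta> / 2\<close> of the decay of \<open>h\<close> in the source, enough to absorb the
    linear factor \<open>1 + x\<close>.\<close>
  have d0: "\<delta> > 0" "\<delta> < \<eta> / 2" using \<delta> by auto
  define \<kappa> where "\<kappa> = m - of_real \<delta>"
  define n1 n2 n3 where "n1 = m1 - \<kappa>" and "n2 = m2 - \<kappa>" and "n3 = m3 - \<kappa>"
  have n: "Re n1 \<noteq> 0" "Re n2 \<noteq> 0" "Re n3 \<noteq> 0" using \<delta>(2) by (auto simp: n1_def n2_def n3_def \<kappa>_def)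
  \<comment> \<open>The residual \<open>h p1\<close> of the unperturbed solution, in the scale of
    the correction.\<close>
  define q where "q x = exp (x *\<^sub>R (- \<kappa>)) * (of_real (h x) * p1 x)" for x
  have K: "K \<ge> 0" using order_trans[OF abs_ge_zero h(2)[of 0]] by simp
  have C: "C \<ge> 0" using order_trans[OF norm_ge_zero pb[of 0]] by simp
  have p1c: "continuous_on UNIV p1"
    using p(2) by (meson continuous_at_imp_continuous_on has_vector_derivative_continuous)
  have qc: "continuous_on UNIV q" unfolding q_def by (intro continuous_intros h p1c)
  have qb: "norm (q x) \<le> K * C * (1 + 1 / (\<eta> / 2))" if x: "x \<ge> 0" for x
  proof -
    have "norm (q x) = exp (x * (\<delta> - Re m)) * (\<bar>h x\<bar> * norm (p1 x))"
      by (simp add: q_def norm_mult norm_exp_eq_Re \<kappa>_def)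
    also have "\<dots> \<le> exp (x * (\<delta> - Re m)) * ((K * exp (- \<eta> * x)) * (C * ((1 + x) * exp (x * Re m))))"
      using h(2)[of x] pb[OF x] x K by (intro mult_left_mono mult_mono) auto
    also have "\<dots> = K * C * ((1 + x) * (exp (x * (\<delta> - Re m)) * exp (- \<eta> * x) * exp (x * Re m)))"
      by (simp only: mult_ac)
    also have "exp (x * (\<delta> - Re m)) * exp (- \<eta> * x) * exp (x * Re m) = exp (x * (\<delta> - \<eta>))"
      by (simp add: exp_add[symmetric] algebra_simps)
    also have "K * C * ((1 + x) * exp (x * (\<delta> - \<eta>))) \<le> K * C * ((1 + x) * exp (- (\<eta> / 2) * x))"
    proof -
      have "x * (\<delta> - \<eta>) \<le> x * (- (\<eta> / 2))" using d0 x by (intro mult_left_mono) auto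
      then have "exp (x * (\<delta> - \<eta>)) \<le> exp (- (\<eta> / 2) * x)" by (simp add: mult.commute)
      then show ?thesis using K C x by (intro mult_left_mono) auto
    qed
    also have "\<dots> \<le> K * C * (1 + 1 / (\<eta> / 2))"
      using K C eta x by (intro mult_left_mono linear_exp_bound) auto
    finally show ?thesis .
  qed
  have h0: "(h \<longlongrightarrow> 0) at_top"
  proof (rule Lim_null_comparison)
    show "\<forall>\<^sub>F x in at_top. norm (h x) \<le> K * exp (- \<eta> * \<bar>x\<bar>)" using h(2) by (intro always_eventually) simp
    have "filterlim (\<lambda>x. \<eta> * \<bar>x\<bar>) at_top at_top"
      by (rule filterlim_tendsto_pos_mult_at_top[OF tendsto_const eta filterlim_abs_at_top_or_bot]) simp
    then have "filterlim (\<lambda>x. - \<eta> * \<bar>x\<bar>) at_bot at_top" by (simp add: filterlim_uminus_at_bot)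
    then show "((\<lambda>x. K * exp (- \<eta> * \<bar>x\<bar>)) \<longlongrightarrow> 0) at_top"
      by (intro tendsto_mult_right_zero filterlim_compose[OF exp_at_bot])
  qed
  obtain X r r1 r2 where X: "X \<ge> 0" and bc: "bounded_continuous r" "bounded_continuous r1" "bounded_continuous r2"
    and r: "\<And>x. (r has_vector_derivative r1 x) (at x)" "\<And>x. (r1 has_vector_derivative r2 x) (at x)"
    "\<And>x. x \<ge> X \<Longrightarrow> (r2 has_vector_derivative (n1 + n2 + n3) * r2 x - (n1 * n2 + n1 * n3 + n2 * n3) * r1 x
       + n1 * n2 * n3 * r x + of_real (h x) * (r1 x + \<kappa> * r x) + q x) (at x)"
    using asymptotic_correction[OF h(1) h0 n qc qb, of \<kappa>] by blast
  define w0 where "w0 x = p0 x + exp (x *\<^sub>R \<kappa>) * r x" for x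
  define w1 where "w1 x = p1 x + exp (x *\<^sub>R \<kappa>) * (r1 x + \<kappa> * r x)" for x
  define w2 where "w2 x = p2 x + exp (x *\<^sub>R \<kappa>) * (r2 x + \<kappa> * r1 x + \<kappa> * (r1 x + \<kappa> * r x))" for x
  have de: "((\<lambda>x. exp (x *\<^sub>R \<kappa>) * f x) has_vector_derivative exp (x *\<^sub>R \<kappa>) * (f' + \<kappa> * f x)) (at x)"
    if "(f has_vector_derivative f') (at x)" for f f' x
  proof -
    have "((\<lambda>x. exp (x *\<^sub>R \<kappa>) * f x) has_vector_derivative exp (x *\<^sub>R \<kappa>) * f' + \<kappa> * exp (x *\<^sub>R \<kappa>) * f x) (at x)"
      by (rule has_vector_derivative_mult[OF has_vector_derivative_exp_scaleR that])
    then show ?thesis by (rule has_vector_derivative_eq_rhs) (simp add: algebra_simps)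
  qed
  have dw0: "(w0 has_vector_derivative w1 x) (at x)" for x
    unfolding w0_def[abs_def] w1_def by (intro has_vector_derivative_add de r p)
  have dw1: "(w1 has_vector_derivative w2 x) (at x)" for x
    unfolding w1_def[abs_def] w2_def by (intro has_vector_derivative_add de has_vector_derivative_mult_right r p)
  have dw2: "(w2 has_vector_derivative (m1 + m2 + m3) * w2 x - (m1 * m2 + m1 * m3 + m2 * m3) * w1 x + m1 * m2 * m3 * w0 x + of_real (h x) * w1 x) (at x)"
    if "x \<ge> X" for x
  proof -
    let ?R = "(n1 + n2 + n3) * r2 x - (n1 * n2 + n1 * n3 + n2 * n3) * r1 x + n1 * n2 * n3 * r x + of_real (h x) * (r1 x + \<kappa> * r x) + q x"
    let ?e = "exp (x *\<^sub>R \<kappa>)"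
    have "(w2 has_vector_derivative ((m1 + m2 + m3) * p2 x - (m1 * m2 + m1 * m3 + m2 * m3) * p1 x + m1 * m2 * m3 * p0 x)
       + ?e * ((?R + \<kappa> * r2 x + \<kappa> * (r2 x + \<kappa> * r1 x)) + \<kappa> * (r2 x + \<kappa> * r1 x + \<kappa> * (r1 x + \<kappa> * r x)))) (at x)"
      unfolding w2_def[abs_def] by (intro has_vector_derivative_add de has_vector_derivative_mult_right r p that)
    moreover have "?e * q x = of_real (h x) * p1 x"
    proof -
      have "?e * exp (x *\<^sub>R (- \<kappa>)) = 1" by (simp flip: exp_add)
      then show ?thesis unfolding q_def by (metis mult.assoc mult_1)
    qed
    then have "?e * ((?R + \<kappa> * r2 x + \<kappa> * (r2 x + \<kappa> * r1 x)) + \<kappa> * (r2 x + \<kappa> * r1 x + \<kappa> * (r1 x + \<kappa> * r x)))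
       = ?e * (?R - q x + \<kappa> * r2 x + \<kappa> * (r2 x + \<kappa> * r1 x) + \<kappa> * (r2 x + \<kappa> * r1 x + \<kappa> * (r1 x + \<kappa> * r x))) + of_real (h x) * p1 x"
      by (simp only: distrib_left right_diff_distrib) simp
    ultimately show ?thesis
      by (elim has_vector_derivative_eq_rhs)
         (simp add: w0_def w1_def w2_def n1_def n2_def n3_def algebra_simps)
  qed
  obtain B0 B1 B2 where B: "B0 > 0" "\<And>x. norm (r x) \<le> B0" "B1 > 0" "\<And>x. norm (r1 x) \<le> B1" "B2 > 0" "\<And>x. norm (r2 x) \<le> B2"
    using bc by (elim bounded_continuousE) blast
  define u where "u = norm \<kappa>"
  have u: "u \<ge> 0" by (simp add: u_def)
  define Bm where "Bm = B0 + (B1 + u * B0) + (B2 + u * B1 + u * (B1 + u * B0))"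
  have n_e: "norm (exp (x *\<^sub>R \<kappa>)) = exp (x * (Re m - \<delta>))" for x
    by (simp add: norm_exp_eq_Re \<kappa>_def)
  have bb0: "norm (r x) \<le> Bm" for x
    using B(2)[of x] B u unfolding Bm_def by (smt (verit) mult_nonneg_nonneg)
  have s1: "norm (r1 x + \<kappa> * r x) \<le> B1 + u * B0" for x
    unfolding u_def using B by (intro order_trans[OF norm_triangle_ineq] add_mono) (auto simp: norm_mult intro: mult_left_mono)
  have bb1: "norm (r1 x + \<kappa> * r x) \<le> Bm" for x
    using s1[of x] B u unfolding Bm_def by (smt (verit) mult_nonneg_nonneg)
  have s2: "norm (r2 x + \<kappa> * r1 x + \<kappa> * (r1 x + \<kappa> * r x)) \<le> B2 + u * B1 + u * (B1 + u * B0)" for x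
    using B s1 unfolding u_def
    by (intro order_trans[OF norm_triangle_ineq] add_mono) (auto simp: norm_mult intro!: mult_left_mono)
  have bb2: "norm (r2 x + \<kappa> * r1 x + \<kappa> * (r1 x + \<kappa> * r x)) \<le> Bm" for x
    using s2[of x] B u unfolding Bm_def by (smt (verit) mult_nonneg_nonneg)
  have fin: "norm (exp (x *\<^sub>R \<kappa>) * y) \<le> Bm * exp (x * (Re m - \<delta>))" if "norm y \<le> Bm" for x y
    unfolding norm_mult n_e mult.commute[of Bm] by (rule mult_left_mono[OF that]) simp
  have "norm (w0 x - p0 x) \<le> Bm * exp (x * (Re m - \<delta>))" "norm (w1 x - p1 x) \<le> Bm * exp (x * (Re m - \<delta>))"
    "norm (w2 x - p2 x) \<le> Bm * exp (x * (Re m - \<delta>))" for x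
    using fin[OF bb0] fin[OF bb1] fin[OF bb2] by (simp_all add: w0_def w1_def w2_def)
  then show ?thesis using d0 X dw0 dw1 dw2 by blast
qed

section \<open>Global solutions with prescribed asymptotics\<close>

context evans_problem
begin

text \<open>The global solution of the initial value problem at \<open>X\<close> agrees with
  \<open>Wl\<close> on \<open>S\<close> by uniqueness along segments, so a solution built near one
  end continues to the whole line.\<close>

lemma extend_solution:
  assumes S: "convex S" "X \<in> S" and Wl: "\<And>x. x \<in> S \<Longrightarrow> (Wl has_vector_derivative A x *v Wl x) (at x)"
  shows "\<exists>W. linear_ode_solution A W \<and> (\<forall>x\<in>S. W x = Wl x)"
proof -
  obtain Mb where Mb: "\<And>x v. norm (A x *v v) \<le> Mb * norm v" using A_bound by blast
  obtain W where W: "linear_ode_solution A W" "W X = Wl X"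
    using linear_ivp[OF A_continuous Mb] by blast
  define D where "D x = W x - Wl x" for x
  have "D x = 0" if x: "x \<in> S" for x
  proof -
    have dD: "(D has_vector_derivative A t *v D t) (at t)" if "t \<in> closed_segment X x" for t
    proof -
      have t: "t \<in> S" using closed_segment_subset[OF S(2) x S(1)] that by blast
      have "(W has_vector_derivative A t *v W t) (at t)" using W(1) unfolding linear_ode_solution_def by blast
      from has_vector_derivative_diff[OF this Wl[OF t]] show ?thesis
        unfolding D_def[abs_def] by (simp only: matrix_vector_mult_diff_distrib)
    qed
    have "D X = 0" using W(2) by (simp add: D_def)
    from linear_ode_zero[OF dD Mb this] show ?thesis by blast
  qed
  then show ?thesis using W(1) by (intro exI[of _ W]) (simp add: D_def)
qed

lemma solution_at_top:
  assumes p: "\<And>x. (p0 has_vector_derivative p1 x) (at x)" "\<And>x. (p1 has_vector_derivative p2 x) (at x)"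
      "\<And>x. (p2 has_vector_derivative third 0 (p0 x) (p1 x) (p2 x)) (at x)"
    and pb: "\<And>x. x \<ge> 0 \<Longrightarrow> norm (p1 x) \<le> C * ((1 + x) * exp (x * Re m))"
  shows "\<exists>W \<delta> B. \<delta> > 0 \<and> linear_ode_solution A W \<and>
    (\<forall>\<^sub>F x in at_top. norm (W x - lift (p0 x) (p1 x) (p2 x)) \<le> B * exp (x * (Re m - \<delta>)))"
proof -
  have th: "third t a b d = (M1 + M2 + M3) * d - (M1 * M2 + M1 * M3 + M2 * M3) * b + M1 * M2 * M3 * a + of_real t * b" for t a b d
    unfolding third_vieta by (simp add: algebra_simps)
  have p3: "(p2 has_vector_derivative (M1 + M2 + M3) * p2 x - (M1 * M2 + M1 * M3 + M2 * M3) * p1 x + M1 * M2 * M3 * p0 x) (at x)" for x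
    using p(3)[of x] unfolding th by simp
  obtain \<delta> X B w0 w1 w2 where d: "\<delta> > 0" and X: "\<And>x. x \<ge> X \<Longrightarrow> (w0 has_vector_derivative w1 x) (at x)"
    "\<And>x. x \<ge> X \<Longrightarrow> (w1 has_vector_derivative w2 x) (at x)"
    "\<And>x. x \<ge> X \<Longrightarrow> (w2 has_vector_derivative (M1 + M2 + M3) * w2 x - (M1 * M2 + M1 * M3 + M2 * M3) * w1 x + M1 * M2 * M3 * w0 x + of_real (h x) * w1 x) (at x)"
    "\<And>x. x \<ge> X \<Longrightarrow> norm (w0 x - p0 x) \<le> B * exp (x * (Re m - \<delta>))"
    "\<And>x. x \<ge> X \<Longrightarrow> norm (w1 x - p1 x) \<le> B * exp (x * (Re m - \<delta>))"
    "\<And>x. x \<ge> X \<Longrightarrow> norm (w2 x - p2 x) \<le> B * exp (x * (Re m - \<delta>))"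
    using asymptotic_solution[OF h eta p(1,2) p3 pb] by blast
  have "\<exists>W. linear_ode_solution A W \<and> (\<forall>x\<in>{X..}. W x = lift (w0 x) (w1 x) (w2 x))"
  proof (rule extend_solution[where X=X])
    show "((\<lambda>x. lift (w0 x) (w1 x) (w2 x)) has_vector_derivative A x *v lift (w0 x) (w1 x) (w2 x)) (at x)" if "x \<in> {X..}" for x
      using X(1-3)[of x] that by (intro lift_deriv) (auto simp: th)
  qed auto
  then obtain W where W: "linear_ode_solution A W" "\<And>x. x \<ge> X \<Longrightarrow> W x = lift (w0 x) (w1 x) (w2 x)" by auto
  have "norm (W x - lift (p0 x) (p1 x) (p2 x)) \<le> ((1 + 2 * c + 2 * z) * (3 * B)) * exp (x * (Re m - \<delta>))" if "x \<ge> X" for x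
  proof -
    have "norm (W x - lift (p0 x) (p1 x) (p2 x)) \<le> (1 + 2 * c + 2 * z) * (norm (w0 x - p0 x) + norm (w1 x - p1 x) + norm (w2 x - p2 x))"
      unfolding W(2)[OF that] diff_lift by (rule norm_lift_le)
    also have "\<dots> \<le> (1 + 2 * c + 2 * z) * (3 * (B * exp (x * (Re m - \<delta>))))"
      using X(4-6)[OF that] c z_pos by (intro mult_left_mono) auto
    finally show ?thesis by (simp only: mult.assoc)
  qed
  then show ?thesis using W(1) d eventually_ge_at_top[of X] by (blast intro: eventually_mono)
qed

text \<open>Reflection negates the three roots, replaces \<open>h x\<close> by
  \<open>h (- x)\<close> and changes the sign of the first derivative, which reduces the claim to
  the behaviour at \<open>+\<infinity>\<close>.\<close>

lemma solution_at_bot: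
  assumes p: "\<And>x. (p0 has_vector_derivative p1 x) (at x)" "\<And>x. (p1 has_vector_derivative p2 x) (at x)"
      "\<And>x. (p2 has_vector_derivative third 0 (p0 x) (p1 x) (p2 x)) (at x)"
    and pb: "\<And>x. x \<le> 0 \<Longrightarrow> norm (p1 x) \<le> C * ((1 - x) * exp (x * Re m))"
  shows "\<exists>W \<delta> B. \<delta> > 0 \<and> linear_ode_solution A W \<and>
    (\<forall>\<^sub>F x in at_bot. norm (W x - lift (p0 x) (p1 x) (p2 x)) \<le> B * exp (x * (Re m + \<delta>)))"
proof -
  have th: "third t a b d = (M1 + M2 + M3) * d - (M1 * M2 + M1 * M3 + M2 * M3) * b + M1 * M2 * M3 * a + of_real t * b" for t a b d
    unfolding third_vieta by (simp add: algebra_simps)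
  define r0 r1 r2 where "r0 x = p0 (- x)" and "r1 x = - p1 (- x)" and "r2 x = p2 (- x)" for x
  have rf: "((\<lambda>x. f (- x)) has_vector_derivative - f') (at x)" "((\<lambda>x. - f (- x)) has_vector_derivative f') (at x)"
    if "(f has_vector_derivative f') (at (- x))" for f :: "real \<Rightarrow> complex" and f' x
    using reflect_has_vector_derivative[OF that] has_vector_derivative_minus[OF reflect_has_vector_derivative[OF that]] by simp_all
  have r1: "(r0 has_vector_derivative r1 x) (at x)" for x unfolding r0_def[abs_def] r1_def by (intro rf p)
  have r2: "(r1 has_vector_derivative r2 x) (at x)" for x unfolding r1_def[abs_def] r2_def by (intro rf p)
  have r3: "(r2 has_vector_derivative (- M1 + - M2 + - M3) * r2 x - (- M1 * - M2 + - M1 * - M3 + - M2 * - M3) * r1 x + - M1 * - M2 * - M3 * r0 x) (at x)" for x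
    using rf(1)[OF p(3)[of "- x"]] unfolding r2_def[abs_def] r1_def r0_def th
    by (rule has_vector_derivative_eq_rhs) (simp add: algebra_simps)
  have rb: "norm (r1 x) \<le> C * ((1 + x) * exp (x * Re (- m)))" if "x \<ge> 0" for x
    using pb[of "- x"] that by (simp add: r1_def)
  have hc: "continuous_on UNIV (\<lambda>x. h (- x))"
    by (rule continuous_on_compose2[OF h(1)]) (auto intro!: continuous_intros)
  have hb: "\<bar>h (- x)\<bar> \<le> K * exp (- \<eta> * \<bar>x\<bar>)" for x using h(2)[of "- x"] by simp
  obtain \<delta> X B v0 v1 v2 where d: "\<delta> > 0" and X: "\<And>x. x \<ge> X \<Longrightarrow> (v0 has_vector_derivative v1 x) (at x)"
    "\<And>x. x \<ge> X \<Longrightarrow> (v1 has_vector_derivative v2 x) (at x)"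
    "\<And>x. x \<ge> X \<Longrightarrow> (v2 has_vector_derivative (- M1 + - M2 + - M3) * v2 x - (- M1 * - M2 + - M1 * - M3 + - M2 * - M3) * v1 x + - M1 * - M2 * - M3 * v0 x + of_real (h (- x)) * v1 x) (at x)"
    "\<And>x. x \<ge> X \<Longrightarrow> norm (v0 x - r0 x) \<le> B * exp (x * (Re (- m) - \<delta>))"
    "\<And>x. x \<ge> X \<Longrightarrow> norm (v1 x - r1 x) \<le> B * exp (x * (Re (- m) - \<delta>))"
    "\<And>x. x \<ge> X \<Longrightarrow> norm (v2 x - r2 x) \<le> B * exp (x * (Re (- m) - \<delta>))"
    using asymptotic_solution[OF hc hb eta r1 r2 r3 rb] by blast
  define w0 w1 w2 where "w0 x = v0 (- x)" and "w1 x = - v1 (- x)" and "w2 x = v2 (- x)" for x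
  have d0: "(w0 has_vector_derivative w1 x) (at x)" if "x \<le> - X" for x
    unfolding w0_def[abs_def] w1_def by (intro rf X) (use that in simp)
  have d1: "(w1 has_vector_derivative w2 x) (at x)" if "x \<le> - X" for x
    unfolding w1_def[abs_def] w2_def by (intro rf X) (use that in simp)
  have d2: "(w2 has_vector_derivative third (h x) (w0 x) (w1 x) (w2 x)) (at x)" if "x \<le> - X" for x
    using rf(1)[OF X(3)[of "- x"]] that unfolding w2_def[abs_def] w1_def w0_def th
    by (auto elim!: has_vector_derivative_eq_rhs simp: algebra_simps)
  have "\<exists>W. linear_ode_solution A W \<and> (\<forall>x\<in>{..- X}. W x = lift (w0 x) (w1 x) (w2 x))"
  proof (rule extend_solution[where X="- X"])
    show "((\<lambda>x. lift (w0 x) (w1 x) (w2 x)) has_vector_derivative A x *v lift (w0 x) (w1 x) (w2 x)) (at x)" if "x \<in> {..- X}" for x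
      using d0 d1 d2 that by (intro lift_deriv) auto
  qed auto
  then obtain W where W: "linear_ode_solution A W" "\<And>x. x \<le> - X \<Longrightarrow> W x = lift (w0 x) (w1 x) (w2 x)" by auto
  have "norm (W x - lift (p0 x) (p1 x) (p2 x)) \<le> ((1 + 2 * c + 2 * z) * (3 * B)) * exp (x * (Re m + \<delta>))" if "x \<le> - X" for x
  proof -
    have e: "exp (- x * (Re (- m) - \<delta>)) = exp (x * (Re m + \<delta>))" by (simp add: algebra_simps)
    have b: "norm (w0 x - p0 x) \<le> B * exp (x * (Re m + \<delta>))" "norm (w2 x - p2 x) \<le> B * exp (x * (Re m + \<delta>))"
      using X(4,6)[of "- x"] that unfolding e by (simp_all add: w0_def w2_def r0_def r2_def)
    have "norm (w1 x - p1 x) = norm (v1 (- x) - r1 (- x))"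
      by (simp add: w1_def r1_def norm_minus_commute add.commute)
    then have b1: "norm (w1 x - p1 x) \<le> B * exp (x * (Re m + \<delta>))"
      using X(5)[of "- x"] that unfolding e by simp
    have "norm (W x - lift (p0 x) (p1 x) (p2 x)) \<le> (1 + 2 * c + 2 * z) * (norm (w0 x - p0 x) + norm (w1 x - p1 x) + norm (w2 x - p2 x))"
      unfolding W(2)[OF that] diff_lift by (rule norm_lift_le)
    also have "\<dots> \<le> (1 + 2 * c + 2 * z) * (3 * (B * exp (x * (Re m + \<delta>))))"
      using b b1 c z_pos by (intro mult_left_mono) auto
    finally show ?thesis by (simp only: mult.assoc)
  qed
  then show ?thesis using W(1) d eventually_le_at_bot[of "- X"] by (blast intro: eventually_mono)
qed

lemma exp_solution:
  assumes "\<mu> = M1 \<or> \<mu> = M2 \<or> \<mu> = M3"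
  shows "((\<lambda>x. exp (x *\<^sub>R \<mu>)) has_vector_derivative \<mu> * exp (x *\<^sub>R \<mu>)) (at x)"
    "((\<lambda>x. \<mu> * exp (x *\<^sub>R \<mu>)) has_vector_derivative \<mu> * (\<mu> * exp (x *\<^sub>R \<mu>))) (at x)"
    "((\<lambda>x. \<mu> * (\<mu> * exp (x *\<^sub>R \<mu>))) has_vector_derivative
       third 0 (exp (x *\<^sub>R \<mu>)) (\<mu> * exp (x *\<^sub>R \<mu>)) (\<mu> * (\<mu> * exp (x *\<^sub>R \<mu>)))) (at x)"
proof -
  note d = has_vector_derivative_exp_scaleR
  show "((\<lambda>x. exp (x *\<^sub>R \<mu>)) has_vector_derivative \<mu> * exp (x *\<^sub>R \<mu>)) (at x)" by (rule d)
  show "((\<lambda>x. \<mu> * exp (x *\<^sub>R \<mu>)) has_vector_derivative \<mu> * (\<mu> * exp (x *\<^sub>R \<mu>))) (at x)"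
    by (intro has_vector_derivative_mult_right d)
  have "((\<lambda>x. \<mu> * (\<mu> * exp (x *\<^sub>R \<mu>))) has_vector_derivative \<mu> * (\<mu> * (\<mu> * exp (x *\<^sub>R \<mu>)))) (at x)"
    by (intro has_vector_derivative_mult_right d)
  moreover have e: "third 0 e (\<mu> * e) (\<mu> * (\<mu> * e)) = e * third 0 1 \<mu> (\<mu> * \<mu>)" for e
    by (simp add: third_def algebra_simps)
  have "third 0 (exp (x *\<^sub>R \<mu>)) (\<mu> * exp (x *\<^sub>R \<mu>)) (\<mu> * (\<mu> * exp (x *\<^sub>R \<mu>))) = \<mu> * (\<mu> * (\<mu> * exp (x *\<^sub>R \<mu>)))"
    unfolding e third_root[OF assms] by (simp only: mult_ac)
  ultimately show "((\<lambda>x. \<mu> * (\<mu> * exp (x *\<^sub>R \<mu>))) has_vector_derivative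
       third 0 (exp (x *\<^sub>R \<mu>)) (\<mu> * exp (x *\<^sub>R \<mu>)) (\<mu> * (\<mu> * exp (x *\<^sub>R \<mu>)))) (at x)" by simp
qed

lemma lift_exp: "lift (exp t) (\<mu> * exp t) (\<mu> * (\<mu> * exp t)) = exp t *s lift 1 \<mu> (\<mu> * \<mu>)"
  by (simp add: smult_lift mult_ac)

lemma norm_smult: "norm (a *s (v :: complex^3)) = norm a * norm v"
  by (simp add: norm_vec_def norm_mult L2_set_right_distrib)

lemma scaled_error:
  fixes W v :: "complex^3"
  assumes "norm (W - exp (x *\<^sub>R m) *s v) \<le> B * exp (x * (Re m + \<delta>))"
  shows "norm (exp (x *\<^sub>R (- m)) *s W - v) \<le> B * exp (x * \<delta>)"
proof -
  have i: "exp (x *\<^sub>R (- m)) * exp (x *\<^sub>R m) = 1" by (simp flip: exp_add)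
  have e: "exp (x *\<^sub>R (- m)) *s W - v = exp (x *\<^sub>R (- m)) *s (W - exp (x *\<^sub>R m) *s v)"
    unfolding vec.scale_right_diff_distrib vec.scale_scale i by simp
  have "norm (exp (x *\<^sub>R (- m)) *s W - v) \<le> exp (x * Re (- m)) * (B * exp (x * (Re m + \<delta>)))"
    unfolding e norm_smult norm_exp_scaleR by (rule mult_left_mono[OF assms]) simp
  also have "\<dots> = B * (exp (x * Re (- m)) * exp (x * (Re m + \<delta>)))" by (simp only: mult_ac)
  also have "exp (x * Re (- m)) * exp (x * (Re m + \<delta>)) = exp (x * \<delta>)"
    by (simp add: algebra_simps flip: exp_add)
  finally show ?thesis .
qed

lemma unscale: "exp (x *\<^sub>R m) *s (exp (x *\<^sub>R (- m)) *s (W :: complex^3)) = W"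
proof -
  have "exp (x *\<^sub>R m) * exp (x *\<^sub>R (- m)) = 1" by (simp flip: exp_add)
  then show ?thesis by (simp only: vec.scale_scale) simp
qed

lemma add_diff_same: "v + (y - v) = (y :: complex^3)" by simp

section \<open>Normalized decaying and growing solutions\<close>

lemma stable_data:
  "\<exists>W P. linear_ode_solution A W \<and> tends_to_identity_exponentially P at_top \<and>
     (\<forall>x. W x = P x *v (matrix_exp (x *\<^sub>R A0) *v E3))"
proof -
  have b: "norm (M3 * exp (x *\<^sub>R M3)) \<le> norm M3 * ((1 + x) * exp (x * Re M3))" if "x \<ge> 0" for x
    unfolding norm_mult norm_exp_scaleR using that by (intro mult_left_mono) auto
  have M3: "M3 = M1 \<or> M3 = M2 \<or> M3 = M3" by simp
  obtain W \<delta> B where W: "\<delta> > 0" "linear_ode_solution A W"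
    "\<forall>\<^sub>F x in at_top. norm (W x - lift (exp (x *\<^sub>R M3)) (M3 * exp (x *\<^sub>R M3)) (M3 * (M3 * exp (x *\<^sub>R M3)))) \<le> B * exp (x * (Re M3 - \<delta>))"
    using solution_at_top[OF exp_solution[OF M3] b] by blast
  define R where "R x = exp (x *\<^sub>R (- M3)) *s W x - E3" for x
  have "\<forall>\<^sub>F x in at_top. norm (R x) \<le> \<bar>B\<bar> * exp (- \<delta> * \<bar>x\<bar>)"
    using W(3) eventually_ge_at_top[of 0]
  proof eventually_elim
    case (elim x)
    have "norm (W x - exp (x *\<^sub>R M3) *s E3) \<le> B * exp (x * (Re M3 + - \<delta>))"
      using elim(1) unfolding lift_exp E3_def by simp
    from scaled_error[OF this] have "norm (R x) \<le> B * exp (x * - \<delta>)" unfolding R_def .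
    also have "\<dots> \<le> \<bar>B\<bar> * exp (x * - \<delta>)" by (intro mult_right_mono) auto
    finally show ?case using elim(2) by (simp add: mult.commute)
  qed
  \<comment> \<open>Only \<open>E3\<close> has to be moved, so the second displacement is 0, and
    \<open>E1\<close>, \<open>E2\<close> merely complete the basis.\<close>
  moreover have "\<forall>\<^sub>F x in at_top. norm (0 :: complex^3) \<le> \<bar>B\<bar> * exp (- \<delta> * \<bar>x\<bar>)" by simp
  moreover have "det_columns E3 E1 E2 \<noteq> 0"
    using nondegenerate by (simp add: det_columns_eq algebra_simps)
  ultimately obtain P where P: "tends_to_identity_exponentially P at_top" "\<And>x. P x *v E3 = E3 + R x"
    using identity_perturbation[of R "\<bar>B\<bar>" \<delta> at_top "\<lambda>_. 0" E3 E1 E2] W(1) by blast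
  have "W x = P x *v (matrix_exp (x *\<^sub>R A0) *v E3)" for x
    unfolding exp_E vector_scalar_commute P(2) R_def by (simp only: add_diff_same unscale)
  then show ?thesis using W(2) P(1) by blast
qed

lemma eigenvector_data:
  assumes \<mu>: "\<mu> = M1 \<or> \<mu> = M2"
  shows "\<exists>W \<delta> B. \<delta> > 0 \<and> linear_ode_solution A W \<and>
     (\<forall>\<^sub>F x in at_bot. norm (exp (x *\<^sub>R (- \<mu>)) *s W x - lift 1 \<mu> (\<mu> * \<mu>)) \<le> B * exp (x * \<delta>))"
proof -
  have b: "norm (\<mu> * exp (x *\<^sub>R \<mu>)) \<le> norm \<mu> * ((1 - x) * exp (x * Re \<mu>))" if "x \<le> 0" for x
    unfolding norm_mult norm_exp_scaleR using that by (intro mult_left_mono) auto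
  have \<mu>3: "\<mu> = M1 \<or> \<mu> = M2 \<or> \<mu> = M3" using \<mu> by blast
  obtain W \<delta> B where W: "\<delta> > 0" "linear_ode_solution A W"
    "\<forall>\<^sub>F x in at_bot. norm (W x - lift (exp (x *\<^sub>R \<mu>)) (\<mu> * exp (x *\<^sub>R \<mu>)) (\<mu> * (\<mu> * exp (x *\<^sub>R \<mu>)))) \<le> B * exp (x * (Re \<mu> + \<delta>))"
    using solution_at_bot[OF exp_solution[OF \<mu>3] b] by blast
  have "\<forall>\<^sub>F x in at_bot. norm (exp (x *\<^sub>R (- \<mu>)) *s W x - lift 1 \<mu> (\<mu> * \<mu>)) \<le> B * exp (x * \<delta>)"
    using W(3) by eventually_elim (rule scaled_error, simp only: lift_exp)
  then show ?thesis using W by blast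
qed

text \<open>At a double root the second solution of the limiting equation is
  \<open>x exp (m x)\<close>, whose lift is \<open>exp (m x) (E2 + x E1)\<close>; the linear factor
  is within the growth allowed for the unperturbed solution.\<close>

lemma double_root_data:
  assumes eq: "M1 = M2"
  shows "\<exists>W \<delta> B. \<delta> > 0 \<and> linear_ode_solution A W \<and>
     (\<forall>\<^sub>F x in at_bot. norm (exp (x *\<^sub>R (- M2)) *s W x - (E2 + of_real x *s E1)) \<le> B * exp (x * \<delta>))"
proof -
  let ?m = "M2" and ?e = "\<lambda>x. exp (x *\<^sub>R M2)"
  let ?p0 = "\<lambda>x. ?e x * of_real x" and ?p1 = "\<lambda>x. ?e x * (1 + of_real x * ?m)"
    and ?p2 = "\<lambda>x. ?e x * (2 * ?m + of_real x * (?m * ?m))"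
  have de: "((\<lambda>x. ?e x * f x) has_vector_derivative ?e x * (f' + ?m * f x)) (at x)"
    if "(f has_vector_derivative f') (at x)" for f f' x
  proof -
    have "((\<lambda>x. ?e x * f x) has_vector_derivative ?e x * f' + ?m * ?e x * f x) (at x)"
      by (rule has_vector_derivative_mult[OF has_vector_derivative_exp_scaleR that])
    then show ?thesis by (rule has_vector_derivative_eq_rhs) (simp add: algebra_simps)
  qed
  have dx: "((\<lambda>x. complex_of_real x) has_vector_derivative 1) (at x)" for x
    using bounded_linear.has_vector_derivative[OF bounded_linear_of_real has_vector_derivative_id, of "at x"] by simp
  have dl: "((\<lambda>x. a + complex_of_real x * b) has_vector_derivative b) (at x)" for a b x
    using has_vector_derivative_add[OF has_vector_derivative_const[of a] has_vector_derivative_mult_left[OF dx, of b]] by simp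
  have 0: "(?p0 has_vector_derivative ?p1 x) (at x)" for x
    using de[OF dx] by (rule has_vector_derivative_eq_rhs) (simp add: algebra_simps)
  have 1: "(?p1 has_vector_derivative ?p2 x) (at x)" for x
    using de[OF dl] by (rule has_vector_derivative_eq_rhs) (simp add: algebra_simps)
  have 2: "(?p2 has_vector_derivative third 0 (?p0 x) (?p1 x) (?p2 x)) (at x)" for x
    using de[OF dl] by (rule has_vector_derivative_eq_rhs) (simp add: third_vieta eq algebra_simps)
  have b: "norm (?p1 x) \<le> (1 + norm ?m) * ((1 - x) * exp (x * Re ?m))" if "x \<le> 0" for x
  proof -
    have "norm (1 + of_real x * ?m) \<le> 1 + \<bar>x\<bar> * norm ?m"
      using norm_triangle_ineq[of 1 "of_real x * ?m"] by (simp add: norm_mult)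
    also have "\<dots> \<le> (1 + norm ?m) * (1 - x)"
      using order_trans[OF that norm_ge_zero[of ?m]] that by (simp add: algebra_simps)
    finally have "exp (x * Re ?m) * norm (1 + of_real x * ?m) \<le> exp (x * Re ?m) * ((1 + norm ?m) * (1 - x))"
      by (intro mult_left_mono) auto
    then show ?thesis unfolding norm_mult norm_exp_scaleR by (simp only: mult_ac)
  qed
  obtain W \<delta> B where W: "\<delta> > 0" "linear_ode_solution A W"
    "\<forall>\<^sub>F x in at_bot. norm (W x - lift (?p0 x) (?p1 x) (?p2 x)) \<le> B * exp (x * (Re ?m + \<delta>))"
    using solution_at_bot[OF 0 1 2 b] by blast
  have l: "lift (?p0 x) (?p1 x) (?p2 x) = ?e x *s (E2 + of_real x *s E1)" for x
    unfolding E1_def E2_def smult_lift add_lift by (simp add: eq algebra_simps)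
  have "\<forall>\<^sub>F x in at_bot. norm (exp (x *\<^sub>R (- M2)) *s W x - (E2 + of_real x *s E1)) \<le> B * exp (x * \<delta>)"
    using W(3) by eventually_elim (rule scaled_error, simp only: l)
  then show ?thesis using W by blast
qed

text \<open>The two errors are found separately and fed into one rank-two perturbation, which yields
  the common \<open>P\<close>. At a double root \<open>P\<close> acts on \<open>E2 + x E1\<close> as
  a whole, so the error of \<open>W2\<close> is corrected by \<open>- x R1\<close>, still
  exponentially small at a reduced rate.\<close>

lemma unstable_data:
  "\<exists>B1 B2 W1 W2 P. B1 \<noteq> B2 \<and> vec.independent {B1, B2} \<and> vec.span {B1, B2} = vec.span {E1, E2} \<and>
     linear_ode_solution A W1 \<and> linear_ode_solution A W2 \<and> tends_to_identity_exponentially P at_bot \<and>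
     (\<forall>x. W1 x = P x *v (matrix_exp (x *\<^sub>R A0) *v B1)) \<and> (\<forall>x. W2 x = P x *v (matrix_exp (x *\<^sub>R A0) *v B2))"
proof -
  obtain B1 B2 where B: "B1 \<noteq> B2" "vec.independent {B1, B2}" "vec.span {B1, B2} = vec.span {E1, E2}"
    "det_columns B1 B2 E3 \<noteq> 0" "B1 = E1"
    and B2: "m1 z \<noteq> m2 z \<and> B2 = E1 - (m1 z - m2 z) *s E2 \<and> (\<forall>x. matrix_exp (x *\<^sub>R A0) *v B2 = exp (x *\<^sub>R m2 z) *s B2) \<or>
     m1 z = m2 z \<and> B2 = E2 \<and> (\<forall>x. matrix_exp (x *\<^sub>R A0) *v B2 = exp (x *\<^sub>R m2 z) *s B2 + (of_real x * exp (x *\<^sub>R m2 z)) *s E1)"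
    by (rule unstable_exp_basis)
  have "M1 = M1 \<or> M1 = M2" by simp
  from eigenvector_data[OF this] obtain W1 d1 C1 where W1: "d1 > 0" "linear_ode_solution A W1"
    "\<forall>\<^sub>F x in at_bot. norm (exp (x *\<^sub>R (- M1)) *s W1 x - E1) \<le> C1 * exp (x * d1)"
    unfolding E1_def by blast
  define R1 where "R1 x = exp (x *\<^sub>R (- M1)) *s W1 x - E1" for x
  have weak: "\<bar>C\<bar> * exp (x * d) \<le> C' * exp (- \<delta> * \<bar>x\<bar>)" if "x \<le> 0" "\<delta> \<le> d" "\<bar>C\<bar> \<le> C'" for C C' d \<delta> x :: real
  proof -
    have "x * d \<le> x * \<delta>" using that by (intro mult_left_mono_neg)
    then show ?thesis using that by (intro mult_mono) (auto simp: mult.commute)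
  qed
  \<comment> \<open>The representation of \<open>W2\<close> is stated for every \<open>P\<close>
    with the right action, because \<open>P\<close> can be built only after both errors are
    known.\<close>
  have "\<exists>W2 R2 d2 C2. d2 > 0 \<and> linear_ode_solution A W2 \<and>
     (\<forall>\<^sub>F x in at_bot. norm (R2 x) \<le> C2 * exp (x * d2)) \<and>
     (\<forall>P. (\<forall>x. P x *v B1 = B1 + R1 x) \<and> (\<forall>x. P x *v B2 = B2 + R2 x) \<longrightarrow> (\<forall>x. W2 x = P x *v (matrix_exp (x *\<^sub>R A0) *v B2)))"
    using B2
  proof (elim disjE conjE)
    assume b2: "B2 = E1 - (m1 z - m2 z) *s E2" and e2: "\<forall>x. matrix_exp (x *\<^sub>R A0) *v B2 = exp (x *\<^sub>R m2 z) *s B2"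
    have "B2 = lift 1 M2 (M2 * M2)"
      unfolding b2 E1_def E2_def smult_lift diff_lift by (simp add: algebra_simps)
    moreover have "M2 = M1 \<or> M2 = M2" by simp
    from eigenvector_data[OF this] obtain W2 d2 C2 where W2: "d2 > 0" "linear_ode_solution A W2"
      "\<forall>\<^sub>F x in at_bot. norm (exp (x *\<^sub>R (- M2)) *s W2 x - lift 1 M2 (M2 * M2)) \<le> C2 * exp (x * d2)" by blast
    ultimately have ev: "\<forall>\<^sub>F x in at_bot. norm (exp (x *\<^sub>R (- M2)) *s W2 x - B2) \<le> C2 * exp (x * d2)" by simp
    have PW: "W2 x = P x *v (matrix_exp (x *\<^sub>R A0) *v B2)"
      if "\<forall>x. P x *v B2 = B2 + (exp (x *\<^sub>R (- M2)) *s W2 x - B2)" for P x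
      unfolding e2[rule_format] vector_scalar_commute that[rule_format]
      by (simp only: add_diff_same unscale)
    show ?thesis
    proof (intro exI conjI allI impI)
      show "d2 > 0" "linear_ode_solution A W2" by (fact W2)+
      show "\<forall>\<^sub>F x in at_bot. norm (exp (x *\<^sub>R (- M2)) *s W2 x - B2) \<le> C2 * exp (x * d2)" by (fact ev)
      show "W2 x = P x *v (matrix_exp (x *\<^sub>R A0) *v B2)"
        if "(\<forall>x. P x *v B1 = B1 + R1 x) \<and> (\<forall>x. P x *v B2 = B2 + (exp (x *\<^sub>R (- M2)) *s W2 x - B2))" for P x
        by (rule PW[OF conjunct2[OF that]])
    qed
  next
    assume eq: "m1 z = m2 z" and b2: "B2 = E2"
      and e2: "\<forall>x. matrix_exp (x *\<^sub>R A0) *v B2 = exp (x *\<^sub>R m2 z) *s B2 + (of_real x * exp (x *\<^sub>R m2 z)) *s E1"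
    obtain W2 d2 C2 where W2: "d2 > 0" "linear_ode_solution A W2"
      "\<forall>\<^sub>F x in at_bot. norm (exp (x *\<^sub>R (- M2)) *s W2 x - (E2 + of_real x *s E1)) \<le> C2 * exp (x * d2)"
      using double_root_data[OF eq] by blast
    define R2 where "R2 x = (exp (x *\<^sub>R (- M2)) *s W2 x - (E2 + of_real x *s E1)) - of_real x *s R1 x" for x
    \<comment> \<open>Since \<open>2 d \<le> d1\<close>, half of the retained decay of
      \<open>R1\<close> absorbs the factor \<open>x\<close> and the other half survives.\<close>
    define d where "d = min d1 d2 / 2"
    have d: "d > 0" "2 * d \<le> d1" "2 * d \<le> d2" using W1 W2 by (auto simp: d_def)
    have "\<forall>\<^sub>F x in at_bot. norm (R2 x) \<le> (\<bar>C2\<bar> + \<bar>C1\<bar> * (1 + 1 / d)) * exp (x * d)"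
      using W1(3) W2(3) eventually_le_at_bot[of 0]
    proof eventually_elim
      case (elim x)
      have "C2 * exp (x * d2) \<le> \<bar>C2\<bar> * exp (x * d2)" by (intro mult_right_mono) auto
      also have "\<dots> \<le> \<bar>C2\<bar> * exp (- d * \<bar>x\<bar>)" by (rule weak) (use elim(3) d in auto)
      finally have a: "C2 * exp (x * d2) \<le> \<bar>C2\<bar> * exp (x * d)" using elim(3) by (simp add: mult.commute)
      have "C1 * exp (x * d1) \<le> \<bar>C1\<bar> * exp (x * d1)" by (intro mult_right_mono) auto
      also have "\<dots> \<le> \<bar>C1\<bar> * exp (- (2 * d) * \<bar>x\<bar>)" by (rule weak) (use elim(3) d in auto)
      finally have "C1 * exp (x * d1) \<le> \<bar>C1\<bar> * exp (- (2 * d) * \<bar>x\<bar>)" .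
      then have "norm (R1 x) \<le> \<bar>C1\<bar> * exp (- (2 * d) * \<bar>x\<bar>)" using elim(1) by (simp add: R1_def)
      then have "norm (of_real x *s R1 x) \<le> \<bar>x\<bar> * (\<bar>C1\<bar> * exp (- (2 * d) * \<bar>x\<bar>))"
        unfolding norm_smult norm_of_real by (intro mult_left_mono) auto
      also have "\<dots> = \<bar>C1\<bar> * ((\<bar>x\<bar> * exp (- d * \<bar>x\<bar>)) * exp (- d * \<bar>x\<bar>))"
        by (simp add: exp_add[symmetric] mult_ac flip: distrib_left)
      also have "\<dots> \<le> \<bar>C1\<bar> * ((1 + 1 / d) * exp (- d * \<bar>x\<bar>))"
      proof (intro mult_left_mono mult_right_mono)
        have "\<bar>x\<bar> * exp (- d * \<bar>x\<bar>) \<le> (1 + \<bar>x\<bar>) * exp (- d * \<bar>x\<bar>)" by (intro mult_right_mono) auto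
        also have "\<dots> \<le> 1 + 1 / d" by (rule linear_exp_bound) (use d in auto)
        finally show "\<bar>x\<bar> * exp (- d * \<bar>x\<bar>) \<le> 1 + 1 / d" .
      qed auto
      finally have b: "norm (of_real x *s R1 x) \<le> \<bar>C1\<bar> * (1 + 1 / d) * exp (x * d)"
        using elim(3) by (simp add: mult_ac)
      have "norm (R2 x) \<le> C2 * exp (x * d2) + \<bar>C1\<bar> * (1 + 1 / d) * exp (x * d)"
        unfolding R2_def by (rule order_trans[OF norm_triangle_ineq4 add_mono[OF elim(2) b]])
      then show ?case using a by (simp add: distrib_right)
    qed
    moreover have "W2 x = P x *v (matrix_exp (x *\<^sub>R A0) *v B2)"
      if P: "\<forall>x. P x *v B1 = B1 + R1 x" "\<forall>x. P x *v B2 = B2 + R2 x" for P x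
    proof -
      have p1: "P x *v E1 = E1 + R1 x" and p2: "P x *v E2 = E2 + R2 x" using P B(5) b2 by auto
      have "P x *v (matrix_exp (x *\<^sub>R A0) *v B2) = exp (x *\<^sub>R M2) *s ((E2 + R2 x) + of_real x *s (E1 + R1 x))"
        unfolding b2 e2[unfolded b2, rule_format] matrix_vector_right_distrib vector_scalar_commute p1 p2
        by (simp add: vec.scale_right_distrib mult.commute del: scaleR_complex.sel)
      also have "(E2 + R2 x) + of_real x *s (E1 + R1 x) = exp (x *\<^sub>R (- M2)) *s W2 x"
        by (simp add: R2_def vec.scale_right_distrib)
      finally show ?thesis by (simp only: unscale)
    qed
    ultimately show ?thesis using W2(2) d(1) by blast
  qed
  then obtain W2 R2 d2 C2 where W2: "d2 > 0" "linear_ode_solution A W2"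
    "\<forall>\<^sub>F x in at_bot. norm (R2 x) \<le> C2 * exp (x * d2)"
    and PW2: "\<And>P x. \<lbrakk>\<And>x. P x *v B1 = B1 + R1 x; \<And>x. P x *v B2 = B2 + R2 x\<rbrakk> \<Longrightarrow> W2 x = P x *v (matrix_exp (x *\<^sub>R A0) *v B2)"
    by blast
  let ?C = "max \<bar>C1\<bar> \<bar>C2\<bar>" and ?d = "min d1 d2"
  have r1: "\<forall>\<^sub>F x in at_bot. norm (R1 x) \<le> ?C * exp (- ?d * \<bar>x\<bar>)"
    using W1(3) eventually_le_at_bot[of 0]
  proof eventually_elim
    case (elim x)
    have "norm (R1 x) \<le> \<bar>C1\<bar> * exp (x * d1)"
      unfolding R1_def by (rule order_trans[OF elim(1)]) (intro mult_right_mono, auto)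
    also have "\<dots> \<le> ?C * exp (- ?d * \<bar>x\<bar>)" by (rule weak) (use elim(2) in auto)
    finally show ?case .
  qed
  have r2: "\<forall>\<^sub>F x in at_bot. norm (R2 x) \<le> ?C * exp (- ?d * \<bar>x\<bar>)"
    using W2(3) eventually_le_at_bot[of 0]
  proof eventually_elim
    case (elim x)
    have "norm (R2 x) \<le> \<bar>C2\<bar> * exp (x * d2)"
      by (rule order_trans[OF elim(1)]) (intro mult_right_mono, auto)
    also have "\<dots> \<le> ?C * exp (- ?d * \<bar>x\<bar>)" by (rule weak) (use elim(2) in auto)
    finally show ?case .
  qed
  have "?d > 0" using W1 W2 by simp
  from identity_perturbation[OF r1 r2 this B(4)]
  obtain P where P: "tends_to_identity_exponentially P at_bot" "\<And>x. P x *v B1 = B1 + R1 x" "\<And>x. P x *v B2 = B2 + R2 x"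
    by blast
  have "W1 x = P x *v (matrix_exp (x *\<^sub>R A0) *v B1)" for x
  proof -
    have p: "P x *v E1 = E1 + R1 x" using P(2)[of x] B(5) by simp
    show ?thesis unfolding B(5) exp_E vector_scalar_commute p R1_def by (simp only: add_diff_same unscale)
  qed
  then show ?thesis using B(1-3) W1(2) W2(2) P(1) PW2[OF P(2,3)] by blast
qed

lemma evans_quotient_exists: "\<exists>d. evans_quotient A A0 d"
proof -
  obtain W3 Pp where W3: "linear_ode_solution A W3" "tends_to_identity_exponentially Pp at_top"
    "\<And>x. W3 x = Pp x *v (matrix_exp (x *\<^sub>R A0) *v E3)"
    using stable_data by blast
  obtain B1 B2 W1 W2 Pm where *: "B1 \<noteq> B2" "vec.independent {B1, B2}" "vec.span {B1, B2} = vec.span {E1, E2}"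
     "linear_ode_solution A W1" "linear_ode_solution A W2" "tends_to_identity_exponentially Pm at_bot"
     "\<And>x. W1 x = Pm x *v (matrix_exp (x *\<^sub>R A0) *v B1)" "\<And>x. W2 x = Pm x *v (matrix_exp (x *\<^sub>R A0) *v B2)"
    using unstable_data by blast
  have "consistent_splitting A0 (vec.span {E3}) (vec.span {E1, E2})" by (simp add: consistent_splitting_iff)
  then have "evans_quotient A A0 (det_columns (W1 0) (W2 0) (W3 0) / det_columns B1 B2 E3)"
    unfolding evans_quotient_def
    by (intro exI[of _ "vec.span {E3}"] exI[of _ "vec.span {E1, E2}"] exI[of _ B1] exI[of _ B2] exI[of _ E3]
        exI[of _ W1] exI[of _ W2] exI[of _ W3] exI[of _ Pm] exI[of _ Pp] conjI allI * W3 basis_nonzero refl)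
  then show ?thesis by blast
qed

text \<open>At a zero of the transmission every admissible choice of bases and solutions gives the
  quotient 0, and at least one such choice exists; hence the definite description denotes 0.\<close>

lemma evans_quotient_the:
  assumes "transmission z = 0"
  shows "(THE d. evans_quotient A A0 d) = 0"
proof (rule the_equality)
  obtain d where d: "evans_quotient A A0 d" using evans_quotient_exists by blast
  then have "d = 0" by (rule evans_quotient_zero[OF assms])
  then show "evans_quotient A A0 0" using d by simp
qed (rule evans_quotient_zero[OF assms])

lemma A_tendsto: "(A \<longlongrightarrow> A0) at_top"
proof -
  have "(h \<longlongrightarrow> 0) at_top"
  proof (rule Lim_null_comparison)
    show "\<forall>\<^sub>F x in at_top. norm (h x) \<le> K * exp (- \<eta> * \<bar>x\<bar>)" using h(2) by (intro always_eventually) simp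
    have "filterlim (\<lambda>x. \<eta> * \<bar>x\<bar>) at_top at_top"
      by (rule filterlim_tendsto_pos_mult_at_top[OF tendsto_const eta filterlim_abs_at_top_or_bot]) simp
    then have "filterlim (\<lambda>x. - \<eta> * \<bar>x\<bar>) at_bot at_top" by (simp add: filterlim_uminus_at_bot)
    then show "((\<lambda>x. K * exp (- \<eta> * \<bar>x\<bar>)) \<longlongrightarrow> 0) at_top"
      by (intro tendsto_mult_right_zero filterlim_compose[OF exp_at_bot])
  qed
  then have "(A \<longlongrightarrow> A0 - (c * 0) *\<^sub>R vector [0, 0, vector [1, 0, 0]]) at_top"
    unfolding A_perturbation[abs_def] by (intro tendsto_intros)
  then show ?thesis by simp
qed

end

theorem mainTheorem3:
  fixes cs q \<tau>0 :: real and f \<tau> u :: "real \<Rightarrow> real" and I :: "real set"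
  assumes "cs > 0"
    and "smooth_on_interval I f"
    and "homoclinic_profile cs f I q \<tau>0 \<tau> u"
  shows "\<exists>z \<in> point_spectrum cs cs f I \<tau>. Re z > 0"
proof -
  define k where "k = (cs - derivative_on I f \<tau>0) / cs"
  define h where "h = (\<lambda>x. (derivative_on I f \<tau>0 - derivative_on I f (\<tau> x)) / cs)"
  obtain K \<eta> \<phi> \<psi> \<alpha> where "homoclinic_orbit cs k K \<eta> \<phi> \<psi> \<alpha> h"
    using homoclinic_profile_orbit[OF assms] unfolding k_def h_def by blast
  then interpret homoclinic_orbit cs k K \<eta> \<phi> \<psi> \<alpha> h .
  obtain z where z: "z > 0" "transmission z = 0" using transmission_zero by blast
  interpret evans_problem cs k K \<eta> \<phi> \<psi> \<alpha> h z by unfold_locales (rule z)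
  have g: "cs - cs * (k + h x) = derivative_on I f (\<tau> x)" for x
    using assms(1) by (simp add: k_def h_def field_simps)
  have em: "evans_matrix cs cs f I \<tau> (of_real z) = A"
    by (rule ext) (simp add: evans_matrix_def A_def evans_mat_def g)
  have el: "evans_limit_matrix cs cs f I \<tau> (of_real z) = A0"
    unfolding evans_limit_matrix_def em by (rule tendsto_Lim[OF trivial_limit_at_top_linorder A_tendsto])
  have "complex_of_real z \<in> evans_domain cs cs f I \<tau>"
  proof -
    have "consistent_splitting A0 (vec.span {E3}) (vec.span {E1, E2})" by (simp add: consistent_splitting_iff)
    then show ?thesis unfolding evans_domain_def mem_Collect_eq el by blast
  qed
  moreover have "evans_function cs cs f I \<tau> (of_real z) = 0"
    unfolding evans_function_def em el by (rule evans_quotient_the[OF z(2)])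
  ultimately have "complex_of_real z \<in> point_spectrum cs cs f I \<tau>" by (simp add: point_spectrum_def)
  then show ?thesis using z(1) by (intro bexI[of _ "complex_of_real z"]) simp_all
qed

end
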